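(* Assume the setting below with $\mathcal{L}\in H^{-1}(\Omega)^k$. Let $(\mathcal{D}_m)_{m\in\mathbb{N}}$ be a sequence of Hessian discretisations which is coercive, consistent, limit-conforming and compact, and for each $m$ let $E_{\mathcal{D}_m}$ be a companion operator for $\mathcal{D}_m$ such that $\omega(E_{\mathcal{D}_m})\to0$ as $m\to\infty$. Then for every $m$ there exists at least one solution $\Psi_{\mathcal{D}_m}\in X_{\mathcal{D}_m,0}^k$ of the Hessian scheme $$\mathcal{A}(\mathcal{H}_{\mathcal{D}_m}\Psi_{\mathcal{D}_m},\mathcal{H}_{\mathcal{D}_m}\Phi)+\mathcal{B}(\mathcal{H}_{\mathcal{D}_m}\Psi_{\mathcal{D}_m},\nabla_{\mathcal{D}_m}\Psi_{\mathcal{D}_m},\nabla_{\mathcal{D}_m}\Phi)=\mathcal{L}(E_{\mathcal{D}_m}\Phi)\quad\text{for all }\Phi\in X_{\mathcal{D}_m,0}^k.$$ Moreover, there exist a subsequence (not relabelled) and a solution $\Psi\in H^2_0(\Omega)^k$ of $$\mathcal{A}(\mathcal{H}\Psi,\mathcal{H}\Phi)+\mathcal{B}(\mathcal{H}\Psi,\nabla\Psi,\nabla\Phi)=\mathcal{L}(\Phi)\quad\text{for all }\Phi\in H^2_0(\Omega)^k$$ such that $\Pi_{\mathcal{D}_m}\Psi_{\mathcal{D}_m}\to\Psi$ in $L^2(\Omega)^k$, $\nabla_{\mathcal{D}_m}\Psi_{\mathcal{D}_m}\to\nabla\Psi$ in $L^4(\Omega;\mathbb{R}^d)^k$ and $\mathcal{H}_{\mathcal{D}_m}\Psi_{\mathcal{D}_m}\to\mathcal{H}\Psi$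 in $L^2(\Omega;\mathbb{R}^{d\times d})^k$. Furthermore, for a Hessian discretisation $\mathcal{D}=\mathcal{D}_m$ with companion operator $E_{\mathcal{D}}=E_{\mathcal{D}_m}$, if $$\|\mathcal{L}\|_{-1}<\frac{\overline{\alpha}^2}{\|\mathcal{B}\|\,C_{\mathcal{D}}^2\,(\omega(E_{\mathcal{D}})+|\Omega|^{1/4}C_{\mathcal{D}})\,C_{1,\rm eq}},$$ then the discrete solution on $\mathcal{D}$ is unique.
   Context: Let $\Omega\subset\mathbb{R}^d$ ($d\ge1$) be a bounded domain, $k\ge1$ an integer. For a function space $E$, norms on $E^k$ are written as on $E$; $\|\cdot\|$ is the $L^2$ norm, $\|\cdot\|_{0,4}$ the $L^4$ norm, $\|\cdot\|_m,|\cdot|_m$ the $H^m$ norm and seminorm; $\|\cdot\|_{-1}$ is the dual norm on $H^{-1}(\Omega)^k=(H^1_0(\Omega)^k)'$ with respect to $\|\cdot\|_1$. $\mathcal{H}$ is the Hessian; $\mathcal{H}\Psi,\nabla\Psi$ act componentwise. $C_{1,\rm eq}$ is a constant with $\|\phi\|_1\le C_{1,\rm eq}|\phi|_1$ for all $\phi\in H^1_0(\Omega)$. $|\Omega|$ is the measure of $\Omega$. Standing assumptions: $\mathcal{A}$ is a continuous bilinear form on $L^2(\Omega;\mathbb{R}^{d\times d})^k$, coercive with constant $\overline{\alpha}>0$; $\mathcal{B}$ is a continuous trilinear form on $L^2(\Omega;\mathbb{R}^{d\times d})^k\times L^4(\Omega;\mathbb{R}^d)^k\times L^4(\Omega;\mathbb{R}^d)^k$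 with norm $\|\mathcal{B}\|$ and $\mathcal{B}(\Xi,\Theta,\Theta)=0$ for all $\Xi,\Theta$; $\mathcal{L}$ is a continuous linear functional on $H^1_0(\Omega)^k$ (hence also on $H^2_0(\Omega)^k$). A Hessian discretisation (HD) is a quadruple $\mathcal{D}=(X_{\mathcal{D},0},\Pi_{\mathcal{D}},\nabla_{\mathcal{D}},\mathcal{H}_{\mathcal{D}})$ where $X_{\mathcal{D},0}$ is a finite-dimensional real vector space and $\Pi_{\mathcal{D}}:X_{\mathcal{D},0}\to L^2(\Omega)$, $\nabla_{\mathcal{D}}:X_{\mathcal{D},0}\to L^4(\Omega;\mathbb{R}^d)$, $\mathcal{H}_{\mathcal{D}}:X_{\mathcal{D},0}\to L^2(\Omega;\mathbb{R}^{d\times d})$ are linear and $\|w\|_{\mathcal{D}}:=\|\mathcal{H}_{\mathcal{D}}w\|$ is a norm on $X_{\mathcal{D},0}$. A companion operator is a linear map $E_{\mathcal{D}}:X_{\mathcal{D},0}\to H^2_0(\Omega)$, and $\omega(E_{\mathcal{D}}):=\sup_{\psi\ne0}\|\nabla_{\mathcal{D}}\psi-\nabla E_{\mathcal{D}}\psi\|/\|\psi\|_{\mathcal{D}}$. All maps act componentwise on $X_{\mathcal{D},0}^k$. Define $C_{\mathcal{D}}:=\max_{w\ne0}\max\{\|\Pi_{\mathcal{D}}w\|/\|w\|_{\mathcal{D}},\|\nabla_{\mathcal{D}}w\|_{0,4}/\|w\|_{\mathcal{D}}\}$; for $\varphi\in H^2_0(\Omega)$, $S_{\mathcal{D}}(\varphi):=\min_{w\in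 X_{\mathcal{D},0}}(\|\Pi_{\mathcal{D}}w-\varphi\|+\|\nabla_{\mathcal{D}}w-\nabla\varphi\|_{0,4}+\|\mathcal{H}_{\mathcal{D}}w-\mathcal{H}\varphi\|)$; with $H(\Omega)=\{\xi\in L^2(\Omega;\mathbb{R}^{d\times d}):\partial_{ij}\xi_{ij}\in L^2(\Omega)\}$ and $H_{\rm div}(\Omega)=\{\phi\in L^2(\Omega;\mathbb{R}^d):\mathrm{div}\phi\in L^2(\Omega)\}$, set $W_{\mathcal{D}}(\xi):=\max_{w\ne0}\frac{1}{\|w\|_{\mathcal{D}}}\left|\int_\Omega((\partial_{ij}\xi_{ij})\Pi_{\mathcal{D}}w-\xi:\mathcal{H}_{\mathcal{D}}w)\,dx\right|$ and $\hat W_{\mathcal{D}}(\phi):=\max_{w\ne0}\frac{1}{\|w\|_{\mathcal{D}}}\left|\int_\Omega(\nabla_{\mathcal{D}}w\cdot\phi+\Pi_{\mathcal{D}}w\,\mathrm{div}\phi)\,dx\right|$. A sequence $(\mathcal{D}_m)$ of HDs is: coercive if $C_{\mathcal{D}_m}\le C_P$ for all $m$ for some $C_P$; consistent if $S_{\mathcal{D}_m}(\varphi)\to0$ for all $\varphi\in H^2_0(\Omega)$; limit-conforming if $W_{\mathcal{D}_m}(\xi)+\hat W_{\mathcal{D}_m}(\phi)\to0$ for all $\xi\in H(\Omega)$, $\phi\in H_{\rm div}(\Omega)$; compact if for every $u_m\in X_{\mathcal{D}_m,0}$ with $(\|u_m\|_{\mathcal{D}_m})$ bounded, $(\Pi_{\mathcal{D}_m}u_m)$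 is relatively compact in $L^2(\Omega)$ and $(\nabla_{\mathcal{D}_m}u_m)$ is relatively compact in $L^4(\Omega;\mathbb{R}^d)$. *)

theory Defs
  imports "HOL-Analysis.Analysis"
begin

section \<open>Lebesgue norms on a domain (functions are representatives)\<close>

definition lp_mem :: "real \<Rightarrow> (real^'d) set \<Rightarrow> (real^'d \<Rightarrow> 'v::real_normed_vector) \<Rightarrow> bool" where
  "lp_mem p \<Omega> f \<longleftrightarrow> f \<in> borel_measurable (lebesgue_on \<Omega>)
      \<and> integrable (lebesgue_on \<Omega>) (\<lambda>x. norm (f x) powr p)"

definition lp_norm :: "real \<Rightarrow> (real^'d) set \<Rightarrow> (real^'d \<Rightarrow> 'v::real_normed_vector) \<Rightarrow> real" where
  "lp_norm p \<Omega> f = (\<integral>x. norm (f x) powr p \<partial>lebesgue_on \<Omega>) powr (1/p)"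

definition lpk_mem :: "real \<Rightarrow> (real^'d) set \<Rightarrow> ('k::finite \<Rightarrow> real^'d \<Rightarrow> 'v::real_normed_vector) \<Rightarrow> bool" where
  "lpk_mem p \<Omega> F \<longleftrightarrow> (\<forall>c. lp_mem p \<Omega> (F c))"

definition lpk_norm :: "real \<Rightarrow> (real^'d) set \<Rightarrow> ('k::finite \<Rightarrow> real^'d \<Rightarrow> 'v::real_normed_vector) \<Rightarrow> real" where
  "lpk_norm p \<Omega> F =
     (\<integral>x. (sqrt (\<Sum>c\<in>UNIV. (norm (F c x))\<^sup>2)) powr p \<partial>lebesgue_on \<Omega>) powr (1/p)"

definition dpart :: "'d::finite \<Rightarrow> (real^'d \<Rightarrow> real) \<Rightarrow> real^'d \<Rightarrow> real" where
  "dpart i f = (\<lambda>x. frechet_derivative f (at x) (axis i 1))"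

primrec iter_dpart :: "'d::finite list \<Rightarrow> (real^'d \<Rightarrow> real) \<Rightarrow> real^'d \<Rightarrow> real" where
  "iter_dpart [] f = f"
| "iter_dpart (i # is) f = dpart i (iter_dpart is f)"

definition smooth_fn :: "(real^'d::finite \<Rightarrow> real) \<Rightarrow> bool" where
  "smooth_fn f \<longleftrightarrow> (\<forall>is x. iter_dpart is f differentiable (at x))"

definition test_fun :: "(real^'d::finite) set \<Rightarrow> (real^'d \<Rightarrow> real) \<Rightarrow> bool" where
  "test_fun \<Omega> \<phi> \<longleftrightarrow> smooth_fn \<phi> \<and> compact (closure {x. \<phi> x \<noteq> 0})
      \<and> closure {x. \<phi> x \<noteq> 0} \<subseteq> \<Omega>"

definition cgrad :: "(real^'d::finite \<Rightarrow> real) \<Rightarrow> real^'d \<Rightarrow> real^'d" where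
  "cgrad \<phi> x = (\<chi> i. dpart i \<phi> x)"

definition chess :: "(real^'d::finite \<Rightarrow> real) \<Rightarrow> real^'d \<Rightarrow> real^'d^'d" where
  "chess \<phi> x = (\<chi> i j. dpart i (dpart j \<phi>) x)"

definition is_wgrad :: "(real^'d::finite) set \<Rightarrow> (real^'d \<Rightarrow> real) \<Rightarrow> (real^'d \<Rightarrow> real^'d) \<Rightarrow> bool" where
  "is_wgrad \<Omega> u G \<longleftrightarrow> (\<forall>i \<phi>. test_fun \<Omega> \<phi> \<longrightarrow>
      (\<integral>x. u x * dpart i \<phi> x \<partial>lebesgue_on \<Omega>) = - (\<integral>x. G x $ i * \<phi> x \<partial>lebesgue_on \<Omega>))"

definition in_H1 :: "(real^'d::finite) set \<Rightarrow> (real^'d \<Rightarrow> real) \<Rightarrow> (real^'d \<Rightarrow> real^'d) \<Rightarrow> bool" where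
  "in_H1 \<Omega> u G \<longleftrightarrow> lp_mem 2 \<Omega> u \<and> lp_mem 2 \<Omega> G \<and> is_wgrad \<Omega> u G"

definition in_H10 :: "(real^'d::finite) set \<Rightarrow> (real^'d \<Rightarrow> real) \<Rightarrow> (real^'d \<Rightarrow> real^'d) \<Rightarrow> bool" where
  "in_H10 \<Omega> u G \<longleftrightarrow> in_H1 \<Omega> u G \<and>
     (\<exists>\<phi>. (\<forall>n. test_fun \<Omega> (\<phi> n)) \<and>
        (\<lambda>n. lp_norm 2 \<Omega> (\<lambda>x. \<phi> n x - u x) + lp_norm 2 \<Omega> (\<lambda>x. cgrad (\<phi> n) x - G x))
          \<longlonglongrightarrow> 0)"

definition in_H2 :: "(real^'d::finite) set \<Rightarrow> (real^'d \<Rightarrow> real) \<Rightarrow> (real^'d \<Rightarrow> real^'d)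
    \<Rightarrow> (real^'d \<Rightarrow> real^'d^'d) \<Rightarrow> bool" where
  "in_H2 \<Omega> u G H \<longleftrightarrow> lp_mem 2 \<Omega> u \<and> lp_mem 2 \<Omega> G \<and> lp_mem 2 \<Omega> H \<and> is_wgrad \<Omega> u G
      \<and> (\<forall>i. is_wgrad \<Omega> (\<lambda>x. G x $ i) (\<lambda>x. H x $ i))"

definition in_H20 :: "(real^'d::finite) set \<Rightarrow> (real^'d \<Rightarrow> real) \<Rightarrow> (real^'d \<Rightarrow> real^'d)
    \<Rightarrow> (real^'d \<Rightarrow> real^'d^'d) \<Rightarrow> bool" where
  "in_H20 \<Omega> u G H \<longleftrightarrow> in_H2 \<Omega> u G H \<and>
     (\<exists>\<phi>. (\<forall>n. test_fun \<Omega> (\<phi> n)) \<and>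
        (\<lambda>n. lp_norm 2 \<Omega> (\<lambda>x. \<phi> n x - u x) + lp_norm 2 \<Omega> (\<lambda>x. cgrad (\<phi> n) x - G x)
             + lp_norm 2 \<Omega> (\<lambda>x. chess (\<phi> n) x - H x)) \<longlonglongrightarrow> 0)"

definition in_Hdd :: "(real^'d::finite) set \<Rightarrow> (real^'d \<Rightarrow> real^'d^'d) \<Rightarrow> (real^'d \<Rightarrow> real) \<Rightarrow> bool" where
  "in_Hdd \<Omega> \<xi> h \<longleftrightarrow> lp_mem 2 \<Omega> \<xi> \<and> lp_mem 2 \<Omega> h \<and>
     (\<forall>\<psi>. test_fun \<Omega> \<psi> \<longrightarrow>
        (\<integral>x. \<xi> x \<bullet> chess \<psi> x \<partial>lebesgue_on \<Omega>) = (\<integral>x. h x * \<psi> x \<partial>lebesgue_on \<Omega>))"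

definition in_Hdiv :: "(real^'d::finite) set \<Rightarrow> (real^'d \<Rightarrow> real^'d) \<Rightarrow> (real^'d \<Rightarrow> real) \<Rightarrow> bool" where
  "in_Hdiv \<Omega> \<phi> g \<longleftrightarrow> lp_mem 2 \<Omega> \<phi> \<and> lp_mem 2 \<Omega> g \<and>
     (\<forall>\<psi>. test_fun \<Omega> \<psi> \<longrightarrow>
        (\<integral>x. \<phi> x \<bullet> cgrad \<psi> x \<partial>lebesgue_on \<Omega>) = - (\<integral>x. g x * \<psi> x \<partial>lebesgue_on \<Omega>))"

definition h1k_norm :: "(real^'d::finite) set \<Rightarrow> ('k::finite \<Rightarrow> real^'d \<Rightarrow> real)
    \<Rightarrow> ('k \<Rightarrow> real^'d \<Rightarrow> real^'d) \<Rightarrow> real" where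
  "h1k_norm \<Omega> \<Phi> G = sqrt ((lpk_norm 2 \<Omega> \<Phi>)\<^sup>2 + (lpk_norm 2 \<Omega> G)\<^sup>2)"

definition ae_linear_on :: "(real^'d::finite) set \<Rightarrow> 'x::real_vector set
    \<Rightarrow> ('x \<Rightarrow> real^'d \<Rightarrow> 'v::real_vector) \<Rightarrow> bool" where
  "ae_linear_on \<Omega> X T \<longleftrightarrow> (\<forall>u\<in>X. \<forall>v\<in>X. \<forall>a b.
      AE x in lebesgue_on \<Omega>. T (a *\<^sub>R u + b *\<^sub>R v) x = a *\<^sub>R T u x + b *\<^sub>R T v x)"

definition is_HD :: "(real^'d::finite) set \<Rightarrow> 'x::real_vector set \<Rightarrow> ('x \<Rightarrow> real^'d \<Rightarrow> real)
    \<Rightarrow> ('x \<Rightarrow> real^'d \<Rightarrow> real^'d) \<Rightarrow> ('x \<Rightarrow> real^'d \<Rightarrow> real^'d^'d) \<Rightarrow> bool" where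
  "is_HD \<Omega> X PiD Gr Hs \<longleftrightarrow> subspace X \<and> (\<exists>B. finite B \<and> X = span B)
     \<and> (\<forall>w\<in>X. lp_mem 2 \<Omega> (PiD w) \<and> lp_mem 4 \<Omega> (Gr w) \<and> lp_mem 2 \<Omega> (Hs w))
     \<and> ae_linear_on \<Omega> X PiD \<and> ae_linear_on \<Omega> X Gr \<and> ae_linear_on \<Omega> X Hs
     \<and> (\<forall>w\<in>X. lp_norm 2 \<Omega> (Hs w) = 0 \<longrightarrow> w = 0)"

definition is_companion :: "(real^'d::finite) set \<Rightarrow> 'x::real_vector set \<Rightarrow> ('x \<Rightarrow> real^'d \<Rightarrow> real) \<Rightarrow> bool" where
  "is_companion \<Omega> X E \<longleftrightarrow> (\<forall>w\<in>X. \<exists>G H. in_H20 \<Omega> (E w) G H) \<and> ae_linear_on \<Omega> X E"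

definition omegaE :: "(real^'d::finite) set \<Rightarrow> 'x::real_vector set \<Rightarrow> ('x \<Rightarrow> real^'d \<Rightarrow> real^'d)
    \<Rightarrow> ('x \<Rightarrow> real^'d \<Rightarrow> real^'d^'d) \<Rightarrow> ('x \<Rightarrow> real^'d \<Rightarrow> real) \<Rightarrow> real" where
  "omegaE \<Omega> X Gr Hs E = Sup (insert 0
     {lp_norm 2 \<Omega> (\<lambda>x. Gr \<psi> x - G x) / lp_norm 2 \<Omega> (Hs \<psi>) | \<psi> G.
        \<psi> \<in> X \<and> \<psi> \<noteq> 0 \<and> (\<exists>H. in_H20 \<Omega> (E \<psi>) G H)})"

definition C_HD :: "(real^'d::finite) set \<Rightarrow> 'x::real_vector set \<Rightarrow> ('x \<Rightarrow> real^'d \<Rightarrow> real)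
    \<Rightarrow> ('x \<Rightarrow> real^'d \<Rightarrow> real^'d) \<Rightarrow> ('x \<Rightarrow> real^'d \<Rightarrow> real^'d^'d) \<Rightarrow> real" where
  "C_HD \<Omega> X PiD Gr Hs = Sup (insert 0
     {max (lp_norm 2 \<Omega> (PiD w) / lp_norm 2 \<Omega> (Hs w)) (lp_norm 4 \<Omega> (Gr w) / lp_norm 2 \<Omega> (Hs w)) | w.
        w \<in> X \<and> w \<noteq> 0})"

definition S_HD :: "(real^'d::finite) set \<Rightarrow> 'x::real_vector set \<Rightarrow> ('x \<Rightarrow> real^'d \<Rightarrow> real)
    \<Rightarrow> ('x \<Rightarrow> real^'d \<Rightarrow> real^'d) \<Rightarrow> ('x \<Rightarrow> real^'d \<Rightarrow> real^'d^'d)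
    \<Rightarrow> (real^'d \<Rightarrow> real) \<Rightarrow> (real^'d \<Rightarrow> real^'d) \<Rightarrow> (real^'d \<Rightarrow> real^'d^'d) \<Rightarrow> real" where
  "S_HD \<Omega> X PiD Gr Hs \<phi> G H = Inf
     {lp_norm 2 \<Omega> (\<lambda>x. PiD w x - \<phi> x) + lp_norm 4 \<Omega> (\<lambda>x. Gr w x - G x)
        + lp_norm 2 \<Omega> (\<lambda>x. Hs w x - H x) | w. w \<in> X}"

definition W_HD :: "(real^'d::finite) set \<Rightarrow> 'x::real_vector set \<Rightarrow> ('x \<Rightarrow> real^'d \<Rightarrow> real)
    \<Rightarrow> ('x \<Rightarrow> real^'d \<Rightarrow> real^'d^'d) \<Rightarrow> (real^'d \<Rightarrow> real^'d^'d) \<Rightarrow> (real^'d \<Rightarrow> real) \<Rightarrow> real" where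
  "W_HD \<Omega> X PiD Hs \<xi> h = Sup (insert 0
     {\<bar>\<integral>x. h x * PiD w x - \<xi> x \<bullet> Hs w x \<partial>lebesgue_on \<Omega>\<bar> / lp_norm 2 \<Omega> (Hs w) | w.
        w \<in> X \<and> w \<noteq> 0})"

definition What_HD :: "(real^'d::finite) set \<Rightarrow> 'x::real_vector set \<Rightarrow> ('x \<Rightarrow> real^'d \<Rightarrow> real)
    \<Rightarrow> ('x \<Rightarrow> real^'d \<Rightarrow> real^'d) \<Rightarrow> ('x \<Rightarrow> real^'d \<Rightarrow> real^'d^'d)
    \<Rightarrow> (real^'d \<Rightarrow> real^'d) \<Rightarrow> (real^'d \<Rightarrow> real) \<Rightarrow> real" where
  "What_HD \<Omega> X PiD Gr Hs \<phi> g = Sup (insert 0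
     {\<bar>\<integral>x. Gr w x \<bullet> \<phi> x + PiD w x * g x \<partial>lebesgue_on \<Omega>\<bar> / lp_norm 2 \<Omega> (Hs w) | w.
        w \<in> X \<and> w \<noteq> 0})"

text \<open>Relative compactness in L^p of (the range of) a sequence: every sequence of its
  elements has a subsequence converging in L^p.\<close>
definition lp_relcompact_seq :: "real \<Rightarrow> (real^'d::finite) set \<Rightarrow> (nat \<Rightarrow> real^'d \<Rightarrow> 'v::real_normed_vector) \<Rightarrow> bool" where
  "lp_relcompact_seq p \<Omega> f \<longleftrightarrow> (\<forall>r::nat \<Rightarrow> nat. \<exists>s g. strict_mono s \<and> lp_mem p \<Omega> g \<and>
      (\<lambda>n. lp_norm p \<Omega> (\<lambda>x. f (r (s n)) x - g x)) \<longlonglongrightarrow> 0)"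

definition HD_coercive where
  "HD_coercive \<Omega> X PiD Gr Hs \<longleftrightarrow> (\<exists>CP. \<forall>m::nat. C_HD \<Omega> (X m) (PiD m) (Gr m) (Hs m) \<le> CP)"

definition HD_consistent where
  "HD_consistent \<Omega> X PiD Gr Hs \<longleftrightarrow> (\<forall>\<phi> G H. in_H20 \<Omega> \<phi> G H \<longrightarrow>
      (\<lambda>m::nat. S_HD \<Omega> (X m) (PiD m) (Gr m) (Hs m) \<phi> G H) \<longlonglongrightarrow> 0)"

definition HD_limit_conforming where
  "HD_limit_conforming \<Omega> X PiD Gr Hs \<longleftrightarrow> (\<forall>\<xi> h \<phi> g. in_Hdd \<Omega> \<xi> h \<and> in_Hdiv \<Omega> \<phi> g \<longrightarrow>
      (\<lambda>m::nat. W_HD \<Omega> (X m) (PiD m) (Hs m) \<xi> h + What_HD \<Omega> (X m) (PiD m) (Gr m) (Hs m) \<phi> g)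
        \<longlonglongrightarrow> 0)"

definition HD_compact where
  "HD_compact \<Omega> X PiD Gr Hs \<longleftrightarrow> (\<forall>u. (\<forall>m::nat. u m \<in> X m) \<and> (\<exists>M. \<forall>m. lp_norm 2 \<Omega> (Hs m (u m)) \<le> M)
      \<longrightarrow> lp_relcompact_seq 2 \<Omega> (\<lambda>m. PiD m (u m)) \<and> lp_relcompact_seq 4 \<Omega> (\<lambda>m. Gr m (u m)))"

definition norm_trilinear :: "(real^'d::finite) set
    \<Rightarrow> (('k::finite \<Rightarrow> real^'d \<Rightarrow> real^'d^'d) \<Rightarrow> ('k \<Rightarrow> real^'d \<Rightarrow> real^'d) \<Rightarrow> ('k \<Rightarrow> real^'d \<Rightarrow> real^'d) \<Rightarrow> real)
    \<Rightarrow> real" where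
  "norm_trilinear \<Omega> B = Sup (insert 0
     {\<bar>B \<xi> \<theta> \<eta>\<bar> / (lpk_norm 2 \<Omega> \<xi> * lpk_norm 4 \<Omega> \<theta> * lpk_norm 4 \<Omega> \<eta>) | \<xi> \<theta> \<eta>.
        lpk_mem 2 \<Omega> \<xi> \<and> lpk_mem 4 \<Omega> \<theta> \<and> lpk_mem 4 \<Omega> \<eta>
        \<and> lpk_norm 2 \<Omega> \<xi> * lpk_norm 4 \<Omega> \<theta> * lpk_norm 4 \<Omega> \<eta> \<noteq> 0})"

definition dual_norm_H1 :: "(real^'d::finite) set \<Rightarrow> (('k::finite \<Rightarrow> real^'d \<Rightarrow> real) \<Rightarrow> real) \<Rightarrow> real" where
  "dual_norm_H1 \<Omega> L = Sup (insert 0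
     {\<bar>L \<Phi>\<bar> / h1k_norm \<Omega> \<Phi> G | \<Phi> G. (\<forall>c. in_H10 \<Omega> (\<Phi> c) (G c)) \<and> h1k_norm \<Omega> \<Phi> G \<noteq> 0})"

definition disc_sol where
  "disc_sol X Gr Hs E A B L \<Psi> \<longleftrightarrow> (\<forall>c. \<Psi> c \<in> X) \<and>
     (\<forall>\<Phi>. (\<forall>c. \<Phi> c \<in> X) \<longrightarrow>
        A (\<lambda>c. Hs (\<Psi> c)) (\<lambda>c. Hs (\<Phi> c)) + B (\<lambda>c. Hs (\<Psi> c)) (\<lambda>c. Gr (\<Psi> c)) (\<lambda>c. Gr (\<Phi> c))
          = L (\<lambda>c. E (\<Phi> c)))"

definition cont_sol where
  "cont_sol \<Omega> A B L \<Psi> G H \<longleftrightarrow> (\<forall>c. in_H20 \<Omega> (\<Psi> c) (G c) (H c)) \<and>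
     (\<forall>\<Phi> G\<Phi> H\<Phi>. (\<forall>c. in_H20 \<Omega> (\<Phi> c) (G\<Phi> c) (H\<Phi> c)) \<longrightarrow>
        A H H\<Phi> + B H G G\<Phi> = L \<Phi>)"

end

theory Submission
  imports Defs "HOL-Homology.Brouwer_Degree"
begin

text \<open>Testing the scheme with its own solution kills \<open>B\<close> and bounds \<open>\<Psi>\<close> through the coercivity of
  \<open>A\<close>; the same bound makes the Galerkin vector field point outwards on a large sphere, so that it
  has a zero by a degree argument, and it gives uniqueness for small data. For the limit, compactness
  supplies strong limits of the reconstructed functions and gradients. Weak compactness of the
  Hessians is avoided: convex combinations of their tails that nearly minimise \<open>A(\<xi>, \<xi>)\<close> converge
  strongly to some \<open>H\<close>. As the limit equation and the limit-conformity relations are linear in the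
  Hessian, \<open>H\<close> inherits them. Limit-conformity says that the limit triple is orthogonal to the
  annihilator of the graph of the test functions, so by the projection theorem it lies in
  \<open>H\<^sup>2\<^sub>0\<close>. Testing both equations with their solutions shows that the energies converge, and with
  the parallelogram law this makes the convergence of the Hessians strong.\<close>

section \<open>Lebesgue norms\<close>

text \<open>Functions are representatives, not classes: operators are linear only almost everywhere,
  gradients are known only up to null sets, and \<open>A\<close>, \<open>B\<close>, \<open>L\<close>
  act on functions. That these forms ignore null sets is always drawn from their continuity bounds,
  applied to a difference of norm zero. For \<open>L\<close> the bound involves the gradient, so it
  rests on the uniqueness of gradients in \<open>in_H10\<close>. The sum of \<open>omegaE\<close>
  and |Omega|^(1/4) \<open>C_HD\<close> in the uniqueness condition bounds the gradient of a
  companion function by the discrete norm: the first summand is the distance from the discrete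
  gradient, the second comes from Hoelder's inequality and the L^4 bound of that gradient. The
  energy is minimised rather than the norm because testing with the solution reveals the value of
  the energy, and so its limit, while the norm of the Hessians is not visible in the equation. The
  trilinear term is handled by replacing its second argument by the limit gradient, with an error
  that tends to zero; after that the equation is linear in the Hessian.\<close>

lemma convex_powr_nonneg:
  fixes p u x y :: real
  assumes p: "p \<ge> 1" and u: "0 \<le> u" "u \<le> 1" and "0 \<le> x" "0 \<le> y"
  shows "(u * x + (1 - u) * y) powr p \<le> u * x powr p + (1 - u) * y powr p"
proof -
  have aux: "(c * z) powr p \<le> c * z powr p" if "0 \<le> c" "c \<le> 1" "0 \<le> z" for c z :: real
  proof -
    have "c powr p \<le> c"
      using powr_mono'[of 1 p c] that p by simp
    then show ?thesis using that by (simp add: powr_mult mult_right_mono)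
  qed
  \<comment> \<open>Convexity of the power is quoted for positive arguments; if \<open>x\<close> or
    \<open>y\<close> is zero, only \<open>c powr p \<le> c\<close> for \<open>c\<close> in the unit
    interval remains, which is \<open>aux\<close>.\<close>
  consider "x = 0" | "y = 0" | "x > 0" "y > 0" using assms by linarith
  then show ?thesis
  proof cases
    case 1 then show ?thesis using aux[of "1 - u" y] assms by simp
  next
    case 2 then show ?thesis using aux[of u x] assms by simp
  next
    case 3
    then show ?thesis
      using convex_onD[OF powr_convex[OF p], of "1 - u" x y] u by simp
  qed
qed

section \<open>Membership, norms and Minkowski's inequality in L^p\<close>

lemma lp_memD:
  "lp_mem p \<Omega> f \<Longrightarrow> f \<in> borel_measurable (lebesgue_on \<Omega>)"
  "lp_mem p \<Omega> f \<Longrightarrow> integrable (lebesgue_on \<Omega>) (\<lambda>x. norm (f x) powr p)"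
  by (auto simp: lp_mem_def)

lemma lp_norm_nonneg [simp]: "0 \<le> lp_norm p \<Omega> f"
  by (simp add: lp_norm_def)

lemma lp_integral_nonneg [simp]: "0 \<le> (\<integral>x. norm (f x) powr p \<partial>lebesgue_on \<Omega>)"
  by (simp add: integral_nonneg_AE)

lemma lp_norm_powr: "p > 0 \<Longrightarrow> lp_norm p \<Omega> f powr p = (\<integral>x. norm (f x) powr p \<partial>lebesgue_on \<Omega>)"
  by (simp add: lp_norm_def powr_powr)

text \<open>Comparing integrals with \<open>c powr p\<close> keeps roots out of the later
  estimates.\<close>

lemma lp_norm_le_iff:
  assumes "p > 0" "c \<ge> 0"
  shows "lp_norm p \<Omega> f \<le> c \<longleftrightarrow> (\<integral>x. norm (f x) powr p \<partial>lebesgue_on \<Omega>) \<le> c powr p"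
proof
  assume "lp_norm p \<Omega> f \<le> c"
  then show "(\<integral>x. norm (f x) powr p \<partial>lebesgue_on \<Omega>) \<le> c powr p"
    using assms powr_mono2[of p "lp_norm p \<Omega> f" c] by (simp add: lp_norm_powr)
next
  assume *: "(\<integral>x. norm (f x) powr p \<partial>lebesgue_on \<Omega>) \<le> c powr p"
  show "lp_norm p \<Omega> f \<le> c"
  proof (rule ccontr)
    assume "\<not> ?thesis"
    then show False
      using assms powr_less_mono2[of p c "lp_norm p \<Omega> f"] * by (simp add: lp_norm_powr)
  qed
qed

lemma lp_mem_zero [simp]: "lp_mem p \<Omega> (\<lambda>x. 0)"
  by (simp add: lp_mem_def)

lemma lp_norm_zero [simp]: "lp_norm p \<Omega> (\<lambda>x. 0) = 0"
  by (simp add: lp_norm_def)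

lemma lp_mem_scaleR: "lp_mem p \<Omega> f \<Longrightarrow> lp_mem p \<Omega> (\<lambda>x. c *\<^sub>R f x)"
  by (auto simp: lp_mem_def powr_mult)

lemma lp_norm_scaleR:
  assumes "p > 0" shows "lp_norm p \<Omega> (\<lambda>x. c *\<^sub>R f x) = \<bar>c\<bar> * lp_norm p \<Omega> f"
  using assms by (simp add: lp_norm_def powr_mult powr_powr)

lemma lp_mem_minus: "lp_mem p \<Omega> f \<Longrightarrow> lp_mem p \<Omega> (\<lambda>x. - f x)"
  using lp_mem_scaleR[of p \<Omega> f "-1"] by simp

lemma lp_norm_minus_commute: "lp_norm p \<Omega> (\<lambda>x. f x - g x) = lp_norm p \<Omega> (\<lambda>x. g x - f x)"
  by (simp add: lp_norm_def norm_minus_commute)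

lemma lp_mem_add:
  fixes f g :: "real^'d \<Rightarrow> 'v::euclidean_space"
  assumes p: "p \<ge> 1" and f: "lp_mem p \<Omega> f" and g: "lp_mem p \<Omega> g"
  shows "lp_mem p \<Omega> (\<lambda>x. f x + g x)"
proof -
  have [measurable]: "f \<in> borel_measurable (lebesgue_on \<Omega>)" "g \<in> borel_measurable (lebesgue_on \<Omega>)"
    using f g by (auto dest: lp_memD)
  have "integrable (lebesgue_on \<Omega>) (\<lambda>x. norm (f x + g x) powr p)"
  proof (rule Bochner_Integration.integrable_bound)
    show "integrable (lebesgue_on \<Omega>) (\<lambda>x. 2 powr p * (norm (f x) powr p + norm (g x) powr p))"
      using f g by (auto dest: lp_memD)
    have "norm (f x + g x) powr p \<le> 2 powr p * (norm (f x) powr p + norm (g x) powr p)" for x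
    proof -
      \<comment> \<open>Twice the larger norm dominates the sum, and the power of a maximum is at
        most the sum of the powers.\<close>
      have "norm (f x + g x) powr p \<le> (2 * max (norm (f x)) (norm (g x))) powr p"
        using p by (intro powr_mono2) (auto intro: order_trans[OF norm_triangle_ineq])
      also have "\<dots> = 2 powr p * (max (norm (f x)) (norm (g x))) powr p"
        by (simp add: powr_mult)
      also have "\<dots> \<le> 2 powr p * (norm (f x) powr p + norm (g x) powr p)"
        by (intro mult_left_mono) (auto simp: max_def)
      finally show ?thesis .
    qed
    then show "AE x in lebesgue_on \<Omega>. norm (norm (f x + g x) powr p) \<le> norm (2 powr p * (norm (f x) powr p + norm (g x) powr p))"
      by (intro AE_I2) (simp add: powr_ge_zero)
  qed measurable
  then show ?thesis by (simp add: lp_mem_def)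
qed

text \<open>Minkowski's inequality from convexity of the power: f + g is a + b times the convex
  combination of f / a and g / b with weights a / (a + b) and b / (a + b). Adding e / 2 to each norm
  keeps the divisors positive when a function vanishes almost everywhere.\<close>

lemma lp_norm_triangle:
  fixes f g :: "real^'d \<Rightarrow> 'v::euclidean_space"
  assumes p: "p \<ge> 1" and f: "lp_mem p \<Omega> f" and g: "lp_mem p \<Omega> g"
  shows "lp_norm p \<Omega> (\<lambda>x. f x + g x) \<le> lp_norm p \<Omega> f + lp_norm p \<Omega> g"
proof (rule field_le_epsilon)
  fix e :: real assume e: "e > 0"
  define a where "a = lp_norm p \<Omega> f + e/2"
  define b where "b = lp_norm p \<Omega> g + e/2"
  have a: "a > 0" "lp_norm p \<Omega> f \<le> a" and b: "b > 0" "lp_norm p \<Omega> g \<le> b"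
    using e by (auto simp: a_def b_def add_nonneg_pos)
  let ?u = "a / (a + b)"
  have u: "0 \<le> ?u" "?u \<le> 1" "1 - ?u = b / (a + b)" using a b by (auto simp: field_simps)
  have pw: "norm (f x + g x) powr p \<le> (a+b) powr p * (?u * (norm (f x) powr p / a powr p) + (1 - ?u) * (norm (g x) powr p / b powr p))" for x
  proof -
    have "norm (f x + g x) powr p \<le> (norm (f x) + norm (g x)) powr p"
      using p by (intro powr_mono2) (auto intro: norm_triangle_ineq)
    also have "norm (f x) + norm (g x) = (a + b) * (?u * (norm (f x) / a) + (1 - ?u) * (norm (g x) / b))"
      using a b unfolding u(3) by (simp add: distrib_left)
    also have "\<dots> powr p = (a + b) powr p * (?u * (norm (f x) / a) + (1 - ?u) * (norm (g x) / b)) powr p"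
      by (simp add: powr_mult)
    also have "\<dots> \<le> (a + b) powr p * (?u * (norm (f x) / a) powr p + (1 - ?u) * (norm (g x) / b) powr p)"
      using a b u by (intro mult_left_mono convex_powr_nonneg[OF p]) auto
    finally show ?thesis using a b by (simp add: powr_divide)
  qed
  have If: "(\<integral>x. norm (f x) powr p \<partial>lebesgue_on \<Omega>) / a powr p \<le> 1"
    using a lp_norm_le_iff[of p a \<Omega> f] p by simp
  have Ig: "(\<integral>x. norm (g x) powr p \<partial>lebesgue_on \<Omega>) / b powr p \<le> 1"
    using b lp_norm_le_iff[of p b \<Omega> g] p by simp
  have "(\<integral>x. norm (f x + g x) powr p \<partial>lebesgue_on \<Omega>)
     \<le> (\<integral>x. (a+b) powr p * (?u * (norm (f x) powr p / a powr p) + (1 - ?u) * (norm (g x) powr p / b powr p)) \<partial>lebesgue_on \<Omega>)"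
    using lp_mem_add[OF p f g] lp_memD(2)[OF f] lp_memD(2)[OF g]
    by (intro integral_mono pw Bochner_Integration.integrable_add integrable_mult_right integrable_divide)
      (auto dest: lp_memD)
  also have "\<dots> = (a+b) powr p * (?u * ((\<integral>x. norm (f x) powr p \<partial>lebesgue_on \<Omega>) / a powr p)
      + (1 - ?u) * ((\<integral>x. norm (g x) powr p \<partial>lebesgue_on \<Omega>) / b powr p))"
    using f g by (simp add: lp_memD)
  also have "\<dots> \<le> (a+b) powr p * (?u * 1 + (1 - ?u) * 1)"
    using u If Ig by (intro mult_left_mono add_mono) auto
  finally have "lp_norm p \<Omega> (\<lambda>x. f x + g x) \<le> a + b"
    using a b p by (subst lp_norm_le_iff) auto
  then show "lp_norm p \<Omega> (\<lambda>x. f x + g x) \<le> lp_norm p \<Omega> f + lp_norm p \<Omega> g + e"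
    by (simp add: a_def b_def)
qed

lemma lp_mem_diff:
  fixes f g :: "real^'d \<Rightarrow> 'v::euclidean_space"
  assumes "p \<ge> 1" "lp_mem p \<Omega> f" "lp_mem p \<Omega> g"
  shows "lp_mem p \<Omega> (\<lambda>x. f x - g x)"
  using lp_mem_add[OF assms(1,2) lp_mem_minus[OF assms(3)]] by simp

lemma lp_norm_triangle3:
  fixes f g h :: "real^'d \<Rightarrow> 'v::euclidean_space"
  assumes "p \<ge> 1" "lp_mem p \<Omega> f" "lp_mem p \<Omega> g" "lp_mem p \<Omega> h"
  shows "lp_norm p \<Omega> (\<lambda>x. f x - h x) \<le> lp_norm p \<Omega> (\<lambda>x. f x - g x) + lp_norm p \<Omega> (\<lambda>x. g x - h x)"
  using lp_norm_triangle[OF assms(1) lp_mem_diff[OF assms(1-3)] lp_mem_diff[OF assms(1,3,4)]] by simp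

lemma lp_norm_diff_abs:
  fixes f g :: "real^'d \<Rightarrow> 'v::euclidean_space"
  assumes "p \<ge> 1" "lp_mem p \<Omega> f" "lp_mem p \<Omega> g"
  shows "\<bar>lp_norm p \<Omega> f - lp_norm p \<Omega> g\<bar> \<le> lp_norm p \<Omega> (\<lambda>x. f x - g x)"
  using lp_norm_triangle[OF assms(1) lp_mem_diff[OF assms(1-3)] assms(3)]
    lp_norm_triangle[OF assms(1) lp_mem_diff[OF assms(1,3,2)] assms(2)]
  by (simp add: lp_norm_minus_commute[of p \<Omega> f g])

lemma lp_mem_sum:
  fixes f :: "'i \<Rightarrow> real^'d \<Rightarrow> 'v::euclidean_space"
  assumes "p \<ge> 1" "\<And>i. i \<in> I \<Longrightarrow> lp_mem p \<Omega> (f i)"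
  shows "lp_mem p \<Omega> (\<lambda>x. \<Sum>i\<in>I. f i x)"
  using assms(2) by (induction I rule: infinite_finite_induct) (auto intro: lp_mem_add[OF assms(1)])

lemma lp_norm_sum:
  fixes f :: "'i \<Rightarrow> real^'d \<Rightarrow> 'v::euclidean_space"
  assumes "p \<ge> 1" "\<And>i. i \<in> I \<Longrightarrow> lp_mem p \<Omega> (f i)"
  shows "lp_norm p \<Omega> (\<lambda>x. \<Sum>i\<in>I. f i x) \<le> (\<Sum>i\<in>I. lp_norm p \<Omega> (f i))"
  using assms(2)
proof (induction I rule: infinite_finite_induct)
  case (insert i I)
  have "\<And>j. j \<in> I \<Longrightarrow> lp_mem p \<Omega> (f j)" using insert.prems by blast
  then have "lp_norm p \<Omega> (\<lambda>x. f i x + (\<Sum>i\<in>I. f i x)) \<le> lp_norm p \<Omega> (f i) + lp_norm p \<Omega> (\<lambda>x. \<Sum>i\<in>I. f i x)"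
    using insert.prems by (intro lp_norm_triangle lp_mem_sum assms(1)) auto
  with insert show ?case by auto
qed auto

lemma lp_norm_cong_AE:
  assumes "AE x in lebesgue_on \<Omega>. f x = g x"
    "f \<in> borel_measurable (lebesgue_on \<Omega>)" "g \<in> borel_measurable (lebesgue_on \<Omega>)"
  shows "lp_norm p \<Omega> f = lp_norm p \<Omega> g"
  unfolding lp_norm_def using assms by (intro arg_cong2[where f="(powr)"] integral_cong_AE) auto

lemma lp_norm_eq_0_iff:
  assumes "p > 0" "lp_mem p \<Omega> f"
  shows "lp_norm p \<Omega> f = 0 \<longleftrightarrow> (AE x in lebesgue_on \<Omega>. f x = 0)"
proof -
  have "lp_norm p \<Omega> f = 0 \<longleftrightarrow> (\<integral>x. norm (f x) powr p \<partial>lebesgue_on \<Omega>) = 0"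
    by (simp add: lp_norm_def)
  also have "\<dots> \<longleftrightarrow> (AE x in lebesgue_on \<Omega>. norm (f x) powr p = 0)"
    using assms by (intro integral_nonneg_eq_0_iff_AE) (auto dest: lp_memD)
  finally show ?thesis by simp
qed

lemma lp_norm_diff_eq_0_AE:
  fixes f g :: "real^'d \<Rightarrow> 'v::euclidean_space"
  assumes "p \<ge> 1" "lp_mem p \<Omega> f" "lp_mem p \<Omega> g"
  shows "lp_norm p \<Omega> (\<lambda>x. f x - g x) = 0 \<longleftrightarrow> (AE x in lebesgue_on \<Omega>. f x = g x)"
  using lp_norm_eq_0_iff[OF _ lp_mem_diff[OF assms]] assms(1) by simp

section \<open>The inner product of L^2 and embeddings on sets of finite measure\<close>

lemma lp_mem_2_iff:
  "lp_mem 2 \<Omega> f \<longleftrightarrow> f \<in> borel_measurable (lebesgue_on \<Omega>) \<and> integrable (lebesgue_on \<Omega>) (\<lambda>x. (norm (f x))\<^sup>2)"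
  by (simp add: lp_mem_def)

lemma lp_mem_4_iff:
  "lp_mem 4 \<Omega> f \<longleftrightarrow> f \<in> borel_measurable (lebesgue_on \<Omega>) \<and> integrable (lebesgue_on \<Omega>) (\<lambda>x. (norm (f x))^4)"
  by (simp add: lp_mem_def)

lemma lp_norm_2_sq: "(lp_norm 2 \<Omega> f)\<^sup>2 = (\<integral>x. (norm (f x))\<^sup>2 \<partial>lebesgue_on \<Omega>)"
  using lp_norm_powr[of 2 \<Omega> f] by simp

lemma lp_norm_4_pow: "(lp_norm 4 \<Omega> f)^4 = (\<integral>x. (norm (f x))^4 \<partial>lebesgue_on \<Omega>)"
  using lp_norm_powr[of 4 \<Omega> f] by simp

lemma lp_mem_bound:
  fixes f :: "real^'d \<Rightarrow> 'v::euclidean_space" and g :: "real^'d \<Rightarrow> 'w::euclidean_space"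
  assumes g: "lp_mem p \<Omega> g" and f: "f \<in> borel_measurable (lebesgue_on \<Omega>)" and p: "p \<ge> 1"
    and le: "\<And>x. norm (f x) \<le> norm (g x)"
  shows "lp_mem p \<Omega> f" "lp_norm p \<Omega> f \<le> lp_norm p \<Omega> g"
proof -
  have le': "norm (f x) powr p \<le> norm (g x) powr p" for x
    using p le by (intro powr_mono2) auto
  have "integrable (lebesgue_on \<Omega>) (\<lambda>x. norm (f x) powr p)"
  proof (rule Bochner_Integration.integrable_bound[OF lp_memD(2)[OF g]])
    show "(\<lambda>x. norm (f x) powr p) \<in> borel_measurable (lebesgue_on \<Omega>)"
      using f by measurable
    show "AE x in lebesgue_on \<Omega>. norm (norm (f x) powr p) \<le> norm (norm (g x) powr p)"
      by (intro AE_I2) (simp add: le')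
  qed
  then show m: "lp_mem p \<Omega> f" using f by (simp add: lp_mem_def)
  show "lp_norm p \<Omega> f \<le> lp_norm p \<Omega> g"
    unfolding lp_norm_def using p m g
    by (intro powr_mono2 integral_mono le') (auto dest: lp_memD)
qed

lemma lp_mem_inner_integrable:
  fixes f g :: "real^'d \<Rightarrow> 'v::euclidean_space"
  assumes f: "lp_mem 2 \<Omega> f" and g: "lp_mem 2 \<Omega> g"
  shows "integrable (lebesgue_on \<Omega>) (\<lambda>x. f x \<bullet> g x)"
proof (rule Bochner_Integration.integrable_bound)
  show "integrable (lebesgue_on \<Omega>) (\<lambda>x. (norm (f x))\<^sup>2 + (norm (g x))\<^sup>2)"
    using f g by (auto simp: lp_mem_2_iff)
  show "(\<lambda>x. f x \<bullet> g x) \<in> borel_measurable (lebesgue_on \<Omega>)"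
    using f g by (auto simp: lp_mem_2_iff)
  have "\<bar>f x \<bullet> g x\<bar> \<le> (norm (f x))\<^sup>2 + (norm (g x))\<^sup>2" for x
  proof -
    have "\<bar>f x \<bullet> g x\<bar> \<le> norm (f x) * norm (g x)" by (rule Cauchy_Schwarz_ineq2)
    also have "\<dots> \<le> (norm (f x))\<^sup>2 + (norm (g x))\<^sup>2"
      using sum_squares_bound[of "norm (f x)" "norm (g x)"] mult_nonneg_nonneg[OF norm_ge_zero norm_ge_zero, of "f x" "g x"]
      by linarith
    finally show ?thesis .
  qed
  then show "AE x in lebesgue_on \<Omega>. norm (f x \<bullet> g x) \<le> norm ((norm (f x))\<^sup>2 + (norm (g x))\<^sup>2)"
    by (intro AE_I2) simp
qed

lemma lp_norm_2_sq_inner: "(lp_norm 2 \<Omega> f)\<^sup>2 = (\<integral>x. f x \<bullet> f x \<partial>lebesgue_on \<Omega>)"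
  by (simp add: lp_norm_2_sq power2_norm_eq_inner)

lemma lp_norm_2_combo:
  fixes f g :: "real^'d \<Rightarrow> 'v::euclidean_space"
  assumes f: "lp_mem 2 \<Omega> f" and g: "lp_mem 2 \<Omega> g"
  shows "(lp_norm 2 \<Omega> (\<lambda>x. f x + t *\<^sub>R g x))\<^sup>2
    = (lp_norm 2 \<Omega> f)\<^sup>2 + 2 * t * (\<integral>x. f x \<bullet> g x \<partial>lebesgue_on \<Omega>) + t\<^sup>2 * (lp_norm 2 \<Omega> g)\<^sup>2"
proof -
  have "(lp_norm 2 \<Omega> (\<lambda>x. f x + t *\<^sub>R g x))\<^sup>2 = (\<integral>x. f x \<bullet> f x + (2 * t * (f x \<bullet> g x) + t\<^sup>2 * (g x \<bullet> g x)) \<partial>lebesgue_on \<Omega>)"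
    unfolding lp_norm_2_sq_inner
    by (intro Bochner_Integration.integral_cong refl)
      (simp add: inner_add_left inner_add_right inner_commute[of "g _" "f _"] power2_eq_square algebra_simps)
  also have "\<dots> = (lp_norm 2 \<Omega> f)\<^sup>2 + 2 * t * (\<integral>x. f x \<bullet> g x \<partial>lebesgue_on \<Omega>) + t\<^sup>2 * (lp_norm 2 \<Omega> g)\<^sup>2"
    using lp_mem_inner_integrable[OF f f] lp_mem_inner_integrable[OF f g] lp_mem_inner_integrable[OF g g]
    by (simp add: lp_norm_2_sq_inner)
  finally show ?thesis .
qed

lemma lp_Cauchy_Schwarz:
  fixes f g :: "real^'d \<Rightarrow> 'v::euclidean_space"
  assumes f: "lp_mem 2 \<Omega> f" and g: "lp_mem 2 \<Omega> g"
  shows "\<bar>\<integral>x. f x \<bullet> g x \<partial>lebesgue_on \<Omega>\<bar> \<le> lp_norm 2 \<Omega> f * lp_norm 2 \<Omega> g"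
proof -
  let ?i = "\<integral>x. f x \<bullet> g x \<partial>lebesgue_on \<Omega>" and ?a = "lp_norm 2 \<Omega> f" and ?b = "lp_norm 2 \<Omega> g"
  have q: "0 \<le> ?a\<^sup>2 + 2 * t * ?i + t\<^sup>2 * ?b\<^sup>2" for t
    using lp_norm_2_combo[OF f g, of t] by (metis zero_le_power2)
  show ?thesis
  \<comment> \<open>The quadratic in \<open>t\<close> is nonnegative everywhere. If its leading
    coefficient vanishes it is affine, so its slope must vanish; otherwise its value at the
    minimiser \<open>- ?i / ?b\<^sup>2\<close> gives the claim.\<close>
  proof (cases "?b = 0")
    case True
    have "?i = 0"
    proof (rule ccontr)
      assume "?i \<noteq> 0"
      \<comment> \<open>This choice of \<open>t\<close> would make the affine function equal to
        -1.\<close>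
      have "2 * (- (?a\<^sup>2 + 1) / (2 * ?i)) * ?i = - (?a\<^sup>2 + 1)"
        using \<open>?i \<noteq> 0\<close> by (simp add: field_simps)
      then show False using q[of "- (?a\<^sup>2 + 1) / (2 * ?i)"] True by simp
    qed
    then show ?thesis by simp
  next
    case False
    then have b: "?b > 0" using lp_norm_nonneg[of 2 \<Omega> g] by linarith
    have "0 \<le> ?a\<^sup>2 + 2 * (- ?i / ?b\<^sup>2) * ?i + (- ?i / ?b\<^sup>2)\<^sup>2 * ?b\<^sup>2" by (rule q)
    also have "\<dots> = ?a\<^sup>2 - ?i\<^sup>2 / ?b\<^sup>2" using b by (simp add: field_simps power2_eq_square)
    finally have "?i\<^sup>2 \<le> (?a * ?b)\<^sup>2" using b by (simp add: field_simps power_mult_distrib)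
    then show ?thesis using abs_le_square_iff[of ?i "?a * ?b"] by simp
  qed
qed

lemma lp_norm_2_parallelogram:
  fixes f g :: "real^'d \<Rightarrow> 'v::euclidean_space"
  assumes f: "lp_mem 2 \<Omega> f" and g: "lp_mem 2 \<Omega> g"
  shows "(lp_norm 2 \<Omega> (\<lambda>x. f x + g x))\<^sup>2 + (lp_norm 2 \<Omega> (\<lambda>x. f x - g x))\<^sup>2
    = 2 * (lp_norm 2 \<Omega> f)\<^sup>2 + 2 * (lp_norm 2 \<Omega> g)\<^sup>2"
  using lp_norm_2_combo[OF f g, of 1] lp_norm_2_combo[OF f g, of "-1"] by simp

lemma integral_lebesgue_on_mult_le:
  fixes f g :: "real^'d \<Rightarrow> real"
  assumes "lp_mem 2 \<Omega> f" "lp_mem 2 \<Omega> g"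
  shows "integrable (lebesgue_on \<Omega>) (\<lambda>x. f x * g x)"
    "\<bar>\<integral>x. f x * g x \<partial>lebesgue_on \<Omega>\<bar> \<le> lp_norm 2 \<Omega> f * lp_norm 2 \<Omega> g"
  using lp_mem_inner_integrable[OF assms] lp_Cauchy_Schwarz[OF assms] by auto

lemma lp_const:
  fixes c :: "'v::euclidean_space"
  assumes "\<Omega> \<in> sets lebesgue" "emeasure lebesgue \<Omega> < \<infinity>"
  shows "lp_mem p \<Omega> (\<lambda>x. c)" "lp_norm p \<Omega> (\<lambda>x. c) = (norm c powr p * measure lebesgue \<Omega>) powr (1/p)"
proof -
  interpret finite_measure "lebesgue_on \<Omega>"
    using assms by (intro finite_measureI) (auto simp: emeasure_restrict_space)
  show "lp_mem p \<Omega> (\<lambda>x. c)" by (auto simp: lp_mem_def)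
  show "lp_norm p \<Omega> (\<lambda>x. c) = (norm c powr p * measure lebesgue \<Omega>) powr (1/p)"
    using assms by (simp add: lp_norm_def measure_restrict_space mult.commute)
qed

text \<open>Cauchy-Schwarz for the squared norm of \<open>f\<close> against the constant 1. The
  power 1/4 of the measure is the one that appears in the uniqueness condition.\<close>

lemma lp_4_imp_2:
  fixes f :: "real^'d \<Rightarrow> 'v::euclidean_space"
  assumes f: "lp_mem 4 \<Omega> f" and om: "\<Omega> \<in> sets lebesgue" "emeasure lebesgue \<Omega> < \<infinity>"
  shows "lp_mem 2 \<Omega> f" "lp_norm 2 \<Omega> f \<le> measure lebesgue \<Omega> powr (1/4) * lp_norm 4 \<Omega> f"
proof -
  have sq: "lp_mem 2 \<Omega> (\<lambda>x. (norm (f x))\<^sup>2)"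
    using f by (auto simp: lp_mem_2_iff lp_mem_4_iff)
  note one = lp_const[OF om, where c="1::real" and p=2]
  show m: "lp_mem 2 \<Omega> f"
    using integral_lebesgue_on_mult_le(1)[OF sq one(1)] f by (simp add: lp_mem_2_iff lp_mem_4_iff)
  have s4: "lp_norm 2 \<Omega> (\<lambda>x. (norm (f x))\<^sup>2) = (lp_norm 4 \<Omega> f)\<^sup>2"
  proof -
    have "(lp_norm 2 \<Omega> (\<lambda>x. (norm (f x))\<^sup>2))\<^sup>2 = ((lp_norm 4 \<Omega> f)\<^sup>2)\<^sup>2"
      using lp_norm_4_pow[of \<Omega> f] by (simp add: lp_norm_2_sq)
    then show ?thesis using power2_eq_iff_nonneg lp_norm_nonneg zero_le_power2 by blast
  qed
  have "(lp_norm 2 \<Omega> f)\<^sup>2 \<le> (lp_norm 4 \<Omega> f)\<^sup>2 * measure lebesgue \<Omega> powr (1/2)"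
    using integral_lebesgue_on_mult_le(2)[OF sq one(1)] one(2) s4 by (simp add: lp_norm_2_sq)
  also have "measure lebesgue \<Omega> powr (1/2) = (measure lebesgue \<Omega> powr (1/4))\<^sup>2"
    by (simp add: power2_eq_square flip: powr_add)
  finally have "(lp_norm 2 \<Omega> f)\<^sup>2 \<le> (measure lebesgue \<Omega> powr (1/4) * lp_norm 4 \<Omega> f)\<^sup>2"
    by (simp add: power_mult_distrib mult.commute)
  then show "lp_norm 2 \<Omega> f \<le> measure lebesgue \<Omega> powr (1/4) * lp_norm 4 \<Omega> f"
    by (rule power2_le_imp_le) simp
qed

section \<open>Fatou's lemma, completeness and projection in L^2\<close>

text \<open>Fatou's lemma is applied to \<open>nn_integral\<close>, which makes sense before
  integrability of the limit is known; the finite bound then yields membership and the norm estimate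
  together.\<close>

lemma lp_fatou:
  fixes u :: "nat \<Rightarrow> real^'d \<Rightarrow> 'v::euclidean_space"
  assumes p: "p > 0" and u: "\<And>n. lp_mem p \<Omega> (u n)" and g: "g \<in> borel_measurable (lebesgue_on \<Omega>)"
    and lim: "AE x in lebesgue_on \<Omega>. (\<lambda>n. u n x) \<longlonglongrightarrow> g x"
    and le: "\<forall>\<^sub>F n in sequentially. lp_norm p \<Omega> (u n) \<le> C" and C: "0 \<le> C"
  shows "lp_mem p \<Omega> g" "lp_norm p \<Omega> g \<le> C"
proof -
  note [measurable] = lp_memD(1)[OF u] g
  have *: "(\<integral>\<^sup>+x. ennreal (norm (u n x) powr p) \<partial>lebesgue_on \<Omega>) \<le> ennreal (C powr p)"
    if "lp_norm p \<Omega> (u n) \<le> C" for n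
    using that lp_norm_le_iff[OF p C, of \<Omega> "u n"] lp_memD(2)[OF u[of n]]
    by (subst nn_integral_eq_integral) (auto intro: ennreal_leI)
  have "(\<integral>\<^sup>+x. ennreal (norm (g x) powr p) \<partial>lebesgue_on \<Omega>)
     = (\<integral>\<^sup>+x. liminf (\<lambda>n. ennreal (norm (u n x) powr p)) \<partial>lebesgue_on \<Omega>)"
  proof (rule nn_integral_cong_AE)
    show "AE x in lebesgue_on \<Omega>. ennreal (norm (g x) powr p) = liminf (\<lambda>n. ennreal (norm (u n x) powr p))"
      using lim
    proof eventually_elim
      case (elim x)
      have "(\<lambda>n. norm (u n x) powr p) \<longlonglongrightarrow> norm (g x) powr p"
        using elim p by (intro tendsto_powr2 tendsto_norm tendsto_const) auto
      then have "(\<lambda>n. ennreal (norm (u n x) powr p)) \<longlonglongrightarrow> ennreal (norm (g x) powr p)"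
        by (rule tendsto_ennrealI)
      from lim_imp_Liminf[OF _ this] show ?case by simp
    qed
  qed
  also have "\<dots> \<le> liminf (\<lambda>n. \<integral>\<^sup>+x. ennreal (norm (u n x) powr p) \<partial>lebesgue_on \<Omega>)"
    by (intro nn_integral_liminf) measurable
  also have "\<dots> \<le> ennreal (C powr p)"
  proof -
    have "\<forall>\<^sub>F n in sequentially. (\<integral>\<^sup>+x. ennreal (norm (u n x) powr p) \<partial>lebesgue_on \<Omega>) \<le> ennreal (C powr p)"
      using le by eventually_elim (rule *)
    from Liminf_mono[OF this] show ?thesis by (simp add: Liminf_const)
  qed
  finally have fin: "(\<integral>\<^sup>+x. ennreal (norm (g x) powr p) \<partial>lebesgue_on \<Omega>) \<le> ennreal (C powr p)" .
  have int: "integrable (lebesgue_on \<Omega>) (\<lambda>x. norm (g x) powr p)"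
    using fin by (intro integrableI_bounded) (auto simp: le_less_trans[OF _ ennreal_less_top] top.not_eq_extremum)
  then show "lp_mem p \<Omega> g" using g by (simp add: lp_mem_def)
  have "(\<integral>x. norm (g x) powr p \<partial>lebesgue_on \<Omega>) \<le> C powr p"
    using fin nn_integral_eq_integral[OF int] by (simp add: ennreal_le_iff)
  then show "lp_norm p \<Omega> g \<le> C" using p C by (simp add: lp_norm_le_iff)
qed

text \<open>Cauchy-Schwarz against the constant 1. The passage to L^1 gives access to
  almost-everywhere subsequences and to the summation of integrals of norms.\<close>

lemma lp_2_L1:
  fixes f :: "real^'d \<Rightarrow> 'v::euclidean_space"
  assumes f: "lp_mem 2 \<Omega> f" and om: "\<Omega> \<in> sets lebesgue" "emeasure lebesgue \<Omega> < \<infinity>"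
  shows "integrable (lebesgue_on \<Omega>) f"
    "(\<integral>x. norm (f x) \<partial>lebesgue_on \<Omega>) \<le> sqrt (measure lebesgue \<Omega>) * lp_norm 2 \<Omega> f"
proof -
  note one = lp_const[OF om, where c="1::real" and p=2]
  have n: "lp_mem 2 \<Omega> (\<lambda>x. norm (f x))" "lp_norm 2 \<Omega> (\<lambda>x. norm (f x)) = lp_norm 2 \<Omega> f"
    using f by (auto simp: lp_mem_def lp_norm_def)
  show "integrable (lebesgue_on \<Omega>) f"
    using integral_lebesgue_on_mult_le(1)[OF n(1) one(1)] f by (simp add: integrable_norm_iff lp_mem_def)
  show "(\<integral>x. norm (f x) \<partial>lebesgue_on \<Omega>) \<le> sqrt (measure lebesgue \<Omega>) * lp_norm 2 \<Omega> f"
    using integral_lebesgue_on_mult_le(2)[OF n(1) one(1)] n(2) one(2)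
    by (simp add: powr_half_sqrt mult.commute)
qed

lemma lp_2_tendsto_AE_subseq:
  fixes u :: "nat \<Rightarrow> real^'d \<Rightarrow> 'v::euclidean_space"
  assumes u: "\<And>n. lp_mem 2 \<Omega> (u n)" and g: "lp_mem 2 \<Omega> g"
    and lim: "(\<lambda>n. lp_norm 2 \<Omega> (\<lambda>x. u n x - g x)) \<longlonglongrightarrow> 0"
    and om: "\<Omega> \<in> sets lebesgue" "emeasure lebesgue \<Omega> < \<infinity>"
  shows "\<exists>r::nat\<Rightarrow>nat. strict_mono r \<and> (AE x in lebesgue_on \<Omega>. (\<lambda>n. u (r n) x) \<longlonglongrightarrow> g x)"
proof -
  have m: "lp_mem 2 \<Omega> (\<lambda>x. u n x - g x)" for n using u g by (intro lp_mem_diff) auto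
  have "(\<lambda>n. \<integral>x. norm (u n x - g x) \<partial>lebesgue_on \<Omega>) \<longlonglongrightarrow> 0"
  proof (rule tendsto_sandwich[OF _ _ tendsto_const])
    show "(\<lambda>n. sqrt (measure lebesgue \<Omega>) * lp_norm 2 \<Omega> (\<lambda>x. u n x - g x)) \<longlonglongrightarrow> 0"
      using tendsto_mult_left[OF lim] by simp
  qed (use lp_2_L1(2)[OF m om] in auto)
  from tendsto_L1_AE_subseq[OF lp_2_L1(1)[OF m om] this]
  obtain r :: "nat \<Rightarrow> nat" where "strict_mono r" "AE x in lebesgue_on \<Omega>. (\<lambda>n. u (r n) x - g x) \<longlonglongrightarrow> 0" by auto
  then show ?thesis by (auto simp: LIM_zero_iff)
qed

text \<open>The Riesz-Fischer argument: along a subsequence with consecutive distances at most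
  \<open>(1/2)^k\<close> the increments are summable in L^1, hence the telescoping series converges
  absolutely at almost every point.\<close>

lemma lp_2_Cauchy_AE_subseq:
  fixes f :: "nat \<Rightarrow> real^'d \<Rightarrow> 'v::euclidean_space"
  assumes f: "\<And>n. lp_mem 2 \<Omega> (f n)"
    and Cauchy: "\<And>e. e > 0 \<Longrightarrow> \<exists>N. \<forall>m\<ge>N. \<forall>n\<ge>N. lp_norm 2 \<Omega> (\<lambda>x. f m x - f n x) < e"
    and om: "\<Omega> \<in> sets lebesgue" "emeasure lebesgue \<Omega> < \<infinity>"
  shows "\<exists>r::nat\<Rightarrow>nat. strict_mono r \<and> (AE x in lebesgue_on \<Omega>. convergent (\<lambda>n. f (r n) x))"
proof -
  note [measurable] = lp_memD(1)[OF f]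
  \<comment> \<open>Dependent choice, because each index has to exceed the previous one.\<close>
  have "\<exists>r. \<forall>k. (\<forall>m\<ge>r k. \<forall>n\<ge>r k. lp_norm 2 \<Omega> (\<lambda>x. f m x - f n x) < (1/2)^k) \<and> r k < r (Suc k)"
  proof (rule dependent_nat_choice)
    show "\<exists>N. \<forall>m\<ge>N. \<forall>n\<ge>N. lp_norm 2 \<Omega> (\<lambda>x. f m x - f n x) < (1/2)^0" using Cauchy[of 1] by simp
    fix N and k :: nat
    obtain N' where "\<forall>m\<ge>N'. \<forall>n\<ge>N'. lp_norm 2 \<Omega> (\<lambda>x. f m x - f n x) < (1/2)^Suc k"
      using Cauchy[of "(1/2)^Suc k"] by auto
    then show "\<exists>M. (\<forall>m\<ge>M. \<forall>n\<ge>M. lp_norm 2 \<Omega> (\<lambda>x. f m x - f n x) < (1/2)^Suc k) \<and> N < M"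
      by (intro exI[of _ "max N' (Suc N)"]) auto
  qed
  then obtain r where r: "\<And>k m n. m \<ge> r k \<Longrightarrow> n \<ge> r k \<Longrightarrow> lp_norm 2 \<Omega> (\<lambda>x. f m x - f n x) < (1/2)^k"
    and mono: "strict_mono r" by (auto simp: strict_mono_Suc_iff)
  define h where "h k x = f (r (Suc k)) x - f (r k) x" for k x
  have hm: "lp_mem 2 \<Omega> (h k)" for k unfolding h_def by (intro lp_mem_diff f) auto
  note [measurable] = lp_memD(1)[OF hm]
  have hn: "lp_norm 2 \<Omega> (h k) \<le> (1/2)^k" for k
    unfolding h_def using r[of k "r (Suc k)" "r k"] mono by (simp add: strict_mono_less_eq less_imp_le)
  let ?c = "sqrt (measure lebesgue \<Omega>)"
  have "(\<integral>\<^sup>+x. (suminf (\<lambda>k. ennreal (norm (h k x)))) \<partial>lebesgue_on \<Omega>) = (suminf (\<lambda>k. \<integral>\<^sup>+x. ennreal (norm (h k x)) \<partial>lebesgue_on \<Omega>))"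
    by (intro nn_integral_suminf) measurable
  also have "\<dots> \<le> (suminf (\<lambda>k. ennreal (?c * (1/2)^k)))"
  proof (intro suminf_le)
    fix k
    have "(\<integral>\<^sup>+x. ennreal (norm (h k x)) \<partial>lebesgue_on \<Omega>) = ennreal (\<integral>x. norm (h k x) \<partial>lebesgue_on \<Omega>)"
      using lp_2_L1(1)[OF hm om] by (intro nn_integral_eq_integral) auto
    also have "\<dots> \<le> ennreal (?c * (1/2)^k)"
      using order_trans[OF lp_2_L1(2)[OF hm om] mult_left_mono[OF hn]] by (intro ennreal_leI) auto
    finally show "(\<integral>\<^sup>+x. ennreal (norm (h k x)) \<partial>lebesgue_on \<Omega>) \<le> ennreal (?c * (1/2)^k)" .
  qed auto
  also have "\<dots> = ennreal (suminf (\<lambda>k. ?c * (1/2)^k))"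
    by (intro suminf_ennreal2) (auto intro!: summable_mult summable_geometric)
  finally have "(\<integral>\<^sup>+x. (suminf (\<lambda>k. ennreal (norm (h k x)))) \<partial>lebesgue_on \<Omega>) \<noteq> \<infinity>"
    by (auto simp: top_unique)
  then have "AE x in lebesgue_on \<Omega>. (suminf (\<lambda>k. ennreal (norm (h k x)))) \<noteq> \<infinity>"
    by (intro nn_integral_PInf_AE) auto
  then have "AE x in lebesgue_on \<Omega>. convergent (\<lambda>n. f (r n) x)"
  proof eventually_elim
    case (elim x)
    then have "summable (\<lambda>k. norm (h k x))"
      by (intro summable_suminf_not_top) auto
    then have "summable (\<lambda>k. h k x)" by (rule summable_norm_cancel)
    then have "convergent (\<lambda>n. \<Sum>k<n. h k x)" by (simp add: summable_iff_convergent)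
    then have "convergent (\<lambda>n. f (r 0) x + (\<Sum>k<n. h k x))"
      by (intro convergent_add convergent_const)
    moreover have "f (r 0) x + (\<Sum>k<n. h k x) = f (r n) x" for n
      using sum_lessThan_telescope[of "\<lambda>k. f (r k) x" n] by (simp add: h_def)
    ultimately show ?case by simp
  qed
  then show ?thesis using mono by blast
qed

lemma lp_2_complete:
  fixes f :: "nat \<Rightarrow> real^'d \<Rightarrow> 'v::euclidean_space"
  assumes f: "\<And>n. lp_mem 2 \<Omega> (f n)"
    and Cauchy: "\<And>e. e > 0 \<Longrightarrow> \<exists>N. \<forall>m\<ge>N. \<forall>n\<ge>N. lp_norm 2 \<Omega> (\<lambda>x. f m x - f n x) < e"
    and om: "\<Omega> \<in> sets lebesgue" "emeasure lebesgue \<Omega> < \<infinity>"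
  obtains g where "lp_mem 2 \<Omega> g" "(\<lambda>n. lp_norm 2 \<Omega> (\<lambda>x. f n x - g x)) \<longlonglongrightarrow> 0"
proof -
  note [measurable] = lp_memD(1)[OF f]
  obtain r :: "nat \<Rightarrow> nat" where r: "strict_mono r" and conv: "AE x in lebesgue_on \<Omega>. convergent (\<lambda>n. f (r n) x)"
    using lp_2_Cauchy_AE_subseq[OF assms] by blast
  define g where "g x = lim (\<lambda>n. f (r n) x)" for x
  have gm[measurable]: "g \<in> borel_measurable (lebesgue_on \<Omega>)"
    unfolding g_def by (intro borel_measurable_lim_metric) measurable
  have lim: "AE x in lebesgue_on \<Omega>. (\<lambda>n. f (r n) x) \<longlonglongrightarrow> g x"
    using conv unfolding g_def by eventually_elim (simp add: convergent_LIMSEQ_iff)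
  \<comment> \<open>Fatou in the subsequence index \<open>k\<close> with \<open>n\<close> fixed: the
    Cauchy bound on the distance of \<open>f n\<close> and \<open>f (r k)\<close> passes to the
    distance of \<open>f n\<close> and \<open>g\<close>.\<close>
  have *: "lp_mem 2 \<Omega> (\<lambda>x. f n x - g x) \<and> lp_norm 2 \<Omega> (\<lambda>x. f n x - g x) \<le> e"
    if e: "e > 0" and N: "\<forall>m\<ge>N. \<forall>n\<ge>N. lp_norm 2 \<Omega> (\<lambda>x. f m x - f n x) < e" "n \<ge> N" for e N n
  proof -
    have 1: "lp_mem 2 \<Omega> (\<lambda>x. f n x - f (r k) x)" for k
      by (intro lp_mem_diff f) auto
    have 2: "AE x in lebesgue_on \<Omega>. (\<lambda>k. f n x - f (r k) x) \<longlonglongrightarrow> f n x - g x"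
      using lim by eventually_elim (intro tendsto_intros)
    have 3: "\<forall>\<^sub>F k in sequentially. lp_norm 2 \<Omega> (\<lambda>x. f n x - f (r k) x) \<le> e"
      using eventually_ge_at_top[of N]
    proof eventually_elim
      case (elim k)
      then have "r k \<ge> N" using seq_suble[OF r, of k] by linarith
      then show ?case using N by (auto intro: less_imp_le)
    qed
    have 4: "(\<lambda>x. f n x - g x) \<in> borel_measurable (lebesgue_on \<Omega>)" by measurable
    show ?thesis using lp_fatou[OF _ 1 4 2 3] e by auto
  qed
  show thesis
  proof
    obtain N where "\<forall>m\<ge>N. \<forall>n\<ge>N. lp_norm 2 \<Omega> (\<lambda>x. f m x - f n x) < 1" using Cauchy[of 1] by auto
    then have "lp_mem 2 \<Omega> (\<lambda>x. f N x - g x)" using *[of 1 N N] by auto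
    \<comment> \<open>\<open>g\<close> is recovered as \<open>f N\<close> minus a difference just
      shown to lie in L^2.\<close>
    from lp_mem_diff[OF _ f[of N] this] show "lp_mem 2 \<Omega> g" by simp
    show "(\<lambda>n. lp_norm 2 \<Omega> (\<lambda>x. f n x - g x)) \<longlonglongrightarrow> 0"
    proof (rule LIMSEQ_I)
      fix e :: real assume "e > 0"
      then obtain N where "\<forall>m\<ge>N. \<forall>n\<ge>N. lp_norm 2 \<Omega> (\<lambda>x. f m x - f n x) < e/2" using Cauchy[of "e/2"] by auto
      then show "\<exists>N. \<forall>n\<ge>N. norm (lp_norm 2 \<Omega> (\<lambda>x. f n x - g x) - 0) < e"
        using *[of "e/2" N] \<open>e > 0\<close> by (intro exI[of _ N]) fastforce
    qed
  qed
qed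

lemma lp_2_tendsto_inner:
  fixes u :: "nat \<Rightarrow> real^'d \<Rightarrow> 'v::euclidean_space"
  assumes u: "\<And>n. lp_mem 2 \<Omega> (u n)" and g: "lp_mem 2 \<Omega> g" and w: "lp_mem 2 \<Omega> w"
    and lim: "(\<lambda>n. lp_norm 2 \<Omega> (\<lambda>x. u n x - g x)) \<longlonglongrightarrow> 0"
  shows "(\<lambda>n. \<integral>x. u n x \<bullet> w x \<partial>lebesgue_on \<Omega>) \<longlonglongrightarrow> (\<integral>x. g x \<bullet> w x \<partial>lebesgue_on \<Omega>)"
proof (rule LIM_zero_cancel, rule Lim_null_comparison)
  show "(\<lambda>n. lp_norm 2 \<Omega> (\<lambda>x. u n x - g x) * lp_norm 2 \<Omega> w) \<longlonglongrightarrow> 0"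
    using tendsto_mult_right[OF lim, of "lp_norm 2 \<Omega> w"] by simp
  show "\<forall>\<^sub>F n in sequentially. norm ((\<integral>x. u n x \<bullet> w x \<partial>lebesgue_on \<Omega>) - (\<integral>x. g x \<bullet> w x \<partial>lebesgue_on \<Omega>))
      \<le> lp_norm 2 \<Omega> (\<lambda>x. u n x - g x) * lp_norm 2 \<Omega> w"
  proof (intro always_eventually allI)
    fix n
    have m: "lp_mem 2 \<Omega> (\<lambda>x. u n x - g x)" using u g by (intro lp_mem_diff) auto
    have "(\<integral>x. u n x \<bullet> w x \<partial>lebesgue_on \<Omega>) - (\<integral>x. g x \<bullet> w x \<partial>lebesgue_on \<Omega>) = (\<integral>x. (u n x - g x) \<bullet> w x \<partial>lebesgue_on \<Omega>)"
      using lp_mem_inner_integrable[OF u w] lp_mem_inner_integrable[OF g w] by (simp add: inner_diff_left)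
    then show "norm ((\<integral>x. u n x \<bullet> w x \<partial>lebesgue_on \<Omega>) - (\<integral>x. g x \<bullet> w x \<partial>lebesgue_on \<Omega>))
      \<le> lp_norm 2 \<Omega> (\<lambda>x. u n x - g x) * lp_norm 2 \<Omega> w"
      using lp_Cauchy_Schwarz[OF m w] by simp
  qed
qed

lemma lp_tendsto_norm:
  fixes u :: "nat \<Rightarrow> real^'d \<Rightarrow> 'v::euclidean_space"
  assumes p: "p \<ge> 1" and u: "\<And>n. lp_mem p \<Omega> (u n)" and g: "lp_mem p \<Omega> g"
    and lim: "(\<lambda>n. lp_norm p \<Omega> (\<lambda>x. u n x - g x)) \<longlonglongrightarrow> 0"
  shows "(\<lambda>n. lp_norm p \<Omega> (u n)) \<longlonglongrightarrow> lp_norm p \<Omega> g"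
  using lp_norm_diff_abs[OF p u g]
  by (intro LIM_zero_cancel[OF Lim_null_comparison[OF _ lim]] always_eventually) auto

lemma quadratic_nonneg_imp_linear_zero:
  fixes a b :: real
  assumes "\<And>t. 0 \<le> t * a + t\<^sup>2 * b"
  shows "a = 0"
proof (rule ccontr)
  assume "a \<noteq> 0"
  \<comment> \<open>With \<open>t = - a / c\<close> the quadratic term cannot compensate the linear
    one: the sum is at most \<open>- a\<^sup>2 / c\<^sup>2\<close>.\<close>
  define c where "c = \<bar>b\<bar> + 1"
  have c: "c > 0" "b \<le> c - 1" by (auto simp: c_def)
  have "0 \<le> (- a / c) * a + (- a / c)\<^sup>2 * b" by (rule assms)
  also have "\<dots> \<le> (- a / c) * a + (- a / c)\<^sup>2 * (c - 1)" using c by (intro add_left_mono mult_left_mono) auto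
  also have "\<dots> = - a\<^sup>2 / c\<^sup>2" using c by (simp add: field_simps power2_eq_square)
  finally show False using c \<open>a \<noteq> 0\<close> by (simp add: divide_le_0_iff)
qed

text \<open>\<open>V\<close> need not be closed, and the conclusion places \<open>F\<close> in its
  closure. A minimising sequence for the distance to \<open>F\<close> is Cauchy by the parallelogram
  law; the residual \<open>R\<close> at its limit is orthogonal to \<open>V\<close>, hence to the
  limit and, by \<open>orth\<close>, to \<open>F\<close>, so it has norm zero.\<close>

lemma lp_2_projection:
  fixes V :: "(real^'d \<Rightarrow> 'v::euclidean_space) set" and F :: "real^'d \<Rightarrow> 'v"
  assumes V: "\<And>v. v \<in> V \<Longrightarrow> lp_mem 2 \<Omega> v" "(\<lambda>x. 0) \<in> V"
      "\<And>v w t. v \<in> V \<Longrightarrow> w \<in> V \<Longrightarrow> (\<lambda>x. v x + t *\<^sub>R w x) \<in> V"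
    and F: "lp_mem 2 \<Omega> F"
    and orth: "\<And>R. lp_mem 2 \<Omega> R \<Longrightarrow> (\<And>v. v \<in> V \<Longrightarrow> (\<integral>x. R x \<bullet> v x \<partial>lebesgue_on \<Omega>) = 0) \<Longrightarrow>
        (\<integral>x. R x \<bullet> F x \<partial>lebesgue_on \<Omega>) = 0"
    and om: "\<Omega> \<in> sets lebesgue" "emeasure lebesgue \<Omega> < \<infinity>"
  obtains v where "\<forall>n. v n \<in> V" "(\<lambda>n. lp_norm 2 \<Omega> (\<lambda>x. v n x - F x)) \<longlonglongrightarrow> 0"
proof -
  define D where "D = (\<lambda>v. (lp_norm 2 \<Omega> (\<lambda>x. F x - v x))\<^sup>2) ` V"
  define d where "d = Inf D"
  have Dne: "D \<noteq> {}" using V(2) by (auto simp: D_def)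
  have bdd: "bdd_below D" by (rule bdd_belowI[of _ 0]) (auto simp: D_def)
  have dle: "d \<le> (lp_norm 2 \<Omega> (\<lambda>x. F x - v x))\<^sup>2" if "v \<in> V" for v
    unfolding d_def using that bdd by (intro cInf_lower) (auto simp: D_def)
  have "\<exists>v\<in>V. (lp_norm 2 \<Omega> (\<lambda>x. F x - v x))\<^sup>2 < d + inverse (real (Suc n))" for n
    using cInf_lessD[OF Dne, of "d + inverse (real (Suc n))"] by (auto simp: d_def D_def)
  then obtain v where v: "\<And>n. v n \<in> V"
    and vd: "\<And>n. (lp_norm 2 \<Omega> (\<lambda>x. F x - v n x))\<^sup>2 < d + inverse (real (Suc n))" by metis
  have vm: "lp_mem 2 \<Omega> (v n)" for n using V(1) v by auto
  have Fvm: "lp_mem 2 \<Omega> (\<lambda>x. F x - v n x)" for n using F vm by (intro lp_mem_diff) auto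
  \<comment> \<open>The closure property of \<open>V\<close> yields midpoints in two moves: add,
    then scale starting from zero.\<close>
  have half: "(\<lambda>x. (1/2) *\<^sub>R (v m x + v n x)) \<in> V" for m n
  proof -
    have "(\<lambda>x. v m x + 1 *\<^sub>R v n x) \<in> V" by (intro V v)
    from V(3)[OF V(2) this, of "1/2"] show ?thesis by simp
  qed
  have dist: "(lp_norm 2 \<Omega> (\<lambda>x. v m x - v n x))\<^sup>2 \<le> 2 * inverse (real (Suc m)) + 2 * inverse (real (Suc n))" for m n
  proof -
    have "(lp_norm 2 \<Omega> (\<lambda>x. (F x - v n x) + (F x - v m x)))\<^sup>2 = 4 * (lp_norm 2 \<Omega> (\<lambda>x. F x - (1/2) *\<^sub>R (v m x + v n x)))\<^sup>2"
    proof -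
      have "(F x - v n x) + (F x - v m x) = 2 *\<^sub>R (F x - (1/2) *\<^sub>R (v m x + v n x))" for x
        by (simp add: scaleR_2 algebra_simps)
      then show ?thesis by (simp only: lp_norm_scaleR) (simp add: power_mult_distrib)
    qed
    also have "\<dots> \<ge> 4 * d" using dle[OF half[of m n]] by simp
    finally have "4 * d \<le> (lp_norm 2 \<Omega> (\<lambda>x. (F x - v n x) + (F x - v m x)))\<^sup>2" .
    moreover have "(lp_norm 2 \<Omega> (\<lambda>x. (F x - v n x) + (F x - v m x)))\<^sup>2 + (lp_norm 2 \<Omega> (\<lambda>x. v m x - v n x))\<^sup>2
        = 2 * (lp_norm 2 \<Omega> (\<lambda>x. F x - v n x))\<^sup>2 + 2 * (lp_norm 2 \<Omega> (\<lambda>x. F x - v m x))\<^sup>2"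
      using lp_norm_2_parallelogram[OF Fvm[of n] Fvm[of m]] by simp
    ultimately show ?thesis using vd[of n] vd[of m] by linarith
  qed
  obtain P where P: "lp_mem 2 \<Omega> P" and Plim: "(\<lambda>n. lp_norm 2 \<Omega> (\<lambda>x. v n x - P x)) \<longlonglongrightarrow> 0"
  proof (rule lp_2_complete[OF vm _ om])
    fix e :: real assume e: "e > 0"
    then obtain N where N: "inverse (real (Suc N)) < e\<^sup>2 / 4"
      using reals_Archimedean[of "e\<^sup>2/4"] by auto
    show "\<exists>N. \<forall>m\<ge>N. \<forall>n\<ge>N. lp_norm 2 \<Omega> (\<lambda>x. v m x - v n x) < e"
    proof (intro exI allI impI)
      fix m n assume "N \<le> m" "N \<le> n"
      then have "inverse (real (Suc m)) \<le> inverse (real (Suc N))" "inverse (real (Suc n)) \<le> inverse (real (Suc N))"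
        by (auto intro: le_imp_inverse_le)
      then have "(lp_norm 2 \<Omega> (\<lambda>x. v m x - v n x))\<^sup>2 < e\<^sup>2" using dist[of m n] N by linarith
      then show "lp_norm 2 \<Omega> (\<lambda>x. v m x - v n x) < e" using e power2_less_imp_less less_imp_le by blast
    qed
  qed
  define R where "R x = F x - P x" for x
  have R: "lp_mem 2 \<Omega> R" unfolding R_def using F P by (intro lp_mem_diff) auto
  have FvR: "(\<lambda>n. lp_norm 2 \<Omega> (\<lambda>x. (F x - v n x) - R x)) \<longlonglongrightarrow> 0"
    using Plim by (simp add: R_def lp_norm_minus_commute[of _ _ P] algebra_simps)
  have Rorth: "(\<integral>x. R x \<bullet> w x \<partial>lebesgue_on \<Omega>) = 0" if w: "w \<in> V" for w
  proof -
    have wm: "lp_mem 2 \<Omega> w" using V(1) w by auto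
    \<comment> \<open>First-order condition at an approximate minimum: moving from
      \<open>v n\<close> along \<open>w\<close> cannot beat the infimum, and the slack
      \<open>inverse (real (Suc n))\<close> disappears in the limit.\<close>
    have "0 \<le> t * (- 2 * (\<integral>x. R x \<bullet> w x \<partial>lebesgue_on \<Omega>)) + t\<^sup>2 * (lp_norm 2 \<Omega> w)\<^sup>2" for t
    proof (rule tendsto_le[OF sequentially_bot _ _ always_eventually])
      show "(\<lambda>n. inverse (real (Suc n)) + (t * (- 2 * (\<integral>x. (F x - v n x) \<bullet> w x \<partial>lebesgue_on \<Omega>)) + t\<^sup>2 * (lp_norm 2 \<Omega> w)\<^sup>2))
        \<longlonglongrightarrow> t * (- 2 * (\<integral>x. R x \<bullet> w x \<partial>lebesgue_on \<Omega>)) + t\<^sup>2 * (lp_norm 2 \<Omega> w)\<^sup>2"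
        using tendsto_add[OF LIMSEQ_inverse_real_of_nat tendsto_add[OF tendsto_mult[OF tendsto_const
            tendsto_mult[OF tendsto_const lp_2_tendsto_inner[OF Fvm R wm FvR]]] tendsto_const], of t "-2" "t\<^sup>2 * (lp_norm 2 \<Omega> w)\<^sup>2"]
        by simp
      show "(\<lambda>n. 0) \<longlonglongrightarrow> (0::real)" by simp
      show "\<forall>n. 0 \<le> inverse (real (Suc n)) + (t * (- 2 * (\<integral>x. (F x - v n x) \<bullet> w x \<partial>lebesgue_on \<Omega>)) + t\<^sup>2 * (lp_norm 2 \<Omega> w)\<^sup>2)"
      proof
        fix n
        have "(\<lambda>x. v n x + t *\<^sub>R w x) \<in> V" using V(3) v w by blast
        from dle[OF this] have "d \<le> (lp_norm 2 \<Omega> (\<lambda>x. (F x - v n x) + (- t) *\<^sub>R w x))\<^sup>2"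
          by (simp add: algebra_simps)
        also have "\<dots> = (lp_norm 2 \<Omega> (\<lambda>x. F x - v n x))\<^sup>2 + 2 * (- t) * (\<integral>x. (F x - v n x) \<bullet> w x \<partial>lebesgue_on \<Omega>) + (- t)\<^sup>2 * (lp_norm 2 \<Omega> w)\<^sup>2"
          by (rule lp_norm_2_combo[OF Fvm wm])
        finally show "0 \<le> inverse (real (Suc n)) + (t * (- 2 * (\<integral>x. (F x - v n x) \<bullet> w x \<partial>lebesgue_on \<Omega>)) + t\<^sup>2 * (lp_norm 2 \<Omega> w)\<^sup>2)"
          using vd[of n] by (simp add: algebra_simps)
      qed
    qed
    from quadratic_nonneg_imp_linear_zero[OF this] show ?thesis by simp
  qed
  have RF: "(\<integral>x. R x \<bullet> F x \<partial>lebesgue_on \<Omega>) = 0" using orth[OF R Rorth] .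
  have "(\<lambda>n. \<integral>x. v n x \<bullet> R x \<partial>lebesgue_on \<Omega>) \<longlonglongrightarrow> (\<integral>x. P x \<bullet> R x \<partial>lebesgue_on \<Omega>)"
    by (rule lp_2_tendsto_inner[OF vm P R Plim])
  moreover have "(\<integral>x. v n x \<bullet> R x \<partial>lebesgue_on \<Omega>) = 0" for n using Rorth[OF v] by (simp add: inner_commute)
  ultimately have RP: "(\<integral>x. R x \<bullet> P x \<partial>lebesgue_on \<Omega>) = 0"
    by (simp add: LIMSEQ_const_iff inner_commute)
  have "(lp_norm 2 \<Omega> R)\<^sup>2 = (\<integral>x. R x \<bullet> F x - R x \<bullet> P x \<partial>lebesgue_on \<Omega>)"
    unfolding lp_norm_2_sq_inner by (intro Bochner_Integration.integral_cong) (auto simp: R_def inner_diff_right)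
  also have "\<dots> = 0" using lp_mem_inner_integrable[OF R F] lp_mem_inner_integrable[OF R P] RF RP by simp
  finally have R0: "lp_norm 2 \<Omega> (\<lambda>x. P x - F x) = 0" by (simp add: R_def[abs_def] lp_norm_minus_commute[of 2 \<Omega> P F])
  show thesis
  proof (rule that)
    show "\<forall>n. v n \<in> V" using v by blast
    show "(\<lambda>n. lp_norm 2 \<Omega> (\<lambda>x. v n x - F x)) \<longlonglongrightarrow> 0"
      by (rule Lim_null_comparison[OF always_eventually Plim])
        (use lp_norm_triangle3[OF _ vm P F] R0 in auto)
  qed
qed

section \<open>Tuples of functions as vector-valued functions\<close>

lemma norm_vec_lambda: "norm (\<chi> c. f c) = sqrt (\<Sum>c\<in>UNIV. (norm (f c))\<^sup>2)"
  by (simp add: norm_vec_def L2_set_def)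

lemma linear_axis: "linear (axis c :: 'v::real_vector \<Rightarrow> 'v^'k)"
  by (rule linearI) (auto simp: vec_eq_iff axis_def)

lemma norm_axis: "norm (axis c v :: 'v::real_normed_vector^'k::finite) = norm v"
proof -
  have "(\<Sum>i\<in>UNIV. (norm ((axis c v :: 'v^'k) $ i))\<^sup>2) = (\<Sum>i\<in>UNIV. if i = c then (norm v)\<^sup>2 else 0)"
    by (intro sum.cong) (auto simp: axis_def)
  then show ?thesis by (simp add: norm_vec_def L2_set_def)
qed

text \<open>A tuple is a single function with values in a finite Euclidean product, so the facts
  about \<open>lp_norm\<close> carry over to tuples.\<close>

lemma lpk_norm_eq: "lpk_norm p \<Omega> F = lp_norm p \<Omega> (\<lambda>x. \<chi> c. F c x)"
  by (simp add: lpk_norm_def lp_norm_def norm_vec_lambda)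

text \<open>Writing the tuple as a sum of \<open>axis\<close> embeddings reduces its membership to
  that of sums; conversely a component is bounded by the whole.\<close>

lemma lpk_mem_iff:
  fixes F :: "'k::finite \<Rightarrow> real^'d \<Rightarrow> 'v::euclidean_space"
  assumes p: "p \<ge> 1"
  shows "lpk_mem p \<Omega> F \<longleftrightarrow> lp_mem p \<Omega> (\<lambda>x. \<chi> c. F c x)"
proof
  assume F: "lpk_mem p \<Omega> F"
  have ax: "lp_mem p \<Omega> (\<lambda>x. axis c (F c x))" for c
  proof (rule lp_mem_bound(1)[OF _ _ p])
    have "continuous_on UNIV (\<lambda>v::'v. axis c v :: 'v^'k)"
      by (intro linear_continuous_on linear_conv_bounded_linear[THEN iffD1, OF linear_axis])
    then have [measurable]: "(\<lambda>v::'v. axis c v :: 'v^'k) \<in> borel_measurable borel"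
      by (rule borel_measurable_continuous_onI)
    have [measurable]: "F c \<in> borel_measurable (lebesgue_on \<Omega>)" using F by (auto simp: lpk_mem_def lp_mem_def)
    show "(\<lambda>x. axis c (F c x)) \<in> borel_measurable (lebesgue_on \<Omega>)" by measurable
    show "lp_mem p \<Omega> (F c)" using F by (simp add: lpk_mem_def)
  qed (simp add: norm_axis)
  have "(\<Sum>c\<in>UNIV. axis c (F c x)) = (\<chi> c. F c x)" for x
    by (simp add: vec_eq_iff axis_def)
  with lp_mem_sum[where f="\<lambda>c x. axis c (F c x)", OF p ax, of UNIV]
  show "lp_mem p \<Omega> (\<lambda>x. \<chi> c. F c x)" by simp
next
  assume F: "lp_mem p \<Omega> (\<lambda>x. \<chi> c. F c x)"
  have "lp_mem p \<Omega> (F c)" for c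
  proof (rule lp_mem_bound(1)[OF F _ p])
    have "continuous_on UNIV (\<lambda>v::'v^'k. v $ c)" by (intro continuous_intros)
    then have [measurable]: "(\<lambda>v::'v^'k. v $ c) \<in> borel_measurable borel"
      by (rule borel_measurable_continuous_onI)
    have [measurable]: "(\<lambda>x. \<chi> c. F c x) \<in> borel_measurable (lebesgue_on \<Omega>)" using F by (simp add: lp_mem_def)
    have "(\<lambda>x. (\<chi> c. F c x) $ c) \<in> borel_measurable (lebesgue_on \<Omega>)" by measurable
    then show "F c \<in> borel_measurable (lebesgue_on \<Omega>)" by simp
    show "norm (F c x) \<le> norm (\<chi> c. F c x)" for x
      using Finite_Cartesian_Product.norm_nth_le[of "\<chi> c. F c x" c] by simp
  qed
  then show "lpk_mem p \<Omega> F" by (simp add: lpk_mem_def)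
qed

lemma lpk_norm_nonneg [simp]: "0 \<le> lpk_norm p \<Omega> F"
  by (simp add: lpk_norm_eq)

lemma lpk_norm_2_sq:
  fixes F :: "'k::finite \<Rightarrow> real^'d \<Rightarrow> 'v::euclidean_space"
  assumes "\<And>c. lp_mem 2 \<Omega> (F c)"
  shows "(lpk_norm 2 \<Omega> F)\<^sup>2 = (\<Sum>c\<in>UNIV. (lp_norm 2 \<Omega> (F c))\<^sup>2)"
proof -
  have "(lpk_norm 2 \<Omega> F)\<^sup>2 = (\<integral>x. (\<Sum>c\<in>UNIV. (norm (F c x))\<^sup>2) \<partial>lebesgue_on \<Omega>)"
    by (simp add: lpk_norm_eq lp_norm_2_sq norm_vec_lambda sum_nonneg)
  also have "\<dots> = (\<Sum>c\<in>UNIV. \<integral>x. (norm (F c x))\<^sup>2 \<partial>lebesgue_on \<Omega>)"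
    using assms by (intro Bochner_Integration.integral_sum) (auto simp: lp_mem_2_iff)
  finally show ?thesis by (simp add: lp_norm_2_sq)
qed

lemma lpk_norm_2_mono:
  fixes F :: "'k::finite \<Rightarrow> real^'d \<Rightarrow> 'v::euclidean_space" and H :: "'k \<Rightarrow> real^'d \<Rightarrow> 'w::euclidean_space"
  assumes F: "\<And>c. lp_mem 2 \<Omega> (F c)" and H: "\<And>c. lp_mem 2 \<Omega> (H c)" and C: "0 \<le> C"
    and le: "\<And>c. lp_norm 2 \<Omega> (F c) \<le> C * lp_norm 2 \<Omega> (H c)"
  shows "lpk_norm 2 \<Omega> F \<le> C * lpk_norm 2 \<Omega> H"
proof -
  have "(lpk_norm 2 \<Omega> F)\<^sup>2 \<le> (\<Sum>c\<in>UNIV. (C * lp_norm 2 \<Omega> (H c))\<^sup>2)"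
    unfolding lpk_norm_2_sq[OF F] by (intro sum_mono power_mono le) simp
  also have "\<dots> = (C * lpk_norm 2 \<Omega> H)\<^sup>2"
    by (simp add: power_mult_distrib lpk_norm_2_sq[OF H] sum_distrib_left)
  finally show ?thesis using C by (intro power2_le_imp_le[of "lpk_norm 2 \<Omega> F"]) simp_all
qed

text \<open>Minkowski in L^2 for the squared norms of the components: the squared L^4 norm of the
  tuple is at most the sum of the squared component norms. Thus the scalar constant \<open>C\<close>
  serves for tuples unchanged, and the uniqueness condition contains no factor that depends on their
  length.\<close>

lemma lpk_norm_4_mono:
  fixes F :: "'k::finite \<Rightarrow> real^'d \<Rightarrow> 'v::euclidean_space" and H :: "'k \<Rightarrow> real^'d \<Rightarrow> 'w::euclidean_space"
  assumes F: "\<And>c. lp_mem 4 \<Omega> (F c)" and H: "\<And>c. lp_mem 2 \<Omega> (H c)" and C: "0 \<le> C"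
    and le: "\<And>c. lp_norm 4 \<Omega> (F c) \<le> C * lp_norm 2 \<Omega> (H c)"
  shows "lpk_norm 4 \<Omega> F \<le> C * lpk_norm 2 \<Omega> H"
proof -
  have sqm: "lp_mem 2 \<Omega> (\<lambda>x. (norm (F c x))\<^sup>2)" for c
    using F[of c] by (auto simp: lp_mem_2_iff lp_mem_4_iff)
  have sqn: "lp_norm 2 \<Omega> (\<lambda>x. (norm (F c x))\<^sup>2) = (lp_norm 4 \<Omega> (F c))\<^sup>2" for c
  proof -
    have "(lp_norm 2 \<Omega> (\<lambda>x. (norm (F c x))\<^sup>2))\<^sup>2 = ((lp_norm 4 \<Omega> (F c))\<^sup>2)\<^sup>2"
      using lp_norm_4_pow[of \<Omega> "F c"] by (simp add: lp_norm_2_sq)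
    then show ?thesis using power2_eq_iff_nonneg lp_norm_nonneg zero_le_power2 by blast
  qed
  have "((lpk_norm 4 \<Omega> F)\<^sup>2)\<^sup>2 = (lpk_norm 4 \<Omega> F)^4" by simp
  also have "\<dots> = (\<integral>x. (\<Sum>c\<in>UNIV. (norm (F c x))\<^sup>2)\<^sup>2 \<partial>lebesgue_on \<Omega>)"
  proof -
    have "norm (\<chi> c. F c x) ^ 4 = (\<Sum>c\<in>UNIV. (norm (F c x))\<^sup>2)\<^sup>2" for x
    proof -
      have "norm (\<chi> c. F c x) ^ 4 = ((norm (\<chi> c. F c x))\<^sup>2)\<^sup>2" by simp
      then show ?thesis by (simp add: norm_vec_lambda sum_nonneg)
    qed
    then show ?thesis by (simp add: lpk_norm_eq lp_norm_4_pow)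
  qed
  also have "\<dots> = (lp_norm 2 \<Omega> (\<lambda>x. \<Sum>c\<in>UNIV. (norm (F c x))\<^sup>2))\<^sup>2"
    by (simp add: lp_norm_2_sq)
  finally have "(lpk_norm 4 \<Omega> F)\<^sup>2 = lp_norm 2 \<Omega> (\<lambda>x. \<Sum>c\<in>UNIV. (norm (F c x))\<^sup>2)"
    using power2_eq_iff_nonneg lp_norm_nonneg zero_le_power2 by blast
  also have "\<dots> \<le> (\<Sum>c\<in>UNIV. (lp_norm 4 \<Omega> (F c))\<^sup>2)"
    using lp_norm_sum[where f="\<lambda>c x. (norm (F c x))\<^sup>2", OF _ sqm, of UNIV] by (simp add: sqn)
  also have "\<dots> \<le> (\<Sum>c\<in>UNIV. (C * lp_norm 2 \<Omega> (H c))\<^sup>2)"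
    by (intro sum_mono power_mono le) simp
  also have "\<dots> = (C * lpk_norm 2 \<Omega> H)\<^sup>2"
    by (simp add: power_mult_distrib lpk_norm_2_sq[OF H] sum_distrib_left)
  finally show ?thesis using C by (intro power2_le_imp_le[of "lpk_norm 4 \<Omega> F"]) simp_all
qed

lemma lpk_norm_le_sum:
  fixes F :: "'k::finite \<Rightarrow> real^'d \<Rightarrow> 'v::euclidean_space"
  assumes p: "p \<ge> 1" and F: "\<And>c. lp_mem p \<Omega> (F c)"
  shows "lpk_norm p \<Omega> F \<le> (\<Sum>c\<in>UNIV. lp_norm p \<Omega> (F c))"
proof -
  have m: "lp_mem p \<Omega> (\<lambda>x. norm (F c x))" for c using F[of c] by (auto simp: lp_mem_def)
  have Fm: "lp_mem p \<Omega> (\<lambda>x. \<chi> c. F c x)" using F lpk_mem_iff[OF p, of \<Omega> F] by (simp add: lpk_mem_def)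
  have "lpk_norm p \<Omega> F \<le> lp_norm p \<Omega> (\<lambda>x. \<Sum>c\<in>UNIV. norm (F c x))"
    unfolding lpk_norm_eq
  proof (rule lp_mem_bound(2)[OF _ lp_memD(1)[OF Fm] p])
    show "lp_mem p \<Omega> (\<lambda>x. \<Sum>c\<in>UNIV. norm (F c x))" by (rule lp_mem_sum[where f="\<lambda>c x. norm (F c x)", OF p m])
    show "norm (\<chi> c. F c x) \<le> norm (\<Sum>c\<in>UNIV. norm (F c x))" for x
      using L2_set_le_sum[of UNIV "\<lambda>c. norm (F c x)"] sum_nonneg[of UNIV "\<lambda>c. norm (F c x)"]
      unfolding norm_vec_def by simp
  qed
  also have "\<dots> \<le> (\<Sum>c\<in>UNIV. lp_norm p \<Omega> (\<lambda>x. norm (F c x)))" by (rule lp_norm_sum[where f="\<lambda>c x. norm (F c x)", OF p m])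
  also have "\<dots> = (\<Sum>c\<in>UNIV. lp_norm p \<Omega> (F c))" by (simp add: lp_norm_def)
  finally show ?thesis .
qed

lemma lp_norm_le_lpk_norm:
  fixes F :: "'k::finite \<Rightarrow> real^'d \<Rightarrow> 'v::euclidean_space"
  assumes p: "p \<ge> 1" and F: "\<And>c. lp_mem p \<Omega> (F c)"
  shows "lp_norm p \<Omega> (F c) \<le> lpk_norm p \<Omega> F"
proof -
  have Fm: "lp_mem p \<Omega> (\<lambda>x. \<chi> c. F c x)" using F lpk_mem_iff[OF p, of \<Omega> F] by (simp add: lpk_mem_def)
  have "norm (F c x) \<le> norm (\<chi> c. F c x)" for x using Finite_Cartesian_Product.norm_nth_le[of "\<chi> c. F c x" c] by simp
  then show ?thesis unfolding lpk_norm_eq by (rule lp_mem_bound(2)[OF Fm lp_memD(1)[OF F] p])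
qed

section \<open>Convex combinations of tails in place of weak limits\<close>

text \<open>The convex hull of a tail of the sequence, generated by binary combinations rather than
  by finite weighted sums, so that convex properties pass to it by induction.\<close>

inductive_set fconv :: "(nat \<Rightarrow> real^'d \<Rightarrow> 'v::real_vector) \<Rightarrow> nat \<Rightarrow> (real^'d \<Rightarrow> 'v) set"
  for u :: "nat \<Rightarrow> real^'d \<Rightarrow> 'v" and n :: nat where
  base: "m \<ge> n \<Longrightarrow> u m \<in> fconv u n"
| comb: "f \<in> fconv u n \<Longrightarrow> g \<in> fconv u n \<Longrightarrow> 0 \<le> t \<Longrightarrow> t \<le> 1 \<Longrightarrow> (\<lambda>x. (1 - t) *\<^sub>R f x + t *\<^sub>R g x) \<in> fconv u n"

lemma fconv_antimono: "f \<in> fconv u m \<Longrightarrow> n \<le> m \<Longrightarrow> f \<in> fconv u n"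
proof (induction rule: fconv.induct)
  case (base k) then show ?case by (intro fconv.base) simp
next
  case (comb f g t) then show ?case by (intro fconv.comb) simp_all
qed

lemma fconv_lp_mem:
  fixes u :: "nat \<Rightarrow> real^'d \<Rightarrow> 'v::euclidean_space"
  assumes "p \<ge> 1" "\<And>n. lp_mem p \<Omega> (u n)" "f \<in> fconv u n"
  shows "lp_mem p \<Omega> f"
  using assms(3) by (induction rule: fconv.induct) (auto intro!: lp_mem_add lp_mem_scaleR assms(1,2))

text \<open>For linear \<open>l\<close> the condition \<open>\<bar>l f - c\<bar> \<le> e\<close> is
  stable under convex combinations, so it spreads from a tail of \<open>u\<close> to its
  hull.\<close>

lemma fconv_linear_tendsto:
  fixes u :: "nat \<Rightarrow> real^'d \<Rightarrow> 'v::euclidean_space"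
  assumes um: "\<And>n. lp_mem 2 \<Omega> (u n)"
    and lin: "\<And>f g a b. lp_mem 2 \<Omega> f \<Longrightarrow> lp_mem 2 \<Omega> g \<Longrightarrow> l (\<lambda>x. a *\<^sub>R f x + b *\<^sub>R g x) = a * l f + b * (l g :: real)"
    and w: "\<And>n. w n \<in> fconv u n" and lim: "(\<lambda>n. l (u n)) \<longlonglongrightarrow> c"
  shows "(\<lambda>n. l (w n)) \<longlonglongrightarrow> c"
proof (rule LIMSEQ_I)
  have *: "\<bar>l f - c\<bar> \<le> e" if f: "f \<in> fconv u n" and N: "\<forall>m\<ge>n. \<bar>l (u m) - c\<bar> \<le> e" for f n e
    using f
  proof (induction rule: fconv.induct)
    case (base m) then show ?case using N by auto
  next
    case (comb f g t)
    have "l (\<lambda>x. (1 - t) *\<^sub>R f x + t *\<^sub>R g x) - c = (1 - t) * (l f - c) + t * (l g - c)"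
      using lin[OF fconv_lp_mem[OF _ um comb.hyps(1)] fconv_lp_mem[OF _ um comb.hyps(2)], of "1 - t" t]
      by (simp add: algebra_simps)
    also have "\<bar>\<dots>\<bar> \<le> (1 - t) * \<bar>l f - c\<bar> + t * \<bar>l g - c\<bar>"
      using comb.hyps by (intro order_trans[OF abs_triangle_ineq]) (simp add: abs_mult)
    also have "\<dots> \<le> (1 - t) * e + t * e" using comb by (intro add_mono mult_left_mono) auto
    finally show ?case by (simp add: algebra_simps)
  qed
  fix e :: real assume e: "e > 0"
  then obtain N where "\<forall>m\<ge>N. norm (l (u m) - c) < e/2" using LIMSEQ_D[OF lim, of "e/2"] by auto
  then have N: "\<bar>l (u m) - c\<bar> \<le> e/2" if "m \<ge> N" for m using that by (auto intro: less_imp_le)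
  have "\<bar>l (w n) - c\<bar> \<le> e/2" if "n \<ge> N" for n
    using *[OF w[of n], of "e/2"] N that by auto
  then show "\<exists>N. \<forall>n\<ge>N. norm (l (w n) - c) < e" using e by (intro exI[of _ N]) fastforce
qed

text \<open>A substitute for weak compactness: convex combinations of the tails of a bounded sequence that
  almost minimise a coercive quadratic form are Cauchy, and if the form converges along the
  original sequence to its value at the limit, then the parallelogram law gives strong convergence
  of that sequence.\<close>
lemma fconv_minimising:
  fixes u :: "nat \<Rightarrow> real^'d \<Rightarrow> 'v::euclidean_space"
  assumes um: "\<And>n. lp_mem 2 \<Omega> (u n)" and ub: "\<And>n. lp_norm 2 \<Omega> (u n) \<le> M"
    and a1: "\<And>f g h s t. lp_mem 2 \<Omega> f \<Longrightarrow> lp_mem 2 \<Omega> g \<Longrightarrow> lp_mem 2 \<Omega> h \<Longrightarrow>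
        a (\<lambda>x. s *\<^sub>R f x + t *\<^sub>R g x) h = s * a f h + t * (a g h :: real)"
    and a2: "\<And>f g h s t. lp_mem 2 \<Omega> f \<Longrightarrow> lp_mem 2 \<Omega> g \<Longrightarrow> lp_mem 2 \<Omega> h \<Longrightarrow>
        a h (\<lambda>x. s *\<^sub>R f x + t *\<^sub>R g x) = s * a h f + t * a h g"
    and ac: "\<And>f g. lp_mem 2 \<Omega> f \<Longrightarrow> lp_mem 2 \<Omega> g \<Longrightarrow> \<bar>a f g\<bar> \<le> C * lp_norm 2 \<Omega> f * lp_norm 2 \<Omega> g"
    and al: "\<alpha> > 0" "\<And>f. lp_mem 2 \<Omega> f \<Longrightarrow> \<alpha> * (lp_norm 2 \<Omega> f)\<^sup>2 \<le> a f f"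
    and om: "\<Omega> \<in> sets lebesgue" "emeasure lebesgue \<Omega> < \<infinity>"
  obtains w H where "lp_mem 2 \<Omega> H" "\<forall>n. w n \<in> fconv u n"
    "(\<lambda>n. lp_norm 2 \<Omega> (\<lambda>x. w n x - H x)) \<longlonglongrightarrow> 0"
    "(\<lambda>n. a (u n) (u n)) \<longlonglongrightarrow> a H H \<longrightarrow> (\<lambda>n. lp_norm 2 \<Omega> (\<lambda>x. u n x - H x)) \<longlonglongrightarrow> 0"
proof -
  define q where "q f = a f f" for f
  have q0: "0 \<le> q f" if "lp_mem 2 \<Omega> f" for f
    using order_trans[OF mult_nonneg_nonneg[OF less_imp_le[OF al(1)] zero_le_power2] al(2)[OF that]]
    by (simp add: q_def)
  \<comment> \<open>Parallelogram law for \<open>q\<close>: the mixed terms \<open>a f g\<close> and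
    \<open>a g f\<close> cancel between the difference and the midpoint. The midpoint is written in
    the form of \<open>fconv.comb\<close>, so that it is recognised as an element of the
    hull.\<close>
  have par: "q (\<lambda>x. f x - g x) = 2 * q f + 2 * q g - 4 * q (\<lambda>x. (1 - 1/2) *\<^sub>R f x + (1/2) *\<^sub>R g x)"
    if f: "lp_mem 2 \<Omega> f" and g: "lp_mem 2 \<Omega> g" for f g
  proof -
    have fg: "lp_mem 2 \<Omega> (\<lambda>x. s *\<^sub>R f x + t *\<^sub>R g x)" for s t
      using f g by (intro lp_mem_add lp_mem_scaleR) auto
    have ex: "q (\<lambda>x. s *\<^sub>R f x + t *\<^sub>R g x) = s * s * a f f + s * t * a f g + t * s * a g f + t * t * a g g" for s t
      unfolding q_def a1[OF f g fg] a2[OF f g f] a2[OF f g g] by (simp add: algebra_simps)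
    show ?thesis using ex[of 1 "-1"] ex[of "1 - 1/2" "1/2"] by (simp add: q_def)
  qed
  define K where "K n = fconv u n" for n
  have Km: "lp_mem 2 \<Omega> f" if "f \<in> K n" for f n using fconv_lp_mem[OF _ um] that unfolding K_def by simp
  \<comment> \<open>Least energy over the hull of the \<open>n\<close>-th tail. The tails shrink, so
    \<open>d\<close> increases; it stays below the energies of the sequence itself and therefore
    converges.\<close>
  define d where "d n = Inf (q ` K n)" for n
  have bdd: "bdd_below (q ` K n)" for n using Km q0 by (intro bdd_belowI[of _ 0]) auto
  have une: "u m \<in> K n" if "m \<ge> n" for m n using that by (auto simp: K_def intro: fconv.base)
  have ne: "q ` K n \<noteq> {}" for n using une[of n n] by auto
  have dle: "d n \<le> q f" if "f \<in> K n" for f n using bdd that unfolding d_def by (intro cInf_lower) auto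
  have dmono: "d n \<le> d m" if "n \<le> m" for n m
    unfolding d_def[of m] using dle fconv_antimono[OF _ that] by (intro cInf_greatest[OF ne]) (auto simp: K_def)
  have M0: "0 \<le> M" using order_trans[OF lp_norm_nonneg ub] .
  have qb: "q (u n) \<le> \<bar>C\<bar> * M * M" for n
  proof -
    have "q (u n) \<le> C * lp_norm 2 \<Omega> (u n) * lp_norm 2 \<Omega> (u n)" using ac[OF um um] unfolding q_def by (meson abs_le_D1)
    also have "\<dots> \<le> \<bar>C\<bar> * lp_norm 2 \<Omega> (u n) * lp_norm 2 \<Omega> (u n)" by (intro mult_right_mono) auto
    also have "\<dots> \<le> \<bar>C\<bar> * M * M" using ub[of n] M0 by (intro mult_mono) auto
    finally show ?thesis .
  qed
  have db: "d n \<le> \<bar>C\<bar> * M * M" for n using dle[OF une[of n n]] qb[of n] by simp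
  have "incseq d" using dmono by (auto simp: incseq_def)
  then obtain D where D: "d \<longlonglongrightarrow> D"
    using incseq_convergent[of d "\<bar>C\<bar> * M * M"] db by blast
  have "\<exists>w\<in>K n. q w < d n + inverse (real (Suc n))" for n
    using cInf_lessD[OF ne, of n "d n + inverse (real (Suc n))"] by (auto simp: d_def)
  then obtain w where w: "\<And>n. w n \<in> K n" and wd: "\<And>n. q (w n) < d n + inverse (real (Suc n))" by metis
  have wm: "lp_mem 2 \<Omega> (w n)" for n using Km w by blast
  have qw: "(\<lambda>n. q (w n)) \<longlonglongrightarrow> D"
  proof (rule tendsto_sandwich[OF _ _ D])
    show "(\<lambda>n. d n + inverse (real (Suc n))) \<longlonglongrightarrow> D"
      using tendsto_add[OF D LIMSEQ_inverse_real_of_nat] by simp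
  qed (use dle[OF w] wd in \<open>auto intro: less_imp_le always_eventually\<close>)
  \<comment> \<open>The midpoint of \<open>f\<close> and \<open>w n\<close> lies in the hull and has
    energy at least \<open>d n\<close>. With the parallelogram law and coercivity, elements of
    almost minimal energy must be close to \<open>w n\<close>.\<close>
  have est: "\<alpha> * (lp_norm 2 \<Omega> (\<lambda>x. f x - w n x))\<^sup>2 \<le> 2 * q f + 2 * q (w n) - 4 * d n" if "f \<in> K n" for f n
  proof -
    have mid: "(\<lambda>x. (1 - 1/2) *\<^sub>R f x + (1/2) *\<^sub>R w n x) \<in> K n"
      using that w unfolding K_def by (intro fconv.comb) auto
    have "\<alpha> * (lp_norm 2 \<Omega> (\<lambda>x. f x - w n x))\<^sup>2 \<le> q (\<lambda>x. f x - w n x)"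
      unfolding q_def using Km[OF that] wm by (intro al lp_mem_diff) auto
    also have "\<dots> \<le> 2 * q f + 2 * q (w n) - 4 * d n"
      unfolding par[OF Km[OF that] wm] using dle[OF mid] by linarith
    finally show ?thesis .
  qed
  obtain H where H: "lp_mem 2 \<Omega> H" and wH: "(\<lambda>n. lp_norm 2 \<Omega> (\<lambda>x. w n x - H x)) \<longlonglongrightarrow> 0"
  proof (rule lp_2_complete[OF wm _ om])
    fix e :: real assume e: "e > 0"
    \<comment> \<open>All three quantities deviate from their common limit by less than \<alpha> e^2
      / 8, and the weights 2, 2 and 4 in \<open>est\<close> add up to 8. The later
      \<open>w m\<close> lies in the hull of the earlier tail, whence the order
      \<open>n \<le> m\<close>.\<close>
    have close: "lp_norm 2 \<Omega> (\<lambda>x. w m x - w n x) < e" if mn: "n \<le> m"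
      and 1: "\<bar>q (w m) - D\<bar> < \<alpha> * e\<^sup>2 / 8" "\<bar>q (w n) - D\<bar> < \<alpha> * e\<^sup>2 / 8" "\<bar>d n - D\<bar> < \<alpha> * e\<^sup>2 / 8" for m n
    proof -
      have "w m \<in> K n" using fconv_antimono[OF _ mn] w[of m] by (auto simp: K_def)
      from est[OF this] 1 have "\<alpha> * (lp_norm 2 \<Omega> (\<lambda>x. w m x - w n x))\<^sup>2 < \<alpha> * e\<^sup>2" by linarith
      then have "(lp_norm 2 \<Omega> (\<lambda>x. w m x - w n x))\<^sup>2 < e\<^sup>2" using al(1) by simp
      then show ?thesis using e power2_less_imp_less less_imp_le by blast
    qed
    have "\<alpha> * e\<^sup>2 / 8 > 0" using al(1) e by simp
    from LIMSEQ_D[OF qw this] LIMSEQ_D[OF D this]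
    obtain N1 N2 where N: "\<And>n. n\<ge>N1 \<Longrightarrow> \<bar>q (w n) - D\<bar> < \<alpha> * e\<^sup>2 / 8" "\<And>n. n\<ge>N2 \<Longrightarrow> \<bar>d n - D\<bar> < \<alpha> * e\<^sup>2 / 8"
      unfolding real_norm_def by blast
    show "\<exists>N. \<forall>m\<ge>N. \<forall>n\<ge>N. lp_norm 2 \<Omega> (\<lambda>x. w m x - w n x) < e"
    proof (intro exI[of _ "max N1 N2"] allI impI)
      fix m n assume "max N1 N2 \<le> m" "max N1 N2 \<le> n"
      then have "N1 \<le> m" "N1 \<le> n" "N2 \<le> m" "N2 \<le> n" by auto
      note N' = N(1)[OF this(1)] N(1)[OF this(2)] N(2)[OF this(3)] N(2)[OF this(4)]
      consider "n \<le> m" | "m \<le> n" by linarith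
      then show "lp_norm 2 \<Omega> (\<lambda>x. w m x - w n x) < e"
      proof cases
        case 1 then show ?thesis using close N' by blast
      next
        case 2 then show ?thesis
          using close N' unfolding lp_norm_minus_commute[of 2 \<Omega> "w m" "w n"] by blast
      qed
    qed
  qed
  \<comment> \<open>Continuity of \<open>q\<close> identifies the limit energy \<open>D\<close> with
    \<open>q H\<close>. Energies of \<open>u\<close> that tend to \<open>a H H\<close> therefore
    tend to the minimal energy, and \<open>est\<close> can be applied to \<open>u n\<close>
    itself.\<close>
  have "(\<lambda>n. q (w n)) \<longlonglongrightarrow> q H"
  proof (rule LIM_zero_cancel, rule Lim_null_comparison[OF always_eventually])
    show "\<forall>n. norm (q (w n) - q H) \<le> \<bar>C\<bar> * lp_norm 2 \<Omega> (\<lambda>x. w n x - H x) * (lp_norm 2 \<Omega> (w n) + lp_norm 2 \<Omega> H)"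
    proof
      fix n
      have dm: "lp_mem 2 \<Omega> (\<lambda>x. w n x - H x)" using wm H by (intro lp_mem_diff) auto
      have "a (\<lambda>x. w n x - H x) (w n) = a (w n) (w n) - a H (w n)" using a1[OF wm H wm, where s=1 and t="-1"] by simp
      moreover have "a H (\<lambda>x. w n x - H x) = a H (w n) - a H H" using a2[OF wm H H, where s=1 and t="-1"] by simp
      ultimately have "q (w n) - q H = a (\<lambda>x. w n x - H x) (w n) + a H (\<lambda>x. w n x - H x)" by (simp add: q_def)
      also have "norm \<dots> \<le> \<bar>a (\<lambda>x. w n x - H x) (w n)\<bar> + \<bar>a H (\<lambda>x. w n x - H x)\<bar>" by simp
      also have "\<dots> \<le> C * lp_norm 2 \<Omega> (\<lambda>x. w n x - H x) * lp_norm 2 \<Omega> (w n) + C * lp_norm 2 \<Omega> H * lp_norm 2 \<Omega> (\<lambda>x. w n x - H x)"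
        by (intro add_mono ac dm wm H)
      also have "\<dots> = C * (lp_norm 2 \<Omega> (\<lambda>x. w n x - H x) * (lp_norm 2 \<Omega> (w n) + lp_norm 2 \<Omega> H))" by (simp add: algebra_simps)
      also have "\<dots> \<le> \<bar>C\<bar> * (lp_norm 2 \<Omega> (\<lambda>x. w n x - H x) * (lp_norm 2 \<Omega> (w n) + lp_norm 2 \<Omega> H))"
        by (intro mult_right_mono) auto
      finally show "norm (q (w n) - q H) \<le> \<bar>C\<bar> * lp_norm 2 \<Omega> (\<lambda>x. w n x - H x) * (lp_norm 2 \<Omega> (w n) + lp_norm 2 \<Omega> H)"
        by (simp add: mult.assoc)
    qed
    show "(\<lambda>n. \<bar>C\<bar> * lp_norm 2 \<Omega> (\<lambda>x. w n x - H x) * (lp_norm 2 \<Omega> (w n) + lp_norm 2 \<Omega> H)) \<longlonglongrightarrow> 0"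
      using tendsto_mult[OF tendsto_mult_left[OF wH, of "\<bar>C\<bar>"] tendsto_add[OF lp_tendsto_norm[OF _ wm H wH] tendsto_const[of "lp_norm 2 \<Omega> H"]]] by simp
  qed
  then have qHD: "q H = D" using qw LIMSEQ_unique by blast
  show thesis
  proof (rule that[OF H _ wH])
    show "\<forall>n. w n \<in> fconv u n" using w by (simp add: K_def)
  next
    show "(\<lambda>n. a (u n) (u n)) \<longlonglongrightarrow> a H H \<longrightarrow> (\<lambda>n. lp_norm 2 \<Omega> (\<lambda>x. u n x - H x)) \<longlonglongrightarrow> 0"
    proof
      assume "(\<lambda>n. a (u n) (u n)) \<longlonglongrightarrow> a H H"
      then have qu: "(\<lambda>n. q (u n)) \<longlonglongrightarrow> D" using qHD by (simp add: q_def)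
      have lim0: "(\<lambda>n. (2 * q (u n) + 2 * q (w n) - 4 * d n) / \<alpha>) \<longlonglongrightarrow> (2 * D + 2 * D - 4 * D) / \<alpha>"
        by (intro tendsto_divide tendsto_diff tendsto_add tendsto_mult tendsto_const qu qw D) (use al in auto)
      have sq0: "(\<lambda>n. (lp_norm 2 \<Omega> (\<lambda>x. u n x - w n x))\<^sup>2) \<longlonglongrightarrow> 0"
      proof (rule Lim_null_comparison[OF always_eventually])
        show "\<forall>n. norm ((lp_norm 2 \<Omega> (\<lambda>x. u n x - w n x))\<^sup>2) \<le> (2 * q (u n) + 2 * q (w n) - 4 * d n) / \<alpha>"
          using est[OF une[OF order_refl]] al(1) by (simp add: pos_le_divide_eq mult.commute)
      qed (use lim0 in simp)
      have uw: "(\<lambda>n. lp_norm 2 \<Omega> (\<lambda>x. u n x - w n x)) \<longlonglongrightarrow> 0"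
        using tendsto_real_sqrt[OF sq0] by simp
      show "(\<lambda>n. lp_norm 2 \<Omega> (\<lambda>x. u n x - H x)) \<longlonglongrightarrow> 0"
      proof (rule Lim_null_comparison[OF always_eventually])
        show "\<forall>n. norm (lp_norm 2 \<Omega> (\<lambda>x. u n x - H x)) \<le> lp_norm 2 \<Omega> (\<lambda>x. u n x - w n x) + lp_norm 2 \<Omega> (\<lambda>x. w n x - H x)"
          using lp_norm_triangle3[OF _ um wm H] by simp
      qed (use tendsto_add[OF uw wH] in simp)
    qed
  qed
qed

section \<open>Test functions and weak derivatives\<close>

lemma iter_dpart_append: "iter_dpart (is @ js) f = iter_dpart is (iter_dpart js f)"
  by (induction "is") auto

lemma smooth_fn_iter: "smooth_fn f \<Longrightarrow> smooth_fn (iter_dpart is f)"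
  by (auto simp: smooth_fn_def simp flip: iter_dpart_append)

lemma smooth_fn_dpart: "smooth_fn f \<Longrightarrow> smooth_fn (dpart i f)"
  using smooth_fn_iter[of f "[i]"] by simp

lemma smooth_fn_differentiable: "smooth_fn f \<Longrightarrow> f differentiable (at x)"
  unfolding smooth_fn_def by (metis iter_dpart.simps(1))

lemma smooth_fn_continuous: "smooth_fn f \<Longrightarrow> continuous_on S f"
  by (meson differentiable_imp_continuous_on differentiable_on_def differentiable_at_withinI smooth_fn_differentiable)

lemma dpart_eqI:
  assumes "(f has_derivative f') (at x)"
  shows "dpart i f x = f' (axis i 1)"
  using frechet_derivative_at[OF assms] by (simp add: dpart_def)

lemma dpart_add_mult:
  assumes "f differentiable (at x)" "g differentiable (at x)"
  shows "dpart i (\<lambda>x. f x + t * g x) x = dpart i f x + t * dpart i g x"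
proof -
  have "((\<lambda>x. f x + t * g x) has_derivative (\<lambda>h. frechet_derivative f (at x) h + t * frechet_derivative g (at x) h)) (at x)"
    using assms[unfolded frechet_derivative_works] by (auto intro!: derivative_eq_intros)
  from dpart_eqI[OF this] show ?thesis by (simp add: dpart_def)
qed

lemma dpart_mult:
  assumes "f differentiable (at x)" "g differentiable (at x)"
  shows "dpart i (\<lambda>x. f x * g x) x = f x * dpart i g x + dpart i f x * g x"
proof -
  have "((\<lambda>x. f x * g x) has_derivative (\<lambda>h. f x * frechet_derivative g (at x) h + frechet_derivative f (at x) h * g x)) (at x)"
    using assms[unfolded frechet_derivative_works] by (auto intro!: derivative_eq_intros)
  from dpart_eqI[OF this] show ?thesis by (simp add: dpart_def)
qed

lemma iter_dpart_add_mult: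
  assumes "smooth_fn f" "smooth_fn g"
  shows "iter_dpart is (\<lambda>x. f x + t * g x) = (\<lambda>x. iter_dpart is f x + t * iter_dpart is g x)"
proof (induction "is")
  case (Cons i "is")
  have "iter_dpart is f differentiable at x" "iter_dpart is g differentiable at x" for x
    using assms by (auto simp: smooth_fn_def)
  then show ?case by (auto simp: Cons dpart_add_mult)
qed simp

lemma smooth_fn_add_mult:
  assumes "smooth_fn f" "smooth_fn g"
  shows "smooth_fn (\<lambda>x. f x + t * g x)"
  unfolding smooth_fn_def iter_dpart_add_mult[OF assms]
proof (intro allI)
  fix "is" x
  have "iter_dpart is f differentiable at x" "iter_dpart is g differentiable at x"
    using assms by (auto simp: smooth_fn_def)
  then show "(\<lambda>x. iter_dpart is f x + t * iter_dpart is g x) differentiable at x"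
    by (intro differentiable_add differentiable_mult differentiable_const) auto
qed

lemma dpart_zero [simp]: "dpart i (\<lambda>x. 0) = (\<lambda>x. 0)"
  by (auto simp: dpart_eqI[OF has_derivative_const])

lemma smooth_fn_zero: "smooth_fn (\<lambda>x. 0)"
proof -
  have "iter_dpart is (\<lambda>x. 0) = (\<lambda>x. 0)" for "is" :: "'a list" by (induction "is") auto
  then show ?thesis by (simp add: smooth_fn_def)
qed

lemma test_fun_zero: "test_fun \<Omega> (\<lambda>x. 0)"
  by (simp add: test_fun_def smooth_fn_zero)

lemma test_fun_smooth: "test_fun \<Omega> \<phi> \<Longrightarrow> smooth_fn \<phi>"
  by (simp add: test_fun_def)

lemma test_fun_add_mult:
  assumes "test_fun \<Omega> f" "test_fun \<Omega> g"
  shows "test_fun \<Omega> (\<lambda>x. f x + t * g x)"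
proof -
  let ?S = "closure {x. f x \<noteq> 0} \<union> closure {x. g x \<noteq> 0}"
  have cS: "compact ?S" "?S \<subseteq> \<Omega>" using assms by (auto simp: test_fun_def)
  have "{x. f x + t * g x \<noteq> 0} \<subseteq> ?S"
  proof
    fix x assume "x \<in> {x. f x + t * g x \<noteq> 0}"
    then have "f x \<noteq> 0 \<or> g x \<noteq> 0" by auto
    then show "x \<in> ?S" using closure_subset[of "{x. f x \<noteq> 0}"] closure_subset[of "{x. g x \<noteq> 0}"] by blast
  qed
  then have sub: "closure {x. f x + t * g x \<noteq> 0} \<subseteq> ?S" using cS by (intro closure_minimal compact_imp_closed) auto
  from compact_Int_closed[OF cS(1) closed_closure, of "{x. f x + t * g x \<noteq> 0}"]
  have "compact (closure {x. f x + t * g x \<noteq> 0})" unfolding Int_absorb1[OF sub] .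
  then show ?thesis using sub cS assms by (auto simp: test_fun_def intro: smooth_fn_add_mult)
qed

lemma dpart_outside_support:
  assumes "x \<notin> closure {x. f x \<noteq> 0}"
  shows "dpart i f x = 0"
proof -
  have "(f has_derivative (\<lambda>h. 0)) (at x)"
  proof (rule has_derivative_transform_within_open)
    show "((\<lambda>x. 0) has_derivative (\<lambda>h. 0)) (at x)" by simp
    show "open (- closure {x. f x \<noteq> 0})" by auto
    show "0 = f y" if "y \<in> - closure {x. f x \<noteq> 0}" for y using that closure_subset[of "{x. f x \<noteq> 0}"] by auto
  qed (use assms in auto)
  from dpart_eqI[OF this] show ?thesis .
qed

lemma test_fun_dpart:
  assumes "test_fun \<Omega> f"
  shows "test_fun \<Omega> (dpart i f)"
proof -
  let ?S = "closure {x. f x \<noteq> 0}"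
  have cS: "compact ?S" "?S \<subseteq> \<Omega>" using assms by (auto simp: test_fun_def)
  have "{x. dpart i f x \<noteq> 0} \<subseteq> ?S" using dpart_outside_support[of _ f i] by blast
  then have sub: "closure {x. dpart i f x \<noteq> 0} \<subseteq> ?S" by (intro closure_minimal) auto
  from compact_Int_closed[OF cS(1) closed_closure, of "{x. dpart i f x \<noteq> 0}"]
  have "compact (closure {x. dpart i f x \<noteq> 0})" unfolding Int_absorb1[OF sub] .
  then show ?thesis using sub cS assms by (auto simp: test_fun_def intro: smooth_fn_dpart)
qed

lemma test_fun_bounded:
  assumes "test_fun \<Omega> f"
  obtains K where "\<And>x. \<bar>f x\<bar> \<le> K"
proof -
  let ?S = "closure {x. f x \<noteq> 0}"
  have "compact (f ` ?S)" using assms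
    by (intro compact_continuous_image smooth_fn_continuous) (auto simp: test_fun_def)
  then have "bounded (insert 0 (f ` ?S))" by (simp add: compact_imp_bounded)
  then obtain K where K: "\<And>y. y \<in> insert 0 (f ` ?S) \<Longrightarrow> \<bar>y\<bar> \<le> K" unfolding bounded_real by blast
  have "\<bar>f x\<bar> \<le> K" for x
  proof (cases "f x = 0")
    case False
    then have "x \<in> ?S" using closure_subset[of "{x. f x \<noteq> 0}"] by blast
    then show ?thesis using K by blast
  qed (use K[of 0] in simp)
  then show thesis by (rule that)
qed

lemma continuous_measurable_lebesgue_on:
  fixes f :: "real^'d \<Rightarrow> 'v::euclidean_space"
  assumes "continuous_on UNIV f"
  shows "f \<in> borel_measurable (lebesgue_on \<Omega>)"
  by (intro measurable_restrict_space1 measurable_completion) (use borel_measurable_continuous_onI[OF assms] in simp)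

lemma lp_mem_test_fun:
  assumes f: "test_fun \<Omega> f" and p: "p \<ge> 1" and om: "\<Omega> \<in> sets lebesgue" "emeasure lebesgue \<Omega> < \<infinity>"
  shows "lp_mem p \<Omega> f"
proof -
  obtain K where "\<And>x. \<bar>f x\<bar> \<le> K" using test_fun_bounded[OF f] by blast
  then have "norm (f x) \<le> norm K" for x by (metis abs_ge_self order_trans real_norm_def)
  then show ?thesis
    using lp_mem_bound(1)[OF lp_const(1)[OF om] continuous_measurable_lebesgue_on[OF smooth_fn_continuous[OF test_fun_smooth[OF f]]] p]
    by blast
qed

lemma lp_mem_nth_iff:
  fixes G :: "real^'d \<Rightarrow> ('v::euclidean_space)^'k"
  assumes "p \<ge> 1"
  shows "lp_mem p \<Omega> G \<longleftrightarrow> (\<forall>i. lp_mem p \<Omega> (\<lambda>x. G x $ i))"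
  using lpk_mem_iff[OF assms, of \<Omega> "\<lambda>i x. G x $ i"] by (simp add: lpk_mem_def)

lemma lp_norm_nth_le:
  fixes G :: "real^'d \<Rightarrow> ('v::euclidean_space)^'k"
  assumes "p \<ge> 1" "lp_mem p \<Omega> G"
  shows "lp_norm p \<Omega> (\<lambda>x. G x $ i) \<le> lp_norm p \<Omega> G"
  using lp_norm_le_lpk_norm[where F="\<lambda>i x. G x $ i", OF assms(1), of \<Omega> i] assms lp_mem_nth_iff[OF assms(1), of \<Omega> G]
  by (simp add: lpk_norm_eq)

lemma lp_norm_2_sq_nth:
  fixes G :: "real^'d \<Rightarrow> ('v::euclidean_space)^'k"
  assumes "lp_mem 2 \<Omega> G"
  shows "(lp_norm 2 \<Omega> G)\<^sup>2 = (\<Sum>i\<in>UNIV. (lp_norm 2 \<Omega> (\<lambda>x. G x $ i))\<^sup>2)"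
  using lpk_norm_2_sq[where F="\<lambda>i x. G x $ i", of \<Omega>] assms lp_mem_nth_iff[of 2 \<Omega> G]
  by (simp add: lpk_norm_eq)

lemma lp_mem_cgrad_chess:
  assumes f: "test_fun \<Omega> f" and p: "p \<ge> 1" and om: "\<Omega> \<in> sets lebesgue" "emeasure lebesgue \<Omega> < \<infinity>"
  shows "lp_mem p \<Omega> (cgrad f)" "lp_mem p \<Omega> (chess f)"
  using f by (auto simp: lp_mem_nth_iff[OF p] cgrad_def chess_def
      intro!: lp_mem_test_fun[OF _ p om] test_fun_dpart)

lemma cgrad_add_mult:
  assumes "smooth_fn f" "smooth_fn g"
  shows "cgrad (\<lambda>x. f x + t * g x) x = cgrad f x + t *\<^sub>R cgrad g x"
    "chess (\<lambda>x. f x + t * g x) x = chess f x + t *\<^sub>R chess g x"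
  using iter_dpart_add_mult[OF assms, of "[i]" t for i] iter_dpart_add_mult[OF assms, of "[i,j]" t for i j]
  by (auto simp: cgrad_def chess_def vec_eq_iff fun_eq_iff)

lemma cgrad_diff:
  assumes "smooth_fn f" "smooth_fn g"
  shows "cgrad (\<lambda>x. f x - g x) x = cgrad f x - cgrad g x"
    "chess (\<lambda>x. f x - g x) x = chess f x - chess g x"
  using cgrad_add_mult[OF assms, of "-1"] by simp_all

lemma test_fun_diff: "test_fun \<Omega> f \<Longrightarrow> test_fun \<Omega> g \<Longrightarrow> test_fun \<Omega> (\<lambda>x. f x - g x)"
  using test_fun_add_mult[of \<Omega> f g "-1"] by simp

section \<open>Integration by parts and symmetry of second derivatives\<close>

text \<open>Restriction to a coordinate line makes the one-variable mean value theorem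
  available.\<close>

lemma dpart_line:
  assumes "f differentiable (at (x + s *\<^sub>R axis i 1))"
  shows "((\<lambda>s. f (x + s *\<^sub>R axis i 1)) has_real_derivative dpart i f (x + s *\<^sub>R axis i 1)) (at s)"
proof -
  let ?y = "x + s *\<^sub>R axis i 1"
  have 1: "((\<lambda>s. x + s *\<^sub>R axis i (1::real)) has_derivative (\<lambda>h. h *\<^sub>R axis i 1)) (at s)"
    by (auto intro!: derivative_eq_intros)
  have 2: "(f has_derivative frechet_derivative f (at ?y)) (at ?y)"
    using assms frechet_derivative_works by blast
  have lin: "linear (frechet_derivative f (at ?y))" using 2 by (rule has_derivative_linear)
  have "((\<lambda>s. f (x + s *\<^sub>R axis i 1)) has_derivative (\<lambda>h. frechet_derivative f (at ?y) (h *\<^sub>R axis i 1))) (at s)"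
    using has_derivative_compose[OF 1 2] by simp
  moreover have "(\<lambda>h. frechet_derivative f (at ?y) (h *\<^sub>R axis i 1)) = (*) (dpart i f ?y)"
    by (auto simp: linear_scale[OF lin] dpart_def)
  ultimately show ?thesis by (simp add: has_field_derivative_def)
qed

lemma dpart_MVT:
  assumes f: "\<And>x. f differentiable (at x)" and h: "h > 0"
  obtains s where "0 < s" "s < h" "f (x + h *\<^sub>R axis i 1) - f x = h * dpart i f (x + s *\<^sub>R axis i 1)"
proof -
  have "\<exists>z>0. z < h \<and> f (x + h *\<^sub>R axis i 1) - f (x + 0 *\<^sub>R axis i 1) = (h - 0) * dpart i f (x + z *\<^sub>R axis i 1)"
    using h by (intro MVT2 dpart_line f)
  then show thesis using that by auto
qed

text \<open>A function that vanishes outside the domain can be integrated over the whole space,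
  where translation invariance holds.\<close>

lemma lebesgue_on_integral_eq_lborel:
  fixes f :: "real^'d \<Rightarrow> real"
  assumes "f \<in> borel_measurable borel" "\<Omega> \<in> sets lebesgue" "\<And>x. x \<notin> \<Omega> \<Longrightarrow> f x = 0"
  shows "(\<integral>x. f x \<partial>lebesgue_on \<Omega>) = (\<integral>x. f x \<partial>lborel)"
proof -
  have "(\<integral>x. f x \<partial>lebesgue_on \<Omega>) = (\<integral>x. indicator \<Omega> x *\<^sub>R f x \<partial>lebesgue)"
    using assms by (intro integral_restrict_space) auto
  also have "\<dots> = (\<integral>x. f x \<partial>lebesgue)"
    using assms(3) by (intro Bochner_Integration.integral_cong) (auto simp: indicator_def)
  also have "\<dots> = (\<integral>x. f x \<partial>lborel)" using assms(1) by (intro integral_completion) simp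
  finally show ?thesis .
qed

text \<open>The difference quotients of \<open>f\<close> integrate to zero by translation invariance, and they
  converge dominatedly to the partial derivative.\<close>
lemma integral_dpart_eq_0:
  fixes f :: "real^'d \<Rightarrow> real"
  assumes diff: "\<And>x. f differentiable (at x)" and cont: "continuous_on UNIV (dpart i f)"
    and S: "compact S" "\<And>x. x \<notin> S \<Longrightarrow> f x = 0"
  shows "(\<integral>x. dpart i f x \<partial>lborel) = 0"
proof -
  have contf: "continuous_on UNIV f"
    using diff by (meson differentiable_imp_continuous_on differentiable_on_def differentiable_at_withinI)
  have [measurable]: "f \<in> borel_measurable borel" "dpart i f \<in> borel_measurable borel"
    using contf cont by (auto intro: borel_measurable_continuous_onI)
  obtain R where R: "R > 0" "\<And>x. x \<in> S \<Longrightarrow> norm x \<le> R"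
    using compact_imp_bounded[OF S(1)] by (auto simp: bounded_pos)
  have supp: "dpart i f x = 0" if "norm x > R" for x
  proof (rule dpart_outside_support)
    have "{x. f x \<noteq> 0} \<subseteq> cball 0 R" using S(2) R(2) by (auto simp: subset_iff)
    then have "closure {x. f x \<noteq> 0} \<subseteq> cball 0 R" by (intro closure_minimal) auto
    then show "x \<notin> closure {x. f x \<noteq> 0}" using that by auto
  qed
  have "compact (dpart i f ` cball 0 (R+1))"
    by (intro compact_continuous_image continuous_on_subset[OF cont]) auto
  then have "bounded (dpart i f ` cball 0 (R+1))" by (rule compact_imp_bounded)
  then obtain K where "\<forall>y\<in>dpart i f ` cball 0 (R+1). \<bar>y\<bar> \<le> K" unfolding bounded_real by blast
  then have K: "\<bar>dpart i f x\<bar> \<le> K" if "norm x \<le> R + 1" for x using that by simp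
  have K': "\<bar>dpart i f x\<bar> \<le> K" for x
  proof (cases "norm x \<le> R + 1")
    case False
    then have "dpart i f x = 0" using supp[of x] by simp
    then show ?thesis using K[of 0] R(1) by simp
  qed (use K in auto)
  define h where "h n = inverse (real (Suc n))" for n
  have h: "h n > 0" "h n \<le> 1" for n by (auto simp: h_def field_simps)
  define g where "g n x = (f (x + h n *\<^sub>R axis i 1) - f x) / h n" for n x
  have fint: "integrable lborel f"
  proof -
    have "integrable lborel (\<lambda>x. indicator (cball 0 R) x *\<^sub>R f x)"
      by (intro borel_integrable_compact continuous_on_subset[OF contf]) auto
    moreover have "(\<lambda>x. indicator (cball 0 R) x *\<^sub>R f x) = f"
    proof
      fix x show "indicator (cball 0 R) x *\<^sub>R f x = f x"
      using S(2)[of x] R(2)[of x] by (cases "x \<in> S") (auto simp: indicator_def)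
    qed
    ultimately show ?thesis by (simp only:)
  qed
  have trans: "integrable lborel (\<lambda>x. f (x + c))" "(\<integral>x. f (x + c) \<partial>lborel) = (\<integral>x. f x \<partial>lborel)" for c
  proof -
    show "(\<integral>x. f (x + c) \<partial>lborel) = (\<integral>x. f x \<partial>lborel)"
      using integral_distr[of "(+) c" lborel borel f] by (simp add: lborel_distr_plus add.commute)
    show "integrable lborel (\<lambda>x. f (x + c))"
      using integrable_distr[of "(+) c" lborel borel f] fint by (simp add: lborel_distr_plus add.commute)
  qed
  have g0: "(\<integral>x. g n x \<partial>lborel) = 0" for n
    unfolding g_def using trans fint by simp
  \<comment> \<open>The steps \<open>h n\<close> are at most 1 and \<open>f\<close> is supported in
    the ball of radius \<open>R\<close>; by the mean value theorem all quotients are bounded by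
    \<open>K\<close> on the ball of radius \<open>R + 1\<close> and vanish outside it.\<close>
  have "(\<lambda>n. \<integral>x. g n x \<partial>lborel) \<longlonglongrightarrow> (\<integral>x. dpart i f x \<partial>lborel)"
  proof (rule integral_dominated_convergence[where w="\<lambda>x. indicator (cball 0 (R+1)) x *\<^sub>R K"])
    show "integrable lborel (\<lambda>x::real^'d. indicator (cball 0 (R+1)) x *\<^sub>R K)"
      by (intro borel_integrable_compact) auto
    show "AE x in lborel. (\<lambda>n. g n x) \<longlonglongrightarrow> dpart i f x"
    proof (intro AE_I2)
      fix x
      have "((\<lambda>s. f (x + s *\<^sub>R axis i 1)) has_real_derivative dpart i f x) (at 0)"
        using dpart_line[of f x 0 i] diff by simp
      then have lim: "((\<lambda>s. (f (x + s *\<^sub>R axis i 1) - f x) / s) \<longlongrightarrow> dpart i f x) (at 0)"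
        by (simp add: DERIV_def)
      have "filterlim h (at 0) sequentially"
        using LIMSEQ_inverse_real_of_nat h by (auto simp: filterlim_at h_def[abs_def] simp del: of_nat_Suc)
      from filterlim_compose[OF lim this] show "(\<lambda>n. g n x) \<longlonglongrightarrow> dpart i f x" by (simp add: g_def)
    qed
    show "AE x in lborel. norm (g n x) \<le> indicator (cball 0 (R+1)) x *\<^sub>R K" for n
    proof (intro AE_I2)
      fix x
      obtain s where s: "0 < s" "s < h n" "f (x + h n *\<^sub>R axis i 1) - f x = h n * dpart i f (x + s *\<^sub>R axis i 1)"
        using dpart_MVT[OF diff h(1)] by blast
      then have gs: "g n x = dpart i f (x + s *\<^sub>R axis i 1)" using h(1)[of n] by (simp add: g_def)
      show "norm (g n x) \<le> indicator (cball 0 (R+1)) x *\<^sub>R K"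
      proof (cases "norm x \<le> R + 1")
        case True then show ?thesis using K' gs by simp
      next
        case False
        have "norm (s *\<^sub>R axis i (1::real) :: real^'d) \<le> 1" using s h(2)[of n] by (simp add: norm_axis)
        then have "norm (x + s *\<^sub>R axis i 1) > R" using False norm_triangle_ineq4[of "x + s *\<^sub>R axis i 1" "s *\<^sub>R axis i 1"] by simp
        then show ?thesis using supp gs False by simp
      qed
    qed
  qed (simp_all add: g_def)
  then show ?thesis by (simp add: g0 LIMSEQ_const_iff)
qed

lemma test_fun_outside: "test_fun \<Omega> \<phi> \<Longrightarrow> x \<notin> \<Omega> \<Longrightarrow> \<phi> x = 0"
  unfolding test_fun_def using closure_subset[of "{x. \<phi> x \<noteq> 0}"] by blast

text \<open>The product rule is integrated over the whole space, where the derivative of a compactly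
  supported product has integral zero; all terms vanish outside \<Omega>.\<close>

lemma test_fun_by_parts:
  assumes f: "test_fun \<Omega> f" and g: "test_fun \<Omega> g" and om: "\<Omega> \<in> sets lebesgue" "emeasure lebesgue \<Omega> < \<infinity>"
  shows "(\<integral>x. f x * dpart i g x \<partial>lebesgue_on \<Omega>) = - (\<integral>x. dpart i f x * g x \<partial>lebesgue_on \<Omega>)"
proof -
  note sm = test_fun_smooth[OF f] test_fun_smooth[OF g]
  note d = smooth_fn_differentiable[OF sm(1)] smooth_fn_differentiable[OF sm(2)]
  note c = sm[THEN smooth_fn_continuous] sm[THEN smooth_fn_dpart, THEN smooth_fn_continuous]
  have eq: "dpart i (\<lambda>x. f x * g x) x = f x * dpart i g x + dpart i f x * g x" for x
    by (rule dpart_mult[OF d])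
  have "(\<integral>x. dpart i (\<lambda>x. f x * g x) x \<partial>lborel) = 0"
  proof (rule integral_dpart_eq_0)
    show "(\<lambda>x. f x * g x) differentiable (at x)" for x using d by (intro differentiable_mult)
    show "continuous_on UNIV (dpart i (\<lambda>x. f x * g x))"
      unfolding eq[abs_def] by (intro continuous_intros c)
    show "compact (closure {x. f x \<noteq> 0})" using f by (simp add: test_fun_def)
    show "f x * g x = 0" if "x \<notin> closure {x. f x \<noteq> 0}" for x
      using that closure_subset[of "{x. f x \<noteq> 0}"] by auto
  qed
  moreover have "(\<integral>x. dpart i (\<lambda>x. f x * g x) x \<partial>lebesgue_on \<Omega>) = (\<integral>x. dpart i (\<lambda>x. f x * g x) x \<partial>lborel)"
  proof (rule lebesgue_on_integral_eq_lborel[OF _ om(1)])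
    show "dpart i (\<lambda>x. f x * g x) \<in> borel_measurable borel"
      unfolding eq[abs_def] by (intro borel_measurable_continuous_onI continuous_intros c)
    show "dpart i (\<lambda>x. f x * g x) x = 0" if "x \<notin> \<Omega>" for x
      using that test_fun_outside[OF f] test_fun_outside[OF g] by (simp add: eq)
  qed
  ultimately have "0 = (\<integral>x. f x * dpart i g x + dpart i f x * g x \<partial>lebesgue_on \<Omega>)" by (simp add: eq)
  also have "\<dots> = (\<integral>x. f x * dpart i g x \<partial>lebesgue_on \<Omega>) + (\<integral>x. dpart i f x * g x \<partial>lebesgue_on \<Omega>)"
    using f g by (intro Bochner_Integration.integral_add integral_lebesgue_on_mult_le(1) lp_mem_test_fun[OF _ _ om] test_fun_dpart) auto
  finally show ?thesis by simp
qed

text \<open>The second difference of \<open>f\<close> is symmetric in the two directions, and each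
  order of applying mean value theorems equates it with h^2 times one mixed derivative at a point
  near \<open>x\<close>. Both mixed derivatives are continuous, because \<open>smooth_fn\<close>
  makes every iterated derivative differentiable.\<close>

lemma dpart_commute:
  assumes f: "smooth_fn f"
  shows "dpart i (dpart j f) x = dpart j (dpart i f) x"
proof -
  have *: "\<exists>s t. 0 < s \<and> s < h \<and> 0 < t \<and> t < h \<and>
      f (x + h *\<^sub>R axis i 1 + h *\<^sub>R axis j 1) - f (x + h *\<^sub>R axis i 1) - f (x + h *\<^sub>R axis j 1) + f x
      = h * h * dpart j (dpart i f) (x + s *\<^sub>R axis i 1 + t *\<^sub>R axis j 1)" if h: "h > 0" for h i j
  proof -
    \<comment> \<open>The increment of \<open>f\<close> in direction \<open>j\<close>, whose
      increment in direction \<open>i\<close> is the second difference. The factor -1 puts it in the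
      form of \<open>dpart_add_mult\<close>.\<close>
    define F where "F y = f (h *\<^sub>R axis j 1 + y) + (-1) * f y" for y
    have d1: "(\<lambda>y. f (h *\<^sub>R axis j 1 + y)) differentiable (at y)" for y
      using differentiable_compose[of f "\<lambda>y. h *\<^sub>R axis j 1 + y" y UNIV] smooth_fn_differentiable[OF f] by simp
    have d2: "f differentiable (at y)" for y using smooth_fn_differentiable[OF f] .
    have dF: "F differentiable (at y)" for y unfolding F_def
      by (intro differentiable_add differentiable_mult differentiable_const d1 d2)
    have sh: "dpart i (\<lambda>y. f (h *\<^sub>R axis j 1 + y)) y = dpart i f (h *\<^sub>R axis j 1 + y)" for y
    proof -
      let ?D = "frechet_derivative f (at (h *\<^sub>R axis j 1 + y))"
      have "(f has_derivative ?D) (at (h *\<^sub>R axis j 1 + y))" using d2 frechet_derivative_works by blast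
      moreover have "((\<lambda>y. h *\<^sub>R axis j 1 + y) has_derivative (\<lambda>y. y)) (at y)"
        by (auto intro!: derivative_eq_intros)
      ultimately have "((\<lambda>y. f (h *\<^sub>R axis j 1 + y)) has_derivative ?D) (at y)"
        using has_derivative_compose[of "\<lambda>y. h *\<^sub>R axis j 1 + y" "\<lambda>y. y" y UNIV f ?D] by simp
      from dpart_eqI[OF this] show ?thesis by (simp add: dpart_def)
    qed
    have Fi: "dpart i F y = dpart i f (h *\<^sub>R axis j 1 + y) - dpart i f y" for y
      unfolding F_def[abs_def] by (subst dpart_add_mult[OF d1 d2]) (simp add: sh)
    obtain s where s: "0 < s" "s < h" "F (x + h *\<^sub>R axis i 1) - F x = h * dpart i F (x + s *\<^sub>R axis i 1)"
      using dpart_MVT[OF dF h] by blast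
    obtain t where t: "0 < t" "t < h"
      "dpart i f (x + s *\<^sub>R axis i 1 + h *\<^sub>R axis j 1) - dpart i f (x + s *\<^sub>R axis i 1) = h * dpart j (dpart i f) (x + s *\<^sub>R axis i 1 + t *\<^sub>R axis j 1)"
      using dpart_MVT[OF smooth_fn_differentiable[OF smooth_fn_dpart[OF f]] h] by blast
    have "f (x + h *\<^sub>R axis i 1 + h *\<^sub>R axis j 1) - f (x + h *\<^sub>R axis i 1) - f (x + h *\<^sub>R axis j 1) + f x = F (x + h *\<^sub>R axis i 1) - F x"
      by (simp add: F_def algebra_simps)
    also have "\<dots> = h * (dpart i f (x + s *\<^sub>R axis i 1 + h *\<^sub>R axis j 1) - dpart i f (x + s *\<^sub>R axis i 1))"
      using s(3) by (simp add: Fi algebra_simps)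
    also have "\<dots> = h * h * dpart j (dpart i f) (x + s *\<^sub>R axis i 1 + t *\<^sub>R axis j 1)" using t(3) by simp
    finally show ?thesis using s t by blast
  qed
  define h where "h n = inverse (real (Suc n))" for n
  have hp: "h n > 0" for n by (simp add: h_def)
  have h0: "h \<longlonglongrightarrow> 0" unfolding h_def by (rule LIMSEQ_inverse_real_of_nat)
  obtain s t where st: "\<And>n. 0 < s n" "\<And>n. s n < h n" "\<And>n. 0 < t n" "\<And>n. t n < h n"
    and est: "\<And>n. f (x + h n *\<^sub>R axis i 1 + h n *\<^sub>R axis j 1) - f (x + h n *\<^sub>R axis i 1) - f (x + h n *\<^sub>R axis j 1) + f x
      = h n * h n * dpart j (dpart i f) (x + s n *\<^sub>R axis i 1 + t n *\<^sub>R axis j 1)"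
    using *[OF hp, where i=i and j=j] by metis
  obtain s' t' where st': "\<And>n. 0 < s' n" "\<And>n. s' n < h n" "\<And>n. 0 < t' n" "\<And>n. t' n < h n"
    and est': "\<And>n. f (x + h n *\<^sub>R axis j 1 + h n *\<^sub>R axis i 1) - f (x + h n *\<^sub>R axis j 1) - f (x + h n *\<^sub>R axis i 1) + f x
      = h n * h n * dpart i (dpart j f) (x + s' n *\<^sub>R axis j 1 + t' n *\<^sub>R axis i 1)"
    using *[OF hp, where i=j and j=i] by metis
  have sq: "u \<longlonglongrightarrow> 0" if "\<And>n. 0 < u n" "\<And>n. u n < h n" for u
    using that by (intro tendsto_sandwich[OF _ _ tendsto_const h0]) (auto intro!: always_eventually less_imp_le)
  have lim: "(\<lambda>n. F (x + u n *\<^sub>R a + v n *\<^sub>R b)) \<longlonglongrightarrow> F x" if "smooth_fn F" "u \<longlonglongrightarrow> 0" "v \<longlonglongrightarrow> 0" for F u v and a b :: "real^'a"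
  proof -
    have "isCont F x" using smooth_fn_continuous[OF that(1), of UNIV] by (simp add: continuous_on_eq_continuous_at)
    moreover have "(\<lambda>n. x + u n *\<^sub>R a + v n *\<^sub>R b) \<longlonglongrightarrow> x + 0 *\<^sub>R a + 0 *\<^sub>R b"
      by (intro tendsto_intros that)
    ultimately show ?thesis using isCont_tendsto_compose[of x F] by simp
  qed
  have "dpart j (dpart i f) (x + s n *\<^sub>R axis i 1 + t n *\<^sub>R axis j 1) = dpart i (dpart j f) (x + s' n *\<^sub>R axis j 1 + t' n *\<^sub>R axis i 1)" for n
  proof -
    have c: "x + h n *\<^sub>R axis i 1 + h n *\<^sub>R axis j 1 = x + h n *\<^sub>R axis j 1 + h n *\<^sub>R axis i 1" by (simp add: add_ac)
    have "h n * h n * dpart j (dpart i f) (x + s n *\<^sub>R axis i 1 + t n *\<^sub>R axis j 1)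
      = h n * h n * dpart i (dpart j f) (x + s' n *\<^sub>R axis j 1 + t' n *\<^sub>R axis i 1)"
      unfolding est[of n, symmetric] est'[of n, symmetric] c by simp
    then show ?thesis using hp[of n] by simp
  qed
  moreover have "(\<lambda>n. dpart j (dpart i f) (x + s n *\<^sub>R axis i 1 + t n *\<^sub>R axis j 1)) \<longlonglongrightarrow> dpart j (dpart i f) x"
    by (intro lim smooth_fn_dpart f sq[of s] sq[of t] st)
  moreover have "(\<lambda>n. dpart i (dpart j f) (x + s' n *\<^sub>R axis j 1 + t' n *\<^sub>R axis i 1)) \<longlonglongrightarrow> dpart i (dpart j f) x"
    by (intro lim smooth_fn_dpart f sq[of s'] sq[of t'] st')
  ultimately show ?thesis using LIMSEQ_unique by simp
qed

section \<open>Strong limits in L^p and weak gradients\<close>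

abbreviation lp_tendsto :: "real \<Rightarrow> (real^'d) set \<Rightarrow> (nat \<Rightarrow> real^'d \<Rightarrow> 'v::real_normed_vector) \<Rightarrow> (real^'d \<Rightarrow> 'v) \<Rightarrow> bool"
  where "lp_tendsto p \<Omega> u g \<equiv> (\<lambda>n. lp_norm p \<Omega> (\<lambda>x. u n x - g x)) \<longlonglongrightarrow> 0"

lemma lp_tendsto_add_scaleR:
  fixes u v :: "nat \<Rightarrow> real^'d \<Rightarrow> 'v::euclidean_space"
  assumes p: "p \<ge> 1" and m: "\<And>n. lp_mem p \<Omega> (u n)" "lp_mem p \<Omega> f" "\<And>n. lp_mem p \<Omega> (v n)" "lp_mem p \<Omega> g"
    and uv: "lp_tendsto p \<Omega> u f" "lp_tendsto p \<Omega> v g"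
  shows "lp_tendsto p \<Omega> (\<lambda>n x. u n x + t *\<^sub>R v n x) (\<lambda>x. f x + t *\<^sub>R g x)"
proof (rule Lim_null_comparison[OF always_eventually])
  show "\<forall>n. norm (lp_norm p \<Omega> (\<lambda>x. u n x + t *\<^sub>R v n x - (f x + t *\<^sub>R g x)))
      \<le> lp_norm p \<Omega> (\<lambda>x. u n x - f x) + \<bar>t\<bar> * lp_norm p \<Omega> (\<lambda>x. v n x - g x)"
  proof
    fix n
    have 1: "lp_mem p \<Omega> (\<lambda>x. u n x - f x)" "lp_mem p \<Omega> (\<lambda>x. v n x - g x)"
      using m p by (auto intro: lp_mem_diff)
    have "lp_norm p \<Omega> (\<lambda>x. (u n x - f x) + t *\<^sub>R (v n x - g x))
      \<le> lp_norm p \<Omega> (\<lambda>x. u n x - f x) + lp_norm p \<Omega> (\<lambda>x. t *\<^sub>R (v n x - g x))"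
      by (intro lp_norm_triangle 1 p lp_mem_scaleR)
    also have "(\<lambda>x. (u n x - f x) + t *\<^sub>R (v n x - g x)) = (\<lambda>x. u n x + t *\<^sub>R v n x - (f x + t *\<^sub>R g x))"
      by (simp add: algebra_simps)
    finally show "norm (lp_norm p \<Omega> (\<lambda>x. u n x + t *\<^sub>R v n x - (f x + t *\<^sub>R g x)))
      \<le> lp_norm p \<Omega> (\<lambda>x. u n x - f x) + \<bar>t\<bar> * lp_norm p \<Omega> (\<lambda>x. v n x - g x)"
      using p by (simp add: lp_norm_scaleR)
  qed
  show "(\<lambda>n. lp_norm p \<Omega> (\<lambda>x. u n x - f x) + \<bar>t\<bar> * lp_norm p \<Omega> (\<lambda>x. v n x - g x)) \<longlonglongrightarrow> 0"
    using tendsto_add[OF uv(1) tendsto_mult_left[OF uv(2), of "\<bar>t\<bar>"]] by simp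
qed

lemma lp_tendsto_nth:
  fixes u :: "nat \<Rightarrow> real^'d \<Rightarrow> ('v::euclidean_space)^'k"
  assumes p: "p \<ge> 1" and m: "\<And>n. lp_mem p \<Omega> (u n)" "lp_mem p \<Omega> f" and u: "lp_tendsto p \<Omega> u f"
  shows "lp_tendsto p \<Omega> (\<lambda>n x. u n x $ i) (\<lambda>x. f x $ i)"
proof (rule Lim_null_comparison[OF always_eventually u], intro allI)
  fix n
  have "lp_mem p \<Omega> (\<lambda>x. u n x - f x)" using m p by (auto intro: lp_mem_diff)
  from lp_norm_nth_le[OF p this, of i]
  show "norm (lp_norm p \<Omega> (\<lambda>x. u n x $ i - f x $ i)) \<le> lp_norm p \<Omega> (\<lambda>x. u n x - f x)" by simp
qed

lemma lp_tendsto_Cauchy: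
  fixes u :: "nat \<Rightarrow> real^'d \<Rightarrow> 'v::euclidean_space"
  assumes p: "p \<ge> 1" and m: "\<And>n. lp_mem p \<Omega> (u n)" "lp_mem p \<Omega> f" and u: "lp_tendsto p \<Omega> u f" and e: "e > 0"
  shows "\<exists>N. \<forall>m\<ge>N. \<forall>n\<ge>N. lp_norm p \<Omega> (\<lambda>x. u m x - u n x) < e"
proof -
  obtain N where N: "\<forall>n\<ge>N. norm (lp_norm p \<Omega> (\<lambda>x. u n x - f x) - 0) < e/2"
    using LIMSEQ_D[OF u, of "e/2"] e by auto
  have "lp_norm p \<Omega> (\<lambda>x. u k x - u n x) < e" if "k \<ge> N" "n \<ge> N" for k n
  proof -
    have "lp_norm p \<Omega> (\<lambda>x. u k x - u n x) \<le> lp_norm p \<Omega> (\<lambda>x. u k x - f x) + lp_norm p \<Omega> (\<lambda>x. f x - u n x)"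
      by (intro lp_norm_triangle3 p m)
    moreover have "lp_norm p \<Omega> (\<lambda>x. u k x - f x) < e/2" "lp_norm p \<Omega> (\<lambda>x. u n x - f x) < e/2"
      using N that by auto
    ultimately show ?thesis using lp_norm_minus_commute[of p \<Omega> f "u n"] by linarith
  qed
  then show ?thesis by blast
qed

text \<open>For a fixed test function both sides of the defining identity are continuous in
  L^2.\<close>

lemma is_wgrad_tendsto:
  assumes m: "\<And>n. lp_mem 2 \<Omega> (u n)" "lp_mem 2 \<Omega> f" "\<And>n. lp_mem 2 \<Omega> (U n)" "lp_mem 2 \<Omega> F"
    and lim: "lp_tendsto 2 \<Omega> u f" "lp_tendsto 2 \<Omega> U F" and w: "\<And>n. is_wgrad \<Omega> (u n) (U n)"
    and om: "\<Omega> \<in> sets lebesgue" "emeasure lebesgue \<Omega> < \<infinity>"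
  shows "is_wgrad \<Omega> f F"
  unfolding is_wgrad_def
proof (intro allI impI)
  fix i \<phi> assume \<phi>: "test_fun \<Omega> \<phi>"
  have mi: "lp_mem 2 \<Omega> (\<lambda>x. U n x $ i)" "lp_mem 2 \<Omega> (\<lambda>x. F x $ i)" for n
    using m lp_mem_nth_iff[of 2 \<Omega> "U n"] lp_mem_nth_iff[of 2 \<Omega> F] by auto
  have 1: "(\<lambda>n. \<integral>x. u n x * dpart i \<phi> x \<partial>lebesgue_on \<Omega>) \<longlonglongrightarrow> (\<integral>x. f x * dpart i \<phi> x \<partial>lebesgue_on \<Omega>)"
    using lp_2_tendsto_inner[OF m(1,2) lp_mem_test_fun[OF test_fun_dpart[OF \<phi>] _ om] lim(1)] by simp
  have 2: "(\<lambda>n. \<integral>x. U n x $ i * \<phi> x \<partial>lebesgue_on \<Omega>) \<longlonglongrightarrow> (\<integral>x. F x $ i * \<phi> x \<partial>lebesgue_on \<Omega>)"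
    using lp_2_tendsto_inner[OF mi lp_mem_test_fun[OF \<phi> _ om] lp_tendsto_nth[OF _ m(3,4) lim(2)]] by simp
  have eq: "(\<integral>x. u n x * dpart i \<phi> x \<partial>lebesgue_on \<Omega>) = - (\<integral>x. U n x $ i * \<phi> x \<partial>lebesgue_on \<Omega>)" for n
    using w \<phi> by (auto simp: is_wgrad_def)
  show "(\<integral>x. f x * dpart i \<phi> x \<partial>lebesgue_on \<Omega>) = - (\<integral>x. F x $ i * \<phi> x \<partial>lebesgue_on \<Omega>)"
    by (rule LIMSEQ_unique[OF 1[unfolded eq] tendsto_minus[OF 2]])
qed

text \<open>Row \<open>i\<close> of \<open>chess\<close> has the entries
  \<open>dpart i (dpart j \<phi>)\<close>, whereas the gradient of \<open>dpart i \<phi>\<close>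
  takes the derivatives in the other order; symmetry of second derivatives reconciles the
  two.\<close>

lemma is_wgrad_test_fun:
  assumes \<phi>: "test_fun \<Omega> \<phi>" and om: "\<Omega> \<in> sets lebesgue" "emeasure lebesgue \<Omega> < \<infinity>"
  shows "is_wgrad \<Omega> \<phi> (cgrad \<phi>)" "is_wgrad \<Omega> (\<lambda>x. cgrad \<phi> x $ i) (\<lambda>x. chess \<phi> x $ i)"
proof -
  have *: "is_wgrad \<Omega> \<psi> (cgrad \<psi>)" if "test_fun \<Omega> \<psi>" for \<psi>
    using test_fun_by_parts[OF that _ om] by (auto simp: is_wgrad_def cgrad_def)
  show "is_wgrad \<Omega> \<phi> (cgrad \<phi>)" by (rule *[OF \<phi>])
  have "cgrad (dpart i \<phi>) = (\<lambda>x. chess \<phi> x $ i)"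
    using dpart_commute[OF test_fun_smooth[OF \<phi>]] by (auto simp: cgrad_def chess_def vec_eq_iff)
  then show "is_wgrad \<Omega> (\<lambda>x. cgrad \<phi> x $ i) (\<lambda>x. chess \<phi> x $ i)"
    using *[OF test_fun_dpart[OF \<phi>, of i]] by (simp add: cgrad_def[of \<phi>])
qed

section \<open>The spaces H^1_0 and H^2_0 and uniqueness of gradients\<close>

text \<open>The weak gradient relation is inherited from the approximating test functions, so
  convergence is all that has to be checked; \<open>in_H20I\<close> works in the same way.\<close>

lemma in_H10I:
  assumes om: "\<Omega> \<in> sets lebesgue" "emeasure lebesgue \<Omega> < \<infinity>"
    and m: "lp_mem 2 \<Omega> u" "lp_mem 2 \<Omega> G" and \<phi>: "\<And>n. test_fun \<Omega> (\<phi> n)"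
    and lim: "lp_tendsto 2 \<Omega> \<phi> u" "lp_tendsto 2 \<Omega> (\<lambda>n. cgrad (\<phi> n)) G"
  shows "in_H10 \<Omega> u G"
proof -
  have "is_wgrad \<Omega> u G"
    by (rule is_wgrad_tendsto[OF _ m(1) _ m(2) lim is_wgrad_test_fun(1)[OF \<phi> om] om])
      (auto intro: lp_mem_test_fun[OF \<phi> _ om] lp_mem_cgrad_chess(1)[OF \<phi> _ om])
  then show ?thesis using m \<phi> tendsto_add[OF lim] by (auto simp: in_H10_def in_H1_def)
qed

lemma tendsto_add_nonneg_0:
  fixes f g :: "nat \<Rightarrow> real"
  assumes "(\<lambda>n. f n + g n) \<longlonglongrightarrow> 0" "\<And>n. 0 \<le> f n" "\<And>n. 0 \<le> g n"
  shows "f \<longlonglongrightarrow> 0" "g \<longlonglongrightarrow> 0"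
  using assms(2,3) by (auto intro!: Lim_null_comparison[OF always_eventually assms(1)])

lemma in_H10D:
  assumes "in_H10 \<Omega> u G"
  obtains \<phi> where "\<forall>n. test_fun \<Omega> (\<phi> n)" "lp_tendsto 2 \<Omega> \<phi> u" "lp_tendsto 2 \<Omega> (\<lambda>n. cgrad (\<phi> n)) G"
    "lp_mem 2 \<Omega> u" "lp_mem 2 \<Omega> G" "is_wgrad \<Omega> u G"
proof -
  obtain \<phi> where \<phi>: "\<forall>n. test_fun \<Omega> (\<phi> n)" and
    lim: "(\<lambda>n. lp_norm 2 \<Omega> (\<lambda>x. \<phi> n x - u x) + lp_norm 2 \<Omega> (\<lambda>x. cgrad (\<phi> n) x - G x)) \<longlonglongrightarrow> 0"
    using assms by (auto simp: in_H10_def)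
  show thesis using that[OF \<phi> tendsto_add_nonneg_0[OF lim]] assms by (auto simp: in_H10_def in_H1_def)
qed

lemma in_H20I:
  assumes om: "\<Omega> \<in> sets lebesgue" "emeasure lebesgue \<Omega> < \<infinity>"
    and m: "lp_mem 2 \<Omega> u" "lp_mem 2 \<Omega> G" "lp_mem 2 \<Omega> H" and \<phi>: "\<And>n. test_fun \<Omega> (\<phi> n)"
    and lim: "lp_tendsto 2 \<Omega> \<phi> u" "lp_tendsto 2 \<Omega> (\<lambda>n. cgrad (\<phi> n)) G" "lp_tendsto 2 \<Omega> (\<lambda>n. chess (\<phi> n)) H"
  shows "in_H20 \<Omega> u G H"
proof -
  have m': "lp_mem 2 \<Omega> (cgrad (\<phi> n))" "lp_mem 2 \<Omega> (chess (\<phi> n))" for n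
    by (auto intro: lp_mem_cgrad_chess[OF \<phi> _ om])
  have w: "is_wgrad \<Omega> u G" using in_H10I[OF om m(1,2) \<phi> lim(1,2)] by (auto simp: in_H10_def in_H1_def)
  have "is_wgrad \<Omega> (\<lambda>x. G x $ i) (\<lambda>x. H x $ i)" for i
  proof (rule is_wgrad_tendsto[OF _ _ _ _ _ _ is_wgrad_test_fun(2)[OF \<phi> om] om])
    show "lp_mem 2 \<Omega> (\<lambda>x. cgrad (\<phi> n) x $ i)" "lp_mem 2 \<Omega> (\<lambda>x. chess (\<phi> n) x $ i)" for n
      using m'[of n] lp_mem_nth_iff[of 2 \<Omega> "cgrad (\<phi> n)"] lp_mem_nth_iff[of 2 \<Omega> "chess (\<phi> n)"] by simp_all
    show "lp_mem 2 \<Omega> (\<lambda>x. G x $ i)" "lp_mem 2 \<Omega> (\<lambda>x. H x $ i)"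
      using m lp_mem_nth_iff[of 2 \<Omega> G] lp_mem_nth_iff[of 2 \<Omega> H] by simp_all
    show "lp_tendsto 2 \<Omega> (\<lambda>n x. cgrad (\<phi> n) x $ i) (\<lambda>x. G x $ i)"
      by (rule lp_tendsto_nth[OF _ m'(1) m(2) lim(2)]) simp
    show "lp_tendsto 2 \<Omega> (\<lambda>n x. chess (\<phi> n) x $ i) (\<lambda>x. H x $ i)"
      by (rule lp_tendsto_nth[OF _ m'(2) m(3) lim(3)]) simp
  qed
  then show ?thesis using m w \<phi> tendsto_add[OF tendsto_add[OF lim(1,2)] lim(3)] by (auto simp: in_H20_def in_H2_def)
qed

lemma in_H20D:
  assumes "in_H20 \<Omega> u G H"
  obtains \<phi> where "\<forall>n. test_fun \<Omega> (\<phi> n)" "lp_tendsto 2 \<Omega> \<phi> u" "lp_tendsto 2 \<Omega> (\<lambda>n. cgrad (\<phi> n)) G"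
    "lp_tendsto 2 \<Omega> (\<lambda>n. chess (\<phi> n)) H" "lp_mem 2 \<Omega> u" "lp_mem 2 \<Omega> G" "lp_mem 2 \<Omega> H"
proof -
  obtain \<phi> where \<phi>: "\<forall>n. test_fun \<Omega> (\<phi> n)" and
    lim: "(\<lambda>n. (lp_norm 2 \<Omega> (\<lambda>x. \<phi> n x - u x) + lp_norm 2 \<Omega> (\<lambda>x. cgrad (\<phi> n) x - G x)) + lp_norm 2 \<Omega> (\<lambda>x. chess (\<phi> n) x - H x)) \<longlonglongrightarrow> 0"
    using assms by (auto simp: in_H20_def)
  have 1: "(\<lambda>n. lp_norm 2 \<Omega> (\<lambda>x. \<phi> n x - u x) + lp_norm 2 \<Omega> (\<lambda>x. cgrad (\<phi> n) x - G x)) \<longlonglongrightarrow> 0"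
    and 2: "lp_tendsto 2 \<Omega> (\<lambda>n. chess (\<phi> n)) H" using tendsto_add_nonneg_0[OF lim] by auto
  show thesis using that[OF \<phi> tendsto_add_nonneg_0[OF 1] 2] assms by (auto simp: in_H20_def in_H2_def)
qed

lemma in_H20_imp_in_H10:
  assumes "in_H20 \<Omega> u G H" shows "in_H10 \<Omega> u G"
proof -
  obtain \<phi> where "\<forall>n. test_fun \<Omega> (\<phi> n)" "lp_tendsto 2 \<Omega> \<phi> u" "lp_tendsto 2 \<Omega> (\<lambda>n. cgrad (\<phi> n)) G"
    "lp_tendsto 2 \<Omega> (\<lambda>n. chess (\<phi> n)) H" "lp_mem 2 \<Omega> u" "lp_mem 2 \<Omega> G" "lp_mem 2 \<Omega> H"
    by (rule in_H20D[OF assms])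
  then have "(\<forall>n. test_fun \<Omega> (\<phi> n)) \<and> (\<lambda>n. lp_norm 2 \<Omega> (\<lambda>x. \<phi> n x - u x) + lp_norm 2 \<Omega> (\<lambda>x. cgrad (\<phi> n) x - G x)) \<longlonglongrightarrow> 0"
    using tendsto_add[of "\<lambda>n. lp_norm 2 \<Omega> (\<lambda>x. \<phi> n x - u x)" 0 sequentially "\<lambda>n. lp_norm 2 \<Omega> (\<lambda>x. cgrad (\<phi> n) x - G x)" 0] by simp
  then show ?thesis using assms by (auto simp: in_H20_def in_H2_def in_H10_def in_H1_def)
qed

lemma in_H10_add_mult:
  assumes om: "\<Omega> \<in> sets lebesgue" "emeasure lebesgue \<Omega> < \<infinity>"
    and u: "in_H10 \<Omega> u G" and v: "in_H10 \<Omega> v G'"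
  shows "in_H10 \<Omega> (\<lambda>x. u x + t * v x) (\<lambda>x. G x + t *\<^sub>R G' x)"
proof -
  obtain \<phi> where \<phi>': "\<forall>n. test_fun \<Omega> (\<phi> n)" "lp_tendsto 2 \<Omega> \<phi> u" "lp_tendsto 2 \<Omega> (\<lambda>n. cgrad (\<phi> n)) G"
    "lp_mem 2 \<Omega> u" "lp_mem 2 \<Omega> G" "is_wgrad \<Omega> u G" by (rule in_H10D[OF u])
  note \<phi> = \<phi>'[rule_format]
  obtain \<psi> where \<psi>': "\<forall>n. test_fun \<Omega> (\<psi> n)" "lp_tendsto 2 \<Omega> \<psi> v" "lp_tendsto 2 \<Omega> (\<lambda>n. cgrad (\<psi> n)) G'"
    "lp_mem 2 \<Omega> v" "lp_mem 2 \<Omega> G'" "is_wgrad \<Omega> v G'" by (rule in_H10D[OF v])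
  note \<psi> = \<psi>'[rule_format]
  have mu: "lp_mem 2 \<Omega> (\<phi> n)" "lp_mem 2 \<Omega> (\<psi> n)" "lp_mem 2 \<Omega> (cgrad (\<phi> n))" "lp_mem 2 \<Omega> (cgrad (\<psi> n))" for n
    using \<phi>(1) \<psi>(1) by (auto intro: lp_mem_test_fun[OF _ _ om] lp_mem_cgrad_chess[OF _ _ om])
  have cg: "cgrad (\<lambda>x. \<phi> n x + t * \<psi> n x) = (\<lambda>x. cgrad (\<phi> n) x + t *\<^sub>R cgrad (\<psi> n) x)" for n
    using cgrad_add_mult(1)[OF test_fun_smooth[OF \<phi>(1)] test_fun_smooth[OF \<psi>(1)]] by blast
  show ?thesis
  proof (rule in_H10I[OF om])
    show "test_fun \<Omega> (\<lambda>x. \<phi> n x + t * \<psi> n x)" for n using \<phi>(1) \<psi>(1) by (rule test_fun_add_mult)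
    show "lp_mem 2 \<Omega> (\<lambda>x. u x + t * v x)" using lp_mem_add[OF _ \<phi>(4) lp_mem_scaleR[OF \<psi>(4), of t]] by simp
    show "lp_mem 2 \<Omega> (\<lambda>x. G x + t *\<^sub>R G' x)" using lp_mem_add[OF _ \<phi>(5) lp_mem_scaleR[OF \<psi>(5), of t]] by simp
    show "lp_tendsto 2 \<Omega> (\<lambda>n x. \<phi> n x + t * \<psi> n x) (\<lambda>x. u x + t * v x)"
      using lp_tendsto_add_scaleR[OF _ mu(1) \<phi>(4) mu(2) \<psi>(4) \<phi>(2) \<psi>(2), of t] by simp
    show "lp_tendsto 2 \<Omega> (\<lambda>n. cgrad (\<lambda>x. \<phi> n x + t * \<psi> n x)) (\<lambda>x. G x + t *\<^sub>R G' x)"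
      using lp_tendsto_add_scaleR[OF _ mu(3) \<phi>(5) mu(4) \<psi>(5) \<phi>(3) \<psi>(3), of t] by (simp add: cg)
  qed
qed

lemma in_H20_test_fun:
  assumes \<phi>: "test_fun \<Omega> \<phi>" and om: "\<Omega> \<in> sets lebesgue" "emeasure lebesgue \<Omega> < \<infinity>"
  shows "in_H20 \<Omega> \<phi> (cgrad \<phi>) (chess \<phi>)"
  by (rule in_H20I[OF om _ _ _ \<phi>]) (auto intro: lp_mem_test_fun[OF \<phi> _ om] lp_mem_cgrad_chess[OF \<phi> _ om])

text \<open>A field orthogonal to all test functions is orthogonal to their gradients, hence to itself
  if it is a limit of such gradients.\<close>
lemma limit_grad_orthogonal_imp_zero:
  assumes om: "\<Omega> \<in> sets lebesgue" "emeasure lebesgue \<Omega> < \<infinity>"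
    and D: "lp_mem 2 \<Omega> D" "\<And>i \<theta>. test_fun \<Omega> \<theta> \<Longrightarrow> (\<integral>x. D x $ i * \<theta> x \<partial>lebesgue_on \<Omega>) = 0"
    and \<phi>: "\<And>n. test_fun \<Omega> (\<phi> n)" "lp_tendsto 2 \<Omega> (\<lambda>n. cgrad (\<phi> n)) D"
  shows "lp_norm 2 \<Omega> D = 0"
proof -
  have Di: "lp_mem 2 \<Omega> (\<lambda>x. D x $ i)" for i using D(1) lp_mem_nth_iff[of 2 \<Omega> D] by simp
  have "(\<integral>x. cgrad (\<phi> n) x \<bullet> D x \<partial>lebesgue_on \<Omega>) = 0" for n
  proof -
    have "(\<integral>x. cgrad (\<phi> n) x \<bullet> D x \<partial>lebesgue_on \<Omega>) = (\<integral>x. (\<Sum>i\<in>UNIV. D x $ i * dpart i (\<phi> n) x) \<partial>lebesgue_on \<Omega>)"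
      by (simp add: inner_vec_def cgrad_def mult.commute)
    also have "\<dots> = (\<Sum>i\<in>UNIV. \<integral>x. D x $ i * dpart i (\<phi> n) x \<partial>lebesgue_on \<Omega>)"
      by (intro Bochner_Integration.integral_sum integral_lebesgue_on_mult_le(1) Di lp_mem_test_fun[OF test_fun_dpart[OF \<phi>(1)] _ om]) simp
    also have "\<dots> = 0" using D(2)[OF test_fun_dpart[OF \<phi>(1)]] by simp
    finally show ?thesis .
  qed
  moreover have "(\<lambda>n. \<integral>x. cgrad (\<phi> n) x \<bullet> D x \<partial>lebesgue_on \<Omega>) \<longlonglongrightarrow> (\<integral>x. D x \<bullet> D x \<partial>lebesgue_on \<Omega>)"
    by (rule lp_2_tendsto_inner[OF _ D(1) D(1) \<phi>(2)]) (auto intro: lp_mem_cgrad_chess[OF \<phi>(1) _ om])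
  ultimately have "(lp_norm 2 \<Omega> D)\<^sup>2 = 0" by (simp add: LIMSEQ_const_iff lp_norm_2_sq_inner)
  then show ?thesis by simp
qed

text \<open>The difference of the gradients is a weak gradient of a function that vanishes almost
  everywhere, so it is orthogonal to all test functions, and it is a limit of gradients of test
  functions. This makes the gradient of a companion function well defined in norm.\<close>

lemma in_H10_grad_unique:
  assumes om: "\<Omega> \<in> sets lebesgue" "emeasure lebesgue \<Omega> < \<infinity>"
    and u: "in_H10 \<Omega> u G" and v: "in_H10 \<Omega> v G'" and ae: "AE x in lebesgue_on \<Omega>. u x = v x"
  shows "lp_norm 2 \<Omega> (\<lambda>x. G x - G' x) = 0"
proof -
  have d: "in_H10 \<Omega> (\<lambda>x. u x - v x) (\<lambda>x. G x - G' x)"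
    using in_H10_add_mult[OF om u v, of "-1"] by simp
  obtain \<phi> where \<phi>': "\<forall>n. test_fun \<Omega> (\<phi> n)" "lp_tendsto 2 \<Omega> \<phi> (\<lambda>x. u x - v x)" "lp_tendsto 2 \<Omega> (\<lambda>n. cgrad (\<phi> n)) (\<lambda>x. G x - G' x)"
    "lp_mem 2 \<Omega> (\<lambda>x. u x - v x)" "lp_mem 2 \<Omega> (\<lambda>x. G x - G' x)" "is_wgrad \<Omega> (\<lambda>x. u x - v x) (\<lambda>x. G x - G' x)"
    by (rule in_H10D[OF d])
  note \<phi> = \<phi>'[rule_format]
  show ?thesis
  proof (rule limit_grad_orthogonal_imp_zero[OF om \<phi>(5) _ \<phi>(1,3)])
    fix i \<theta> assume \<theta>: "test_fun \<Omega> \<theta>"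
    have "(\<integral>x. (u x - v x) * dpart i \<theta> x \<partial>lebesgue_on \<Omega>) = 0"
      using ae by (intro integral_eq_zero_AE) auto
    then show "(\<integral>x. (G x - G' x) $ i * \<theta> x \<partial>lebesgue_on \<Omega>) = 0"
      using \<phi>(6) \<theta> by (simp add: is_wgrad_def)
  qed
qed

text \<open>Integration by parts moves one derivative: the squared norm of
  \<open>dpart i \<phi>\<close> is minus the integral of \<phi> against its second derivative in
  direction \<open>i\<close>. Summation over the directions produces the dimension as a
  factor.\<close>

lemma cgrad_interpolation:
  assumes \<phi>: "test_fun \<Omega> \<phi>" and om: "\<Omega> \<in> sets lebesgue" "emeasure lebesgue \<Omega> < \<infinity>"
  shows "(lp_norm 2 \<Omega> (cgrad \<phi>))\<^sup>2 \<le> real CARD('d) * lp_norm 2 \<Omega> \<phi> * lp_norm 2 \<Omega> (chess \<phi> :: real^'d \<Rightarrow> real^'d^'d)"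
proof -
  have m: "lp_mem 2 \<Omega> \<phi>" "lp_mem 2 \<Omega> (dpart i \<phi>)" "lp_mem 2 \<Omega> (dpart i (dpart j \<phi>))" for i j
    using \<phi> by (auto intro!: lp_mem_test_fun[OF _ _ om] test_fun_dpart)
  have cm: "lp_mem 2 \<Omega> (chess \<phi>)" "lp_mem 2 \<Omega> (cgrad \<phi>)" by (auto intro!: lp_mem_cgrad_chess[OF \<phi> _ om])
  have "(lp_norm 2 \<Omega> (cgrad \<phi>))\<^sup>2 = (\<Sum>i\<in>UNIV. (lp_norm 2 \<Omega> (dpart i \<phi>))\<^sup>2)"
    using lp_norm_2_sq_nth[OF cm(2)] by (simp add: cgrad_def)
  also have "\<dots> \<le> (\<Sum>i\<in>(UNIV::'d set). lp_norm 2 \<Omega> \<phi> * lp_norm 2 \<Omega> (chess \<phi>))"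
  proof (intro sum_mono)
    fix i
    have "(lp_norm 2 \<Omega> (dpart i \<phi>))\<^sup>2 = (\<integral>x. dpart i \<phi> x * dpart i \<phi> x \<partial>lebesgue_on \<Omega>)"
      by (simp add: lp_norm_2_sq_inner)
    also have "\<dots> = - (\<integral>x. \<phi> x * dpart i (dpart i \<phi>) x \<partial>lebesgue_on \<Omega>)"
      using test_fun_by_parts[OF \<phi> test_fun_dpart[OF \<phi>, of i] om, of i] by simp
    also have "\<dots> \<le> lp_norm 2 \<Omega> \<phi> * lp_norm 2 \<Omega> (dpart i (dpart i \<phi>))"
      using integral_lebesgue_on_mult_le(2)[OF m(1) m(3)[of i i]] by simp
    also have "lp_norm 2 \<Omega> (dpart i (dpart i \<phi>)) \<le> lp_norm 2 \<Omega> (chess \<phi>)"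
    proof -
      have ci: "lp_mem 2 \<Omega> (\<lambda>x. chess \<phi> x $ i)" using cm(1) lp_mem_nth_iff[of 2 \<Omega> "chess \<phi>"] by simp
      have "lp_norm 2 \<Omega> (\<lambda>x. chess \<phi> x $ i $ i) \<le> lp_norm 2 \<Omega> (chess \<phi>)"
        using lp_norm_nth_le[OF _ ci, of i] lp_norm_nth_le[OF _ cm(1), of i] by simp
      then show ?thesis by (simp add: chess_def)
    qed
    finally show "(lp_norm 2 \<Omega> (dpart i \<phi>))\<^sup>2 \<le> lp_norm 2 \<Omega> \<phi> * lp_norm 2 \<Omega> (chess \<phi>)"
      by (simp add: mult_left_mono)
  qed
  also have "\<dots> = real CARD('d) * lp_norm 2 \<Omega> \<phi> * lp_norm 2 \<Omega> (chess \<phi>)" by simp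
  finally show ?thesis .
qed

text \<open>Duality produces separate approximations, \<phi> for the Hessian and \<psi> for the
  gradient, while \<open>in_H20\<close> asks for one sequence. By interpolation the gradients of
  \<phi> are Cauchy, and uniqueness of the gradient of \<open>u\<close> identifies their limit with
  \<open>G\<close>.\<close>

lemma in_H20_closureI:
  fixes u :: "real^'d \<Rightarrow> real" and G :: "real^'d \<Rightarrow> real^'d" and H :: "real^'d \<Rightarrow> real^'d^'d"
  assumes om: "\<Omega> \<in> sets lebesgue" "emeasure lebesgue \<Omega> < \<infinity>"
    and m: "lp_mem 2 \<Omega> u" "lp_mem 2 \<Omega> G" "lp_mem 2 \<Omega> H"
    and \<phi>: "\<And>n. test_fun \<Omega> (\<phi> n)" "lp_tendsto 2 \<Omega> \<phi> u" "lp_tendsto 2 \<Omega> (\<lambda>n. chess (\<phi> n)) H"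
    and \<psi>: "\<And>n. test_fun \<Omega> (\<psi> n)" "lp_tendsto 2 \<Omega> \<psi> u" "lp_tendsto 2 \<Omega> (\<lambda>n. cgrad (\<psi> n)) G"
  shows "in_H20 \<Omega> u G H"
proof -
  have mp: "lp_mem 2 \<Omega> (\<phi> n)" "lp_mem 2 \<Omega> (cgrad (\<phi> n))" "lp_mem 2 \<Omega> (chess (\<phi> n))" for n
    by (auto intro: lp_mem_test_fun[OF \<phi>(1) _ om] lp_mem_cgrad_chess[OF \<phi>(1) _ om])
  let ?d = "real CARD('d)"
  obtain G' where G': "lp_mem 2 \<Omega> G'" "lp_tendsto 2 \<Omega> (\<lambda>n. cgrad (\<phi> n)) G'"
  proof (rule lp_2_complete[OF mp(2) _ om])
    fix e :: real assume e: "e > 0"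
    \<comment> \<open>The interpolation constant is the dimension; dividing by it makes the product
      of the two bounds equal to \<open>e\<^sup>2\<close>.\<close>
    obtain N where N: "\<forall>m\<ge>N. \<forall>n\<ge>N. lp_norm 2 \<Omega> (\<lambda>x. \<phi> m x - \<phi> n x) < e / ?d"
      using lp_tendsto_Cauchy[OF _ mp(1) m(1) \<phi>(2), of "e / ?d"] e by auto
    obtain N' where N': "\<forall>m\<ge>N'. \<forall>n\<ge>N'. lp_norm 2 \<Omega> (\<lambda>x. chess (\<phi> m) x - chess (\<phi> n) x) < e"
      using lp_tendsto_Cauchy[OF _ mp(3) m(3) \<phi>(3), of e] e by auto
    have "lp_norm 2 \<Omega> (\<lambda>x. cgrad (\<phi> k) x - cgrad (\<phi> n) x) < e" if "k \<ge> max N N'" "n \<ge> max N N'" for k n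
    proof -
      let ?\<theta> = "\<lambda>x. \<phi> k x - \<phi> n x"
      have "(lp_norm 2 \<Omega> (cgrad ?\<theta>))\<^sup>2 \<le> ?d * lp_norm 2 \<Omega> ?\<theta> * lp_norm 2 \<Omega> (chess ?\<theta>)"
        by (rule cgrad_interpolation[OF test_fun_diff[OF \<phi>(1) \<phi>(1)] om])
      also have "\<dots> < ?d * (e / ?d) * e"
      proof (rule mult_strict_mono')
        show "?d * lp_norm 2 \<Omega> ?\<theta> < ?d * (e / ?d)" using N that by (intro mult_strict_left_mono) auto
        show "lp_norm 2 \<Omega> (chess ?\<theta>) < e"
          using N' that unfolding cgrad_diff(2)[OF test_fun_smooth[OF \<phi>(1)] test_fun_smooth[OF \<phi>(1)], abs_def] by auto
      qed auto
      also have "\<dots> = e\<^sup>2" by (simp add: power2_eq_square)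
      finally have "lp_norm 2 \<Omega> (cgrad ?\<theta>) < e" using e power2_less_imp_less less_imp_le by blast
      then show ?thesis
        unfolding cgrad_diff(1)[OF test_fun_smooth[OF \<phi>(1)] test_fun_smooth[OF \<phi>(1)], abs_def] .
    qed
    then show "\<exists>N. \<forall>m\<ge>N. \<forall>n\<ge>N. lp_norm 2 \<Omega> (\<lambda>x. cgrad (\<phi> m) x - cgrad (\<phi> n) x) < e" by blast
  qed
  have "in_H10 \<Omega> u G'" by (rule in_H10I[OF om m(1) G'(1) \<phi>(1,2) G'(2)])
  moreover have "in_H10 \<Omega> u G" by (rule in_H10I[OF om m(1,2) \<psi>])
  ultimately have 0: "lp_norm 2 \<Omega> (\<lambda>x. G' x - G x) = 0" by (intro in_H10_grad_unique[OF om]) auto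
  have "lp_tendsto 2 \<Omega> (\<lambda>n. cgrad (\<phi> n)) G"
  proof (rule Lim_null_comparison[OF always_eventually G'(2)], intro allI)
    show "norm (lp_norm 2 \<Omega> (\<lambda>x. cgrad (\<phi> n) x - G x)) \<le> lp_norm 2 \<Omega> (\<lambda>x. cgrad (\<phi> n) x - G' x)" for n
      using lp_norm_triangle3[OF _ mp(2)[of n] G'(1) m(2)] 0 by simp
  qed
  then show ?thesis by (intro in_H20I[OF om m \<phi>(1,2) _ \<phi>(3)])
qed

section \<open>Description of H^2_0 by duality\<close>

lemma lp_mem_Pair:
  fixes f :: "real^'d \<Rightarrow> real" and g :: "real^'d \<Rightarrow> 'w::euclidean_space"
  assumes f: "lp_mem 2 \<Omega> f" and g: "lp_mem 2 \<Omega> g"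
  shows "lp_mem 2 \<Omega> (\<lambda>x. (f x, g x))"
proof -
  have [measurable]: "f \<in> borel_measurable (lebesgue_on \<Omega>)" "g \<in> borel_measurable (lebesgue_on \<Omega>)"
    using f g by (auto dest: lp_memD)
  have "(\<lambda>x. (f x, g x)) \<in> borel_measurable (lebesgue_on \<Omega>)" by measurable
  moreover have "(norm (f x, g x))\<^sup>2 = (norm (f x))\<^sup>2 + (norm (g x))\<^sup>2" for x by (simp add: norm_Pair)
  ultimately show ?thesis using f g by (simp add: lp_mem_2_iff)
qed

lemma lp_2_fst_snd:
  fixes R :: "real^'d \<Rightarrow> real \<times> 'w::euclidean_space"
  assumes R: "lp_mem 2 \<Omega> R"
  shows "lp_mem 2 \<Omega> (\<lambda>x. fst (R x))" "lp_norm 2 \<Omega> (\<lambda>x. fst (R x)) \<le> lp_norm 2 \<Omega> R"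
    "lp_mem 2 \<Omega> (\<lambda>x. snd (R x))" "lp_norm 2 \<Omega> (\<lambda>x. snd (R x)) \<le> lp_norm 2 \<Omega> R"
proof -
  have [measurable]: "R \<in> borel_measurable (lebesgue_on \<Omega>)" using R by (auto dest: lp_memD)
  have [measurable]: "(fst :: real \<times> 'w \<Rightarrow> _) \<in> borel_measurable borel" "(snd :: real \<times> 'w \<Rightarrow> _) \<in> borel_measurable borel"
    by (auto intro!: borel_measurable_continuous_onI continuous_intros)
  have f: "(\<lambda>x. fst (R x)) \<in> borel_measurable (lebesgue_on \<Omega>)" by measurable
  have s: "(\<lambda>x. snd (R x)) \<in> borel_measurable (lebesgue_on \<Omega>)" by measurable
  have le: "norm (fst (R x)) \<le> norm (R x)" "norm (snd (R x)) \<le> norm (R x)" for x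
    using norm_fst_le[of "fst (R x)" "snd (R x)"] norm_snd_le[of "snd (R x)" "fst (R x)"] by auto
  show "lp_mem 2 \<Omega> (\<lambda>x. fst (R x))" "lp_norm 2 \<Omega> (\<lambda>x. fst (R x)) \<le> lp_norm 2 \<Omega> R"
    using lp_mem_bound[OF R f _ le(1)] by auto
  show "lp_mem 2 \<Omega> (\<lambda>x. snd (R x))" "lp_norm 2 \<Omega> (\<lambda>x. snd (R x)) \<le> lp_norm 2 \<Omega> R"
    using lp_mem_bound[OF R s _ le(2)] by auto
qed

text \<open>Projection theorem for pairs: the subspace is the graph of \<open>D\<close> on test
  functions, and the two components of a function orthogonal to it form a pair \<open>h\<close>,
  \<open>\<xi>\<close> as in \<open>dual\<close>. It is used with \<open>chess\<close> and with
  \<open>cgrad\<close> in place of \<open>D\<close>.\<close>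

lemma graph_closure_dual:
  fixes D :: "(real^'d \<Rightarrow> real) \<Rightarrow> real^'d \<Rightarrow> 'w::euclidean_space"
  assumes om: "\<Omega> \<in> sets lebesgue" "emeasure lebesgue \<Omega> < \<infinity>"
    and D: "\<And>f. test_fun \<Omega> f \<Longrightarrow> lp_mem 2 \<Omega> (D f)"
      "\<And>f g t x. test_fun \<Omega> f \<Longrightarrow> test_fun \<Omega> g \<Longrightarrow> D (\<lambda>x. f x + t * g x) x = D f x + t *\<^sub>R D g x"
    and m: "lp_mem 2 \<Omega> u" "lp_mem 2 \<Omega> P"
    and dual: "\<And>h \<xi>. lp_mem 2 \<Omega> h \<Longrightarrow> lp_mem 2 \<Omega> \<xi> \<Longrightarrow>
        (\<And>\<psi>. test_fun \<Omega> \<psi> \<Longrightarrow> (\<integral>x. h x * \<psi> x \<partial>lebesgue_on \<Omega>) + (\<integral>x. \<xi> x \<bullet> D \<psi> x \<partial>lebesgue_on \<Omega>) = 0) \<Longrightarrow>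
        (\<integral>x. h x * u x \<partial>lebesgue_on \<Omega>) + (\<integral>x. \<xi> x \<bullet> P x \<partial>lebesgue_on \<Omega>) = 0"
  obtains \<phi> where "\<forall>n. test_fun \<Omega> (\<phi> n)" "lp_tendsto 2 \<Omega> \<phi> u" "lp_tendsto 2 \<Omega> (\<lambda>n. D (\<phi> n)) P"
proof -
  define V where "V = (\<lambda>\<phi> x. (\<phi> x, D \<phi> x)) ` {\<phi>. test_fun \<Omega> \<phi>}"
  have inn: "(\<integral>x. R x \<bullet> (f x, g x) \<partial>lebesgue_on \<Omega>) = (\<integral>x. fst (R x) * f x \<partial>lebesgue_on \<Omega>) + (\<integral>x. snd (R x) \<bullet> g x \<partial>lebesgue_on \<Omega>)"
    if "lp_mem 2 \<Omega> R" "lp_mem 2 \<Omega> f" "lp_mem 2 \<Omega> g" for R :: "real^'d \<Rightarrow> real \<times> 'w" and f g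
    using integral_lebesgue_on_mult_le(1)[OF lp_2_fst_snd(1)[OF that(1)] that(2)]
      lp_mem_inner_integrable[OF lp_2_fst_snd(3)[OF that(1)] that(3)] by (simp add: inner_prod_def)
  have D0: "D (\<lambda>x. 0) x = 0" for x
    using D(2)[OF test_fun_zero test_fun_zero, of "-1"] by simp
  obtain v where v: "\<forall>n. v n \<in> V" and vlim: "lp_tendsto 2 \<Omega> v (\<lambda>x. (u x, P x))"
  proof (rule lp_2_projection[OF _ _ _ _ _ om])
    show "lp_mem 2 \<Omega> v" if "v \<in> V" for v
      using that by (auto simp: V_def intro!: lp_mem_Pair D lp_mem_test_fun[OF _ _ om])
    show "(\<lambda>x. 0) \<in> V" using test_fun_zero D0 by (auto simp: V_def image_iff zero_prod_def intro!: exI[of _ "\<lambda>x. 0"])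
    show "(\<lambda>x. v x + t *\<^sub>R w x) \<in> V" if v: "v \<in> V" and w: "w \<in> V" for v w t
    proof -
      obtain f g where "test_fun \<Omega> f" "test_fun \<Omega> g" "v = (\<lambda>x. (f x, D f x))" "w = (\<lambda>x. (g x, D g x))"
        using v w by (auto simp: V_def)
      then show ?thesis using D(2) test_fun_add_mult
        by (auto simp: V_def image_iff intro!: exI[of _ "\<lambda>x. f x + t * g x"])
    qed
    show "lp_mem 2 \<Omega> (\<lambda>x. (u x, P x))" by (intro lp_mem_Pair m)
    fix R assume R: "lp_mem 2 \<Omega> R" and orth: "\<And>v. v \<in> V \<Longrightarrow> (\<integral>x. R x \<bullet> v x \<partial>lebesgue_on \<Omega>) = 0"
    show "(\<integral>x. R x \<bullet> (u x, P x) \<partial>lebesgue_on \<Omega>) = 0"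
      unfolding inn[OF R m]
    proof (rule dual[OF lp_2_fst_snd(1)[OF R] lp_2_fst_snd(3)[OF R]])
      fix \<psi> assume \<psi>: "test_fun \<Omega> \<psi>"
      then have "(\<integral>x. R x \<bullet> (\<psi> x, D \<psi> x) \<partial>lebesgue_on \<Omega>) = 0" by (intro orth) (auto simp: V_def)
      then show "(\<integral>x. fst (R x) * \<psi> x \<partial>lebesgue_on \<Omega>) + (\<integral>x. snd (R x) \<bullet> D \<psi> x \<partial>lebesgue_on \<Omega>) = 0"
        using inn[OF R lp_mem_test_fun[OF \<psi> _ om] D(1)[OF \<psi>]] by simp
    qed
  qed
  have "\<exists>\<phi>. test_fun \<Omega> \<phi> \<and> v n = (\<lambda>x. (\<phi> x, D \<phi> x))" for n using v by (auto simp: V_def)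
  then obtain \<phi> where \<phi>: "\<And>n. test_fun \<Omega> (\<phi> n)" "\<And>n. v n = (\<lambda>x. (\<phi> n x, D (\<phi> n) x))" by metis
  have dm: "lp_mem 2 \<Omega> (\<lambda>x. v n x - (u x, P x))" for n
    using \<phi> by (intro lp_mem_diff lp_mem_Pair m) (auto intro!: lp_mem_Pair D lp_mem_test_fun[OF _ _ om])
  show thesis
  proof (rule that)
    show "\<forall>n. test_fun \<Omega> (\<phi> n)" using \<phi>(1) by blast
    show "lp_tendsto 2 \<Omega> \<phi> u"
      using lp_2_fst_snd(2)[OF dm] by (intro Lim_null_comparison[OF always_eventually vlim]) (simp add: \<phi>(2))
    show "lp_tendsto 2 \<Omega> (\<lambda>n. D (\<phi> n)) P"
      using lp_2_fst_snd(4)[OF dm] by (intro Lim_null_comparison[OF always_eventually vlim]) (simp add: \<phi>(2))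
  qed
qed

text \<open>The space \<open>H\<^sup>2\<^sub>0\<close> is recovered by duality, which works on arbitrary bounded domains, where
  extension by zero would not.\<close>
lemma in_H20_dualI:
  fixes u :: "real^'d \<Rightarrow> real" and G :: "real^'d \<Rightarrow> real^'d" and H :: "real^'d \<Rightarrow> real^'d^'d"
  assumes om: "\<Omega> \<in> sets lebesgue" "emeasure lebesgue \<Omega> < \<infinity>"
    and m: "lp_mem 2 \<Omega> u" "lp_mem 2 \<Omega> G" "lp_mem 2 \<Omega> H"
    and dd: "\<And>\<xi> h. in_Hdd \<Omega> \<xi> h \<Longrightarrow> (\<integral>x. h x * u x \<partial>lebesgue_on \<Omega>) = (\<integral>x. \<xi> x \<bullet> H x \<partial>lebesgue_on \<Omega>)"
    and dv: "\<And>\<xi> h. in_Hdiv \<Omega> \<xi> h \<Longrightarrow> (\<integral>x. \<xi> x \<bullet> G x \<partial>lebesgue_on \<Omega>) + (\<integral>x. h x * u x \<partial>lebesgue_on \<Omega>) = 0"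
  shows "in_H20 \<Omega> u G H"
proof -
  obtain \<phi> where \<phi>': "\<forall>n. test_fun \<Omega> (\<phi> n)" "lp_tendsto 2 \<Omega> \<phi> u" "lp_tendsto 2 \<Omega> (\<lambda>n. chess (\<phi> n)) H"
  proof (rule graph_closure_dual[OF om _ _ m(1) m(3)])
    fix h \<xi> assume h: "lp_mem 2 \<Omega> h" "lp_mem 2 \<Omega> \<xi>" and
      orth: "\<And>\<psi>. test_fun \<Omega> \<psi> \<Longrightarrow> (\<integral>x. h x * \<psi> x \<partial>lebesgue_on \<Omega>) + (\<integral>x. \<xi> x \<bullet> chess \<psi> x \<partial>lebesgue_on \<Omega>) = 0"
    \<comment> \<open>Orthogonality to the graph makes \<open>- h\<close> the double divergence of
      \<open>\<xi>\<close>: two integrations by parts keep the sign. In the gradient case one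
      integration changes it, so there \<open>h\<close> appears unchanged.\<close>
    have "in_Hdd \<Omega> \<xi> (\<lambda>x. - h x)"
      using h orth by (auto simp: in_Hdd_def lp_mem_minus eq_neg_iff_add_eq_0 add.commute)
    from dd[OF this] show "(\<integral>x. h x * u x \<partial>lebesgue_on \<Omega>) + (\<integral>x. \<xi> x \<bullet> H x \<partial>lebesgue_on \<Omega>) = 0" by simp
  qed (auto intro: lp_mem_cgrad_chess[OF _ _ om] cgrad_add_mult(2)[OF test_fun_smooth test_fun_smooth])
  note \<phi> = \<phi>'[rule_format]
  obtain \<psi> where \<psi>': "\<forall>n. test_fun \<Omega> (\<psi> n)" "lp_tendsto 2 \<Omega> \<psi> u" "lp_tendsto 2 \<Omega> (\<lambda>n. cgrad (\<psi> n)) G"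
  proof (rule graph_closure_dual[OF om _ _ m(1) m(2)])
    fix h \<xi> assume h: "lp_mem 2 \<Omega> h" "lp_mem 2 \<Omega> \<xi>" and
      orth: "\<And>\<psi>. test_fun \<Omega> \<psi> \<Longrightarrow> (\<integral>x. h x * \<psi> x \<partial>lebesgue_on \<Omega>) + (\<integral>x. \<xi> x \<bullet> cgrad \<psi> x \<partial>lebesgue_on \<Omega>) = 0"
    have "in_Hdiv \<Omega> \<xi> h"
      using h orth by (auto simp: in_Hdiv_def eq_neg_iff_add_eq_0 add.commute)
    from dv[OF this] show "(\<integral>x. h x * u x \<partial>lebesgue_on \<Omega>) + (\<integral>x. \<xi> x \<bullet> G x \<partial>lebesgue_on \<Omega>) = 0" by simp
  qed (auto intro: lp_mem_cgrad_chess[OF _ _ om] cgrad_add_mult(1)[OF test_fun_smooth test_fun_smooth])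
  note \<psi> = \<psi>'[rule_format]
  show ?thesis by (rule in_H20_closureI[OF om m \<phi> \<psi>])
qed

text \<open>The inequality on test functions passes to the limit by Fatou, along a subsequence whose
  gradients converge almost everywhere. The constant \<open>K\<close> is to be supplied by the
  coercivity of the discretisations.\<close>

lemma in_H20_grad_L4:
  assumes om: "\<Omega> \<in> sets lebesgue" "emeasure lebesgue \<Omega> < \<infinity>"
    and K: "0 \<le> K" "\<And>\<phi>. test_fun \<Omega> \<phi> \<Longrightarrow> lp_norm 4 \<Omega> (cgrad \<phi>) \<le> K * lp_norm 2 \<Omega> (chess \<phi>)"
    and u: "in_H20 \<Omega> u G H"
  shows "lp_mem 4 \<Omega> G"
proof -
  obtain \<phi> where \<phi>': "\<forall>n. test_fun \<Omega> (\<phi> n)" "lp_tendsto 2 \<Omega> \<phi> u" "lp_tendsto 2 \<Omega> (\<lambda>n. cgrad (\<phi> n)) G"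
    "lp_tendsto 2 \<Omega> (\<lambda>n. chess (\<phi> n)) H" and m: "lp_mem 2 \<Omega> u" "lp_mem 2 \<Omega> G" "lp_mem 2 \<Omega> H"
    by (rule in_H20D[OF u])
  note \<phi> = \<phi>'[rule_format]
  have mp: "lp_mem 2 \<Omega> (cgrad (\<phi> n))" "lp_mem 4 \<Omega> (cgrad (\<phi> n))" "lp_mem 2 \<Omega> (chess (\<phi> n))" for n
    by (auto intro: lp_mem_cgrad_chess[OF \<phi>(1) _ om])
  obtain r :: "nat \<Rightarrow> nat" where r: "strict_mono r" "AE x in lebesgue_on \<Omega>. (\<lambda>n. cgrad (\<phi> (r n)) x) \<longlonglongrightarrow> G x"
    using lp_2_tendsto_AE_subseq[OF mp(1) m(2) \<phi>(3) om] by blast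
  let ?C = "lp_norm 2 \<Omega> H + 1"
  have "(\<lambda>n. lp_norm 2 \<Omega> (chess (\<phi> (r n)))) \<longlonglongrightarrow> lp_norm 2 \<Omega> H"
    using LIMSEQ_subseq_LIMSEQ[OF lp_tendsto_norm[OF _ mp(3) m(3) \<phi>(4)] r(1)] by (simp add: o_def)
  then have "\<forall>\<^sub>F n in sequentially. lp_norm 2 \<Omega> (chess (\<phi> (r n))) < ?C" by (rule order_tendstoD) simp
  then have "\<forall>\<^sub>F n in sequentially. lp_norm 4 \<Omega> (cgrad (\<phi> (r n))) \<le> K * ?C"
  proof eventually_elim
    case (elim n)
    then have "K * lp_norm 2 \<Omega> (chess (\<phi> (r n))) \<le> K * ?C" using K(1) by (intro mult_left_mono) auto
    then show ?case using K(2)[OF \<phi>(1), of "r n"] by linarith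
  qed
  moreover have "0 \<le> K * ?C" using K(1) by simp
  ultimately show ?thesis
    using lp_fatou(1)[of 4 \<Omega> "\<lambda>n. cgrad (\<phi> (r n))" G "K * ?C"] mp(2) r(2) lp_memD(1)[OF m(2)] by simp
qed

section \<open>Zeros of outward vector fields and Galerkin equations\<close>

text \<open>Relative to a carrier, because a discrete space is a subset of its type and the composed
  forms are controlled there only.\<close>

definition linear_on_set :: "'z::real_vector set \<Rightarrow> ('z \<Rightarrow> real) \<Rightarrow> bool" where
  "linear_on_set Z f \<longleftrightarrow> (\<forall>u\<in>Z. \<forall>v\<in>Z. \<forall>s t. f (s *\<^sub>R u + t *\<^sub>R v) = s * f u + t * f v)"

definition seminorm_on :: "'z::real_vector set \<Rightarrow> ('z \<Rightarrow> real) \<Rightarrow> bool" where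
  "seminorm_on Z q \<longleftrightarrow> (\<forall>u\<in>Z. \<forall>v\<in>Z. q (u + v) \<le> q u + q v) \<and> (\<forall>u\<in>Z. \<forall>t. q (t *\<^sub>R u) = \<bar>t\<bar> * q u)"

section \<open>Zeros of vector fields by Brouwer degree\<close>

lemma nsphere_eq_top_of_set:
  "nsphere p = top_of_set {x. (\<Sum>i\<le>p. (x i)\<^sup>2) = 1 \<and> (\<forall>i>p. x i = 0)}"
  by (simp add: nsphere euclidean_product_topology)

text \<open>Dividing a nowhere vanishing family of vector fields by its length gives a homotopy of
  self-maps of the sphere. \<open>N\<close> is zero beyond \<open>p\<close> because points of
  \<open>nsphere p\<close> are sequences that vanish there.\<close>

lemma nsphere_homotopic_normalised:
  fixes H :: "real \<times> (nat \<Rightarrow> real) \<Rightarrow> nat \<Rightarrow> real"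
  defines "S p \<equiv> {x. (\<Sum>i\<le>p. (x i)\<^sup>2) = 1 \<and> (\<forall>i>p. x i = (0::real))}"
  assumes cont: "\<And>i. i \<le> p \<Longrightarrow> continuous_on ({0..1} \<times> S p) (\<lambda>z. H z i)"
    and ne: "\<And>z. z \<in> {0..1} \<times> S p \<Longrightarrow> (\<Sum>i\<le>p. (H z i)\<^sup>2) > 0"
    and N: "N = (\<lambda>y i. if i \<le> p then y i / sqrt (\<Sum>j\<le>p. (y j)\<^sup>2) else 0)"
  shows "homotopic_with (\<lambda>x. True) (nsphere p) (nsphere p) (\<lambda>x. N (H (0, x))) (\<lambda>x. N (H (1, x)))"
  unfolding nsphere_eq_top_of_set S_def[symmetric] homotopic_with_def prod_topology_subtopology_eu continuous_map_subtopology_eu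
proof (intro exI[of _ "\<lambda>z. N (H z)"] conjI)
  have "continuous_on ({0..1} \<times> S p) (\<lambda>z. N (H z) i)" for i
  proof (cases "i \<le> p")
    case True
    have "\<forall>z\<in>{0..1} \<times> S p. sqrt (\<Sum>j\<le>p. (H z j)\<^sup>2) \<noteq> 0" using ne by fastforce
    then have "continuous_on ({0..1} \<times> S p) (\<lambda>z. H z i / sqrt (\<Sum>j\<le>p. (H z j)\<^sup>2))"
      using True by (intro continuous_intros cont) auto
    then show ?thesis using True by (simp add: N)
  qed (simp add: N)
  then have c: "continuous_on ({0..1} \<times> S p) (\<lambda>z. N (H z))"
    by (rule continuous_on_coordinatewise_then_product)
  have "N (H z) \<in> S p" if z: "z \<in> {0..1} \<times> S p" for z
  proof -
    have "(\<Sum>i\<le>p. (N (H z) i)\<^sup>2) = (\<Sum>i\<le>p. (H z i)\<^sup>2 / (\<Sum>j\<le>p. (H z j)\<^sup>2))"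
      using ne[OF z] by (intro sum.cong) (auto simp: N power_divide)
    also have "\<dots> = 1" using ne[OF z] by (simp flip: sum_divide_distrib)
    finally show ?thesis by (simp add: S_def N)
  qed
  then show "(\<lambda>z. N (H z)) \<in> {0..1} \<times> S p \<rightarrow> S p" by auto
  show "continuous_on ({0..1} \<times> S p) (\<lambda>z. N (H z))" by (rule c)
qed auto

text \<open>Otherwise \<open>P\<close> restricted to the sphere is homotopic, after normalisation, both to the
  identity (it points outwards) and to a constant (contract the radius).\<close>
lemma outward_field_zero_nat:
  fixes P :: "(nat \<Rightarrow> real) \<Rightarrow> nat \<Rightarrow> real"
  assumes cont: "\<And>i. i < n \<Longrightarrow> continuous_on UNIV (\<lambda>x. P x i)" and R: "R > 0"
    and pos: "\<And>x. (\<forall>i\<ge>n. x i = 0) \<Longrightarrow> (\<Sum>i<n. (x i)\<^sup>2) = R\<^sup>2 \<Longrightarrow> (\<Sum>i<n. P x i * x i) > 0"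
  shows "\<exists>x. (\<forall>i\<ge>n. x i = 0) \<and> (\<forall>i<n. P x i = 0)"
proof (cases n)
  case 0 then show ?thesis by (intro exI[of _ "\<lambda>_. 0"]) auto
next
  \<comment> \<open>The unit sphere in dimension \<open>Suc p\<close> is \<open>nsphere p\<close>;
    hence the shift between the ranges \<open>i < n\<close> and \<open>i \<le> p\<close>.\<close>
  case (Suc p)
  show ?thesis
  proof (rule ccontr)
    assume "\<not> ?thesis"
    then have ne: "\<exists>i\<le>p. P x i \<noteq> 0" if "\<forall>i>p. x i = 0" for x using that Suc by (metis Suc_le_eq less_Suc_eq_le)
    define S where "S = {x. (\<Sum>i\<le>p. (x i)\<^sup>2) = 1 \<and> (\<forall>i>p. x i = (0::real))}"
    define N where "N = (\<lambda>y i. if i \<le> p then y i / sqrt (\<Sum>j\<le>p. (y j)\<^sup>2) else (0::real))"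
    have sq_pos: "(\<Sum>i\<le>p. (y i)\<^sup>2) > 0" if "\<exists>i\<le>p. y i \<noteq> 0" for y :: "nat \<Rightarrow> real"
      using that by (auto intro!: sum_pos2)
    have cP: "continuous_on A (\<lambda>z. P (\<lambda>j. f z * snd z j) i)" if "i \<le> p" "continuous_on A f" for i f and A :: "(real \<times> (nat \<Rightarrow> real)) set"
    proof (rule continuous_on_compose2[OF cont])
      show "continuous_on A (\<lambda>z j. f z * snd z j)"
        by (intro continuous_on_coordinatewise_then_product continuous_intros that
            continuous_on_product_then_coordinatewise[OF continuous_on_snd[OF continuous_on_id]])
    qed (use that Suc in auto)
    have csnd: "continuous_on A (\<lambda>z. snd z i)" for A :: "(real \<times> (nat \<Rightarrow> real)) set" and i
      by (rule continuous_on_product_then_coordinatewise[OF continuous_on_snd[OF continuous_on_id]])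
    let ?H1 = "\<lambda>z i. (1 - fst z) * snd z i + fst z * P (\<lambda>j. R * snd z j) i"
    let ?H2 = "\<lambda>z. P (\<lambda>j. (fst z * R) * snd z j)"
    have "homotopic_with (\<lambda>x. True) (nsphere p) (nsphere p) (\<lambda>x. N (?H1 (0, x))) (\<lambda>x. N (?H1 (1, x)))"
    proof (rule nsphere_homotopic_normalised[OF _ _ N_def], fold S_def)
      show "continuous_on ({0..1} \<times> S) (\<lambda>z. ?H1 z i)" if "i \<le> p" for i
        by (intro continuous_intros cP csnd that)
      fix z :: "real \<times> (nat \<Rightarrow> real)" assume z: "z \<in> {0..1} \<times> S"
      then obtain t x where tx: "z = (t, x)" "0 \<le> t" "t \<le> 1" "(\<Sum>i\<le>p. (x i)\<^sup>2) = 1" "\<forall>i>p. x i = 0" by (auto simp: S_def)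
      have "(\<Sum>i<n. P (\<lambda>j. R * x j) i * (R * x i)) > 0"
      proof (rule pos)
        show "\<forall>i\<ge>n. R * x i = 0" using tx Suc by auto
        show "(\<Sum>i<n. (R * x i)\<^sup>2) = R\<^sup>2" using tx unfolding Suc lessThan_Suc_atMost
          by (simp add: power_mult_distrib flip: sum_distrib_left)
      qed
      then have "R * (\<Sum>i\<le>p. P (\<lambda>j. R * x j) i * x i) > 0"
        unfolding Suc lessThan_Suc_atMost by (simp add: sum_distrib_left mult_ac)
      then have q: "(\<Sum>i\<le>p. P (\<lambda>j. R * x j) i * x i) > 0" using R by (simp add: zero_less_mult_iff)
      \<comment> \<open>Pairing with \<open>x\<close> shows that the segment from the identity to
        the field does not vanish on the sphere.\<close>
      have "(\<Sum>i\<le>p. ?H1 z i * x i) = (1 - t) * (\<Sum>i\<le>p. (x i)\<^sup>2) + t * (\<Sum>i\<le>p. P (\<lambda>j. R * x j) i * x i)"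
        by (simp add: tx(1) sum_distrib_left sum.distrib[symmetric] algebra_simps power2_eq_square)
      also have "\<dots> > 0"
      proof (cases "t = 0")
        case False
        then have "t * (\<Sum>i\<le>p. P (\<lambda>j. R * x j) i * x i) > 0" using tx q by simp
        then show ?thesis using tx by simp
      qed (use tx in simp)
      finally have "(\<Sum>i\<le>p. ?H1 z i * x i) \<noteq> 0" by simp
      then have "\<exists>i\<le>p. ?H1 z i \<noteq> 0" by (metis (no_types, lifting) atMost_iff mult_zero_left sum.neutral)
      then show "(\<Sum>i\<le>p. (?H1 z i)\<^sup>2) > 0" by (rule sq_pos)
    qed
    then have 1: "Brouwer_degree2 p (\<lambda>x. N x) = Brouwer_degree2 p (\<lambda>x. N (P (\<lambda>j. R * x j)))"
      using Brouwer_degree2_homotopic by fastforce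
    have "homotopic_with (\<lambda>x. True) (nsphere p) (nsphere p) (\<lambda>x. N (?H2 (0, x))) (\<lambda>x. N (?H2 (1, x)))"
    proof (rule nsphere_homotopic_normalised[OF _ _ N_def], fold S_def)
      show "continuous_on ({0..1} \<times> S) (\<lambda>z. ?H2 z i)" if "i \<le> p" for i
        by (intro continuous_intros cP that)
      fix z :: "real \<times> (nat \<Rightarrow> real)" assume z: "z \<in> {0..1} \<times> S"
      then have "\<exists>i\<le>p. ?H2 z i \<noteq> 0" by (intro ne) (auto simp: S_def)
      then show "(\<Sum>i\<le>p. (?H2 z i)\<^sup>2) > 0" by (rule sq_pos)
    qed
    then have 2: "Brouwer_degree2 p (\<lambda>x. N (P (\<lambda>j. 0))) = Brouwer_degree2 p (\<lambda>x. N (P (\<lambda>j. R * x j)))"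
      using Brouwer_degree2_homotopic by fastforce
    \<comment> \<open>\<open>N\<close> is the identity on the unit sphere, so one end has degree 1;
      the other end is a constant map, of degree 0.\<close>
    have "Brouwer_degree2 p (\<lambda>x. N x) = Brouwer_degree2 p id"
      by (rule Brouwer_degree2_eq) (auto simp: nsphere N_def fun_eq_iff)
    with 1 2 show False by (simp add: Brouwer_degree2_const)
  qed
qed

section \<open>Finite-dimensional spaces in coordinates\<close>

lemma linear_on_set_sum:
  fixes n :: nat
  assumes f: "linear_on_set Z f" and Z: "subspace Z" and e: "\<forall>i<n. e i \<in> Z"
  shows "f (\<Sum>i<n. x i *\<^sub>R e i) = (\<Sum>i<n. x i * f (e i))"
  using e
proof (induction n)
  case 0
  have "f (0 *\<^sub>R 0 + 0 *\<^sub>R 0) = 0 * f 0 + 0 * f 0" using f subspace_0[OF Z] unfolding linear_on_set_def by blast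
  then show ?case by simp
next
  case (Suc n)
  have "(\<Sum>i<n. x i *\<^sub>R e i) \<in> Z" using Suc.prems by (intro subspace_sum[OF Z] subspace_scale[OF Z]) auto
  then have "f (1 *\<^sub>R (\<Sum>i<n. x i *\<^sub>R e i) + x n *\<^sub>R e n) = 1 * f (\<Sum>i<n. x i *\<^sub>R e i) + x n * f (e n)"
    using f Suc.prems[rule_format, of n] unfolding linear_on_set_def by blast
  then show ?case using Suc by simp
qed

lemma seminorm_on_zero: "seminorm_on Z q \<Longrightarrow> subspace Z \<Longrightarrow> q 0 = 0"
  unfolding seminorm_on_def using subspace_0[of Z] by (metis abs_zero mult_zero_left scaleR_zero_left)

lemma seminorm_on_nonneg:
  assumes q: "seminorm_on Z q" and Z: "subspace Z" and u: "u \<in> Z"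
  shows "0 \<le> q u"
proof -
  have "q (u + (-1) *\<^sub>R u) \<le> q u + q ((-1) *\<^sub>R u)" using q u subspace_scale[OF Z u] unfolding seminorm_on_def by blast
  moreover have "q ((-1) *\<^sub>R u) = \<bar>-1\<bar> * q u" using q u unfolding seminorm_on_def by blast
  ultimately show ?thesis using seminorm_on_zero[OF q Z] by simp
qed

lemma seminorm_on_sum_le:
  fixes n :: nat
  assumes q: "seminorm_on Z q" and Z: "subspace Z" and e: "\<forall>i<n. e i \<in> Z"
  shows "q (\<Sum>i<n. x i *\<^sub>R e i) \<le> (\<Sum>i<n. \<bar>x i\<bar> * q (e i))"
  using e
proof (induction n)
  case 0 then show ?case using seminorm_on_zero[OF q Z] by simp
next
  case (Suc n)
  have "(\<Sum>i<n. x i *\<^sub>R e i) \<in> Z" using Suc.prems by (intro subspace_sum[OF Z] subspace_scale[OF Z]) auto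
  then have "q ((\<Sum>i<n. x i *\<^sub>R e i) + x n *\<^sub>R e n) \<le> q (\<Sum>i<n. x i *\<^sub>R e i) + q (x n *\<^sub>R e n)"
    using q subspace_scale[OF Z Suc.prems[rule_format, of n], of "x n"] unfolding seminorm_on_def by blast
  moreover have "q (x n *\<^sub>R e n) = \<bar>x n\<bar> * q (e n)" using q Suc.prems[rule_format, of n] unfolding seminorm_on_def by blast
  ultimately show ?case using Suc by force
qed

text \<open>The basis is indexed by an initial segment of the naturals to match the real sequences
  on which the degree argument works.\<close>

lemma finite_span_basis_nat:
  assumes "finite B" "Z = span B"
  obtains n :: nat and e where "\<forall>i<n. e i \<in> Z" "\<forall>u\<in>Z. \<exists>x. u = (\<Sum>i<n. x i *\<^sub>R e i)"
    "\<forall>x. (\<Sum>i<n. x i *\<^sub>R e i) = 0 \<longrightarrow> (\<forall>i<n. x i = 0)"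
proof -
  obtain C where C: "C \<subseteq> B" "independent C" "B \<subseteq> span C"
    using maximal_independent_subset[of B] by blast
  have fC: "finite C" using C(1) assms(1) finite_subset by blast
  have ZC: "Z = span C" unfolding assms(2) using C span_mono[of C B] span_minimal[of B "span C"] by auto
  obtain e where e: "bij_betw e {0..<card C} C" using ex_bij_betw_nat_finite[OF fC] by blast
  have re: "(\<Sum>i<card C. f (e i)) = (\<Sum>v\<in>C. f v)" for f :: "'a \<Rightarrow> 'a"
    using sum.reindex_bij_betw[OF e, of f] by (simp add: atLeast0LessThan)
  have inv: "the_inv_into {0..<card C} e (e i) = i" if "i < card C" for i
    using e that by (simp add: bij_betw_def the_inv_into_f_f)
  have 1: "e i \<in> Z" if "i < card C" for i
      using e that ZC span_superset[of C] by (auto simp: bij_betw_def)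
  have 2: "\<exists>x. u = (\<Sum>i<card C. x i *\<^sub>R e i)" if uZ: "u \<in> Z" for u
    proof -
      obtain g where "u = (\<Sum>v\<in>C. g v *\<^sub>R v)" using uZ span_finite[OF fC] ZC by auto
      then have "u = (\<Sum>i<card C. g (e i) *\<^sub>R e i)" using re[of "\<lambda>v. g v *\<^sub>R v"] by simp
      then show ?thesis by (intro exI[of _ "\<lambda>i. g (e i)"])
    qed
  have 3: "x i = 0" if "(\<Sum>i<card C. x i *\<^sub>R e i) = 0" "i < card C" for x i
    proof -
      let ?g = "\<lambda>v. x (the_inv_into {0..<card C} e v)"
      have "(\<Sum>v\<in>C. ?g v *\<^sub>R v) = (\<Sum>i<card C. ?g (e i) *\<^sub>R e i)" using re[of "\<lambda>v. ?g v *\<^sub>R v"] by simp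
      also have "\<dots> = 0" using that(1) inv by simp
      finally have "(\<Sum>v\<in>C. ?g v *\<^sub>R v) = 0" .
      moreover have "e i \<in> C" using e that(2) by (auto simp: bij_betw_def)
      ultimately have "?g (e i) = 0" by (rule independentD[OF C(2) fC order_refl])
      then show ?thesis using inv that(2) by simp
    qed
  show thesis by (rule that[of "card C" e]) (use 1 2 3 in blast)+
qed

text \<open>Tychonoff for intervals in the first \<open>n\<close> factors and the singleton of zero
  in all others.\<close>

lemma compact_coordinate_box: "compact {x :: nat \<Rightarrow> real. (\<forall>i<n. \<bar>x i\<bar> \<le> 1) \<and> (\<forall>i\<ge>n. x i = 0)}"
proof -
  define K where "K i = (if i < n then {-1..1} else {0::real})" for i
  have "compactin (product_topology (\<lambda>i::nat. euclidean :: real topology) UNIV) (PiE UNIV K)"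
    by (simp add: compactin_PiE K_def)
  then have "compact (PiE UNIV K)" by (simp add: euclidean_product_topology)
  moreover have "PiE UNIV K = {x. (\<forall>i<n. \<bar>x i\<bar> \<le> 1) \<and> (\<forall>i\<ge>n. x i = 0)}"
    by (force simp: PiE_def Pi_def K_def extensional_def abs_le_iff split: if_splits)
  ultimately show ?thesis by simp
qed

text \<open>As a function of the coordinates, \<open>p\<close> is continuous and attains a minimum
  on the compact unit sphere of the maximum norm; independence and definiteness make it positive,
  and homogeneity extends the bound to all coordinates.\<close>

lemma coordinates_bounded_by_norm:
  fixes e :: "nat \<Rightarrow> 'z::real_vector"
  assumes Z: "subspace Z" and e: "\<forall>i<n. e i \<in> Z"
    and ind: "\<forall>x. (\<Sum>i<n. x i *\<^sub>R e i) = 0 \<longrightarrow> (\<forall>i<n. x i = 0)"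
    and p: "seminorm_on Z p" "\<forall>u\<in>Z. p u = 0 \<longrightarrow> u = 0"
  obtains m where "m > 0" "\<forall>x. \<forall>i<n. m * \<bar>x i\<bar> \<le> p (\<Sum>i<n. x i *\<^sub>R e i)"
proof (cases "n = 0")
  case True then show thesis using that[of 1] by simp
next
  case False
  define comb where "comb x = (\<Sum>i<n. x i *\<^sub>R e i)" for x
  have combZ: "comb x \<in> Z" for x unfolding comb_def by (intro subspace_sum[OF Z] subspace_scale[OF Z]) (use e in auto)
  \<comment> \<open>The unit sphere of the maximum norm: the compact box cut with the closed set
    where some coordinate has modulus 1.\<close>
  define S where "S = {x. (\<forall>i<n. \<bar>x i\<bar> \<le> 1) \<and> (\<forall>i\<ge>n. x i = 0)} \<inter> (\<Union>i<n. {x :: nat \<Rightarrow> real. \<bar>x i\<bar> = 1})"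
  have "closed (\<Union>i<n. {x :: nat \<Rightarrow> real. \<bar>x i\<bar> = 1})"
  proof (intro closed_UN ballI)
    fix i
    have "continuous_on UNIV (\<lambda>x::nat \<Rightarrow> real. \<bar>x i\<bar>)" by (intro continuous_intros continuous_on_product_coordinates)
    then show "closed {x :: nat \<Rightarrow> real. \<bar>x i\<bar> = 1}" by (rule closed_Collect_eq[OF _ continuous_on_const])
  qed simp
  then have cS: "compact S" unfolding S_def by (intro compact_Int_closed compact_coordinate_box)
  have "(\<lambda>i. if i = 0 then 1 else 0) \<in> S" using False by (auto simp: S_def intro!: bexI[of _ 0])
  then have neS: "S \<noteq> {}" by blast
  \<comment> \<open>A Lipschitz bound in the coordinates, from which continuity in the product
    topology follows.\<close>
  have diffp: "\<bar>p (comb x) - p (comb y)\<bar> \<le> (\<Sum>i<n. \<bar>x i - y i\<bar> * p (e i))" for x y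
  proof -
    have *: "p (comb x) \<le> p (comb y) + (\<Sum>i<n. \<bar>x i - y i\<bar> * p (e i))" for x y
    proof -
      have "comb x = comb y + comb (\<lambda>i. x i - y i)" by (simp add: comb_def sum_subtractf scaleR_diff_left)
      moreover have "p (comb y + comb (\<lambda>i. x i - y i)) \<le> p (comb y) + p (comb (\<lambda>i. x i - y i))"
        using p(1) combZ[of y] combZ[of "\<lambda>i. x i - y i"] unfolding seminorm_on_def by blast
      ultimately have "p (comb x) \<le> p (comb y) + p (comb (\<lambda>i. x i - y i))" by simp
      also have "p (comb (\<lambda>i. x i - y i)) \<le> (\<Sum>i<n. \<bar>x i - y i\<bar> * p (e i))"
        unfolding comb_def by (rule seminorm_on_sum_le[OF p(1) Z e])
      finally show ?thesis by simp
    qed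
    show ?thesis using *[of x y] *[of y x] by (simp add: abs_le_iff abs_minus_commute)
  qed
  have contp: "continuous_on S (\<lambda>x. p (comb x))"
    unfolding continuous_on_def
  proof (intro ballI)
    fix x
    have "((\<lambda>y. \<Sum>i<n. \<bar>y i - x i\<bar> * p (e i)) \<longlongrightarrow> (\<Sum>i<n. \<bar>x i - x i\<bar> * p (e i))) (at x within S)"
    proof -
      have "continuous_on UNIV (\<lambda>y::nat\<Rightarrow>real. \<Sum>i<n. \<bar>y i - x i\<bar> * p (e i))"
        by (intro continuous_intros continuous_on_product_coordinates)
      then have "isCont (\<lambda>y::nat\<Rightarrow>real. \<Sum>i<n. \<bar>y i - x i\<bar> * p (e i)) x"
        by (simp add: continuous_on_eq_continuous_at)
      from continuous_at_imp_continuous_at_within[OF this, of S] show ?thesis unfolding continuous_within .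
    qed
    then have "((\<lambda>y. \<Sum>i<n. \<bar>y i - x i\<bar> * p (e i)) \<longlongrightarrow> 0) (at x within S)" by simp
    then show "((\<lambda>y. p (comb y)) \<longlongrightarrow> p (comb x)) (at x within S)"
    proof (rule LIM_zero_cancel[OF Lim_null_comparison, rotated])
      show "\<forall>\<^sub>F y in at x within S. norm (p (comb y) - p (comb x)) \<le> (\<Sum>i<n. \<bar>y i - x i\<bar> * p (e i))"
        using diffp by (intro always_eventually) simp
    qed
  qed
  from continuous_attains_inf[OF cS neS contp]
  obtain x0 where x0': "x0 \<in> S" "\<forall>x\<in>S. p (comb x0) \<le> p (comb x)" by (rule bexE)
  note x0 = x0'[rule_format]
  have m0: "p (comb x0) > 0"
  proof -
    obtain i where i: "i < n" "\<bar>x0 i\<bar> = 1" using x0(1) by (auto simp: S_def)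
    then have "x0 i \<noteq> 0" by auto
    then have "comb x0 \<noteq> 0" using ind i(1) unfolding comb_def by blast
    then have "p (comb x0) \<noteq> 0" using p(2) combZ by blast
    then show ?thesis using seminorm_on_nonneg[OF p(1) Z combZ, of x0] by linarith
  qed
  show thesis
  proof (rule that[OF m0], intro allI impI)
    fix x :: "nat \<Rightarrow> real" and i assume i: "i < n"
    \<comment> \<open>Scaling by the largest modulus reduces to the unit sphere.\<close>
    define M where "M = Max ((\<lambda>i. \<bar>x i\<bar>) ` {..<n})"
    have Mle: "\<bar>x j\<bar> \<le> M" if "j < n" for j unfolding M_def using that by (intro Max_ge) auto
    have "M \<in> (\<lambda>i. \<bar>x i\<bar>) ` {..<n}" unfolding M_def using False by (intro Max_in) auto
    then obtain k where k: "k < n" "M = \<bar>x k\<bar>" by auto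
    show "p (comb x0) * \<bar>x i\<bar> \<le> p (\<Sum>i<n. x i *\<^sub>R e i)"
    proof (cases "M = 0")
      case True
      then have "x i = 0" using Mle[OF i] by simp
      then show ?thesis using seminorm_on_nonneg[OF p(1) Z combZ, of x] by (simp add: comb_def)
    next
      case False
      then have Mp: "M > 0" using k by simp
      define y where "y j = (if j < n then x j / M else 0)" for j
      have "y \<in> S" using Mle Mp k False by (auto simp: S_def y_def intro!: bexI[of _ k])
      have "comb x = M *\<^sub>R comb y" using Mp by (simp add: comb_def y_def scaleR_sum_right)
      then have "p (comb x) = M * p (comb y)" using p(1) combZ[of y] Mp unfolding seminorm_on_def by simp
      also have "\<dots> \<ge> M * p (comb x0)" using x0(2)[OF \<open>y \<in> S\<close>] Mp by simp
      finally have "M * p (comb x0) \<le> p (comb x)" .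
      moreover have "p (comb x0) * \<bar>x i\<bar> \<le> M * p (comb x0)" using Mle[OF i] m0 by simp
      ultimately show ?thesis by (simp add: comb_def)
    qed
  qed
qed

text \<open>Comparison with a norm in finite dimension, by way of coordinates. It guarantees that
  the suprema defining the constants of a discretisation are finite.\<close>

lemma finite_dim_seminorm_le_norm:
  assumes B: "finite B" "Z = span B"
    and p: "seminorm_on Z p" "\<forall>u\<in>Z. p u = 0 \<longrightarrow> u = 0" and q: "seminorm_on Z q"
  obtains C where "C \<ge> 0" "\<forall>u\<in>Z. q u \<le> C * p u"
proof -
  have Z: "subspace Z" using B(2) by simp
  obtain n :: nat and e where e: "\<forall>i<n. e i \<in> Z" and rep: "\<forall>u\<in>Z. \<exists>x. u = (\<Sum>i<n. x i *\<^sub>R e i)"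
    and ind: "\<forall>x. (\<Sum>i<n. x i *\<^sub>R e i) = 0 \<longrightarrow> (\<forall>i<n. x i = 0)"
    by (rule finite_span_basis_nat[OF B])
  note e' = e[rule_format]
  obtain m where m0: "m > 0" "\<forall>x. \<forall>i<n. m * \<bar>x i\<bar> \<le> p (\<Sum>i<n. x i *\<^sub>R e i)"
    by (rule coordinates_bounded_by_norm[OF Z e ind p])
  note m = m0(1) m0(2)[rule_format]
  have qe: "0 \<le> q (e i)" if "i < n" for i using seminorm_on_nonneg[OF q Z e'[OF that]] .
  show thesis
  proof (rule that[of "(\<Sum>i<n. q (e i)) / m"], goal_cases)
    case 1 show "0 \<le> (\<Sum>i<n. q (e i)) / m" using m(1) qe by (intro divide_nonneg_pos sum_nonneg) auto
  next
    case 2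
    show ?case
    proof
    fix u assume "u \<in> Z"
    with rep obtain x where u: "u = (\<Sum>i<n. x i *\<^sub>R e i)" by (elim ballE[where x=u] exE) auto
    have "q u \<le> (\<Sum>i<n. \<bar>x i\<bar> * q (e i))" unfolding u by (rule seminorm_on_sum_le[OF q Z e])
    also have "\<dots> \<le> (\<Sum>i<n. (p u / m) * q (e i))"
    proof (intro sum_mono mult_right_mono)
      fix i assume "i \<in> {..<n}"
      then show "\<bar>x i\<bar> \<le> p u / m" using m(1) m(2)[of i x] by (simp add: u field_simps)
    qed (use qe in auto)
    also have "\<dots> = (\<Sum>i<n. q (e i)) / m * p u" by (simp add: sum_distrib_left sum_divide_distrib mult.commute)
    finally show "q u \<le> (\<Sum>i<n. q (e i)) / m * p u" .
    qed
  qed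
qed

section \<open>Solvability of Galerkin equations\<close>

text \<open>In coordinates the equation asks for a zero of the residual \<open>P\<close>. Its
  pairing with the coordinate vector of \<open>u\<close> is \<open>a u u + b u u u - l u\<close>;
  the middle term vanishes, so coercivity makes the pairing positive as soon as \<open>p u\<close>
  exceeds \<open>K / \<alpha>\<close>.\<close>

lemma galerkin_solution_exists:
  fixes a :: "'z::real_vector \<Rightarrow> 'z \<Rightarrow> real" and b :: "'z \<Rightarrow> 'z \<Rightarrow> 'z \<Rightarrow> real"
  assumes B: "finite B" "Z = span B"
    and p: "seminorm_on Z p" "\<forall>u\<in>Z. p u = 0 \<longrightarrow> u = 0"
    and a: "\<And>v. v \<in> Z \<Longrightarrow> linear_on_set Z (\<lambda>u. a u v)" "\<And>u. u \<in> Z \<Longrightarrow> linear_on_set Z (a u)"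
    and b: "\<And>v w. v \<in> Z \<Longrightarrow> w \<in> Z \<Longrightarrow> linear_on_set Z (\<lambda>u. b u v w)"
      "\<And>u w. u \<in> Z \<Longrightarrow> w \<in> Z \<Longrightarrow> linear_on_set Z (\<lambda>v. b u v w)" "\<And>u v. u \<in> Z \<Longrightarrow> v \<in> Z \<Longrightarrow> linear_on_set Z (b u v)"
    and skew: "\<And>u v. u \<in> Z \<Longrightarrow> v \<in> Z \<Longrightarrow> b u v v = 0"
    and l: "linear_on_set Z l" and coer: "\<alpha> > 0" "\<And>u. u \<in> Z \<Longrightarrow> \<alpha> * (p u)\<^sup>2 \<le> a u u"
  shows "\<exists>u\<in>Z. \<forall>v\<in>Z. a u v + b u u v = l v"
proof -
  have Z: "subspace Z" using B(2) by simp
  obtain n :: nat and e where e: "\<forall>i<n. e i \<in> Z" and rep: "\<forall>u\<in>Z. \<exists>x. u = (\<Sum>i<n. x i *\<^sub>R e i)"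
    and ind: "\<forall>x. (\<Sum>i<n. x i *\<^sub>R e i) = 0 \<longrightarrow> (\<forall>i<n. x i = 0)"
    by (rule finite_span_basis_nat[OF B])
  note e' = e[rule_format]
  define comb where "comb x = (\<Sum>i<n. x i *\<^sub>R e i)" for x
  have combZ: "comb x \<in> Z" for x unfolding comb_def by (intro subspace_sum[OF Z] subspace_scale[OF Z]) (use e in auto)
  note lin = linear_on_set_sum[OF _ Z e, folded comb_def]
  obtain m where m0: "m > 0" "\<forall>x. \<forall>i<n. m * \<bar>x i\<bar> \<le> p (\<Sum>i<n. x i *\<^sub>R e i)"
    by (rule coordinates_bounded_by_norm[OF Z e ind p])
  note m = m0(1) m0(2)[rule_format, folded comb_def]
  have "seminorm_on Z (\<lambda>u. \<bar>l u\<bar>)"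
    unfolding seminorm_on_def
  proof (intro conjI ballI allI)
    fix u v assume uv: "u \<in> Z" "v \<in> Z"
    then have "l (1 *\<^sub>R u + 1 *\<^sub>R v) = 1 * l u + 1 * l v" using l unfolding linear_on_set_def by blast
    then show "\<bar>l (u + v)\<bar> \<le> \<bar>l u\<bar> + \<bar>l v\<bar>" by simp
    fix t
    have "l (t *\<^sub>R u + 0 *\<^sub>R v) = t * l u + 0 * l v" using l uv unfolding linear_on_set_def by blast
    then show "\<bar>l (t *\<^sub>R u)\<bar> = \<bar>t\<bar> * \<bar>l u\<bar>" by (simp add: abs_mult)
  qed
  then obtain K where K': "K \<ge> 0" "\<forall>u\<in>Z. \<bar>l u\<bar> \<le> K * p u"
    by (rule finite_dim_seminorm_le_norm[OF B p])
  note K = K'[rule_format]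
  define P where "P x j = a (comb x) (e j) + b (comb x) (comb x) (e j) - l (e j)" for x j
  \<comment> \<open>An upper bound for the square root of \<open>n\<close> that is positive even for
    \<open>n = 0\<close>.\<close>
  define c where "c = real n + 1"
  have c: "c > 0" "real n \<le> c\<^sup>2" by (auto simp: c_def power2_eq_square algebra_simps)
  \<comment> \<open>Each coordinate of \<open>u\<close> is at most \<open>p u / m\<close>, so a
    coordinate vector of length \<open>R\<close> forces \<open>p u \<ge> R * m / c\<close>, and this
    choice makes the right side \<open>K / \<alpha> + 1\<close>.\<close>
  define R where "R = (K / \<alpha> + 1) * (c / m)"
  have Rpos: "R > 0" using K(1) coer(1) m(1) c(1) by (auto simp: R_def intro!: divide_pos_pos mult_pos_pos add_nonneg_pos)
  have "\<exists>x. (\<forall>i\<ge>n. x i = 0) \<and> (\<forall>i<n. P x i = 0)"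
  proof (rule outward_field_zero_nat[OF _ Rpos])
    fix j assume j: "j < n"
    \<comment> \<open>Expanded in the basis, the residual is a polynomial in finitely many
      coordinates.\<close>
    have "P x j = (\<Sum>i<n. x i * a (e i) (e j)) + (\<Sum>i<n. x i * (\<Sum>k<n. x k * b (e i) (e k) (e j))) - l (e j)" for x
    proof -
      have "a (comb x) (e j) = (\<Sum>i<n. x i * a (e i) (e j))" by (rule lin[OF a(1)[OF e'[OF j]]])
      moreover have "b (comb x) (comb x) (e j) = (\<Sum>i<n. x i * b (e i) (comb x) (e j))" by (rule lin[OF b(1)[OF combZ e'[OF j]]])
      moreover have "b (e i) (comb x) (e j) = (\<Sum>k<n. x k * b (e i) (e k) (e j))" if "i < n" for i
        by (rule lin[OF b(2)[OF e'[OF that] e'[OF j]]])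
      ultimately show ?thesis by (simp add: P_def)
    qed
    then show "continuous_on UNIV (\<lambda>x. P x j)"
      by (simp only:) (intro continuous_intros continuous_on_product_coordinates)
  next
    fix x assume x: "\<forall>i\<ge>n. x i = 0" "(\<Sum>i<n. (x i)\<^sup>2) = R\<^sup>2"
    have "(\<Sum>i<n. P x i * x i) = (\<Sum>i<n. x i * a (comb x) (e i)) + (\<Sum>i<n. x i * b (comb x) (comb x) (e i)) - (\<Sum>i<n. x i * l (e i))"
      by (simp add: P_def algebra_simps sum.distrib sum_subtractf)
    also have "\<dots> = a (comb x) (comb x) + b (comb x) (comb x) (comb x) - l (comb x)"
      by (simp only: lin[OF a(2)[OF combZ]] lin[OF b(3)[OF combZ combZ]] lin[OF l])
    also have "\<dots> \<ge> \<alpha> * (p (comb x))\<^sup>2 - K * p (comb x)"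
      using coer(2)[OF combZ, of x] K(2)[OF combZ, of x] skew[OF combZ combZ, of x x] by simp
    finally have "\<alpha> * (p (comb x))\<^sup>2 - K * p (comb x) \<le> (\<Sum>i<n. P x i * x i)" .
    moreover have "\<alpha> * (p (comb x))\<^sup>2 - K * p (comb x) > 0"
    proof -
      have p0: "0 \<le> p (comb x)" by (rule seminorm_on_nonneg[OF p(1) Z combZ])
      have "R\<^sup>2 \<le> (\<Sum>i<n. (p (comb x) / m)\<^sup>2)" unfolding x(2)[symmetric]
      proof (intro sum_mono)
        fix i assume "i \<in> {..<n}"
        then have "\<bar>x i\<bar> \<le> p (comb x) / m" using m(1) m(2)[of i x] by (simp add: field_simps)
        then show "(x i)\<^sup>2 \<le> (p (comb x) / m)\<^sup>2" by (metis abs_ge_zero power2_abs power_mono)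
      qed
      also have "\<dots> \<le> c\<^sup>2 * (p (comb x) / m)\<^sup>2" using c(2) by (simp add: mult_right_mono)
      also have "\<dots> = (p (comb x) * (c / m))\<^sup>2" by (simp add: power_mult_distrib power_divide)
      finally have "R \<le> p (comb x) * (c / m)" by (rule power2_le_imp_le) (use p0 m(1) c(1) in auto)
      then have "K / \<alpha> + 1 \<le> p (comb x)" using m(1) c(1) unfolding R_def by (subst (asm) mult_le_cancel_right_pos) auto
      then have "K / \<alpha> < p (comb x)" by simp
      then have "K < \<alpha> * p (comb x)" using coer(1) by (simp add: field_simps)
      moreover have "0 < p (comb x)" using \<open>K / \<alpha> < p (comb x)\<close> K(1) coer(1) by (meson divide_nonneg_pos le_less_trans)
      ultimately have "K * p (comb x) < \<alpha> * p (comb x) * p (comb x)" by simp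
      then show ?thesis by (simp add: power2_eq_square)
    qed
    ultimately show "(\<Sum>i<n. P x i * x i) > 0" by linarith
  qed
  then obtain x where x: "\<And>i. i < n \<Longrightarrow> P x i = 0" by blast
  have "a (comb x) v + b (comb x) (comb x) v = l v" if v: "v \<in> Z" for v
  proof -
    obtain y where y: "v = comb y" using bspec[OF rep v] unfolding comb_def by (rule exE)
    have "a (comb x) v + b (comb x) (comb x) v - l v = (\<Sum>i<n. y i * P x i)"
      unfolding y lin[OF a(2)[OF combZ]] lin[OF b(3)[OF combZ combZ]] lin[OF l]
      by (simp add: P_def algebra_simps sum.distrib sum_subtractf)
    also have "\<dots> = 0" using x by simp
    finally show ?thesis by simp
  qed
  then show ?thesis using combZ by blast
qed

text \<open>Copies of a spanning set in every slot span the tuples, so the space of tuples inherits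
  a finite spanning set.\<close>

lemma span_vec_eq:
  fixes B :: "'x::real_vector set"
  shows "{v :: 'x^'k. \<forall>c. v $ c \<in> span B} = span (\<Union>c. axis c ` B)"
proof (rule antisym)
  have lin: "linear (axis c :: 'x \<Rightarrow> 'x^'k)" for c
    by (rule linearI) (auto simp: vec_eq_iff axis_def)
  show "{v :: 'x^'k. \<forall>c. v $ c \<in> span B} \<subseteq> span (\<Union>c. axis c ` B)"
  proof clarify
    fix v :: "'x^'k" assume v: "\<forall>c. v $ c \<in> span B"
    have "axis c (v $ c) \<in> span (\<Union>c. axis c ` B)" for c
    proof -
      have "axis c (v $ c) \<in> span (axis c ` B)" using v by (simp add: linear_span_image[OF lin])
      also have "\<dots> \<subseteq> span (\<Union>c. axis c ` B)" by (intro span_mono) auto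
      finally show ?thesis .
    qed
    then have "(\<Sum>c\<in>UNIV. axis c (v $ c)) \<in> span (\<Union>c. axis c ` B)" by (intro span_sum)
    moreover have "(\<Sum>c\<in>UNIV. axis c (v $ c)) = v" by (simp add: vec_eq_iff axis_def)
    ultimately show "v \<in> span (\<Union>c. axis c ` B)" by simp
  qed
  show "span (\<Union>c. axis c ` B) \<subseteq> {v :: 'x^'k. \<forall>c. v $ c \<in> span B}"
  proof (rule span_minimal)
    show "subspace {v :: 'x^'k. \<forall>c. v $ c \<in> span B}"
      by (auto intro!: subspaceI span_zero span_add span_scale)
    show "(\<Union>c. axis c ` B) \<subseteq> {v :: 'x^'k. \<forall>c. v $ c \<in> span B}"
      by (auto simp: axis_def span_base span_zero)
  qed
qed

section \<open>Hessian discretisations\<close>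

text \<open>Norms ignore null sets, so linearity almost everywhere gives the seminorm laws
  exactly.\<close>

lemma ae_linear_seminorm:
  fixes T :: "'x::real_vector \<Rightarrow> real^'d \<Rightarrow> 'v::euclidean_space"
  assumes p: "p \<ge> 1" and m: "\<forall>w\<in>X. lp_mem p \<Omega> (T w)" and T: "ae_linear_on \<Omega> X T" and X: "subspace X"
  shows "seminorm_on X (\<lambda>w. lp_norm p \<Omega> (T w))"
  unfolding seminorm_on_def
proof (intro conjI ballI allI)
  have lin: "lp_norm p \<Omega> (T (a *\<^sub>R u + b *\<^sub>R v)) = lp_norm p \<Omega> (\<lambda>x. a *\<^sub>R T u x + b *\<^sub>R T v x)"
    if "u \<in> X" "v \<in> X" for u v a b
  proof (rule lp_norm_cong_AE)
    show "AE x in lebesgue_on \<Omega>. T (a *\<^sub>R u + b *\<^sub>R v) x = a *\<^sub>R T u x + b *\<^sub>R T v x"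
      using T that unfolding ae_linear_on_def by blast
    have "a *\<^sub>R u + b *\<^sub>R v \<in> X" using that X by (simp add: subspace_add subspace_scale)
    then show "T (a *\<^sub>R u + b *\<^sub>R v) \<in> borel_measurable (lebesgue_on \<Omega>)" using m by (auto dest: lp_memD)
    have [measurable]: "T u \<in> borel_measurable (lebesgue_on \<Omega>)" "T v \<in> borel_measurable (lebesgue_on \<Omega>)"
      using m that by (auto dest: lp_memD)
    show "(\<lambda>x. a *\<^sub>R T u x + b *\<^sub>R T v x) \<in> borel_measurable (lebesgue_on \<Omega>)" by measurable
  qed
  fix u assume u: "u \<in> X"
  show "lp_norm p \<Omega> (T (u + v)) \<le> lp_norm p \<Omega> (T u) + lp_norm p \<Omega> (T v)" if v: "v \<in> X" for v
    using lin[OF u v, of 1 1] lp_norm_triangle[OF p, of \<Omega> "T u" "T v"] m u v by simp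
  show "lp_norm p \<Omega> (T (t *\<^sub>R u)) = \<bar>t\<bar> * lp_norm p \<Omega> (T u)" for t
    using lin[OF u u, of t 0] lp_norm_scaleR[of p \<Omega> t "T u"] p by simp
qed

text \<open>\<open>f\<close> acts on representatives. Its bound makes it vanish on the difference
  between the image of a combination and the combination of the images, which has norm zero; thus
  almost-everywhere linearity becomes exact.\<close>

lemma ae_linear_compose:
  fixes T :: "'x::real_vector \<Rightarrow> real^'d \<Rightarrow> 'v::euclidean_space"
  assumes p: "p \<ge> 1" and m: "\<forall>w\<in>X. lp_mem p \<Omega> (T w)" and T: "ae_linear_on \<Omega> X T" and X: "subspace X"
    and f: "\<And>g h a b. lp_mem p \<Omega> g \<Longrightarrow> lp_mem p \<Omega> h \<Longrightarrow> f (\<lambda>x. a *\<^sub>R g x + b *\<^sub>R h x) = a * f g + b * (f h :: real)"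
    and bd: "\<And>g. lp_mem p \<Omega> g \<Longrightarrow> \<bar>f g\<bar> \<le> C * lp_norm p \<Omega> g"
  shows "linear_on_set X (\<lambda>u. f (T u))"
  unfolding linear_on_set_def
proof (intro ballI allI)
  fix u v s t assume u: "u \<in> X" and v: "v \<in> X"
  have w: "s *\<^sub>R u + t *\<^sub>R v \<in> X" using u v X by (simp add: subspace_add subspace_scale)
  let ?g = "T (s *\<^sub>R u + t *\<^sub>R v)" and ?h = "\<lambda>x. s *\<^sub>R T u x + t *\<^sub>R T v x"
  have gm: "lp_mem p \<Omega> ?g" using m w by blast
  have hm: "lp_mem p \<Omega> ?h" using m u v p by (intro lp_mem_add lp_mem_scaleR) auto
  have "lp_norm p \<Omega> (\<lambda>x. ?g x - ?h x) = 0"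
    using T u v unfolding lp_norm_diff_eq_0_AE[OF p gm hm] ae_linear_on_def by blast
  then have "f (\<lambda>x. ?g x - ?h x) = 0" using bd[OF lp_mem_diff[OF p gm hm]] by simp
  moreover have "(\<lambda>x. 1 *\<^sub>R g x + (-1) *\<^sub>R h x) = (\<lambda>x. g x - h x)" for g h :: "real^'d \<Rightarrow> 'v" by simp
  ultimately have "f ?g = f ?h" using f[OF gm hm, of 1 "-1"] by (simp only:)
  then show "f ?g = s * f (T u) + t * f (T v)" using f[of "T u" "T v" s t] m u v by simp
qed

abbreviation vec_space :: "'x set \<Rightarrow> ('x^'k::finite) set" where
  "vec_space X \<equiv> {v. \<forall>c. v $ c \<in> X}"

lemma subspace_vec_space: "subspace X \<Longrightarrow> subspace (vec_space X)"
  by (auto intro!: subspaceI simp: subspace_0 subspace_add subspace_scale)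

lemma ae_linear_vec:
  fixes X :: "'x::real_vector set" and T :: "'x \<Rightarrow> real^'d \<Rightarrow> 'v::real_vector"
  assumes "ae_linear_on \<Omega> X T"
  shows "ae_linear_on \<Omega> (vec_space X :: ('x^'k) set) (\<lambda>u x. \<chi> c. T (u $ c) x)"
  unfolding ae_linear_on_def
proof (intro ballI allI)
  fix u v :: "'x^'k" and a b assume "u \<in> vec_space X" "v \<in> vec_space X"
  then have "\<And>c. AE x in lebesgue_on \<Omega>. T (a *\<^sub>R u $ c + b *\<^sub>R v $ c) x = a *\<^sub>R T (u $ c) x + b *\<^sub>R T (v $ c) x"
    using assms unfolding ae_linear_on_def by blast
  then have "AE x in lebesgue_on \<Omega>. \<forall>c. T (a *\<^sub>R u $ c + b *\<^sub>R v $ c) x = a *\<^sub>R T (u $ c) x + b *\<^sub>R T (v $ c) x"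
    by (intro AE_all_countable[THEN iffD2]) auto
  then show "AE x in lebesgue_on \<Omega>. (\<chi> c. T ((a *\<^sub>R u + b *\<^sub>R v) $ c) x) = a *\<^sub>R (\<chi> c. T (u $ c) x) + b *\<^sub>R (\<chi> c. T (v $ c) x)"
    by eventually_elim (simp add: vec_eq_iff)
qed

section \<open>Constants of a single discretisation\<close>

text \<open>The inserted 0 keeps the supremum meaningful on the trivial space and nonnegative in
  general; the common bound \<open>C\<close> makes it a true upper bound.\<close>

lemma le_Sup_insert_0:
  fixes S :: "real set"
  assumes "\<And>r. r \<in> S \<Longrightarrow> r \<le> C"
  shows "0 \<le> Sup (insert 0 S)" "r \<in> S \<Longrightarrow> r \<le> Sup (insert 0 S)"
proof -
  have "bdd_above (insert 0 S)" using assms by (intro bdd_aboveI[of _ "max 0 C"]) (auto simp: le_max_iff_disj)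
  then show "0 \<le> Sup (insert 0 S)" "r \<in> S \<Longrightarrow> r \<le> Sup (insert 0 S)"
    by (auto intro: cSup_upper)
qed

locale hessian_disc =
  fixes \<Omega> :: "(real^'d::finite) set" and X :: "'x::real_vector set"
    and PiD :: "'x \<Rightarrow> real^'d \<Rightarrow> real" and Gr :: "'x \<Rightarrow> real^'d \<Rightarrow> real^'d" and Hs :: "'x \<Rightarrow> real^'d \<Rightarrow> real^'d^'d"
  assumes om: "\<Omega> \<in> sets lebesgue" "emeasure lebesgue \<Omega> < \<infinity>"
    and hd: "is_HD \<Omega> X PiD Gr Hs"
begin

abbreviation nD :: "'x \<Rightarrow> real" where "nD w \<equiv> lp_norm 2 \<Omega> (Hs w)"

lemma subspace_X: "subspace X" and spanned: "\<exists>B. finite B \<and> X = span B"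
  and mem: "w \<in> X \<Longrightarrow> lp_mem 2 \<Omega> (PiD w)" "w \<in> X \<Longrightarrow> lp_mem 4 \<Omega> (Gr w)" "w \<in> X \<Longrightarrow> lp_mem 2 \<Omega> (Hs w)"
  and lin: "ae_linear_on \<Omega> X PiD" "ae_linear_on \<Omega> X Gr" "ae_linear_on \<Omega> X Hs"
  and definite: "\<forall>w\<in>X. nD w = 0 \<longrightarrow> w = 0"
  using hd by (auto simp: is_HD_def)

lemma mem_Gr_2: "w \<in> X \<Longrightarrow> lp_mem 2 \<Omega> (Gr w)"
  using lp_4_imp_2(1)[OF mem(2) om] .

lemma nD_pos: "w \<in> X \<Longrightarrow> w \<noteq> 0 \<Longrightarrow> nD w > 0"
  using definite lp_norm_nonneg[of 2 \<Omega> "Hs w"] by (auto simp: order_less_le)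

lemma seminorms: "seminorm_on X nD" "seminorm_on X (\<lambda>w. lp_norm 2 \<Omega> (PiD w))" "seminorm_on X (\<lambda>w. lp_norm 4 \<Omega> (Gr w))"
    "seminorm_on X (\<lambda>w. lp_norm 2 \<Omega> (Gr w))"
  using mem mem_Gr_2 lin subspace_X by (auto intro!: ae_linear_seminorm)

lemma seminorm_bounded:
  assumes "seminorm_on X q"
  obtains C where "C \<ge> 0" "\<forall>w\<in>X. q w \<le> C * nD w"
proof -
  obtain B where "finite B" "X = span B" using spanned by blast
  from finite_dim_seminorm_le_norm[OF this seminorms(1) definite assms] that show thesis by blast
qed

lemma zero_norms: "q 0 = 0" if "seminorm_on X q"
  using seminorm_on_zero[OF that subspace_X] .

text \<open>The ratios are bounded because \<open>X\<close> is finite-dimensional and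
  \<open>nD\<close> is a norm on it, so the supremum can be used as a constant. The zero vector has
  no ratio and is treated by \<open>zero_norms\<close>.\<close>

lemma
  shows C_HD_nonneg: "0 \<le> C_HD \<Omega> X PiD Gr Hs"
    and PiD_le: "w \<in> X \<Longrightarrow> lp_norm 2 \<Omega> (PiD w) \<le> C_HD \<Omega> X PiD Gr Hs * nD w"
    and Gr_le: "w \<in> X \<Longrightarrow> lp_norm 4 \<Omega> (Gr w) \<le> C_HD \<Omega> X PiD Gr Hs * nD w"
proof -
  obtain C1 where C1: "C1 \<ge> 0" "\<forall>w\<in>X. lp_norm 2 \<Omega> (PiD w) \<le> C1 * nD w" by (rule seminorm_bounded[OF seminorms(2)])
  obtain C2 where C2: "C2 \<ge> 0" "\<forall>w\<in>X. lp_norm 4 \<Omega> (Gr w) \<le> C2 * nD w" by (rule seminorm_bounded[OF seminorms(3)])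
  let ?S = "{max (lp_norm 2 \<Omega> (PiD w) / nD w) (lp_norm 4 \<Omega> (Gr w) / nD w) | w. w \<in> X \<and> w \<noteq> 0}"
  have S: "r \<le> max C1 C2" if rS: "r \<in> ?S" for r
  proof -
    obtain w where w: "w \<in> X" "w \<noteq> 0" "r = max (lp_norm 2 \<Omega> (PiD w) / nD w) (lp_norm 4 \<Omega> (Gr w) / nD w)" using rS by auto
    have "lp_norm 2 \<Omega> (PiD w) / nD w \<le> C1" "lp_norm 4 \<Omega> (Gr w) / nD w \<le> C2"
      using C1(2) C2(2) w nD_pos[OF w(1,2)] by (simp_all add: divide_le_eq)
    then show ?thesis unfolding w(3) by linarith
  qed
  show "0 \<le> C_HD \<Omega> X PiD Gr Hs" unfolding C_HD_def by (rule le_Sup_insert_0(1)[OF S])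
  have main: "max (lp_norm 2 \<Omega> (PiD w) / nD w) (lp_norm 4 \<Omega> (Gr w) / nD w) \<le> C_HD \<Omega> X PiD Gr Hs" if "w \<in> X" "w \<noteq> 0" for w
    unfolding C_HD_def by (rule le_Sup_insert_0(2)[OF S]) (use that in blast)+
  have m: "lp_norm 2 \<Omega> (PiD w) \<le> C_HD \<Omega> X PiD Gr Hs * nD w \<and> lp_norm 4 \<Omega> (Gr w) \<le> C_HD \<Omega> X PiD Gr Hs * nD w" if w: "w \<in> X" for w
  proof (cases "w = 0")
    case True then show ?thesis using zero_norms[OF seminorms(1)] zero_norms[OF seminorms(2)] zero_norms[OF seminorms(3)] by simp
  next
    case False
    then show ?thesis using main[OF w False] nD_pos[OF w False] by (simp add: divide_le_eq)
  qed
  show "w \<in> X \<Longrightarrow> lp_norm 2 \<Omega> (PiD w) \<le> C_HD \<Omega> X PiD Gr Hs * nD w" using m by blast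
  show "w \<in> X \<Longrightarrow> lp_norm 4 \<Omega> (Gr w) \<le> C_HD \<Omega> X PiD Gr Hs * nD w" using m by blast
qed

text \<open>Linearity of \<open>E\<close> carries over to gradients in norm, because functions that
  agree almost everywhere have gradients that differ by norm zero.\<close>

lemma companion_combo:
  assumes E: "is_companion \<Omega> X E" and u: "u \<in> X" "in_H10 \<Omega> (E u) G" and v: "v \<in> X" "in_H10 \<Omega> (E v) G'"
    and w: "in_H10 \<Omega> (E (a *\<^sub>R u + b *\<^sub>R v)) G''"
  shows "AE x in lebesgue_on \<Omega>. E (a *\<^sub>R u + b *\<^sub>R v) x = a * E u x + b * E v x"
    "in_H10 \<Omega> (\<lambda>x. a * E u x + b * E v x) (\<lambda>x. a *\<^sub>R G x + b *\<^sub>R G' x)"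
    "lp_norm 2 \<Omega> (\<lambda>x. G'' x - (a *\<^sub>R G x + b *\<^sub>R G' x)) = 0"
proof -
  show ae: "AE x in lebesgue_on \<Omega>. E (a *\<^sub>R u + b *\<^sub>R v) x = a * E u x + b * E v x"
  proof -
    have "AE x in lebesgue_on \<Omega>. E (a *\<^sub>R u + b *\<^sub>R v) x = a *\<^sub>R E u x + b *\<^sub>R E v x"
      using E u v unfolding is_companion_def ae_linear_on_def by blast
    then show ?thesis by simp
  qed
  \<comment> \<open>Scaling by \<open>a\<close> is written as adding \<open>a - 1\<close> times the
    same function, to fit \<open>in_H10_add_mult\<close>.\<close>
  have "in_H10 \<Omega> (\<lambda>x. E u x + (a - 1) * E u x) (\<lambda>x. G x + (a - 1) *\<^sub>R G x)"
    by (rule in_H10_add_mult[OF om u(2) u(2)])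
  then have "in_H10 \<Omega> (\<lambda>x. a * E u x) (\<lambda>x. a *\<^sub>R G x)" by (simp add: algebra_simps)
  from in_H10_add_mult[OF om this v(2), of b]
  show 2: "in_H10 \<Omega> (\<lambda>x. a * E u x + b * E v x) (\<lambda>x. a *\<^sub>R G x + b *\<^sub>R G' x)" .
  show "lp_norm 2 \<Omega> (\<lambda>x. G'' x - (a *\<^sub>R G x + b *\<^sub>R G' x)) = 0"
    by (rule in_H10_grad_unique[OF om w 2 ae])
qed

text \<open>The supremum runs over all gradients of companion functions. A selection
  \<open>g\<close> of gradients is linear almost everywhere by uniqueness, so the norm of
  \<open>Gr w - g w\<close> is a seminorm on a finite-dimensional space and is bounded by
  \<open>nD\<close>; any other gradient yields the same norm.\<close>

lemma
  assumes E: "is_companion \<Omega> X E"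
  shows omegaE_nonneg: "0 \<le> omegaE \<Omega> X Gr Hs E"
    and omegaE_le: "w \<in> X \<Longrightarrow> in_H20 \<Omega> (E w) G H \<Longrightarrow> lp_norm 2 \<Omega> (\<lambda>x. Gr w x - G x) \<le> omegaE \<Omega> X Gr Hs E * nD w"
proof -
  define g where "g w = (SOME G. \<exists>H. in_H20 \<Omega> (E w) G H)" for w
  have g: "in_H10 \<Omega> (E w) (g w)" if "w \<in> X" for w
  proof -
    have "\<exists>G H. in_H20 \<Omega> (E w) G H" using E that by (auto simp: is_companion_def)
    then have "\<exists>H. in_H20 \<Omega> (E w) (g w) H" unfolding g_def by (rule someI_ex)
    then show ?thesis using in_H20_imp_in_H10 by blast
  qed
  have gm: "lp_mem 2 \<Omega> (g w)" if "w \<in> X" for w using g[OF that] by (simp add: in_H10_def in_H1_def)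
  have glin: "ae_linear_on \<Omega> X g"
    unfolding ae_linear_on_def
  proof (intro ballI allI)
    fix u v a b assume u: "u \<in> X" and v: "v \<in> X"
    have w: "a *\<^sub>R u + b *\<^sub>R v \<in> X" using u v subspace_X by (simp add: subspace_add subspace_scale)
    have m: "lp_mem 2 \<Omega> (\<lambda>x. a *\<^sub>R g u x + b *\<^sub>R g v x)" using gm u v by (intro lp_mem_add lp_mem_scaleR) auto
    show "AE x in lebesgue_on \<Omega>. g (a *\<^sub>R u + b *\<^sub>R v) x = a *\<^sub>R g u x + b *\<^sub>R g v x"
      using companion_combo(3)[OF E u g[OF u] v g[OF v] g[OF w]] lp_norm_diff_eq_0_AE[OF _ gm[OF w] m] by simp
  qed
  define T where "T w x = Gr w x - g w x" for w x
  have Tm: "\<forall>w\<in>X. lp_mem 2 \<Omega> (T w)" unfolding T_def using mem_Gr_2 gm by (auto intro: lp_mem_diff)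
  have Tlin: "ae_linear_on \<Omega> X T"
    unfolding ae_linear_on_def
  proof (intro ballI allI)
    fix u v a b assume u: "u \<in> X" and v: "v \<in> X"
    have "AE x in lebesgue_on \<Omega>. g (a *\<^sub>R u + b *\<^sub>R v) x = a *\<^sub>R g u x + b *\<^sub>R g v x"
      "AE x in lebesgue_on \<Omega>. Gr (a *\<^sub>R u + b *\<^sub>R v) x = a *\<^sub>R Gr u x + b *\<^sub>R Gr v x"
      using glin lin(2) u v unfolding ae_linear_on_def by blast+
    then show "AE x in lebesgue_on \<Omega>. T (a *\<^sub>R u + b *\<^sub>R v) x = a *\<^sub>R T u x + b *\<^sub>R T v x"
      by eventually_elim (simp add: T_def algebra_simps)
  qed
  have "seminorm_on X (\<lambda>w. lp_norm 2 \<Omega> (T w))" by (rule ae_linear_seminorm[OF _ Tm Tlin subspace_X]) simp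
  then obtain C where C: "C \<ge> 0" "\<forall>w\<in>X. lp_norm 2 \<Omega> (T w) \<le> C * nD w" by (rule seminorm_bounded)
  have TG: "lp_norm 2 \<Omega> (\<lambda>x. Gr w x - G x) = lp_norm 2 \<Omega> (T w)" if w: "w \<in> X" and G: "in_H20 \<Omega> (E w) G H" for w G H
  proof (rule lp_norm_cong_AE)
    have Gm: "lp_mem 2 \<Omega> G" using G by (simp add: in_H20_def in_H2_def)
    have "lp_norm 2 \<Omega> (\<lambda>x. g w x - G x) = 0"
      by (rule in_H10_grad_unique[OF om g[OF w] in_H20_imp_in_H10[OF G]]) simp
    then have "AE x in lebesgue_on \<Omega>. g w x = G x" using lp_norm_diff_eq_0_AE[OF _ gm[OF w] Gm] by simp
    then show "AE x in lebesgue_on \<Omega>. Gr w x - G x = T w x" by eventually_elim (simp add: T_def)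
    show "(\<lambda>x. Gr w x - G x) \<in> borel_measurable (lebesgue_on \<Omega>)"
      using lp_mem_diff[OF _ mem_Gr_2[OF w] Gm] by (auto dest: lp_memD)
    show "T w \<in> borel_measurable (lebesgue_on \<Omega>)" using Tm w by (auto dest: lp_memD)
  qed
  let ?S = "{lp_norm 2 \<Omega> (\<lambda>x. Gr \<psi> x - G x) / nD \<psi> | \<psi> G. \<psi> \<in> X \<and> \<psi> \<noteq> 0 \<and> (\<exists>H. in_H20 \<Omega> (E \<psi>) G H)}"
  have S: "r \<le> C" if rS: "r \<in> ?S" for r
  proof -
    obtain w G H where w: "w \<in> X" "w \<noteq> 0" "in_H20 \<Omega> (E w) G H" "r = lp_norm 2 \<Omega> (\<lambda>x. Gr w x - G x) / nD w"
      using rS by auto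
    show ?thesis unfolding w(4) TG[OF w(1,3)] using C(2) w(1) nD_pos[OF w(1,2)] by (simp add: divide_le_eq)
  qed
  show "0 \<le> omegaE \<Omega> X Gr Hs E" unfolding omegaE_def by (rule le_Sup_insert_0(1)[OF S])
  show "lp_norm 2 \<Omega> (\<lambda>x. Gr w x - G x) \<le> omegaE \<Omega> X Gr Hs E * nD w" if w: "w \<in> X" "in_H20 \<Omega> (E w) G H"
  proof (cases "w = 0")
    case True
    then show ?thesis using TG[OF w] C(2) w(1) zero_norms[OF seminorms(1)] by fastforce
  next
    case False
    have "lp_norm 2 \<Omega> (\<lambda>x. Gr w x - G x) / nD w \<le> omegaE \<Omega> X Gr Hs E"
      unfolding omegaE_def by (rule le_Sup_insert_0(2)[OF S]) (use w False in blast)+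
    then show ?thesis using nD_pos[OF w(1) False] by (simp add: divide_le_eq)
  qed
qed

text \<open>Both conformity defects are suprema of this shape.\<close>

lemma defect_le_Sup:
  assumes d: "\<And>w. w \<in> X \<Longrightarrow> \<bar>f w\<bar> \<le> C * nD w"
  shows "0 \<le> Sup (insert 0 {\<bar>f w\<bar> / nD w | w. w \<in> X \<and> w \<noteq> 0})"
    "w \<in> X \<Longrightarrow> \<bar>f w\<bar> \<le> Sup (insert 0 {\<bar>f w\<bar> / nD w | w. w \<in> X \<and> w \<noteq> 0}) * nD w"
proof -
  have S: "r \<le> C" if rS: "r \<in> {\<bar>f w\<bar> / nD w | w. w \<in> X \<and> w \<noteq> 0}" for r
  proof -
    obtain w where "w \<in> X" "w \<noteq> 0" "r = \<bar>f w\<bar> / nD w" using rS by auto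
    then show ?thesis using d[of w] nD_pos[of w] by (simp add: divide_le_eq)
  qed
  show "0 \<le> Sup (insert 0 {\<bar>f w\<bar> / nD w | w. w \<in> X \<and> w \<noteq> 0})" by (rule le_Sup_insert_0(1)[OF S])
  show "\<bar>f w\<bar> \<le> Sup (insert 0 {\<bar>f w\<bar> / nD w | w. w \<in> X \<and> w \<noteq> 0}) * nD w" if w: "w \<in> X"
  proof (cases "w = 0")
    case True then show ?thesis using d[OF w] zero_norms[OF seminorms(1)] by simp
  next
    case False
    have "\<bar>f w\<bar> / nD w \<le> Sup (insert 0 {\<bar>f w\<bar> / nD w | w. w \<in> X \<and> w \<noteq> 0})"
      by (rule le_Sup_insert_0(2)[OF S]) (use w False in blast)+
    then show ?thesis using nD_pos[OF w False] by (simp add: divide_le_eq)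
  qed
qed

lemma
  assumes \<xi>: "in_Hdd \<Omega> \<xi> h"
  shows W_HD_nonneg: "0 \<le> W_HD \<Omega> X PiD Hs \<xi> h"
    and W_HD_le: "w \<in> X \<Longrightarrow> \<bar>\<integral>x. h x * PiD w x - \<xi> x \<bullet> Hs w x \<partial>lebesgue_on \<Omega>\<bar> \<le> W_HD \<Omega> X PiD Hs \<xi> h * nD w"
proof -
  have m: "lp_mem 2 \<Omega> \<xi>" "lp_mem 2 \<Omega> h" using \<xi> by (auto simp: in_Hdd_def)
  have d: "\<bar>\<integral>x. h x * PiD w x - \<xi> x \<bullet> Hs w x \<partial>lebesgue_on \<Omega>\<bar> \<le> (lp_norm 2 \<Omega> h * C_HD \<Omega> X PiD Gr Hs + lp_norm 2 \<Omega> \<xi>) * nD w"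
    if w: "w \<in> X" for w
  proof -
    have "(\<integral>x. h x * PiD w x - \<xi> x \<bullet> Hs w x \<partial>lebesgue_on \<Omega>) = (\<integral>x. h x * PiD w x \<partial>lebesgue_on \<Omega>) - (\<integral>x. \<xi> x \<bullet> Hs w x \<partial>lebesgue_on \<Omega>)"
      by (intro Bochner_Integration.integral_diff integral_lebesgue_on_mult_le(1) lp_mem_inner_integrable m mem w)
    moreover have "\<bar>\<integral>x. h x * PiD w x \<partial>lebesgue_on \<Omega>\<bar> \<le> lp_norm 2 \<Omega> h * lp_norm 2 \<Omega> (PiD w)"
      by (rule integral_lebesgue_on_mult_le(2)[OF m(2) mem(1)[OF w]])
    moreover have "lp_norm 2 \<Omega> h * lp_norm 2 \<Omega> (PiD w) \<le> lp_norm 2 \<Omega> h * (C_HD \<Omega> X PiD Gr Hs * nD w)"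
      using PiD_le[OF w] by (simp add: mult_left_mono)
    moreover have "\<bar>\<integral>x. \<xi> x \<bullet> Hs w x \<partial>lebesgue_on \<Omega>\<bar> \<le> lp_norm 2 \<Omega> \<xi> * nD w"
      by (rule lp_Cauchy_Schwarz[OF m(1) mem(3)[OF w]])
    ultimately show ?thesis by (simp add: algebra_simps)
  qed
  note D = defect_le_Sup[where f="\<lambda>w. \<integral>x. h x * PiD w x - \<xi> x \<bullet> Hs w x \<partial>lebesgue_on \<Omega>", OF d]
  show "0 \<le> W_HD \<Omega> X PiD Hs \<xi> h" unfolding W_HD_def by (rule D(1))
  show "w \<in> X \<Longrightarrow> \<bar>\<integral>x. h x * PiD w x - \<xi> x \<bullet> Hs w x \<partial>lebesgue_on \<Omega>\<bar> \<le> W_HD \<Omega> X PiD Hs \<xi> h * nD w"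
    unfolding W_HD_def by (rule D(2))
qed

lemma
  assumes \<xi>: "in_Hdiv \<Omega> \<xi> h"
  shows What_HD_nonneg: "0 \<le> What_HD \<Omega> X PiD Gr Hs \<xi> h"
    and What_HD_le: "w \<in> X \<Longrightarrow> \<bar>\<integral>x. Gr w x \<bullet> \<xi> x + PiD w x * h x \<partial>lebesgue_on \<Omega>\<bar> \<le> What_HD \<Omega> X PiD Gr Hs \<xi> h * nD w"
proof -
  have m: "lp_mem 2 \<Omega> \<xi>" "lp_mem 2 \<Omega> h" using \<xi> by (auto simp: in_Hdiv_def)
  obtain C where C: "C \<ge> 0" "\<forall>w\<in>X. lp_norm 2 \<Omega> (Gr w) \<le> C * nD w" by (rule seminorm_bounded[OF seminorms(4)])
  have d: "\<bar>\<integral>x. Gr w x \<bullet> \<xi> x + PiD w x * h x \<partial>lebesgue_on \<Omega>\<bar> \<le> (C * lp_norm 2 \<Omega> \<xi> + C_HD \<Omega> X PiD Gr Hs * lp_norm 2 \<Omega> h) * nD w"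
    if w: "w \<in> X" for w
  proof -
    have "(\<integral>x. Gr w x \<bullet> \<xi> x + PiD w x * h x \<partial>lebesgue_on \<Omega>) = (\<integral>x. Gr w x \<bullet> \<xi> x \<partial>lebesgue_on \<Omega>) + (\<integral>x. PiD w x * h x \<partial>lebesgue_on \<Omega>)"
      by (intro Bochner_Integration.integral_add integral_lebesgue_on_mult_le(1) lp_mem_inner_integrable m mem mem_Gr_2 w)
    moreover have "\<bar>\<integral>x. PiD w x * h x \<partial>lebesgue_on \<Omega>\<bar> \<le> lp_norm 2 \<Omega> (PiD w) * lp_norm 2 \<Omega> h"
      by (rule integral_lebesgue_on_mult_le(2)[OF mem(1)[OF w] m(2)])
    moreover have "lp_norm 2 \<Omega> (PiD w) * lp_norm 2 \<Omega> h \<le> C_HD \<Omega> X PiD Gr Hs * nD w * lp_norm 2 \<Omega> h"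
      using PiD_le[OF w] by (simp add: mult_right_mono)
    moreover have "\<bar>\<integral>x. Gr w x \<bullet> \<xi> x \<partial>lebesgue_on \<Omega>\<bar> \<le> lp_norm 2 \<Omega> (Gr w) * lp_norm 2 \<Omega> \<xi>"
      by (rule lp_Cauchy_Schwarz[OF mem_Gr_2[OF w] m(1)])
    moreover have "lp_norm 2 \<Omega> (Gr w) * lp_norm 2 \<Omega> \<xi> \<le> C * nD w * lp_norm 2 \<Omega> \<xi>"
      using C(2) w by (simp add: mult_right_mono)
    ultimately show ?thesis by (simp add: algebra_simps)
  qed
  note D = defect_le_Sup[where f="\<lambda>w. \<integral>x. Gr w x \<bullet> \<xi> x + PiD w x * h x \<partial>lebesgue_on \<Omega>", OF d]
  show "0 \<le> What_HD \<Omega> X PiD Gr Hs \<xi> h" unfolding What_HD_def by (rule D(1))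
  show "w \<in> X \<Longrightarrow> \<bar>\<integral>x. Gr w x \<bullet> \<xi> x + PiD w x * h x \<partial>lebesgue_on \<Omega>\<bar> \<le> What_HD \<Omega> X PiD Gr Hs \<xi> h * nD w"
    unfolding What_HD_def by (rule D(2))
qed

text \<open>\<open>S_HD\<close> is encoded as an infimum, so near-minimisers stand in for best
  interpolants.\<close>

lemma S_HD_near_min:
  assumes "e > 0"
  shows "\<exists>w\<in>X. lp_norm 2 \<Omega> (\<lambda>x. PiD w x - \<phi> x) + lp_norm 4 \<Omega> (\<lambda>x. Gr w x - G x) + lp_norm 2 \<Omega> (\<lambda>x. Hs w x - H x)
    < S_HD \<Omega> X PiD Gr Hs \<phi> G H + e"
proof -
  let ?f = "\<lambda>w. lp_norm 2 \<Omega> (\<lambda>x. PiD w x - \<phi> x) + lp_norm 4 \<Omega> (\<lambda>x. Gr w x - G x) + lp_norm 2 \<Omega> (\<lambda>x. Hs w x - H x)"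
  have "{?f w | w. w \<in> X} \<noteq> {}" using subspace_0[OF subspace_X] by blast
  moreover have "Inf {?f w | w. w \<in> X} < S_HD \<Omega> X PiD Gr Hs \<phi> G H + e" unfolding S_HD_def using assms by simp
  ultimately obtain r where "r \<in> {?f w | w. w \<in> X}" "r < S_HD \<Omega> X PiD Gr Hs \<phi> G H + e"
    by (rule cInf_lessD[THEN bexE])
  then show ?thesis by blast
qed

end

section \<open>Limits of linear functionals and of tuples\<close>

text \<open>Two computations of the limit of \<open>l (w n)\<close> are compared: continuity of
  \<open>l\<close> along the strong limit, and stability of limits under convex combinations. This
  is how relations that are linear in the Hessian reach \<open>H\<close>.\<close>

lemma fconv_limit_value:
  fixes u :: "nat \<Rightarrow> real^'d \<Rightarrow> 'v::euclidean_space"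
  assumes um: "\<And>n. lp_mem 2 \<Omega> (u n)"
    and lin: "\<And>f g a b. lp_mem 2 \<Omega> f \<Longrightarrow> lp_mem 2 \<Omega> g \<Longrightarrow> l (\<lambda>x. a *\<^sub>R f x + b *\<^sub>R g x) = a * l f + b * (l g :: real)"
    and bd: "\<And>f. lp_mem 2 \<Omega> f \<Longrightarrow> \<bar>l f\<bar> \<le> C * lp_norm 2 \<Omega> f"
    and w: "\<forall>n. w n \<in> fconv u n" and H: "lp_mem 2 \<Omega> H" and wH: "lp_tendsto 2 \<Omega> w H"
    and lim: "(\<lambda>n. l (u n)) \<longlonglongrightarrow> c"
  shows "l H = c"
proof -
  have wm: "lp_mem 2 \<Omega> (w n)" for n
    by (rule fconv_lp_mem[where u=u and n=n]) (use um w in auto)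
  have "(\<lambda>n. l (w n)) \<longlonglongrightarrow> l H"
  proof (rule LIM_zero_cancel[OF Lim_null_comparison, rotated])
    show "(\<lambda>n. C * lp_norm 2 \<Omega> (\<lambda>x. w n x - H x)) \<longlonglongrightarrow> 0" using tendsto_mult_left[OF wH, of C] by simp
    show "\<forall>\<^sub>F n in sequentially. norm (l (w n) - l H) \<le> C * lp_norm 2 \<Omega> (\<lambda>x. w n x - H x)"
    proof (intro always_eventually allI)
      fix n
      have "l (\<lambda>x. w n x - H x) = l (w n) - l H" using lin[OF wm H, where a=1 and b="-1"] by simp
      then show "norm (l (w n) - l H) \<le> C * lp_norm 2 \<Omega> (\<lambda>x. w n x - H x)"
        using bd[OF lp_mem_diff[OF _ wm[of n] H]] by simp
    qed
  qed
  moreover have "(\<lambda>n. l (w n)) \<longlonglongrightarrow> c"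
    using fconv_linear_tendsto[where l=l and w=w, OF um lin _ lim] w by blast
  ultimately show ?thesis using LIMSEQ_unique by blast
qed

lemma lpk_nth:
  fixes f :: "real^'d \<Rightarrow> ('v::euclidean_space)^'k"
  shows "p \<ge> 1 \<Longrightarrow> lp_mem p \<Omega> f \<Longrightarrow> lpk_mem p \<Omega> (\<lambda>c x. f x $ c)" "lpk_norm p \<Omega> (\<lambda>c x. f x $ c) = lp_norm p \<Omega> f"
  by (auto simp: lpk_mem_iff lpk_norm_eq)

lemma lpk_mem_diff:
  fixes F :: "'k::finite \<Rightarrow> real^'d \<Rightarrow> 'v::euclidean_space"
  shows "p \<ge> 1 \<Longrightarrow> lpk_mem p \<Omega> F \<Longrightarrow> lpk_mem p \<Omega> G \<Longrightarrow> lpk_mem p \<Omega> (\<lambda>c x. F c x - G c x)"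
  by (auto simp: lpk_mem_def intro: lp_mem_diff)

lemma lpk_tendsto:
  fixes u :: "nat \<Rightarrow> 'k::finite \<Rightarrow> real^'d \<Rightarrow> 'v::euclidean_space"
  assumes p: "p \<ge> 1" and m: "\<And>n c. lp_mem p \<Omega> (u n c)" "\<And>c. lp_mem p \<Omega> (g c)"
    and lim: "\<And>c. lp_tendsto p \<Omega> (\<lambda>n. u n c) (g c)"
  shows "(\<lambda>n. lpk_norm p \<Omega> (\<lambda>c x. u n c x - g c x)) \<longlonglongrightarrow> 0"
proof (rule Lim_null_comparison[OF always_eventually])
  show "\<forall>n. norm (lpk_norm p \<Omega> (\<lambda>c x. u n c x - g c x)) \<le> (\<Sum>c\<in>UNIV. lp_norm p \<Omega> (\<lambda>x. u n c x - g c x))"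
  proof
    fix n
    have "lp_mem p \<Omega> (\<lambda>x. u n c x - g c x)" for c by (intro lp_mem_diff p m)
    from lpk_norm_le_sum[where F="\<lambda>c x. u n c x - g c x", OF p this]
    show "norm (lpk_norm p \<Omega> (\<lambda>c x. u n c x - g c x)) \<le> (\<Sum>c\<in>UNIV. lp_norm p \<Omega> (\<lambda>x. u n c x - g c x))" by simp
  qed
  show "(\<lambda>n. \<Sum>c\<in>UNIV. lp_norm p \<Omega> (\<lambda>x. u n c x - g c x)) \<longlonglongrightarrow> 0"
    using tendsto_sum[of UNIV "\<lambda>c n. lp_norm p \<Omega> (\<lambda>x. u n c x - g c x)" "\<lambda>_. 0"] lim by simp
qed

section \<open>The continuous forms and their bounds\<close>

locale hessian_forms =
  fixes \<Omega> :: "(real^'d::finite) set"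
    and A :: "('k::finite \<Rightarrow> real^'d \<Rightarrow> real^'d^'d) \<Rightarrow> ('k \<Rightarrow> real^'d \<Rightarrow> real^'d^'d) \<Rightarrow> real"
    and B :: "('k \<Rightarrow> real^'d \<Rightarrow> real^'d^'d) \<Rightarrow> ('k \<Rightarrow> real^'d \<Rightarrow> real^'d) \<Rightarrow> ('k \<Rightarrow> real^'d \<Rightarrow> real^'d) \<Rightarrow> real"
    and L :: "('k \<Rightarrow> real^'d \<Rightarrow> real) \<Rightarrow> real"
    and alpha C1eq :: real
  assumes om: "\<Omega> \<in> sets lebesgue" "emeasure lebesgue \<Omega> < \<infinity>"
    and A_bilin1: "\<And>\<xi> \<eta> \<zeta> a b. lpk_mem 2 \<Omega> \<xi> \<Longrightarrow> lpk_mem 2 \<Omega> \<eta> \<Longrightarrow> lpk_mem 2 \<Omega> \<zeta> \<Longrightarrow>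
        A (\<lambda>c x. a *\<^sub>R \<xi> c x + b *\<^sub>R \<eta> c x) \<zeta> = a * A \<xi> \<zeta> + b * A \<eta> \<zeta>"
    and A_bilin2: "\<And>\<xi> \<eta> \<zeta> a b. lpk_mem 2 \<Omega> \<xi> \<Longrightarrow> lpk_mem 2 \<Omega> \<eta> \<Longrightarrow> lpk_mem 2 \<Omega> \<zeta> \<Longrightarrow>
        A \<zeta> (\<lambda>c x. a *\<^sub>R \<xi> c x + b *\<^sub>R \<eta> c x) = a * A \<zeta> \<xi> + b * A \<zeta> \<eta>"
    and A_cont: "\<exists>CA. \<forall>\<xi> \<eta>. lpk_mem 2 \<Omega> \<xi> \<and> lpk_mem 2 \<Omega> \<eta> \<longrightarrow>
        \<bar>A \<xi> \<eta>\<bar> \<le> CA * lpk_norm 2 \<Omega> \<xi> * lpk_norm 2 \<Omega> \<eta>"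
    and alpha_pos: "alpha > 0"
    and A_coer: "\<And>\<xi>. lpk_mem 2 \<Omega> \<xi> \<Longrightarrow> A \<xi> \<xi> \<ge> alpha * (lpk_norm 2 \<Omega> \<xi>)\<^sup>2"
    and B_lin1: "\<And>\<xi> \<xi>' \<theta> \<eta> a b. lpk_mem 2 \<Omega> \<xi> \<Longrightarrow> lpk_mem 2 \<Omega> \<xi>' \<Longrightarrow> lpk_mem 4 \<Omega> \<theta> \<Longrightarrow>
        lpk_mem 4 \<Omega> \<eta> \<Longrightarrow> B (\<lambda>c x. a *\<^sub>R \<xi> c x + b *\<^sub>R \<xi>' c x) \<theta> \<eta> = a * B \<xi> \<theta> \<eta> + b * B \<xi>' \<theta> \<eta>"
    and B_lin2: "\<And>\<xi> \<theta> \<theta>' \<eta> a b. lpk_mem 2 \<Omega> \<xi> \<Longrightarrow> lpk_mem 4 \<Omega> \<theta> \<Longrightarrow> lpk_mem 4 \<Omega> \<theta>' \<Longrightarrow>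
        lpk_mem 4 \<Omega> \<eta> \<Longrightarrow> B \<xi> (\<lambda>c x. a *\<^sub>R \<theta> c x + b *\<^sub>R \<theta>' c x) \<eta> = a * B \<xi> \<theta> \<eta> + b * B \<xi> \<theta>' \<eta>"
    and B_lin3: "\<And>\<xi> \<theta> \<eta> \<eta>' a b. lpk_mem 2 \<Omega> \<xi> \<Longrightarrow> lpk_mem 4 \<Omega> \<theta> \<Longrightarrow> lpk_mem 4 \<Omega> \<eta> \<Longrightarrow>
        lpk_mem 4 \<Omega> \<eta>' \<Longrightarrow> B \<xi> \<theta> (\<lambda>c x. a *\<^sub>R \<eta> c x + b *\<^sub>R \<eta>' c x) = a * B \<xi> \<theta> \<eta> + b * B \<xi> \<theta> \<eta>'"
    and B_cont: "\<exists>CB. \<forall>\<xi> \<theta> \<eta>. lpk_mem 2 \<Omega> \<xi> \<and> lpk_mem 4 \<Omega> \<theta> \<and> lpk_mem 4 \<Omega> \<eta> \<longrightarrow>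
        \<bar>B \<xi> \<theta> \<eta>\<bar> \<le> CB * lpk_norm 2 \<Omega> \<xi> * lpk_norm 4 \<Omega> \<theta> * lpk_norm 4 \<Omega> \<eta>"
    and B_skew: "\<And>\<xi> \<theta>. lpk_mem 2 \<Omega> \<xi> \<Longrightarrow> lpk_mem 4 \<Omega> \<theta> \<Longrightarrow> B \<xi> \<theta> \<theta> = 0"
    and L_lin: "\<And>\<Phi> G\<Phi> \<Psi> G\<Psi> a b. (\<forall>c. in_H10 \<Omega> (\<Phi> c) (G\<Phi> c)) \<Longrightarrow> (\<forall>c. in_H10 \<Omega> (\<Psi> c) (G\<Psi> c)) \<Longrightarrow>
        L (\<lambda>c x. a * \<Phi> c x + b * \<Psi> c x) = a * L \<Phi> + b * L \<Psi>"
    and L_cont: "\<exists>CL. \<forall>\<Phi> G. (\<forall>c. in_H10 \<Omega> (\<Phi> c) (G c)) \<longrightarrow> \<bar>L \<Phi>\<bar> \<le> CL * h1k_norm \<Omega> \<Phi> G"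
    and C1eq: "\<And>\<phi> G. in_H10 \<Omega> \<phi> G \<Longrightarrow>
        sqrt ((lp_norm 2 \<Omega> \<phi>)\<^sup>2 + (lp_norm 2 \<Omega> G)\<^sup>2) \<le> C1eq * lp_norm 2 \<Omega> G"
begin

abbreviation "nB \<equiv> norm_trilinear \<Omega> B"
abbreviation "nL \<equiv> dual_norm_H1 \<Omega> L"
text \<open>The sign of \<open>C1eq\<close> is not among the assumptions; the truncation keeps
  products with it monotone.\<close>

abbreviation "C1 \<equiv> max 0 C1eq"

lemma A_bound: obtains CA where "CA \<ge> 0" "\<forall>\<xi> \<eta>. lpk_mem 2 \<Omega> \<xi> \<longrightarrow> lpk_mem 2 \<Omega> \<eta> \<longrightarrow>
        \<bar>A \<xi> \<eta>\<bar> \<le> CA * lpk_norm 2 \<Omega> \<xi> * lpk_norm 2 \<Omega> \<eta>"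
proof -
  from A_cont obtain CA where CA: "\<forall>\<xi> \<eta>. lpk_mem 2 \<Omega> \<xi> \<and> lpk_mem 2 \<Omega> \<eta> \<longrightarrow>
        \<bar>A \<xi> \<eta>\<bar> \<le> CA * lpk_norm 2 \<Omega> \<xi> * lpk_norm 2 \<Omega> \<eta>" by (rule exE)
  have "\<bar>A \<xi> \<eta>\<bar> \<le> \<bar>CA\<bar> * lpk_norm 2 \<Omega> \<xi> * lpk_norm 2 \<Omega> \<eta>" if "lpk_mem 2 \<Omega> \<xi>" "lpk_mem 2 \<Omega> \<eta>" for \<xi> \<eta>
  proof -
    have "\<bar>A \<xi> \<eta>\<bar> \<le> CA * lpk_norm 2 \<Omega> \<xi> * lpk_norm 2 \<Omega> \<eta>" using CA that by blast
    also have "\<dots> \<le> \<bar>CA\<bar> * lpk_norm 2 \<Omega> \<xi> * lpk_norm 2 \<Omega> \<eta>" by (intro mult_right_mono) auto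
    finally show ?thesis .
  qed
  then show thesis by (intro that[of "\<bar>CA\<bar>"]) auto
qed

text \<open>Continuity bounds the ratios, so \<open>nB\<close> is a valid constant for
  \<open>B\<close>; where the product of norms is zero there is no ratio, and continuity gives the
  value zero directly.\<close>

lemma
  shows nB_nonneg: "0 \<le> nB"
    and B_bound: "lpk_mem 2 \<Omega> \<xi> \<Longrightarrow> lpk_mem 4 \<Omega> \<theta> \<Longrightarrow> lpk_mem 4 \<Omega> \<eta> \<Longrightarrow>
        \<bar>B \<xi> \<theta> \<eta>\<bar> \<le> nB * (lpk_norm 2 \<Omega> \<xi> * lpk_norm 4 \<Omega> \<theta> * lpk_norm 4 \<Omega> \<eta>)"
proof -
  from B_cont obtain CB where CB: "\<forall>\<xi> \<theta> \<eta>. lpk_mem 2 \<Omega> \<xi> \<and> lpk_mem 4 \<Omega> \<theta> \<and> lpk_mem 4 \<Omega> \<eta> \<longrightarrow>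
        \<bar>B \<xi> \<theta> \<eta>\<bar> \<le> CB * lpk_norm 2 \<Omega> \<xi> * lpk_norm 4 \<Omega> \<theta> * lpk_norm 4 \<Omega> \<eta>" by (rule exE)
  let ?N = "\<lambda>\<xi> \<theta> \<eta>. lpk_norm 2 \<Omega> \<xi> * lpk_norm 4 \<Omega> \<theta> * lpk_norm 4 \<Omega> \<eta>"
  let ?S = "{\<bar>B \<xi> \<theta> \<eta>\<bar> / ?N \<xi> \<theta> \<eta> | \<xi> \<theta> \<eta>. lpk_mem 2 \<Omega> \<xi> \<and> lpk_mem 4 \<Omega> \<theta> \<and> lpk_mem 4 \<Omega> \<eta> \<and> ?N \<xi> \<theta> \<eta> \<noteq> 0}"
  have le: "\<bar>B \<xi> \<theta> \<eta>\<bar> \<le> CB * ?N \<xi> \<theta> \<eta>" if "lpk_mem 2 \<Omega> \<xi>" "lpk_mem 4 \<Omega> \<theta>" "lpk_mem 4 \<Omega> \<eta>" for \<xi> \<theta> \<eta>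
  proof -
    have "\<bar>B \<xi> \<theta> \<eta>\<bar> \<le> CB * lpk_norm 2 \<Omega> \<xi> * lpk_norm 4 \<Omega> \<theta> * lpk_norm 4 \<Omega> \<eta>" using CB that by blast
    then show ?thesis by (simp only: mult.assoc)
  qed
  have pos: "?N \<xi> \<theta> \<eta> \<ge> 0" for \<xi> :: "'k \<Rightarrow> real^'d \<Rightarrow> real^'d^'d" and \<theta> \<eta> :: "'k \<Rightarrow> real^'d \<Rightarrow> real^'d" by simp
  have S: "r \<le> CB" if rS: "r \<in> ?S" for r
  proof -
    from rS obtain \<xi> \<theta> \<eta> where r: "r = \<bar>B \<xi> \<theta> \<eta>\<bar> / ?N \<xi> \<theta> \<eta>" and m: "lpk_mem 2 \<Omega> \<xi>" "lpk_mem 4 \<Omega> \<theta>" "lpk_mem 4 \<Omega> \<eta>" and "?N \<xi> \<theta> \<eta> \<noteq> 0"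
      by auto
    then have "?N \<xi> \<theta> \<eta> > 0" using pos[of \<xi> \<theta> \<eta>] by linarith
    then show ?thesis unfolding r using le[OF m] by (simp only: pos_divide_le_eq)
  qed
  show "0 \<le> nB" unfolding norm_trilinear_def by (rule le_Sup_insert_0(1)[OF S])
  assume m: "lpk_mem 2 \<Omega> \<xi>" "lpk_mem 4 \<Omega> \<theta>" "lpk_mem 4 \<Omega> \<eta>"
  show "\<bar>B \<xi> \<theta> \<eta>\<bar> \<le> nB * ?N \<xi> \<theta> \<eta>"
  proof (cases "?N \<xi> \<theta> \<eta> = 0")
    case True
    then show ?thesis using le[OF m] unfolding True by simp
  next
    case False
    then have p: "?N \<xi> \<theta> \<eta> > 0" using pos[of \<xi> \<theta> \<eta>] by linarith
    have "\<bar>B \<xi> \<theta> \<eta>\<bar> / ?N \<xi> \<theta> \<eta> \<le> nB"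
      unfolding norm_trilinear_def by (rule le_Sup_insert_0(2)[OF S]) (use m False in blast)+
    then show ?thesis using p by (simp only: pos_divide_le_eq)
  qed
qed

text \<open>The scalar inequality is squared and summed over the components, so its constant serves
  for tuples without loss.\<close>

lemma h1k_norm_le:
  assumes \<Phi>: "\<And>c. in_H10 \<Omega> (\<Phi> c) (G c)"
  shows "h1k_norm \<Omega> \<Phi> G \<le> C1 * lpk_norm 2 \<Omega> G"
proof -
  have m: "lp_mem 2 \<Omega> (\<Phi> c)" "lp_mem 2 \<Omega> (G c)" for c using \<Phi>[of c] by (auto simp: in_H10_def in_H1_def)
  have "(lp_norm 2 \<Omega> (\<Phi> c))\<^sup>2 + (lp_norm 2 \<Omega> (G c))\<^sup>2 \<le> C1\<^sup>2 * (lp_norm 2 \<Omega> (G c))\<^sup>2" for c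
  proof -
    have "sqrt ((lp_norm 2 \<Omega> (\<Phi> c))\<^sup>2 + (lp_norm 2 \<Omega> (G c))\<^sup>2) \<le> C1 * lp_norm 2 \<Omega> (G c)"
      using C1eq[OF \<Phi>[of c]] mult_right_mono[of C1eq C1 "lp_norm 2 \<Omega> (G c)"] by simp
    then have "(sqrt ((lp_norm 2 \<Omega> (\<Phi> c))\<^sup>2 + (lp_norm 2 \<Omega> (G c))\<^sup>2))\<^sup>2 \<le> (C1 * lp_norm 2 \<Omega> (G c))\<^sup>2"
      by (rule power_mono) simp
    then show ?thesis by (simp add: power_mult_distrib)
  qed
  then have "(\<Sum>c\<in>UNIV. (lp_norm 2 \<Omega> (\<Phi> c))\<^sup>2 + (lp_norm 2 \<Omega> (G c))\<^sup>2) \<le> (\<Sum>c\<in>UNIV. C1\<^sup>2 * (lp_norm 2 \<Omega> (G c))\<^sup>2)"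
    by (rule sum_mono)
  then have "(lpk_norm 2 \<Omega> \<Phi>)\<^sup>2 + (lpk_norm 2 \<Omega> G)\<^sup>2 \<le> (C1 * lpk_norm 2 \<Omega> G)\<^sup>2"
    unfolding power_mult_distrib lpk_norm_2_sq[OF m(1)] lpk_norm_2_sq[OF m(2)] by (simp add: sum.distrib sum_distrib_left)
  then show ?thesis unfolding h1k_norm_def by (intro real_le_lsqrt) auto
qed

lemma
  shows nL_nonneg: "0 \<le> nL"
    and L_bound: "(\<And>c. in_H10 \<Omega> (\<Phi> c) (G c)) \<Longrightarrow> \<bar>L \<Phi>\<bar> \<le> nL * C1 * lpk_norm 2 \<Omega> G"
proof -
  from L_cont obtain CL where CL: "\<forall>\<Phi> G. (\<forall>c. in_H10 \<Omega> (\<Phi> c) (G c)) \<longrightarrow> \<bar>L \<Phi>\<bar> \<le> CL * h1k_norm \<Omega> \<Phi> G" by (rule exE)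
  let ?S = "{\<bar>L \<Phi>\<bar> / h1k_norm \<Omega> \<Phi> G | \<Phi> G. (\<forall>c. in_H10 \<Omega> (\<Phi> c) (G c)) \<and> h1k_norm \<Omega> \<Phi> G \<noteq> 0}"
  have pos: "h1k_norm \<Omega> \<Phi> G \<ge> 0" for \<Phi> :: "'k \<Rightarrow> real^'d \<Rightarrow> real" and G by (simp add: h1k_norm_def)
  have S: "r \<le> CL" if rS: "r \<in> ?S" for r
  proof -
    from rS obtain \<Phi> G where r: "r = \<bar>L \<Phi>\<bar> / h1k_norm \<Omega> \<Phi> G" and m: "\<forall>c. in_H10 \<Omega> (\<Phi> c) (G c)" and "h1k_norm \<Omega> \<Phi> G \<noteq> 0" by auto
    then have "h1k_norm \<Omega> \<Phi> G > 0" using pos[of \<Phi> G] by linarith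
    then show ?thesis unfolding r using CL m by (simp add: pos_divide_le_eq)
  qed
  show n: "0 \<le> nL" unfolding dual_norm_H1_def by (rule le_Sup_insert_0(1)[OF S])
  assume m: "\<And>c. in_H10 \<Omega> (\<Phi> c) (G c)"
  have "\<bar>L \<Phi>\<bar> \<le> nL * h1k_norm \<Omega> \<Phi> G"
  proof (cases "h1k_norm \<Omega> \<Phi> G = 0")
    case True
    have "\<bar>L \<Phi>\<bar> \<le> CL * h1k_norm \<Omega> \<Phi> G" using CL m by blast
    then show ?thesis using True by simp
  next
    case False
    have "\<bar>L \<Phi>\<bar> / h1k_norm \<Omega> \<Phi> G \<le> nL"
      unfolding dual_norm_H1_def by (rule le_Sup_insert_0(2)[OF S]) (use m False in blast)+
    then show ?thesis using False pos[of \<Phi> G] by (simp add: pos_divide_le_eq)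
  qed
  also have "\<dots> \<le> nL * (C1 * lpk_norm 2 \<Omega> G)" using n h1k_norm_le[OF m] by (rule mult_left_mono[rotated])
  finally show "\<bar>L \<Phi>\<bar> \<le> nL * C1 * lpk_norm 2 \<Omega> G" by (simp add: mult.assoc)
qed

text \<open>The right side involves gradients only. Hence \<open>L\<close> takes the same value on
  functions whose gradients differ by norm zero, and strong convergence of gradients implies
  convergence of \<open>L\<close>.\<close>

lemma L_diff_bound:
  assumes \<Phi>: "\<And>c. in_H10 \<Omega> (\<Phi> c) (G c)" and \<Psi>: "\<And>c. in_H10 \<Omega> (\<Psi> c) (G' c)"
  shows "\<bar>L \<Phi> - L \<Psi>\<bar> \<le> nL * C1 * lpk_norm 2 \<Omega> (\<lambda>c x. G c x - G' c x)"
proof -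
  have "in_H10 \<Omega> (\<lambda>x. \<Phi> c x - \<Psi> c x) (\<lambda>x. G c x - G' c x)" for c
    using in_H10_add_mult[OF om \<Phi>[of c] \<Psi>[of c], of "-1"] by simp
  then have "\<bar>L (\<lambda>c x. \<Phi> c x - \<Psi> c x)\<bar> \<le> nL * C1 * lpk_norm 2 \<Omega> (\<lambda>c x. G c x - G' c x)" by (rule L_bound)
  moreover have "L (\<lambda>c x. 1 * \<Phi> c x + (-1) * \<Psi> c x) = 1 * L \<Phi> + (-1) * L \<Psi>"
    by (rule L_lin[of \<Phi> G \<Psi> G']) (use \<Phi> \<Psi> in blast)+
  ultimately show ?thesis by simp
qed

lemma A_diff1: "lpk_mem 2 \<Omega> \<xi> \<Longrightarrow> lpk_mem 2 \<Omega> \<eta> \<Longrightarrow> lpk_mem 2 \<Omega> \<zeta> \<Longrightarrow> A (\<lambda>c x. \<xi> c x - \<eta> c x) \<zeta> = A \<xi> \<zeta> - A \<eta> \<zeta>"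
  using A_bilin1[of \<xi> \<eta> \<zeta> 1 "-1"] by simp

lemma A_diff2: "lpk_mem 2 \<Omega> \<xi> \<Longrightarrow> lpk_mem 2 \<Omega> \<eta> \<Longrightarrow> lpk_mem 2 \<Omega> \<zeta> \<Longrightarrow> A \<zeta> (\<lambda>c x. \<xi> c x - \<eta> c x) = A \<zeta> \<xi> - A \<zeta> \<eta>"
  using A_bilin2[of \<xi> \<eta> \<zeta> 1 "-1"] by simp

lemma B_diff1: "lpk_mem 2 \<Omega> \<xi> \<Longrightarrow> lpk_mem 2 \<Omega> \<xi>' \<Longrightarrow> lpk_mem 4 \<Omega> \<theta> \<Longrightarrow> lpk_mem 4 \<Omega> \<eta> \<Longrightarrow>
    B (\<lambda>c x. \<xi> c x - \<xi>' c x) \<theta> \<eta> = B \<xi> \<theta> \<eta> - B \<xi>' \<theta> \<eta>"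
  using B_lin1[of \<xi> \<xi>' \<theta> \<eta> 1 "-1"] by simp

lemma B_diff2: "lpk_mem 2 \<Omega> \<xi> \<Longrightarrow> lpk_mem 4 \<Omega> \<theta> \<Longrightarrow> lpk_mem 4 \<Omega> \<theta>' \<Longrightarrow> lpk_mem 4 \<Omega> \<eta> \<Longrightarrow>
    B \<xi> (\<lambda>c x. \<theta> c x - \<theta>' c x) \<eta> = B \<xi> \<theta> \<eta> - B \<xi> \<theta>' \<eta>"
  using B_lin2[of \<xi> \<theta> \<theta>' \<eta> 1 "-1"] by simp

lemma B_diff3: "lpk_mem 2 \<Omega> \<xi> \<Longrightarrow> lpk_mem 4 \<Omega> \<theta> \<Longrightarrow> lpk_mem 4 \<Omega> \<eta> \<Longrightarrow> lpk_mem 4 \<Omega> \<eta>' \<Longrightarrow>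
    B \<xi> \<theta> (\<lambda>c x. \<eta> c x - \<eta>' c x) = B \<xi> \<theta> \<eta> - B \<xi> \<theta> \<eta>'"
  using B_lin3[of \<xi> \<theta> \<eta> \<eta>' 1 "-1"] by simp

end

section \<open>The discrete scheme: bounds, existence, uniqueness\<close>

locale hessian_scheme = hessian_forms \<Omega> A B L alpha C1eq
  for \<Omega> :: "(real^'d::finite) set"
    and A :: "('k::finite \<Rightarrow> real^'d \<Rightarrow> real^'d^'d) \<Rightarrow> ('k \<Rightarrow> real^'d \<Rightarrow> real^'d^'d) \<Rightarrow> real"
    and B L alpha C1eq +
  fixes X :: "'x::real_vector set"
    and PiD :: "'x \<Rightarrow> real^'d \<Rightarrow> real" and Gr :: "'x \<Rightarrow> real^'d \<Rightarrow> real^'d" and Hs :: "'x \<Rightarrow> real^'d \<Rightarrow> real^'d^'d"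
    and E :: "'x \<Rightarrow> real^'d \<Rightarrow> real"
  assumes hd: "is_HD \<Omega> X PiD Gr Hs" and companion: "is_companion \<Omega> X E"
begin

sublocale hessian_disc \<Omega> X PiD Gr Hs
  using om hd by unfold_locales

abbreviation "CD \<equiv> C_HD \<Omega> X PiD Gr Hs"
text \<open>The bracket of the uniqueness condition, which acts as the norm bound of the companion
  gradient relative to the discrete norm.\<close>

abbreviation "\<kappa> \<equiv> omegaE \<Omega> X Gr Hs E + measure lebesgue \<Omega> powr (1/4) * CD"

lemma \<kappa>_nonneg: "0 \<le> \<kappa>"
  using omegaE_nonneg[OF companion] C_HD_nonneg by simp

lemma lpk_mem_disc:
  assumes "\<And>c. u c \<in> X"
  shows "lpk_mem 2 \<Omega> (\<lambda>c. Hs (u c))" "lpk_mem 4 \<Omega> (\<lambda>c. Gr (u c))"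
  using assms mem by (auto simp: lpk_mem_def)

lemma lpk_norm_Gr_le:
  assumes "\<And>c. u c \<in> X"
  shows "lpk_norm 4 \<Omega> (\<lambda>c. Gr (u c)) \<le> CD * lpk_norm 2 \<Omega> (\<lambda>c. Hs (u c))"
  by (rule lpk_norm_4_mono) (use assms mem C_HD_nonneg Gr_le in auto)

text \<open>Comparison with the discrete gradient: \<open>omegaE\<close> controls the difference,
  while the embedding of L^4 into L^2 and \<open>CD\<close> control the discrete gradient. This is
  the origin of the two summands of \<open>\<kappa>\<close>.\<close>

lemma companion_grad_le:
  assumes w: "w \<in> X" and G: "in_H20 \<Omega> (E w) G H"
  shows "lp_norm 2 \<Omega> G \<le> \<kappa> * nD w"
proof -
  have Gm: "lp_mem 2 \<Omega> G" using G by (simp add: in_H20_def in_H2_def)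
  have "lp_norm 2 \<Omega> G \<le> lp_norm 2 \<Omega> (Gr w) + lp_norm 2 \<Omega> (\<lambda>x. Gr w x - G x)"
    using lp_norm_diff_abs[OF _ mem_Gr_2[OF w] Gm] by simp
  moreover have "lp_norm 2 \<Omega> (\<lambda>x. Gr w x - G x) \<le> omegaE \<Omega> X Gr Hs E * nD w" by (rule omegaE_le[OF companion w G])
  moreover have "lp_norm 2 \<Omega> (Gr w) \<le> measure lebesgue \<Omega> powr (1/4) * lp_norm 4 \<Omega> (Gr w)"
    by (rule lp_4_imp_2(2)[OF mem(2)[OF w] om])
  moreover have "measure lebesgue \<Omega> powr (1/4) * lp_norm 4 \<Omega> (Gr w) \<le> measure lebesgue \<Omega> powr (1/4) * (CD * nD w)"
    by (rule mult_left_mono[OF Gr_le[OF w]]) simp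
  ultimately show ?thesis by (simp add: algebra_simps)
qed

lemma companion_H20:
  assumes "\<And>c. u c \<in> X"
  obtains G H where "\<forall>c. in_H20 \<Omega> (E (u c)) (G c) (H c)"
proof -
  have "\<forall>c. \<exists>G H. in_H20 \<Omega> (E (u c)) G H" using companion assms by (auto simp: is_companion_def)
  then show thesis using that by metis
qed

text \<open>The dual norm, the Poincare constant and \<open>\<kappa>\<close> combine to a bound of
  the right-hand side by the discrete norm.\<close>

lemma L_companion_le:
  assumes u: "\<And>c. u c \<in> X"
  shows "\<bar>L (\<lambda>c. E (u c))\<bar> \<le> nL * C1 * \<kappa> * lpk_norm 2 \<Omega> (\<lambda>c. Hs (u c))"
proof -
  obtain G H where G: "\<forall>c. in_H20 \<Omega> (E (u c)) (G c) (H c)" by (rule companion_H20[where u=u, OF u])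
  have "\<bar>L (\<lambda>c. E (u c))\<bar> \<le> nL * C1 * lpk_norm 2 \<Omega> G"
    by (rule L_bound) (use G in_H20_imp_in_H10 in blast)
  also have "\<dots> \<le> nL * C1 * (\<kappa> * lpk_norm 2 \<Omega> (\<lambda>c. Hs (u c)))"
  proof (intro mult_left_mono lpk_norm_2_mono)
    show "lp_mem 2 \<Omega> (G c)" for c using G by (auto simp: in_H20_def in_H2_def)
    show "lp_norm 2 \<Omega> (G c) \<le> \<kappa> * nD (u c)" for c using companion_grad_le[OF u] G by blast
  qed (use \<kappa>_nonneg nL_nonneg mem u in auto)
  finally show ?thesis by (simp add: mult.assoc)
qed

lemma disc_sol_bound:
  assumes sol: "disc_sol X Gr Hs E A B L \<Psi>"
  shows "alpha * lpk_norm 2 \<Omega> (\<lambda>c. Hs (\<Psi> c)) \<le> nL * C1 * \<kappa>"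
proof -
  let ?n = "lpk_norm 2 \<Omega> (\<lambda>c. Hs (\<Psi> c))"
  have \<Psi>: "\<Psi> c \<in> X" for c using sol by (simp add: disc_sol_def)
  note m = lpk_mem_disc[where u=\<Psi>, OF \<Psi>]
  have "A (\<lambda>c. Hs (\<Psi> c)) (\<lambda>c. Hs (\<Psi> c)) + B (\<lambda>c. Hs (\<Psi> c)) (\<lambda>c. Gr (\<Psi> c)) (\<lambda>c. Gr (\<Psi> c)) = L (\<lambda>c. E (\<Psi> c))"
    using sol \<Psi> by (simp add: disc_sol_def)
  then have "alpha * ?n\<^sup>2 \<le> L (\<lambda>c. E (\<Psi> c))" using A_coer[OF m(1)] B_skew[OF m] by simp
  also have "\<dots> \<le> nL * C1 * \<kappa> * ?n" using L_companion_le[where u=\<Psi>, OF \<Psi>] by linarith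
  finally have *: "(alpha * ?n) * ?n \<le> (nL * C1 * \<kappa>) * ?n" by (simp add: power2_eq_square mult.assoc)
  show ?thesis
  proof (cases "?n = 0")
    case True
    have "0 \<le> nL * C1 * \<kappa>" using nL_nonneg \<kappa>_nonneg by simp
    then show ?thesis unfolding True by simp
  next
    case False
    then have "?n > 0" using lpk_norm_nonneg[of 2 \<Omega> "\<lambda>c. Hs (\<Psi> c)"] by linarith
    then show ?thesis using * by simp
  qed
qed

text \<open>\<open>E\<close> is linear only almost everywhere. The companion of a combination and
  the combination of the companions have gradients that differ by norm zero, and
  \<open>L_diff_bound\<close> forces equal values of \<open>L\<close>.\<close>

lemma linear_on_L: "linear_on_set (vec_space X) (\<lambda>u. L (\<lambda>c. E (u $ c)))"
  unfolding linear_on_set_def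
proof (intro ballI allI)
  fix u v :: "'x^'k" and s t assume u: "u \<in> vec_space X" and v: "v \<in> vec_space X"
  let ?w = "s *\<^sub>R u + t *\<^sub>R v"
  have w: "?w \<in> vec_space X"
    by (intro subspace_add[OF subspace_vec_space] subspace_scale[OF subspace_vec_space] subspace_X u v)
  obtain G H where G: "\<forall>c. in_H20 \<Omega> (E (u $ c)) (G c) (H c)" by (rule companion_H20[where u="\<lambda>c. u $ c"]) (use u in auto)
  obtain G' H' where G': "\<forall>c. in_H20 \<Omega> (E (v $ c)) (G' c) (H' c)" by (rule companion_H20[where u="\<lambda>c. v $ c"]) (use v in auto)
  obtain G'' H'' where G'': "\<forall>c. in_H20 \<Omega> (E (?w $ c)) (G'' c) (H'' c)" by (rule companion_H20[where u="\<lambda>c. ?w $ c"]) (use w in auto)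
  note h = in_H20_imp_in_H10[OF G[rule_format]] in_H20_imp_in_H10[OF G'[rule_format]] in_H20_imp_in_H10[OF G''[rule_format]]
  have h3: "in_H10 \<Omega> (E (s *\<^sub>R (u $ c) + t *\<^sub>R (v $ c))) (G'' c)" for c using h(3)[of c] by simp
  have uc: "u $ c \<in> X" "v $ c \<in> X" for c using u v by auto
  note cc = companion_combo(2,3)[OF companion uc(1) h(1) uc(2) h(2) h3]
  have "\<bar>L (\<lambda>c. E (?w $ c)) - L (\<lambda>c x. s * E (u $ c) x + t * E (v $ c) x)\<bar>
    \<le> nL * C1 * lpk_norm 2 \<Omega> (\<lambda>c x. G'' c x - (s *\<^sub>R G c x + t *\<^sub>R G' c x))"
    by (rule L_diff_bound[OF h(3) cc(1)])
  also have "lpk_norm 2 \<Omega> (\<lambda>c x. G'' c x - (s *\<^sub>R G c x + t *\<^sub>R G' c x)) = 0"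
  proof -
    have gm: "lp_mem 2 \<Omega> (\<lambda>x. G'' c x - (s *\<^sub>R G c x + t *\<^sub>R G' c x))" for c
      using h(1)[of c] h(2)[of c] h(3)[of c]
      by (intro lp_mem_diff lp_mem_add lp_mem_scaleR) (auto simp: in_H10_def in_H1_def)
    have "lpk_norm 2 \<Omega> (\<lambda>c x. G'' c x - (s *\<^sub>R G c x + t *\<^sub>R G' c x)) \<le> (\<Sum>c\<in>UNIV. 0)"
      using lpk_norm_le_sum[where F="\<lambda>c x. G'' c x - (s *\<^sub>R G c x + t *\<^sub>R G' c x)", OF _ gm] by (simp add: cc(2))
    then show ?thesis using lpk_norm_nonneg[of 2 \<Omega> "\<lambda>c x. G'' c x - (s *\<^sub>R G c x + t *\<^sub>R G' c x)"] by simp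
  qed
  finally have "L (\<lambda>c. E (?w $ c)) = L (\<lambda>c x. s * E (u $ c) x + t * E (v $ c) x)" by simp
  also have "\<dots> = s * L (\<lambda>c. E (u $ c)) + t * L (\<lambda>c. E (v $ c))"
    by (rule L_lin[of "\<lambda>c. E (u $ c)" G "\<lambda>c. E (v $ c)" G']) (use h in blast)+
  finally show "L (\<lambda>c. E (?w $ c)) = s * L (\<lambda>c. E (u $ c)) + t * L (\<lambda>c. E (v $ c))" .
qed

text \<open>The version of \<open>ae_linear_compose\<close> for tuples, obtained by reading a tuple
  as one vector-valued function.\<close>

lemma linear_on_compose:
  fixes T :: "'x \<Rightarrow> real^'d \<Rightarrow> 'v::euclidean_space" and f :: "('k \<Rightarrow> real^'d \<Rightarrow> 'v) \<Rightarrow> real"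
  assumes p: "p \<ge> 1" and T: "\<And>w. w \<in> X \<Longrightarrow> lp_mem p \<Omega> (T w)" "ae_linear_on \<Omega> X T"
    and f: "\<And>g h a b. lpk_mem p \<Omega> g \<Longrightarrow> lpk_mem p \<Omega> h \<Longrightarrow> f (\<lambda>c x. a *\<^sub>R g c x + b *\<^sub>R h c x) = a * f g + b * f h"
    and bd: "\<And>g. lpk_mem p \<Omega> g \<Longrightarrow> \<bar>f g\<bar> \<le> C * lpk_norm p \<Omega> g"
  shows "linear_on_set (vec_space X) (\<lambda>u. f (\<lambda>c. T (u $ c)))"
proof -
  have "linear_on_set (vec_space X) (\<lambda>u. (\<lambda>F. f (\<lambda>c x. F x $ c)) (\<lambda>x. \<chi> c. T (u $ c) x))"
  proof (rule ae_linear_compose[OF p _ ae_linear_vec[OF T(2)] subspace_vec_space[OF subspace_X]])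
    show "\<forall>w\<in>vec_space X. lp_mem p \<Omega> (\<lambda>x. \<chi> c. T (w $ c) x)"
      using T(1) p by (auto simp: lp_mem_nth_iff)
    show "f (\<lambda>c x. (a *\<^sub>R g x + b *\<^sub>R h x) $ c) = a * f (\<lambda>c x. g x $ c) + b * f (\<lambda>c x. h x $ c)"
      if "lp_mem p \<Omega> g" "lp_mem p \<Omega> h" for g h a b
      using f[OF lpk_nth(1)[OF p that(1)] lpk_nth(1)[OF p that(2)], of a b] by simp
    show "\<bar>f (\<lambda>c x. g x $ c)\<bar> \<le> C * lp_norm p \<Omega> g" if "lp_mem p \<Omega> g" for g
      using bd[OF lpk_nth(1)[OF p that]] by (simp add: lpk_nth(2))
  qed
  then show ?thesis by simp
qed

lemma disc_sol_exists: "\<exists>\<Psi>. disc_sol X Gr Hs E A B L \<Psi>"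
proof -
  obtain B0 where B0: "finite B0" "X = span B0" using spanned by blast
  let ?Z = "vec_space X :: ('x^'k) set"
  have Z: "finite (\<Union>c. axis c ` B0 :: ('x^'k) set)" "?Z = span (\<Union>c. axis c ` B0)"
    using B0 span_vec_eq[of B0] by auto
  obtain CA where CA: "CA \<ge> 0" "\<forall>\<xi> \<eta>. lpk_mem 2 \<Omega> \<xi> \<longrightarrow> lpk_mem 2 \<Omega> \<eta> \<longrightarrow> \<bar>A \<xi> \<eta>\<bar> \<le> CA * lpk_norm 2 \<Omega> \<xi> * lpk_norm 2 \<Omega> \<eta>"
    by (rule A_bound)
  have mZ: "lpk_mem 2 \<Omega> (\<lambda>c. Hs (u $ c))" "lpk_mem 4 \<Omega> (\<lambda>c. Gr (u $ c))" if "u \<in> ?Z" for u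
    using that lpk_mem_disc[where u="\<lambda>c. u $ c"] by auto
  define p where "p u = lpk_norm 2 \<Omega> (\<lambda>c. Hs (u $ c))" for u :: "'x^'k"
  have psemi: "seminorm_on ?Z p"
  proof -
    have "seminorm_on ?Z (\<lambda>u. lp_norm 2 \<Omega> (\<lambda>x. \<chi> c. Hs (u $ c) x))"
      by (rule ae_linear_seminorm[OF _ _ ae_linear_vec[OF lin(3)] subspace_vec_space[OF subspace_X]])
        (use mem in \<open>auto simp: lp_mem_nth_iff\<close>)
    then show ?thesis by (simp add: p_def[abs_def] lpk_norm_eq)
  qed
  have pdef: "\<forall>u\<in>?Z. p u = 0 \<longrightarrow> u = 0"
  proof (intro ballI impI)
    fix u assume u: "u \<in> ?Z" and 0: "p u = 0"
    have "nD (u $ c) \<le> 0" for c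
      using lp_norm_le_lpk_norm[where F="\<lambda>c. Hs (u $ c)" and p=2 and \<Omega>=\<Omega> and c=c] u mem 0 by (simp add: p_def)
    then have "nD (u $ c) = 0" for c using lp_norm_nonneg[of 2 \<Omega> "Hs (u $ c)"] by (metis order_antisym)
    then have "u $ c = 0" for c using definite u by auto
    then show "u = 0" by (simp add: vec_eq_iff)
  qed
  \<comment> \<open>The scheme is a Galerkin equation on tuples, with a trilinear form that reads
    its first argument through \<open>Hs\<close> and the other two through \<open>Gr\<close>. The
    bounds \<open>C\<close> in the single slots serve to show that the forms ignore null
    sets.\<close>
  have "\<exists>u\<in>?Z. \<forall>v\<in>?Z. A (\<lambda>c. Hs (u $ c)) (\<lambda>c. Hs (v $ c)) + B (\<lambda>c. Hs (u $ c)) (\<lambda>c. Gr (u $ c)) (\<lambda>c. Gr (v $ c)) = L (\<lambda>c. E (v $ c))"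
  proof (rule galerkin_solution_exists[OF Z psemi pdef, where b="\<lambda>u v w. B (\<lambda>c. Hs (u $ c)) (\<lambda>c. Gr (v $ c)) (\<lambda>c. Gr (w $ c))" and \<alpha>=alpha])
    fix v w assume v: "v \<in> ?Z" and w: "w \<in> ?Z"
    note mv = mZ[OF v] and mw = mZ[OF w]
    show "linear_on_set ?Z (\<lambda>u. A (\<lambda>c. Hs (u $ c)) (\<lambda>c. Hs (v $ c)))"
    proof (rule linear_on_compose[where f="\<lambda>\<xi>. A \<xi> (\<lambda>c. Hs (v $ c))" and p=2 and C="CA * lpk_norm 2 \<Omega> (\<lambda>c. Hs (v $ c))"])
      show "\<bar>A g (\<lambda>c. Hs (v $ c))\<bar> \<le> CA * lpk_norm 2 \<Omega> (\<lambda>c. Hs (v $ c)) * lpk_norm 2 \<Omega> g" if "lpk_mem 2 \<Omega> g" for g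
        using CA(2)[rule_format, OF that mv(1)] by (simp add: mult_ac)
    qed (use mem lin mv A_bilin1 in auto)
    show "linear_on_set ?Z (\<lambda>u. A (\<lambda>c. Hs (v $ c)) (\<lambda>c. Hs (u $ c)))"
    proof (rule linear_on_compose[where f="\<lambda>\<xi>. A (\<lambda>c. Hs (v $ c)) \<xi>" and p=2 and C="CA * lpk_norm 2 \<Omega> (\<lambda>c. Hs (v $ c))"])
      show "\<bar>A (\<lambda>c. Hs (v $ c)) g\<bar> \<le> CA * lpk_norm 2 \<Omega> (\<lambda>c. Hs (v $ c)) * lpk_norm 2 \<Omega> g" if "lpk_mem 2 \<Omega> g" for g
        using CA(2)[rule_format, OF mv(1) that] by (simp add: mult_ac)
    qed (use mem lin mv A_bilin2 in auto)
    show "linear_on_set ?Z (\<lambda>u. B (\<lambda>c. Hs (u $ c)) (\<lambda>c. Gr (v $ c)) (\<lambda>c. Gr (w $ c)))"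
    proof (rule linear_on_compose[where f="\<lambda>\<xi>. B \<xi> (\<lambda>c. Gr (v $ c)) (\<lambda>c. Gr (w $ c))" and p=2
          and C="nB * lpk_norm 4 \<Omega> (\<lambda>c. Gr (v $ c)) * lpk_norm 4 \<Omega> (\<lambda>c. Gr (w $ c))"])
      show "\<bar>B g (\<lambda>c. Gr (v $ c)) (\<lambda>c. Gr (w $ c))\<bar> \<le> nB * lpk_norm 4 \<Omega> (\<lambda>c. Gr (v $ c)) * lpk_norm 4 \<Omega> (\<lambda>c. Gr (w $ c)) * lpk_norm 2 \<Omega> g"
        if "lpk_mem 2 \<Omega> g" for g
        using B_bound[OF that mv(2) mw(2)] by (simp add: mult_ac)
    qed (use mem lin mv mw B_lin1 in auto)
    show "linear_on_set ?Z (\<lambda>u. B (\<lambda>c. Hs (v $ c)) (\<lambda>c. Gr (u $ c)) (\<lambda>c. Gr (w $ c)))"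
    proof (rule linear_on_compose[where f="\<lambda>\<xi>. B (\<lambda>c. Hs (v $ c)) \<xi> (\<lambda>c. Gr (w $ c))" and p=4
          and C="nB * lpk_norm 2 \<Omega> (\<lambda>c. Hs (v $ c)) * lpk_norm 4 \<Omega> (\<lambda>c. Gr (w $ c))"])
      show "\<bar>B (\<lambda>c. Hs (v $ c)) g (\<lambda>c. Gr (w $ c))\<bar> \<le> nB * lpk_norm 2 \<Omega> (\<lambda>c. Hs (v $ c)) * lpk_norm 4 \<Omega> (\<lambda>c. Gr (w $ c)) * lpk_norm 4 \<Omega> g"
        if "lpk_mem 4 \<Omega> g" for g
        using B_bound[OF mv(1) that mw(2)] by (simp add: mult_ac)
    qed (use mem lin mv mw B_lin2 in auto)
    show "linear_on_set ?Z (\<lambda>u. B (\<lambda>c. Hs (v $ c)) (\<lambda>c. Gr (w $ c)) (\<lambda>c. Gr (u $ c)))"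
    proof (rule linear_on_compose[where f="\<lambda>\<xi>. B (\<lambda>c. Hs (v $ c)) (\<lambda>c. Gr (w $ c)) \<xi>" and p=4
          and C="nB * lpk_norm 2 \<Omega> (\<lambda>c. Hs (v $ c)) * lpk_norm 4 \<Omega> (\<lambda>c. Gr (w $ c))"])
      show "\<bar>B (\<lambda>c. Hs (v $ c)) (\<lambda>c. Gr (w $ c)) g\<bar> \<le> nB * lpk_norm 2 \<Omega> (\<lambda>c. Hs (v $ c)) * lpk_norm 4 \<Omega> (\<lambda>c. Gr (w $ c)) * lpk_norm 4 \<Omega> g"
        if "lpk_mem 4 \<Omega> g" for g
        using B_bound[OF mv(1) mw(2) that] by (simp add: mult_ac)
    qed (use mem lin mv mw B_lin3 in auto)
    show "B (\<lambda>c. Hs (v $ c)) (\<lambda>c. Gr (w $ c)) (\<lambda>c. Gr (w $ c)) = 0" by (rule B_skew[OF mv(1) mw(2)])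
    show "alpha * (p v)\<^sup>2 \<le> A (\<lambda>c. Hs (v $ c)) (\<lambda>c. Hs (v $ c))" unfolding p_def by (rule A_coer[OF mv(1)])
  qed (rule linear_on_L alpha_pos)+
  then obtain u where u: "u \<in> ?Z" "\<forall>v\<in>?Z. A (\<lambda>c. Hs (u $ c)) (\<lambda>c. Hs (v $ c)) + B (\<lambda>c. Hs (u $ c)) (\<lambda>c. Gr (u $ c)) (\<lambda>c. Gr (v $ c)) = L (\<lambda>c. E (v $ c))"
    by (rule bexE)
  have "disc_sol X Gr Hs E A B L (\<lambda>c. u $ c)"
    unfolding disc_sol_def
  proof (intro conjI allI impI)
    show "u $ c \<in> X" for c using u(1) by simp
    fix \<Phi> :: "'k \<Rightarrow> 'x" assume "\<forall>c. \<Phi> c \<in> X"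
    then have "(\<chi> c. \<Phi> c) \<in> ?Z" by simp
    from bspec[OF u(2) this]
    show "A (\<lambda>c. Hs (u $ c)) (\<lambda>c. Hs (\<Phi> c)) + B (\<lambda>c. Hs (u $ c)) (\<lambda>c. Gr (u $ c)) (\<lambda>c. Gr (\<Phi> c)) = L (\<lambda>c. E (\<Phi> c))" by simp
  qed
  then show ?thesis by blast
qed

text \<open>Subtracting the equations tested with \<open>d\<close> leaves
  \<open>B ?Hd ?G1 ?Gd\<close>, because exchanging \<open>?G1\<close> for \<open>?G2\<close> beside
  \<open>?H2\<close> costs \<open>B ?H2 ?Gd ?Gd\<close>, which is zero. Bounding the gradients by
  \<open>CD\<close> and the first solution by \<open>disc_sol_bound\<close> produces the constants
  of the condition.\<close>

lemma disc_sol_unique: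
  assumes small: "nL * nB * CD\<^sup>2 * \<kappa> * C1eq < alpha\<^sup>2"
    and sol: "disc_sol X Gr Hs E A B L \<Psi>1" "disc_sol X Gr Hs E A B L \<Psi>2"
  shows "\<Psi>1 = \<Psi>2"
proof -
  have X: "\<Psi>1 c \<in> X" "\<Psi>2 c \<in> X" for c using sol by (auto simp: disc_sol_def)
  define d where "d c = \<Psi>1 c - \<Psi>2 c" for c
  have dX: "d c \<in> X" for c unfolding d_def using X subspace_X by (simp add: subspace_diff)
  note m1 = lpk_mem_disc[where u=\<Psi>1, OF X(1)] and m2 = lpk_mem_disc[where u=\<Psi>2, OF X(2)] and md = lpk_mem_disc[where u=d, OF dX]
  let ?H1 = "\<lambda>c. Hs (\<Psi>1 c)" and ?H2 = "\<lambda>c. Hs (\<Psi>2 c)" and ?G1 = "\<lambda>c. Gr (\<Psi>1 c)" and ?G2 = "\<lambda>c. Gr (\<Psi>2 c)"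
    and ?Hd = "\<lambda>c. Hs (d c)" and ?Gd = "\<lambda>c. Gr (d c)"
  have ae: "AE x in lebesgue_on \<Omega>. T (d c) x = T (\<Psi>1 c) x - T (\<Psi>2 c) x"
    if "ae_linear_on \<Omega> X T" for T :: "'x \<Rightarrow> real^'d \<Rightarrow> 'v::real_vector" and c
  proof -
    have "AE x in lebesgue_on \<Omega>. T (1 *\<^sub>R \<Psi>1 c + (-1) *\<^sub>R \<Psi>2 c) x = 1 *\<^sub>R T (\<Psi>1 c) x + (-1) *\<^sub>R T (\<Psi>2 c) x"
      using that X unfolding ae_linear_on_def by blast
    then show ?thesis by (simp add: d_def)
  qed
  \<comment> \<open>\<open>Hs\<close> is linear only almost everywhere, so \<open>?Hd\<close> and
    the difference of the two Hessians differ by a function of norm zero, which the bounds of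
    \<open>A\<close> and \<open>B\<close> turn into equal values.\<close>
  have zH: "lpk_norm 2 \<Omega> (\<lambda>c x. ?Hd c x - (?H1 c x - ?H2 c x)) = 0"
  proof -
    have mm: "lp_mem 2 \<Omega> (\<lambda>x. ?H1 c x - ?H2 c x)" for c using mem(3) X by (auto intro: lp_mem_diff)
    have "lp_norm 2 \<Omega> (\<lambda>x. ?Hd c x - (?H1 c x - ?H2 c x)) = 0" for c
      using ae[OF lin(3)] lp_norm_diff_eq_0_AE[OF _ mem(3)[OF dX] mm] by simp
    moreover have "lp_mem 2 \<Omega> (\<lambda>x. ?Hd c x - (?H1 c x - ?H2 c x))" for c by (rule lp_mem_diff[OF _ mem(3)[OF dX] mm]) simp
    ultimately have "lpk_norm 2 \<Omega> (\<lambda>c x. ?Hd c x - (?H1 c x - ?H2 c x)) \<le> (\<Sum>c\<in>(UNIV::'k set). 0)"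
      using lpk_norm_le_sum[where F="\<lambda>c x. ?Hd c x - (?H1 c x - ?H2 c x)" and p=2 and \<Omega>=\<Omega>] by simp
    then show ?thesis using lpk_norm_nonneg[of 2 \<Omega> "\<lambda>c x. ?Hd c x - (?H1 c x - ?H2 c x)"] by simp
  qed
  have zG: "lpk_norm 4 \<Omega> (\<lambda>c x. ?Gd c x - (?G1 c x - ?G2 c x)) = 0"
  proof -
    have mm: "lp_mem 4 \<Omega> (\<lambda>x. ?G1 c x - ?G2 c x)" for c using mem(2) X by (auto intro: lp_mem_diff)
    have "lp_norm 4 \<Omega> (\<lambda>x. ?Gd c x - (?G1 c x - ?G2 c x)) = 0" for c
      using ae[OF lin(2)] lp_norm_diff_eq_0_AE[OF _ mem(2)[OF dX] mm] by simp
    moreover have "lp_mem 4 \<Omega> (\<lambda>x. ?Gd c x - (?G1 c x - ?G2 c x))" for c by (rule lp_mem_diff[OF _ mem(2)[OF dX] mm]) simp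
    ultimately have "lpk_norm 4 \<Omega> (\<lambda>c x. ?Gd c x - (?G1 c x - ?G2 c x)) \<le> (\<Sum>c\<in>(UNIV::'k set). 0)"
      using lpk_norm_le_sum[where F="\<lambda>c x. ?Gd c x - (?G1 c x - ?G2 c x)" and p=4 and \<Omega>=\<Omega>] by simp
    then show ?thesis using lpk_norm_nonneg[of 4 \<Omega> "\<lambda>c x. ?Gd c x - (?G1 c x - ?G2 c x)"] by simp
  qed
  obtain CA where CA: "CA \<ge> 0" "\<forall>\<xi> \<eta>. lpk_mem 2 \<Omega> \<xi> \<longrightarrow> lpk_mem 2 \<Omega> \<eta> \<longrightarrow> \<bar>A \<xi> \<eta>\<bar> \<le> CA * lpk_norm 2 \<Omega> \<xi> * lpk_norm 2 \<Omega> \<eta>"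
    by (rule A_bound)
  have m12: "lpk_mem 2 \<Omega> (\<lambda>c x. ?H1 c x - ?H2 c x)" "lpk_mem 4 \<Omega> (\<lambda>c x. ?G1 c x - ?G2 c x)"
    using m1 m2 by (auto intro: lpk_mem_diff)
  have A12: "A ?Hd ?Hd = A ?H1 ?Hd - A ?H2 ?Hd"
  proof -
    have "\<bar>A (\<lambda>c x. ?Hd c x - (?H1 c x - ?H2 c x)) ?Hd\<bar> \<le> CA * lpk_norm 2 \<Omega> (\<lambda>c x. ?Hd c x - (?H1 c x - ?H2 c x)) * lpk_norm 2 \<Omega> ?Hd"
      using CA(2) lpk_mem_diff[OF _ md(1) m12(1)] md(1) by auto
    then have "A (\<lambda>c x. ?Hd c x - (?H1 c x - ?H2 c x)) ?Hd = 0" unfolding zH by simp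
    then show ?thesis
      unfolding A_diff1[OF md(1) m12(1) md(1)] A_diff1[OF m1(1) m2(1) md(1)] by simp
  qed
  have B12: "B ?Hd ?G1 ?Gd = B ?H1 ?G1 ?Gd - B ?H2 ?G1 ?Gd"
  proof -
    have "\<bar>B (\<lambda>c x. ?Hd c x - (?H1 c x - ?H2 c x)) ?G1 ?Gd\<bar> \<le> nB * (lpk_norm 2 \<Omega> (\<lambda>c x. ?Hd c x - (?H1 c x - ?H2 c x)) * lpk_norm 4 \<Omega> ?G1 * lpk_norm 4 \<Omega> ?Gd)"
      by (rule B_bound[OF lpk_mem_diff[OF _ md(1) m12(1)] m1(2) md(2)]) simp
    then have "B (\<lambda>c x. ?Hd c x - (?H1 c x - ?H2 c x)) ?G1 ?Gd = 0" unfolding zH by simp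
    then show ?thesis
      unfolding B_diff1[OF md(1) m12(1) m1(2) md(2)] B_diff1[OF m1(1) m2(1) m1(2) md(2)] by simp
  qed
  \<comment> \<open>The vanishing of \<open>B\<close> on equal last arguments, transferred from
    \<open>?Gd\<close> to the difference of the discrete gradients.\<close>
  have Bsk: "0 = B ?H2 ?G1 ?Gd - B ?H2 ?G2 ?Gd"
  proof -
    have "\<bar>B ?H2 (\<lambda>c x. ?Gd c x - (?G1 c x - ?G2 c x)) ?Gd\<bar> \<le> nB * (lpk_norm 2 \<Omega> ?H2 * lpk_norm 4 \<Omega> (\<lambda>c x. ?Gd c x - (?G1 c x - ?G2 c x)) * lpk_norm 4 \<Omega> ?Gd)"
      by (rule B_bound[OF m2(1) lpk_mem_diff[OF _ md(2) m12(2)] md(2)]) simp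
    then have "B ?H2 (\<lambda>c x. ?Gd c x - (?G1 c x - ?G2 c x)) ?Gd = 0" unfolding zG by simp
    then show ?thesis
      unfolding B_diff2[OF m2(1) md(2) m12(2) md(2)] B_diff2[OF m2(1) m1(2) m2(2) md(2)] B_skew[OF m2(1) md(2)] by simp
  qed
  have "A ?H1 ?Hd + B ?H1 ?G1 ?Gd = L (\<lambda>c. E (d c))" "A ?H2 ?Hd + B ?H2 ?G2 ?Gd = L (\<lambda>c. E (d c))"
    using sol dX by (auto simp: disc_sol_def)
  then have "A ?Hd ?Hd = - B ?Hd ?G1 ?Gd" using A12 B12 Bsk by linarith
  also have "\<dots> \<le> nB * (lpk_norm 2 \<Omega> ?Hd * lpk_norm 4 \<Omega> ?G1 * lpk_norm 4 \<Omega> ?Gd)"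
    using B_bound[OF md(1) m1(2) md(2)] by linarith
  also have "\<dots> \<le> nB * (lpk_norm 2 \<Omega> ?Hd * (CD * lpk_norm 2 \<Omega> ?H1) * (CD * lpk_norm 2 \<Omega> ?Hd))"
    by (intro mult_left_mono mult_mono lpk_norm_Gr_le[where u=\<Psi>1, OF X(1)] lpk_norm_Gr_le[where u=d, OF dX] nB_nonneg)
      (auto intro!: mult_nonneg_nonneg C_HD_nonneg)
  finally have "alpha * (lpk_norm 2 \<Omega> ?Hd)\<^sup>2 \<le> nB * (lpk_norm 2 \<Omega> ?Hd * (CD * lpk_norm 2 \<Omega> ?H1) * (CD * lpk_norm 2 \<Omega> ?Hd))"
    using A_coer[OF md(1)] by linarith
  \<comment> \<open>The extra factor matches the left side of \<open>disc_sol_bound\<close>; hence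
    the square of \<open>alpha\<close> in the condition.\<close>
  then have "alpha * (alpha * (lpk_norm 2 \<Omega> ?Hd)\<^sup>2) \<le> alpha * (nB * (lpk_norm 2 \<Omega> ?Hd * (CD * lpk_norm 2 \<Omega> ?H1) * (CD * lpk_norm 2 \<Omega> ?Hd)))"
    using alpha_pos by (intro mult_left_mono) auto
  also have "\<dots> = (nB * CD\<^sup>2 * (lpk_norm 2 \<Omega> ?Hd)\<^sup>2) * (alpha * lpk_norm 2 \<Omega> ?H1)"
    by (simp add: power2_eq_square mult_ac)
  also have "\<dots> \<le> (nB * CD\<^sup>2 * (lpk_norm 2 \<Omega> ?Hd)\<^sup>2) * (nL * C1 * \<kappa>)"
    by (intro mult_left_mono disc_sol_bound[OF sol(1)]) (use nB_nonneg in auto)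
  finally have "alpha\<^sup>2 * (lpk_norm 2 \<Omega> ?Hd)\<^sup>2 \<le> (nL * nB * CD\<^sup>2 * \<kappa> * C1) * (lpk_norm 2 \<Omega> ?Hd)\<^sup>2"
    by (simp add: power2_eq_square mult_ac)
  \<comment> \<open>If \<open>C1eq \<le> 0\<close>, the truncated constant is zero and positivity of
    \<open>alpha\<close> is enough.\<close>
  moreover have "nL * nB * CD\<^sup>2 * \<kappa> * C1 < alpha\<^sup>2" using small alpha_pos by (cases "C1eq \<le> 0") (simp_all add: max_def)
  ultimately have "lpk_norm 2 \<Omega> ?Hd = 0"
    by (metis mult_right_less_imp_less not_less zero_less_power2 zero_le_power2 mult_less_cancel_right_pos)
  then have "nD (d c) \<le> 0" for c using lp_norm_le_lpk_norm[where F="?Hd" and p=2 and \<Omega>=\<Omega> and c=c] mem(3)[OF dX] by simp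
  then have "d c = 0" for c using definite dX lp_norm_nonneg[of 2 \<Omega> "Hs (d c)"] by (metis order_antisym)
  then show ?thesis by (auto simp: d_def fun_eq_iff)
qed

end

section \<open>Passage to the limit\<close>

text \<open>Collects properties that pass to subsequences, so that the limit argument can be
  interpreted again along a subsequence extracted by compactness.\<close>

locale hessian_scheme_seq = hessian_forms \<Omega> A B L alpha C1eq
  for \<Omega> :: "(real^'d::finite) set"
    and A :: "('k::finite \<Rightarrow> real^'d \<Rightarrow> real^'d^'d) \<Rightarrow> ('k \<Rightarrow> real^'d \<Rightarrow> real^'d^'d) \<Rightarrow> real"
    and B L alpha C1eq +
  fixes X :: "nat \<Rightarrow> 'x::real_vector set"
    and PiD :: "nat \<Rightarrow> 'x \<Rightarrow> real^'d \<Rightarrow> real"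
    and Gr :: "nat \<Rightarrow> 'x \<Rightarrow> real^'d \<Rightarrow> real^'d"
    and Hs :: "nat \<Rightarrow> 'x \<Rightarrow> real^'d \<Rightarrow> real^'d^'d"
    and E :: "nat \<Rightarrow> 'x \<Rightarrow> real^'d \<Rightarrow> real"
  assumes HD: "\<And>m. is_HD \<Omega> (X m) (PiD m) (Gr m) (Hs m)"
    and companion: "\<And>m. is_companion \<Omega> (X m) (E m)"
    and coercive: "HD_coercive \<Omega> X PiD Gr Hs"
    and consistent: "HD_consistent \<Omega> X PiD Gr Hs"
    and limit_conforming: "HD_limit_conforming \<Omega> X PiD Gr Hs"
    and omega_lim: "(\<lambda>m. omegaE \<Omega> (X m) (Gr m) (Hs m) (E m)) \<longlonglongrightarrow> 0"
begin

lemma scheme: "hessian_scheme \<Omega> A B L alpha C1eq (X m) (PiD m) (Gr m) (Hs m) (E m)"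
  by unfold_locales (rule HD companion)+

sublocale S: hessian_scheme \<Omega> A B L alpha C1eq "X m" "PiD m" "Gr m" "Hs m" "E m" for m
  by (rule scheme)

lemma C_bound:
  obtains CP where "CP \<ge> 0" "\<forall>m. C_HD \<Omega> (X m) (PiD m) (Gr m) (Hs m) \<le> CP"
proof -
  obtain CP where "\<forall>m. C_HD \<Omega> (X m) (PiD m) (Gr m) (Hs m) \<le> CP" using coercive by (auto simp: HD_coercive_def)
  moreover from this have "0 \<le> CP" using S.C_HD_nonneg order_trans by blast
  ultimately show thesis using that by blast
qed

text \<open>The coercivity constant and the boundedness of the convergent sequence of
  \<open>omegaE\<close> values make the a priori bound uniform in \<open>m\<close>.\<close>

lemma disc_sol_bounded:
  obtains M where "M \<ge> 0" "\<forall>m \<Psi>. disc_sol (X m) (Gr m) (Hs m) (E m) A B L \<Psi> \<longrightarrow> lpk_norm 2 \<Omega> (\<lambda>c. Hs m (\<Psi> c)) \<le> M"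
proof -
  obtain CP where CP: "CP \<ge> 0" "\<forall>m. C_HD \<Omega> (X m) (PiD m) (Gr m) (Hs m) \<le> CP" by (rule C_bound)
  have "Bseq (\<lambda>m. omegaE \<Omega> (X m) (Gr m) (Hs m) (E m))" using omega_lim by (auto intro: convergent_imp_Bseq convergentI)
  then obtain W where W: "W > 0" "\<forall>m. norm (omegaE \<Omega> (X m) (Gr m) (Hs m) (E m)) \<le> W" by (rule BseqE)
  let ?K = "W + measure lebesgue \<Omega> powr (1/4) * CP"
  show thesis
  proof (rule that[of "nL * C1 * ?K / alpha"])
    show "0 \<le> nL * C1 * ?K / alpha" using nL_nonneg W(1) CP(1) alpha_pos by simp
    show "\<forall>m \<Psi>. disc_sol (X m) (Gr m) (Hs m) (E m) A B L \<Psi> \<longrightarrow> lpk_norm 2 \<Omega> (\<lambda>c. Hs m (\<Psi> c)) \<le> nL * C1 * ?K / alpha"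
    proof (intro allI impI)
      fix m \<Psi> assume "disc_sol (X m) (Gr m) (Hs m) (E m) A B L \<Psi>"
      from S.disc_sol_bound[OF this]
      have "alpha * lpk_norm 2 \<Omega> (\<lambda>c. Hs m (\<Psi> c)) \<le> nL * C1 * (omegaE \<Omega> (X m) (Gr m) (Hs m) (E m) + measure lebesgue \<Omega> powr (1/4) * C_HD \<Omega> (X m) (PiD m) (Gr m) (Hs m))" .
      also have "\<dots> \<le> nL * C1 * ?K"
      proof (intro mult_left_mono add_mono)
        show "omegaE \<Omega> (X m) (Gr m) (Hs m) (E m) \<le> W" using W(2) by (metis abs_le_D1 real_norm_def)
        show "C_HD \<Omega> (X m) (PiD m) (Gr m) (Hs m) \<le> CP" using CP(2) by blast
      qed (use nL_nonneg in auto)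
      finally show "lpk_norm 2 \<Omega> (\<lambda>c. Hs m (\<Psi> c)) \<le> nL * C1 * ?K / alpha"
        using alpha_pos by (simp add: pos_le_divide_eq mult.commute)
    qed
  qed
qed

text \<open>Near-minimisers of \<open>S_HD\<close> with slack \<open>inverse (real (Suc m))\<close>:
  consistency drives the sum of three nonnegative errors to zero, hence each of them.\<close>

lemma interpolant_exists:
  assumes u: "in_H20 \<Omega> \<phi> G H"
  obtains w where "\<forall>m. w m \<in> X m" "lp_tendsto 2 \<Omega> (\<lambda>m. PiD m (w m)) \<phi>"
    "lp_tendsto 4 \<Omega> (\<lambda>m. Gr m (w m)) G" "lp_tendsto 2 \<Omega> (\<lambda>m. Hs m (w m)) H"
proof -
  let ?f = "\<lambda>m w. lp_norm 2 \<Omega> (\<lambda>x. PiD m w x - \<phi> x) + lp_norm 4 \<Omega> (\<lambda>x. Gr m w x - G x) + lp_norm 2 \<Omega> (\<lambda>x. Hs m w x - H x)"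
  have "\<forall>m. \<exists>w. w \<in> X m \<and> ?f m w < S_HD \<Omega> (X m) (PiD m) (Gr m) (Hs m) \<phi> G H + inverse (real (Suc m))"
  proof
    fix m
    show "\<exists>w. w \<in> X m \<and> ?f m w < S_HD \<Omega> (X m) (PiD m) (Gr m) (Hs m) \<phi> G H + inverse (real (Suc m))"
      using S.S_HD_near_min[where m=m and e="inverse (real (Suc m))" and \<phi>=\<phi> and G=G and H=H] by auto
  qed
  then obtain w where w: "\<forall>m. w m \<in> X m \<and> ?f m (w m) < S_HD \<Omega> (X m) (PiD m) (Gr m) (Hs m) \<phi> G H + inverse (real (Suc m))"
    by (rule choice[THEN exE])
  have "(\<lambda>m. S_HD \<Omega> (X m) (PiD m) (Gr m) (Hs m) \<phi> G H) \<longlonglongrightarrow> 0" using consistent u unfolding HD_consistent_def by blast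
  from tendsto_add[OF this LIMSEQ_inverse_real_of_nat]
  have up: "(\<lambda>m. S_HD \<Omega> (X m) (PiD m) (Gr m) (Hs m) \<phi> G H + inverse (real (Suc m))) \<longlonglongrightarrow> 0" by simp
  have f0: "(\<lambda>m. ?f m (w m)) \<longlonglongrightarrow> 0"
  proof (rule Lim_null_comparison[OF always_eventually up], intro allI)
    fix m
    have "0 \<le> ?f m (w m)" by simp
    then show "norm (?f m (w m)) \<le> S_HD \<Omega> (X m) (PiD m) (Gr m) (Hs m) \<phi> G H + inverse (real (Suc m))"
      using w[rule_format, of m] by simp
  qed
  have f1: "(\<lambda>m. lp_norm 2 \<Omega> (\<lambda>x. PiD m (w m) x - \<phi> x) + lp_norm 4 \<Omega> (\<lambda>x. Gr m (w m) x - G x)) \<longlonglongrightarrow> 0"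
    by (rule tendsto_add_nonneg_0(1)[OF f0]) auto
  show thesis
  proof (rule that)
    show "\<forall>m. w m \<in> X m" using w by blast
    show "lp_tendsto 2 \<Omega> (\<lambda>m. PiD m (w m)) \<phi>" by (rule tendsto_add_nonneg_0(1)[OF f1]) auto
    show "lp_tendsto 4 \<Omega> (\<lambda>m. Gr m (w m)) G" by (rule tendsto_add_nonneg_0(2)[OF f1]) auto
    show "lp_tendsto 2 \<Omega> (\<lambda>m. Hs m (w m)) H" by (rule tendsto_add_nonneg_0(2)[OF f0]) auto
  qed
qed

text \<open>Coercivity and consistency transfer the discrete bound on \<open>Gr\<close> to test functions, so the
  embedding of \<open>H\<^sup>2\<^sub>0\<close> gradients into \<open>L\<^sup>4\<close> holds in any dimension in which such a sequence exists.\<close>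
lemma in_H20_grad_mem_4:
  assumes u: "in_H20 \<Omega> u G H"
  shows "lp_mem 4 \<Omega> G"
proof -
  obtain CP where CP: "CP \<ge> 0" "\<forall>m. C_HD \<Omega> (X m) (PiD m) (Gr m) (Hs m) \<le> CP" by (rule C_bound)
  show ?thesis
  proof (rule in_H20_grad_L4[OF om CP(1) _ u])
    fix \<phi> assume \<phi>: "test_fun \<Omega> \<phi>"
    obtain w where w: "\<forall>m. w m \<in> X m" "lp_tendsto 2 \<Omega> (\<lambda>m. PiD m (w m)) \<phi>"
      "lp_tendsto 4 \<Omega> (\<lambda>m. Gr m (w m)) (cgrad \<phi>)" "lp_tendsto 2 \<Omega> (\<lambda>m. Hs m (w m)) (chess \<phi>)"
      by (rule interpolant_exists[OF in_H20_test_fun[OF \<phi> om]])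
    have wX: "w m \<in> X m" for m using w(1) by blast
    have c: "lp_mem 4 \<Omega> (cgrad \<phi>)" "lp_mem 2 \<Omega> (chess \<phi>)" using lp_mem_cgrad_chess[OF \<phi> _ om] by auto
    have "(\<lambda>m. lp_norm 4 \<Omega> (Gr m (w m))) \<longlonglongrightarrow> lp_norm 4 \<Omega> (cgrad \<phi>)"
      by (rule lp_tendsto_norm[OF _ S.mem(2)[OF wX] c(1) w(3)]) simp
    moreover have "(\<lambda>m. lp_norm 2 \<Omega> (Hs m (w m))) \<longlonglongrightarrow> lp_norm 2 \<Omega> (chess \<phi>)"
      by (rule lp_tendsto_norm[OF _ S.mem(3)[OF wX] c(2) w(4)]) simp
    then have "(\<lambda>m. CP * lp_norm 2 \<Omega> (Hs m (w m))) \<longlonglongrightarrow> CP * lp_norm 2 \<Omega> (chess \<phi>)" by (rule tendsto_mult_left)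
    ultimately show "lp_norm 4 \<Omega> (cgrad \<phi>) \<le> CP * lp_norm 2 \<Omega> (chess \<phi>)"
    proof (rule LIMSEQ_le)
      have "lp_norm 4 \<Omega> (Gr m (w m)) \<le> CP * lp_norm 2 \<Omega> (Hs m (w m))" for m
        using order_trans[OF S.Gr_le[OF wX] mult_right_mono[OF CP(2)[rule_format] lp_norm_nonneg]] .
      then show "\<exists>N. \<forall>n\<ge>N. lp_norm 4 \<Omega> (Gr n (w n)) \<le> CP * lp_norm 2 \<Omega> (Hs n (w n))" by blast
    qed
  qed
qed

text \<open>The gradients of the companions converge in L^2: \<open>omegaE\<close> times
  \<open>M\<close> bounds their distance from the discrete gradients, which converge in L^4. By
  \<open>L_diff_bound\<close> this suffices. It serves both for interpolants of a test function and
  for the solutions themselves.\<close>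

lemma L_companion_tendsto:
  assumes P: "\<And>m c. P m c \<in> X m" and M: "\<And>m c. lp_norm 2 \<Omega> (Hs m (P m c)) \<le> M"
    and lim: "\<And>c. lp_tendsto 4 \<Omega> (\<lambda>m. Gr m (P m c)) (G c)" and \<Phi>: "\<And>c. in_H20 \<Omega> (\<Phi> c) (G c) (H c)"
  shows "(\<lambda>m. L (\<lambda>c. E m (P m c))) \<longlonglongrightarrow> L \<Phi>"
proof -
  have "\<forall>m. \<exists>g. \<forall>c. \<exists>h. in_H20 \<Omega> (E m (P m c)) (g c) h"
  proof
    fix m
    have "\<forall>c. \<exists>g h. in_H20 \<Omega> (E m (P m c)) g h" using companion[of m] P by (auto simp: is_companion_def)
    then show "\<exists>g. \<forall>c. \<exists>h. in_H20 \<Omega> (E m (P m c)) (g c) h" by (rule choice)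
  qed
  then obtain g where g: "\<forall>m c. \<exists>h. in_H20 \<Omega> (E m (P m c)) (g m c) h" by (rule choice[THEN exE])
  have gm: "lp_mem 2 \<Omega> (g m c)" for m c using g by (auto simp: in_H20_def in_H2_def)
  have Gm: "lp_mem 2 \<Omega> (G c)" "lp_mem 4 \<Omega> (G c)" for c using \<Phi>[of c] in_H20_grad_mem_4[OF \<Phi>[of c]] by (auto simp: in_H20_def in_H2_def)
  let ?w = "\<lambda>m. omegaE \<Omega> (X m) (Gr m) (Hs m) (E m)" and ?v = "measure lebesgue \<Omega> powr (1/4)"
  have gc: "lp_tendsto 2 \<Omega> (\<lambda>m. g m c) (G c)" for c
  proof (rule Lim_null_comparison[OF always_eventually])
    have "(\<lambda>m. ?w m * M + ?v * lp_norm 4 \<Omega> (\<lambda>x. Gr m (P m c) x - G c x)) \<longlonglongrightarrow> 0 * M + ?v * 0"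
      by (intro tendsto_intros omega_lim lim)
    then show "(\<lambda>m. ?w m * M + ?v * lp_norm 4 \<Omega> (\<lambda>x. Gr m (P m c) x - G c x)) \<longlonglongrightarrow> 0" by simp
    show "\<forall>m. norm (lp_norm 2 \<Omega> (\<lambda>x. g m c x - G c x)) \<le> ?w m * M + ?v * lp_norm 4 \<Omega> (\<lambda>x. Gr m (P m c) x - G c x)"
    proof
      fix m
      have "lp_norm 2 \<Omega> (\<lambda>x. g m c x - G c x) \<le> lp_norm 2 \<Omega> (\<lambda>x. g m c x - Gr m (P m c) x) + lp_norm 2 \<Omega> (\<lambda>x. Gr m (P m c) x - G c x)"
        by (rule lp_norm_triangle3[OF _ gm S.mem_Gr_2[OF P] Gm(1)]) simp
      moreover have "lp_norm 2 \<Omega> (\<lambda>x. g m c x - Gr m (P m c) x) \<le> ?w m * M"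
      proof -
        obtain h where "in_H20 \<Omega> (E m (P m c)) (g m c) h" using g by blast
        from S.omegaE_le[OF companion P this]
        have "lp_norm 2 \<Omega> (\<lambda>x. Gr m (P m c) x - g m c x) \<le> ?w m * lp_norm 2 \<Omega> (Hs m (P m c))" .
        also have "\<dots> \<le> ?w m * M" by (rule mult_left_mono[OF M S.omegaE_nonneg[OF companion]])
        finally show ?thesis by (simp add: lp_norm_minus_commute[of 2 \<Omega> "g m c"])
      qed
      moreover have "lp_norm 2 \<Omega> (\<lambda>x. Gr m (P m c) x - G c x) \<le> ?v * lp_norm 4 \<Omega> (\<lambda>x. Gr m (P m c) x - G c x)"
        by (rule lp_4_imp_2(2)[OF lp_mem_diff[OF _ S.mem(2)[OF P] Gm(2)] om]) simp
      ultimately show "norm (lp_norm 2 \<Omega> (\<lambda>x. g m c x - G c x)) \<le> ?w m * M + ?v * lp_norm 4 \<Omega> (\<lambda>x. Gr m (P m c) x - G c x)" by simp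
    qed
  qed
  have "(\<lambda>m. lpk_norm 2 \<Omega> (\<lambda>c x. g m c x - G c x)) \<longlonglongrightarrow> 0" by (rule lpk_tendsto[OF _ gm Gm(1) gc]) simp
  then have z: "(\<lambda>m. nL * C1 * lpk_norm 2 \<Omega> (\<lambda>c x. g m c x - G c x)) \<longlonglongrightarrow> 0" using tendsto_mult_left[of _ 0 sequentially "nL * C1"] by simp
  show ?thesis
  proof (rule LIM_zero_cancel[OF Lim_null_comparison[OF always_eventually z]], intro allI)
    fix m
    have "in_H10 \<Omega> (E m (P m c)) (g m c)" for c using g in_H20_imp_in_H10 by blast
    from L_diff_bound[OF this in_H20_imp_in_H10[OF \<Phi>]]
    show "norm (L (\<lambda>c. E m (P m c)) - L \<Phi>) \<le> nL * C1 * lpk_norm 2 \<Omega> (\<lambda>c x. g m c x - G c x)" by simp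
  qed
qed

text \<open>Limit-conformity concerns the sum of two nonnegative defects; pairing with a zero field
  isolates each of them.\<close>

lemma conformity_defects_tendsto_0:
  shows "in_Hdd \<Omega> \<xi> h \<Longrightarrow> (\<lambda>m. W_HD \<Omega> (X m) (PiD m) (Hs m) \<xi> h) \<longlonglongrightarrow> 0"
    "in_Hdiv \<Omega> \<phi> g \<Longrightarrow> (\<lambda>m. What_HD \<Omega> (X m) (PiD m) (Gr m) (Hs m) \<phi> g) \<longlonglongrightarrow> 0"
proof -
  have z: "in_Hdd \<Omega> (\<lambda>x. 0) (\<lambda>x. 0)" "in_Hdiv \<Omega> (\<lambda>x. 0) (\<lambda>x. 0)" by (auto simp: in_Hdd_def in_Hdiv_def)
  have lc: "(\<lambda>m. W_HD \<Omega> (X m) (PiD m) (Hs m) \<xi> h + What_HD \<Omega> (X m) (PiD m) (Gr m) (Hs m) \<phi> g) \<longlonglongrightarrow> 0"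
    if "in_Hdd \<Omega> \<xi> h" "in_Hdiv \<Omega> \<phi> g" for \<xi> h \<phi> g
    using limit_conforming that unfolding HD_limit_conforming_def by blast
  show "(\<lambda>m. W_HD \<Omega> (X m) (PiD m) (Hs m) \<xi> h) \<longlonglongrightarrow> 0" if \<xi>: "in_Hdd \<Omega> \<xi> h"
    by (rule tendsto_add_nonneg_0(1)[OF lc[OF \<xi> z(2)] S.W_HD_nonneg[OF \<xi>] S.What_HD_nonneg[OF z(2)]])
  show "(\<lambda>m. What_HD \<Omega> (X m) (PiD m) (Gr m) (Hs m) \<phi> g) \<longlonglongrightarrow> 0" if \<phi>: "in_Hdiv \<Omega> \<phi> g"
    by (rule tendsto_add_nonneg_0(2)[OF lc[OF z(1) \<phi>] S.W_HD_nonneg[OF z(1)] S.What_HD_nonneg[OF \<phi>]])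
qed

section \<open>Identification of the limit\<close>

text \<open>Hypothesis \<open>H\<close> is weak convergence in conditional form: whenever a pairing
  converges, its limit is the pairing with \<open>H\<close>. This is what convex combinations
  provide, and limit-conformity shows that the pairings with fields in \<open>in_Hdd\<close> do
  converge.\<close>

lemma limit_in_H20:
  assumes P: "\<And>m. P m \<in> X m" and M: "\<And>m. lp_norm 2 \<Omega> (Hs m (P m)) \<le> M"
    and m: "lp_mem 2 \<Omega> u" "lp_mem 4 \<Omega> G" "lp_mem 2 \<Omega> H"
    and lim: "lp_tendsto 2 \<Omega> (\<lambda>m. PiD m (P m)) u" "lp_tendsto 4 \<Omega> (\<lambda>m. Gr m (P m)) G"
    and H: "\<And>\<xi> c. lp_mem 2 \<Omega> \<xi> \<Longrightarrow> (\<lambda>m. \<integral>x. \<xi> x \<bullet> Hs m (P m) x \<partial>lebesgue_on \<Omega>) \<longlonglongrightarrow> c \<Longrightarrow> (\<integral>x. \<xi> x \<bullet> H x \<partial>lebesgue_on \<Omega>) = c"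
  shows "in_H20 \<Omega> u G H"
proof -
  note G2 = lp_4_imp_2(1)[OF m(2) om]
  have lim2: "lp_tendsto 2 \<Omega> (\<lambda>m. Gr m (P m)) G"
  proof (rule Lim_null_comparison[OF always_eventually])
    show "(\<lambda>n. measure lebesgue \<Omega> powr (1/4) * lp_norm 4 \<Omega> (\<lambda>x. Gr n (P n) x - G x)) \<longlonglongrightarrow> 0"
      using tendsto_mult_left[OF lim(2), of "measure lebesgue \<Omega> powr (1/4)"] by simp
    show "\<forall>n. norm (lp_norm 2 \<Omega> (\<lambda>x. Gr n (P n) x - G x)) \<le> measure lebesgue \<Omega> powr (1/4) * lp_norm 4 \<Omega> (\<lambda>x. Gr n (P n) x - G x)"
      using lp_4_imp_2(2)[OF lp_mem_diff[OF _ S.mem(2)[OF P] m(2)] om] by simp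
  qed
  have M0: "0 \<le> M" using order_trans[OF lp_norm_nonneg M] .
  show ?thesis
  proof (rule in_H20_dualI[OF om m(1) G2 m(3)])
    fix \<xi> h assume \<xi>: "in_Hdd \<Omega> \<xi> h"
    then have mm: "lp_mem 2 \<Omega> \<xi>" "lp_mem 2 \<Omega> h" by (auto simp: in_Hdd_def)
    have d: "(\<lambda>n. \<integral>x. h x * PiD n (P n) x - \<xi> x \<bullet> Hs n (P n) x \<partial>lebesgue_on \<Omega>) \<longlonglongrightarrow> 0"
    proof (rule Lim_null_comparison[OF always_eventually])
      show "(\<lambda>n. W_HD \<Omega> (X n) (PiD n) (Hs n) \<xi> h * M) \<longlonglongrightarrow> 0"
        using tendsto_mult_right[OF conformity_defects_tendsto_0(1)[OF \<xi>], of M] by simp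
      show "\<forall>n. norm (\<integral>x. h x * PiD n (P n) x - \<xi> x \<bullet> Hs n (P n) x \<partial>lebesgue_on \<Omega>) \<le> W_HD \<Omega> (X n) (PiD n) (Hs n) \<xi> h * M"
        using order_trans[OF S.W_HD_le[OF \<xi> P] mult_left_mono[OF M S.W_HD_nonneg[OF \<xi>]]] by simp
    qed
    have p: "(\<lambda>n. \<integral>x. PiD n (P n) x \<bullet> h x \<partial>lebesgue_on \<Omega>) \<longlonglongrightarrow> (\<integral>x. u x \<bullet> h x \<partial>lebesgue_on \<Omega>)"
      by (rule lp_2_tendsto_inner[OF S.mem(1)[OF P] m(1) mm(2) lim(1)])
    \<comment> \<open>The pairing with the Hessian is a term that converges minus the conformity
      defect, so it converges as \<open>H\<close> requires.\<close>
    have e: "(\<integral>x. PiD n (P n) x \<bullet> h x \<partial>lebesgue_on \<Omega>) - (\<integral>x. h x * PiD n (P n) x - \<xi> x \<bullet> Hs n (P n) x \<partial>lebesgue_on \<Omega>)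
        = (\<integral>x. \<xi> x \<bullet> Hs n (P n) x \<partial>lebesgue_on \<Omega>)" for n
      using integral_lebesgue_on_mult_le(1)[OF mm(2) S.mem(1)[OF P]] lp_mem_inner_integrable[OF mm(1) S.mem(3)[OF P]]
      by (simp add: mult.commute)
    have "(\<lambda>n. \<integral>x. \<xi> x \<bullet> Hs n (P n) x \<partial>lebesgue_on \<Omega>) \<longlonglongrightarrow> (\<integral>x. u x \<bullet> h x \<partial>lebesgue_on \<Omega>)"
      using tendsto_diff[OF p d] unfolding e by simp
    from H[OF mm(1) this] show "(\<integral>x. h x * u x \<partial>lebesgue_on \<Omega>) = (\<integral>x. \<xi> x \<bullet> H x \<partial>lebesgue_on \<Omega>)" by (simp add: mult.commute)
  next
    fix \<xi> h assume \<xi>: "in_Hdiv \<Omega> \<xi> h"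
    then have mm: "lp_mem 2 \<Omega> \<xi>" "lp_mem 2 \<Omega> h" by (auto simp: in_Hdiv_def)
    have d: "(\<lambda>n. \<integral>x. Gr n (P n) x \<bullet> \<xi> x + PiD n (P n) x * h x \<partial>lebesgue_on \<Omega>) \<longlonglongrightarrow> 0"
    proof (rule Lim_null_comparison[OF always_eventually])
      show "(\<lambda>n. What_HD \<Omega> (X n) (PiD n) (Gr n) (Hs n) \<xi> h * M) \<longlonglongrightarrow> 0"
        using tendsto_mult_right[OF conformity_defects_tendsto_0(2)[OF \<xi>], of M] by simp
      show "\<forall>n. norm (\<integral>x. Gr n (P n) x \<bullet> \<xi> x + PiD n (P n) x * h x \<partial>lebesgue_on \<Omega>) \<le> What_HD \<Omega> (X n) (PiD n) (Gr n) (Hs n) \<xi> h * M"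
        using order_trans[OF S.What_HD_le[OF \<xi> P] mult_left_mono[OF M S.What_HD_nonneg[OF \<xi>]]] by simp
    qed
    have e: "(\<integral>x. Gr n (P n) x \<bullet> \<xi> x + PiD n (P n) x * h x \<partial>lebesgue_on \<Omega>)
        = (\<integral>x. Gr n (P n) x \<bullet> \<xi> x \<partial>lebesgue_on \<Omega>) + (\<integral>x. PiD n (P n) x \<bullet> h x \<partial>lebesgue_on \<Omega>)" for n
      using integral_lebesgue_on_mult_le(1)[OF S.mem(1)[OF P] mm(2)] lp_mem_inner_integrable[OF S.mem_Gr_2[OF P] mm(1)] by simp
    have "(\<lambda>n. \<integral>x. Gr n (P n) x \<bullet> \<xi> x + PiD n (P n) x * h x \<partial>lebesgue_on \<Omega>) \<longlonglongrightarrow> (\<integral>x. G x \<bullet> \<xi> x \<partial>lebesgue_on \<Omega>) + (\<integral>x. u x \<bullet> h x \<partial>lebesgue_on \<Omega>)"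
      unfolding e by (intro tendsto_add lp_2_tendsto_inner[OF S.mem_Gr_2[OF P] G2 mm(1) lim2] lp_2_tendsto_inner[OF S.mem(1)[OF P] m(1) mm(2) lim(1)])
    from LIMSEQ_unique[OF this d]
    show "(\<integral>x. \<xi> x \<bullet> G x \<partial>lebesgue_on \<Omega>) + (\<integral>x. h x * u x \<partial>lebesgue_on \<Omega>) = 0" by (simp add: inner_commute mult.commute)
  qed
qed

text \<open>The scheme is tested with interpolants of \<open>\<Phi>\<close>. The Hessians of the
  solutions are merely bounded, so every other argument is replaced by its strong limit; what
  remains is a bounded linear functional of the Hessian.\<close>

lemma form_limit_identity:
  assumes sol: "\<And>m. disc_sol (X m) (Gr m) (Hs m) (E m) A B L (\<Psi>d m)"
    and M: "\<And>m. lpk_norm 2 \<Omega> (\<lambda>c. Hs m (\<Psi>d m c)) \<le> M"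
    and Gm: "\<And>c. lp_mem 4 \<Omega> (G c)" and Glim: "\<And>c. lp_tendsto 4 \<Omega> (\<lambda>m. Gr m (\<Psi>d m c)) (G c)"
    and \<Phi>: "\<And>c. in_H20 \<Omega> (\<Phi> c) (G\<Phi> c) (H\<Phi> c)"
  shows "(\<lambda>m. A (\<lambda>c. Hs m (\<Psi>d m c)) H\<Phi> + B (\<lambda>c. Hs m (\<Psi>d m c)) G G\<Phi>) \<longlonglongrightarrow> L \<Phi>"
proof -
  obtain CP where CP: "CP \<ge> 0" "\<forall>m. C_HD \<Omega> (X m) (PiD m) (Gr m) (Hs m) \<le> CP" by (rule C_bound)
  obtain CA where CA: "CA \<ge> 0" "\<forall>\<xi> \<eta>. lpk_mem 2 \<Omega> \<xi> \<longrightarrow> lpk_mem 2 \<Omega> \<eta> \<longrightarrow> \<bar>A \<xi> \<eta>\<bar> \<le> CA * lpk_norm 2 \<Omega> \<xi> * lpk_norm 2 \<Omega> \<eta>"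
    by (rule A_bound)
  have X: "\<Psi>d m c \<in> X m" for m c using sol by (simp add: disc_sol_def)
  have M0: "0 \<le> M" using order_trans[OF lpk_norm_nonneg M] .
  have "\<forall>c. \<exists>w. (\<forall>m. w m \<in> X m) \<and> lp_tendsto 4 \<Omega> (\<lambda>m. Gr m (w m)) (G\<Phi> c) \<and> lp_tendsto 2 \<Omega> (\<lambda>m. Hs m (w m)) (H\<Phi> c)"
  proof
    fix c
    obtain w where "\<forall>m. w m \<in> X m" "lp_tendsto 2 \<Omega> (\<lambda>m. PiD m (w m)) (\<Phi> c)"
      "lp_tendsto 4 \<Omega> (\<lambda>m. Gr m (w m)) (G\<Phi> c)" "lp_tendsto 2 \<Omega> (\<lambda>m. Hs m (w m)) (H\<Phi> c)"
      by (rule interpolant_exists[OF \<Phi>[of c]])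
    then show "\<exists>w. (\<forall>m. w m \<in> X m) \<and> lp_tendsto 4 \<Omega> (\<lambda>m. Gr m (w m)) (G\<Phi> c) \<and> lp_tendsto 2 \<Omega> (\<lambda>m. Hs m (w m)) (H\<Phi> c)" by blast
  qed
  then obtain Q where Q: "\<forall>c. (\<forall>m. Q c m \<in> X m) \<and> lp_tendsto 4 \<Omega> (\<lambda>m. Gr m (Q c m)) (G\<Phi> c) \<and> lp_tendsto 2 \<Omega> (\<lambda>m. Hs m (Q c m)) (H\<Phi> c)"
    by (rule choice[THEN exE])
  define P where "P m c = Q c m" for m c
  have P: "P m c \<in> X m" "lp_tendsto 4 \<Omega> (\<lambda>m. Gr m (P m c)) (G\<Phi> c)" "lp_tendsto 2 \<Omega> (\<lambda>m. Hs m (P m c)) (H\<Phi> c)" for m c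
    using Q by (auto simp: P_def)
  have \<Phi>m: "lp_mem 4 \<Omega> (G\<Phi> c)" "lp_mem 2 \<Omega> (H\<Phi> c)" for c using \<Phi>[of c] in_H20_grad_mem_4[OF \<Phi>[of c]] by (auto simp: in_H20_def in_H2_def)
  have \<Phi>k: "lpk_mem 4 \<Omega> G\<Phi>" "lpk_mem 2 \<Omega> H\<Phi>" "lpk_mem 4 \<Omega> G" using \<Phi>m Gm by (auto simp: lpk_mem_def)
  note mP = S.lpk_mem_disc[where u="P m" and m=m for m, OF P(1)]
  note mX = S.lpk_mem_disc[where u="\<Psi>d m" and m=m for m, OF X]
  have "\<forall>c. \<exists>K. \<forall>m. norm (lp_norm 2 \<Omega> (Hs m (P m c))) \<le> K"
  proof
    fix c
    have "(\<lambda>m. lp_norm 2 \<Omega> (Hs m (P m c))) \<longlonglongrightarrow> lp_norm 2 \<Omega> (H\<Phi> c)"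
      by (rule lp_tendsto_norm[OF _ S.mem(3)[OF P(1)] \<Phi>m(2) P(3)]) simp
    then have "Bseq (\<lambda>m. lp_norm 2 \<Omega> (Hs m (P m c)))" by (auto intro: convergent_imp_Bseq convergentI)
    then show "\<exists>K. \<forall>m. norm (lp_norm 2 \<Omega> (Hs m (P m c))) \<le> K" by (auto simp: Bseq_def)
  qed
  then obtain K where K: "\<forall>c m. norm (lp_norm 2 \<Omega> (Hs m (P m c))) \<le> K c" by (rule choice[THEN exE])
  \<comment> \<open>Summation over the components gives one bound for all of them, as
    \<open>L_companion_tendsto\<close> requires.\<close>
  have KM: "lp_norm 2 \<Omega> (Hs m (P m c)) \<le> (\<Sum>c\<in>UNIV. \<bar>K c\<bar>)" for m c
  proof -
    have "lp_norm 2 \<Omega> (Hs m (P m c)) \<le> \<bar>K c\<bar>" using K[rule_format, of m c] by simp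
    also have "\<dots> \<le> (\<Sum>c\<in>UNIV. \<bar>K c\<bar>)" by (rule member_le_sum) auto
    finally show ?thesis .
  qed
  have Llim: "(\<lambda>m. L (\<lambda>c. E m (P m c))) \<longlonglongrightarrow> L \<Phi>"
    by (rule L_companion_tendsto[where P=P, OF P(1) KM P(2) \<Phi>])
  have HP: "(\<lambda>m. lpk_norm 2 \<Omega> (\<lambda>c x. Hs m (P m c) x - H\<Phi> c x)) \<longlonglongrightarrow> 0"
    by (rule lpk_tendsto[where u="\<lambda>m c. Hs m (P m c)", OF _ S.mem(3)[OF P(1)] \<Phi>m(2) P(3)]) simp
  have GP: "(\<lambda>m. lpk_norm 4 \<Omega> (\<lambda>c x. Gr m (P m c) x - G\<Phi> c x)) \<longlonglongrightarrow> 0"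
    by (rule lpk_tendsto[where u="\<lambda>m c. Gr m (P m c)", OF _ S.mem(2)[OF P(1)] \<Phi>m(1) P(2)]) simp
  have GX: "(\<lambda>m. lpk_norm 4 \<Omega> (\<lambda>c x. Gr m (\<Psi>d m c) x - G c x)) \<longlonglongrightarrow> 0"
    by (rule lpk_tendsto[where u="\<lambda>m c. Gr m (\<Psi>d m c)", OF _ S.mem(2)[OF X] Gm Glim]) simp
  let ?H = "\<lambda>m c. Hs m (\<Psi>d m c)" and ?G = "\<lambda>m c. Gr m (\<Psi>d m c)"
  \<comment> \<open>Three replacement errors: the test Hessian in \<open>A\<close>, the solution
    gradient in the second slot of \<open>B\<close>, and the test gradient in the third slot, where
    \<open>CP * M\<close> bounds the solution gradient.\<close>
  let ?e = "\<lambda>m. CA * M * lpk_norm 2 \<Omega> (\<lambda>c x. Hs m (P m c) x - H\<Phi> c x)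
     + nB * (M * lpk_norm 4 \<Omega> (\<lambda>c x. ?G m c x - G c x) * lpk_norm 4 \<Omega> G\<Phi>)
     + nB * (M * (CP * M) * lpk_norm 4 \<Omega> (\<lambda>c x. Gr m (P m c) x - G\<Phi> c x))"
  have "?e \<longlonglongrightarrow> CA * M * 0 + nB * (M * 0 * lpk_norm 4 \<Omega> G\<Phi>) + nB * (M * (CP * M) * 0)"
    by (intro tendsto_intros HP GP GX)
  then have e0: "?e \<longlonglongrightarrow> 0" by simp
  have "(\<lambda>m. (A (?H m) H\<Phi> + B (?H m) G G\<Phi>) - L (\<lambda>c. E m (P m c))) \<longlonglongrightarrow> 0"
  proof (rule Lim_null_comparison[OF always_eventually e0], intro allI)
    fix m
    have eq: "A (?H m) (\<lambda>c. Hs m (P m c)) + B (?H m) (?G m) (\<lambda>c. Gr m (P m c)) = L (\<lambda>c. E m (P m c))"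
      using sol[of m] P(1) by (simp add: disc_sol_def)
    have a: "\<bar>A (?H m) (\<lambda>c. Hs m (P m c)) - A (?H m) H\<Phi>\<bar> \<le> CA * M * lpk_norm 2 \<Omega> (\<lambda>c x. Hs m (P m c) x - H\<Phi> c x)"
    proof -
      have d: "lpk_mem 2 \<Omega> (\<lambda>c x. Hs m (P m c) x - H\<Phi> c x)" by (rule lpk_mem_diff[OF _ mP(1) \<Phi>k(2)]) simp
      have "\<bar>A (?H m) (\<lambda>c x. Hs m (P m c) x - H\<Phi> c x)\<bar> \<le> CA * lpk_norm 2 \<Omega> (?H m) * lpk_norm 2 \<Omega> (\<lambda>c x. Hs m (P m c) x - H\<Phi> c x)"
        using CA(2) mX(1) d by blast
      also have "\<dots> \<le> CA * M * lpk_norm 2 \<Omega> (\<lambda>c x. Hs m (P m c) x - H\<Phi> c x)"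
        by (intro mult_right_mono mult_left_mono M CA(1)) simp
      finally show ?thesis unfolding A_diff2[OF mP(1) \<Phi>k(2) mX(1)] .
    qed
    have b: "\<bar>B (?H m) (?G m) G\<Phi> - B (?H m) G G\<Phi>\<bar> \<le> nB * (M * lpk_norm 4 \<Omega> (\<lambda>c x. ?G m c x - G c x) * lpk_norm 4 \<Omega> G\<Phi>)"
    proof -
      have d: "lpk_mem 4 \<Omega> (\<lambda>c x. ?G m c x - G c x)" by (rule lpk_mem_diff[OF _ mX(2) \<Phi>k(3)]) simp
      have "\<bar>B (?H m) (\<lambda>c x. ?G m c x - G c x) G\<Phi>\<bar> \<le> nB * (lpk_norm 2 \<Omega> (?H m) * lpk_norm 4 \<Omega> (\<lambda>c x. ?G m c x - G c x) * lpk_norm 4 \<Omega> G\<Phi>)"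
        by (rule B_bound[OF mX(1) d \<Phi>k(1)])
      also have "\<dots> \<le> nB * (M * lpk_norm 4 \<Omega> (\<lambda>c x. ?G m c x - G c x) * lpk_norm 4 \<Omega> G\<Phi>)"
        by (intro mult_left_mono mult_right_mono M nB_nonneg) auto
      finally show ?thesis unfolding B_diff2[OF mX(1) mX(2) \<Phi>k(3) \<Phi>k(1)] .
    qed
    have c: "\<bar>B (?H m) (?G m) (\<lambda>c. Gr m (P m c)) - B (?H m) (?G m) G\<Phi>\<bar> \<le> nB * (M * (CP * M) * lpk_norm 4 \<Omega> (\<lambda>c x. Gr m (P m c) x - G\<Phi> c x))"
    proof -
      have d: "lpk_mem 4 \<Omega> (\<lambda>c x. Gr m (P m c) x - G\<Phi> c x)" by (rule lpk_mem_diff[OF _ mP(2) \<Phi>k(1)]) simp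
      have g: "lpk_norm 4 \<Omega> (?G m) \<le> CP * M"
        by (rule order_trans[OF S.lpk_norm_Gr_le[where u="\<Psi>d m", OF X] mult_mono[OF CP(2)[rule_format] M CP(1) lpk_norm_nonneg]])
      have "\<bar>B (?H m) (?G m) (\<lambda>c x. Gr m (P m c) x - G\<Phi> c x)\<bar> \<le> nB * (lpk_norm 2 \<Omega> (?H m) * lpk_norm 4 \<Omega> (?G m) * lpk_norm 4 \<Omega> (\<lambda>c x. Gr m (P m c) x - G\<Phi> c x))"
        by (rule B_bound[OF mX(1) mX(2) d])
      also have "\<dots> \<le> nB * (M * (CP * M) * lpk_norm 4 \<Omega> (\<lambda>c x. Gr m (P m c) x - G\<Phi> c x))"
        by (intro mult_left_mono mult_right_mono mult_mono M g nB_nonneg) (use M0 in auto)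
      finally show ?thesis unfolding B_diff3[OF mX(1) mX(2) mP(2) \<Phi>k(1)] .
    qed
    show "norm ((A (?H m) H\<Phi> + B (?H m) G G\<Phi>) - L (\<lambda>c. E m (P m c))) \<le> ?e m"
      using a b c eq unfolding real_norm_def by linarith
  qed
  from tendsto_add[OF this Llim] show ?thesis by simp
qed

text \<open>The hypotheses fix the limits of functions and gradients, so the Hessians converge
  strongly along the whole given sequence.\<close>

lemma limit_of_solutions:
  assumes sol: "\<And>m. disc_sol (X m) (Gr m) (Hs m) (E m) A B L (\<Psi>d m)"
    and mem: "\<And>c. lp_mem 2 \<Omega> (\<Psi> c)" "\<And>c. lp_mem 4 \<Omega> (G c)"
    and lim: "\<And>c. lp_tendsto 2 \<Omega> (\<lambda>m. PiD m (\<Psi>d m c)) (\<Psi> c)" "\<And>c. lp_tendsto 4 \<Omega> (\<lambda>m. Gr m (\<Psi>d m c)) (G c)"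
  shows "\<exists>H. cont_sol \<Omega> A B L \<Psi> G H \<and> (\<lambda>m. lpk_norm 2 \<Omega> (\<lambda>c x. Hs m (\<Psi>d m c) x - H c x)) \<longlonglongrightarrow> 0"
proof -
  have X: "\<Psi>d m c \<in> X m" for m c using sol by (simp add: disc_sol_def)
  obtain M where M: "M \<ge> 0" "\<forall>m \<Psi>. disc_sol (X m) (Gr m) (Hs m) (E m) A B L \<Psi> \<longrightarrow> lpk_norm 2 \<Omega> (\<lambda>c. Hs m (\<Psi> c)) \<le> M"
    by (rule disc_sol_bounded)
  have Mk: "lpk_norm 2 \<Omega> (\<lambda>c. Hs m (\<Psi>d m c)) \<le> M" for m using M(2) sol by blast
  have Mc: "lp_norm 2 \<Omega> (Hs m (\<Psi>d m c)) \<le> M" for m c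
    using order_trans[OF lp_norm_le_lpk_norm[where F="\<lambda>c. Hs m (\<Psi>d m c)" and p=2 and c=c] Mk] S.mem(3)[OF X] by simp
  obtain CA where CA: "CA \<ge> 0" "\<forall>\<xi> \<eta>. lpk_mem 2 \<Omega> \<xi> \<longrightarrow> lpk_mem 2 \<Omega> \<eta> \<longrightarrow> \<bar>A \<xi> \<eta>\<bar> \<le> CA * lpk_norm 2 \<Omega> \<xi> * lpk_norm 2 \<Omega> \<eta>"
    by (rule A_bound)
  \<comment> \<open>The components are glued into one vector-valued function, because one sequence
    of convex combinations has to serve all of them.\<close>
  define u where "u m x = (\<chi> c. Hs m (\<Psi>d m c) x)" for m x
  define a where "a f g = A (\<lambda>c x. f x $ c) (\<lambda>c x. g x $ c)" for f g :: "real^'d \<Rightarrow> real^'d^'d^'k"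
  have mX: "lpk_mem 2 \<Omega> (\<lambda>c. Hs m (\<Psi>d m c))" "lpk_mem 4 \<Omega> (\<lambda>c. Gr m (\<Psi>d m c))" for m
    using S.lpk_mem_disc[where u="\<Psi>d m" and m=m, OF X] by auto
  have um: "lp_mem 2 \<Omega> (u m)" for m
    using S.mem(3)[OF X] by (simp add: lp_mem_nth_iff u_def)
  have un: "(\<lambda>c x. u m x $ c) = (\<lambda>c. Hs m (\<Psi>d m c))" for m by (simp add: u_def)
  have nth: "lpk_mem 2 \<Omega> (\<lambda>c x. f x $ c)" if "lp_mem 2 \<Omega> f" for f :: "real^'d \<Rightarrow> real^'d^'d^'k" using lpk_nth(1)[OF _ that] by simp
  obtain w Hv where Hv: "lp_mem 2 \<Omega> Hv" and w: "\<forall>n. w n \<in> fconv u n" and wH: "lp_tendsto 2 \<Omega> w Hv"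
    and strong: "(\<lambda>n. a (u n) (u n)) \<longlonglongrightarrow> a Hv Hv \<longrightarrow> lp_tendsto 2 \<Omega> u Hv"
  proof (rule fconv_minimising[where u=u and M=M and a=a and C=CA and \<alpha>=alpha and \<Omega>=\<Omega>])
    show "lp_mem 2 \<Omega> (u n)" for n by (rule um)
    show "lp_norm 2 \<Omega> (u n) \<le> M" for n using Mk[of n] by (simp add: lpk_norm_eq u_def[abs_def])
    show "a (\<lambda>x. s *\<^sub>R f x + t *\<^sub>R g x) h = s * a f h + t * a g h" if "lp_mem 2 \<Omega> f" "lp_mem 2 \<Omega> g" "lp_mem 2 \<Omega> h" for f g h s t
      using A_bilin1[OF nth[OF that(1)] nth[OF that(2)] nth[OF that(3)]] by (simp add: a_def)
    show "a h (\<lambda>x. s *\<^sub>R f x + t *\<^sub>R g x) = s * a h f + t * a h g" if "lp_mem 2 \<Omega> f" "lp_mem 2 \<Omega> g" "lp_mem 2 \<Omega> h" for f g h s t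
      using A_bilin2[OF nth[OF that(1)] nth[OF that(2)] nth[OF that(3)]] by (simp add: a_def)
    show "\<bar>a f g\<bar> \<le> CA * lp_norm 2 \<Omega> f * lp_norm 2 \<Omega> g" if "lp_mem 2 \<Omega> f" "lp_mem 2 \<Omega> g" for f g
      using CA(2)[rule_format, OF nth[OF that(1)] nth[OF that(2)]] by (simp add: a_def lpk_nth(2))
    show "alpha * (lp_norm 2 \<Omega> f)\<^sup>2 \<le> a f f" if "lp_mem 2 \<Omega> f" for f
      using A_coer[OF nth[OF that]] by (simp add: a_def lpk_nth(2))
    show "alpha > 0" by (rule alpha_pos)
  qed (rule om)+
  define H where "H c x = Hv x $ c" for c x
  have Hm: "lp_mem 2 \<Omega> (H c)" for c using Hv by (simp add: lp_mem_nth_iff H_def[abs_def])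
  have H20: "in_H20 \<Omega> (\<Psi> c) (G c) (H c)" for c
  proof (rule limit_in_H20[where P="\<lambda>m. \<Psi>d m c", OF X Mc mem(1) mem(2) Hm lim])
    fix \<xi> :: "real^'d \<Rightarrow> real^'d^'d" and k
    assume \<xi>: "lp_mem 2 \<Omega> \<xi>" and k: "(\<lambda>m. \<integral>x. \<xi> x \<bullet> Hs m (\<Psi>d m c) x \<partial>lebesgue_on \<Omega>) \<longlonglongrightarrow> k"
    have fc: "lp_mem 2 \<Omega> (\<lambda>x. f x $ c)" if "lp_mem 2 \<Omega> f" for f :: "real^'d \<Rightarrow> real^'d^'d^'k"
      using that lp_mem_nth_iff[of 2 \<Omega> f] by simp
    have "(\<integral>x. \<xi> x \<bullet> (Hv x $ c) \<partial>lebesgue_on \<Omega>) = k"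
    proof (rule fconv_limit_value[where l="\<lambda>f. \<integral>x. \<xi> x \<bullet> (f x $ c) \<partial>lebesgue_on \<Omega>" and u=u and w=w and C="lp_norm 2 \<Omega> \<xi>" and \<Omega>=\<Omega>])
      show "(\<integral>x. \<xi> x \<bullet> ((a *\<^sub>R f x + b *\<^sub>R g x) $ c) \<partial>lebesgue_on \<Omega>) = a * (\<integral>x. \<xi> x \<bullet> (f x $ c) \<partial>lebesgue_on \<Omega>) + b * (\<integral>x. \<xi> x \<bullet> (g x $ c) \<partial>lebesgue_on \<Omega>)"
        if "lp_mem 2 \<Omega> f" "lp_mem 2 \<Omega> g" for f g :: "real^'d \<Rightarrow> real^'d^'d^'k" and a b
        using lp_mem_inner_integrable[OF \<xi> fc[OF that(1)]] lp_mem_inner_integrable[OF \<xi> fc[OF that(2)]] by (simp add: inner_add_right)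
      show "\<bar>\<integral>x. \<xi> x \<bullet> (f x $ c) \<partial>lebesgue_on \<Omega>\<bar> \<le> lp_norm 2 \<Omega> \<xi> * lp_norm 2 \<Omega> f" if f: "lp_mem 2 \<Omega> f" for f :: "real^'d \<Rightarrow> real^'d^'d^'k"
        using order_trans[OF lp_Cauchy_Schwarz[OF \<xi> fc[OF f]] mult_left_mono[OF lp_norm_nth_le[OF _ f]]] by simp
      show "(\<lambda>n. \<integral>x. \<xi> x \<bullet> (u n x $ c) \<partial>lebesgue_on \<Omega>) \<longlonglongrightarrow> k" using k by (simp add: u_def)
    qed (use um w Hv wH in auto)
    then show "(\<integral>x. \<xi> x \<bullet> H c x \<partial>lebesgue_on \<Omega>) = k" by (simp add: H_def)
  qed
  have Gk: "lpk_mem 4 \<Omega> G" and Hk: "lpk_mem 2 \<Omega> H" using mem Hm by (auto simp: lpk_mem_def)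
  have weak: "A H H\<Phi> + B H G G\<Phi> = L \<Phi>" if \<Phi>: "\<And>c. in_H20 \<Omega> (\<Phi> c) (G\<Phi> c) (H\<Phi> c)" for \<Phi> G\<Phi> H\<Phi>
  proof -
    have k: "lpk_mem 2 \<Omega> H\<Phi>" "lpk_mem 4 \<Omega> G\<Phi>"
      using \<Phi> in_H20_grad_mem_4[OF \<Phi>] by (auto simp: lpk_mem_def in_H20_def in_H2_def)
    let ?l = "\<lambda>f. A (\<lambda>c x. f x $ c) H\<Phi> + B (\<lambda>c x. f x $ c) G G\<Phi>"
    have "?l Hv = L \<Phi>"
    proof (rule fconv_limit_value[where l="?l" and u=u and w=w and \<Omega>=\<Omega>
          and C="CA * lpk_norm 2 \<Omega> H\<Phi> + nB * (lpk_norm 4 \<Omega> G * lpk_norm 4 \<Omega> G\<Phi>)"])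
      show "?l (\<lambda>x. a *\<^sub>R f x + b *\<^sub>R g x) = a * ?l f + b * ?l g" if "lp_mem 2 \<Omega> f" "lp_mem 2 \<Omega> g" for f g a b
        using A_bilin1[OF nth[OF that(1)] nth[OF that(2)] k(1), of a b] B_lin1[OF nth[OF that(1)] nth[OF that(2)] Gk k(2), of a b]
        by (simp add: algebra_simps)
      show "\<bar>?l f\<bar> \<le> (CA * lpk_norm 2 \<Omega> H\<Phi> + nB * (lpk_norm 4 \<Omega> G * lpk_norm 4 \<Omega> G\<Phi>)) * lp_norm 2 \<Omega> f" if "lp_mem 2 \<Omega> f" for f
        using CA(2)[rule_format, OF nth[OF that] k(1)] B_bound[OF nth[OF that] Gk k(2)]
        by (simp add: lpk_nth(2) algebra_simps)
      show "(\<lambda>n. ?l (u n)) \<longlonglongrightarrow> L \<Phi>"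
        unfolding un by (rule form_limit_identity[where \<Psi>d=\<Psi>d, OF sol Mk mem(2) lim(2) \<Phi>])
    qed (use um w Hv wH in auto)
    then show ?thesis by (simp add: H_def[abs_def])
  qed
  have cs: "cont_sol \<Omega> A B L \<Psi> G H" unfolding cont_sol_def using H20 weak by blast
  \<comment> \<open>The energies are the values of \<open>L\<close> on the companions of the
    solutions, because \<open>B\<close> vanishes on equal last arguments. They converge to
    \<open>L \<Psi>\<close>, which is the energy of the limit by the same cancellation.\<close>
  have "(\<lambda>n. a (u n) (u n)) \<longlonglongrightarrow> a Hv Hv"
  proof -
    have 1: "a (u n) (u n) = L (\<lambda>c. E n (\<Psi>d n c))" for n
      using sol[of n, unfolded disc_sol_def, THEN conjunct2, rule_format, of "\<Psi>d n"] X B_skew[OF mX] unfolding a_def un by simp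
    have 2: "a Hv Hv = L \<Psi>" using weak[where \<Phi>=\<Psi> and G\<Phi>=G and H\<Phi>=H, OF H20] B_skew[OF Hk Gk] by (simp add: a_def H_def[abs_def])
    show ?thesis unfolding 1 2 by (rule L_companion_tendsto[where P=\<Psi>d, OF X Mc lim(2) H20])
  qed
  then have uH: "lp_tendsto 2 \<Omega> u Hv" using strong by blast
  have "(\<lambda>m. lpk_norm 2 \<Omega> (\<lambda>c x. Hs m (\<Psi>d m c) x - H c x)) \<longlonglongrightarrow> 0"
  proof (rule lpk_tendsto[where u="\<lambda>m c. Hs m (\<Psi>d m c)", OF _ S.mem(3)[OF X] Hm])
    show "lp_tendsto 2 \<Omega> (\<lambda>m. Hs m (\<Psi>d m c)) (H c)" for c
      using lp_tendsto_nth[OF _ um Hv uH, of c] by (simp add: u_def H_def)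
  qed simp
  then show ?thesis using cs by blast
qed

section \<open>Extraction of a subsequence\<close>

lemma subsequence:
  assumes r: "strict_mono (r :: nat \<Rightarrow> nat)"
  shows "hessian_scheme_seq \<Omega> A B L alpha C1eq (\<lambda>n. X (r n)) (\<lambda>n. PiD (r n)) (\<lambda>n. Gr (r n)) (\<lambda>n. Hs (r n)) (\<lambda>n. E (r n))"
proof (unfold_locales)
  note sub = LIMSEQ_subseq_LIMSEQ[OF _ r, unfolded o_def]
  show "HD_coercive \<Omega> (\<lambda>n. X (r n)) (\<lambda>n. PiD (r n)) (\<lambda>n. Gr (r n)) (\<lambda>n. Hs (r n))"
    using coercive unfolding HD_coercive_def by blast
  show "HD_consistent \<Omega> (\<lambda>n. X (r n)) (\<lambda>n. PiD (r n)) (\<lambda>n. Gr (r n)) (\<lambda>n. Hs (r n))"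
    unfolding HD_consistent_def
  proof (intro allI impI)
    fix \<phi> G H assume "in_H20 \<Omega> \<phi> G H"
    then have "(\<lambda>m. S_HD \<Omega> (X m) (PiD m) (Gr m) (Hs m) \<phi> G H) \<longlonglongrightarrow> 0" using consistent unfolding HD_consistent_def by blast
    from sub[OF this] show "(\<lambda>m. S_HD \<Omega> (X (r m)) (PiD (r m)) (Gr (r m)) (Hs (r m)) \<phi> G H) \<longlonglongrightarrow> 0" .
  qed
  show "HD_limit_conforming \<Omega> (\<lambda>n. X (r n)) (\<lambda>n. PiD (r n)) (\<lambda>n. Gr (r n)) (\<lambda>n. Hs (r n))"
    unfolding HD_limit_conforming_def
  proof (intro allI impI)
    fix \<xi> h \<phi> g assume "in_Hdd \<Omega> \<xi> h \<and> in_Hdiv \<Omega> \<phi> g"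
    then have "(\<lambda>m. W_HD \<Omega> (X m) (PiD m) (Hs m) \<xi> h + What_HD \<Omega> (X m) (PiD m) (Gr m) (Hs m) \<phi> g) \<longlonglongrightarrow> 0"
      using limit_conforming unfolding HD_limit_conforming_def by blast
    from sub[OF this] show "(\<lambda>m. W_HD \<Omega> (X (r m)) (PiD (r m)) (Hs (r m)) \<xi> h + What_HD \<Omega> (X (r m)) (PiD (r m)) (Gr (r m)) (Hs (r m)) \<phi> g) \<longlonglongrightarrow> 0" .
  qed
  show "(\<lambda>m. omegaE \<Omega> (X (r m)) (Gr (r m)) (Hs (r m)) (E (r m))) \<longlonglongrightarrow> 0" by (rule sub[OF omega_lim])
qed (rule HD companion)+

text \<open>One extraction for each component and each of the two operators; convergence already
  obtained survives the later ones. \<open>lp_relcompact_seq\<close> admits arbitrary index maps, so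
  it applies along \<open>r\<close> and then along the refinement of \<open>r\<close> by
  \<open>s\<close>.\<close>

lemma compact_subsequence:
  assumes cp: "HD_compact \<Omega> X PiD Gr Hs" and X: "\<And>m c. \<Psi>d m c \<in> X m"
    and M: "\<And>m c. lp_norm 2 \<Omega> (Hs m (\<Psi>d m c)) \<le> M" and C: "finite C"
  shows "\<exists>r::nat\<Rightarrow>nat. strict_mono r \<and> (\<forall>c\<in>C. \<exists>f g. lp_mem 2 \<Omega> f \<and> lp_mem 4 \<Omega> g
      \<and> lp_tendsto 2 \<Omega> (\<lambda>n. PiD (r n) (\<Psi>d (r n) c)) f \<and> lp_tendsto 4 \<Omega> (\<lambda>n. Gr (r n) (\<Psi>d (r n) c)) g)"
  using C
proof (induction C)
  case empty then show ?case by (intro exI[of _ id]) (auto simp: strict_mono_def)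
next
  case (insert c C)
  then obtain r :: "nat \<Rightarrow> nat" where r: "strict_mono r" and conv: "\<forall>c\<in>C. \<exists>f g. lp_mem 2 \<Omega> f \<and> lp_mem 4 \<Omega> g
      \<and> lp_tendsto 2 \<Omega> (\<lambda>n. PiD (r n) (\<Psi>d (r n) c)) f \<and> lp_tendsto 4 \<Omega> (\<lambda>n. Gr (r n) (\<Psi>d (r n) c)) g" by blast
  have rc: "lp_relcompact_seq 2 \<Omega> (\<lambda>m. PiD m (\<Psi>d m c))" "lp_relcompact_seq 4 \<Omega> (\<lambda>m. Gr m (\<Psi>d m c))"
    using cp[unfolded HD_compact_def, rule_format, of "\<lambda>m. \<Psi>d m c", OF conjI] X M by blast+
  obtain s f where s: "strict_mono s" "lp_mem 2 \<Omega> f" "lp_tendsto 2 \<Omega> (\<lambda>n. PiD (r (s n)) (\<Psi>d (r (s n)) c)) f"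
    using rc(1)[unfolded lp_relcompact_seq_def, rule_format, of r] by blast
  obtain t g where t: "strict_mono t" "lp_mem 4 \<Omega> g" "lp_tendsto 4 \<Omega> (\<lambda>n. Gr (r (s (t n))) (\<Psi>d (r (s (t n))) c)) g"
    using rc(2)[unfolded lp_relcompact_seq_def, rule_format, of "\<lambda>n. r (s n)"] by blast
  let ?r = "\<lambda>n. r (s (t n))"
  have st: "strict_mono (\<lambda>n. s (t n))" using s(1) t(1) by (simp add: strict_mono_def)
  have "strict_mono ?r" using st r by (simp add: strict_mono_def)
  moreover have "lp_tendsto 2 \<Omega> (\<lambda>n. PiD (?r n) (\<Psi>d (?r n) c)) f"
    using LIMSEQ_subseq_LIMSEQ[OF s(3) t(1)] by (simp add: o_def)
  moreover have "\<exists>f g. lp_mem 2 \<Omega> f \<and> lp_mem 4 \<Omega> g \<and> lp_tendsto 2 \<Omega> (\<lambda>n. PiD (?r n) (\<Psi>d (?r n) c')) f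
      \<and> lp_tendsto 4 \<Omega> (\<lambda>n. Gr (?r n) (\<Psi>d (?r n) c')) g" if "c' \<in> C" for c'
  proof -
    obtain f g where "lp_mem 2 \<Omega> f" "lp_mem 4 \<Omega> g" "lp_tendsto 2 \<Omega> (\<lambda>n. PiD (r n) (\<Psi>d (r n) c')) f"
      "lp_tendsto 4 \<Omega> (\<lambda>n. Gr (r n) (\<Psi>d (r n) c')) g" using conv \<open>c' \<in> C\<close> by blast
    then show ?thesis
      using LIMSEQ_subseq_LIMSEQ[OF _ st, of "\<lambda>n. lp_norm 2 \<Omega> (\<lambda>x. PiD (r n) (\<Psi>d (r n) c') x - f x)"]
        LIMSEQ_subseq_LIMSEQ[OF _ st, of "\<lambda>n. lp_norm 4 \<Omega> (\<lambda>x. Gr (r n) (\<Psi>d (r n) c') x - g x)"]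
      by (intro exI[of _ f] exI[of _ g]) (simp add: o_def)
  qed
  ultimately show ?case using s(2) t(2,3) by (intro exI[of _ ?r]) blast
qed

theorem subsequential_convergence:
  assumes cp: "HD_compact \<Omega> X PiD Gr Hs" and sol: "\<And>m. disc_sol (X m) (Gr m) (Hs m) (E m) A B L (\<Psi>d m)"
  shows "\<exists>r \<Psi> G H. strict_mono r \<and> cont_sol \<Omega> A B L \<Psi> G H
            \<and> (\<lambda>n. lpk_norm 2 \<Omega> (\<lambda>c x. PiD (r n) (\<Psi>d (r n) c) x - \<Psi> c x)) \<longlonglongrightarrow> 0
            \<and> (\<lambda>n. lpk_norm 4 \<Omega> (\<lambda>c x. Gr (r n) (\<Psi>d (r n) c) x - G c x)) \<longlonglongrightarrow> 0
            \<and> (\<lambda>n. lpk_norm 2 \<Omega> (\<lambda>c x. Hs (r n) (\<Psi>d (r n) c) x - H c x)) \<longlonglongrightarrow> 0"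
proof -
  have X: "\<Psi>d m c \<in> X m" for m c using sol by (simp add: disc_sol_def)
  obtain M where M: "M \<ge> 0" "\<forall>m \<Psi>. disc_sol (X m) (Gr m) (Hs m) (E m) A B L \<Psi> \<longrightarrow> lpk_norm 2 \<Omega> (\<lambda>c. Hs m (\<Psi> c)) \<le> M"
    by (rule disc_sol_bounded)
  have Mk: "lpk_norm 2 \<Omega> (\<lambda>c. Hs m (\<Psi>d m c)) \<le> M" for m using M(2) sol by blast
  have Mc: "lp_norm 2 \<Omega> (Hs m (\<Psi>d m c)) \<le> M" for m c
    using order_trans[OF lp_norm_le_lpk_norm[where F="\<lambda>c. Hs m (\<Psi>d m c)" and p=2 and c=c] Mk] S.mem(3)[OF X] by simp
  from compact_subsequence[where \<Psi>d=\<Psi>d, OF cp X Mc finite[of UNIV]]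
  obtain r :: "nat \<Rightarrow> nat" where r: "strict_mono r" and "\<forall>c\<in>UNIV. \<exists>f g. lp_mem 2 \<Omega> f \<and> lp_mem 4 \<Omega> g
      \<and> lp_tendsto 2 \<Omega> (\<lambda>n. PiD (r n) (\<Psi>d (r n) c)) f \<and> lp_tendsto 4 \<Omega> (\<lambda>n. Gr (r n) (\<Psi>d (r n) c)) g" by blast
  then have "\<forall>c. \<exists>fg. lp_mem 2 \<Omega> (fst fg) \<and> lp_mem 4 \<Omega> (snd fg)
      \<and> lp_tendsto 2 \<Omega> (\<lambda>n. PiD (r n) (\<Psi>d (r n) c)) (fst fg) \<and> lp_tendsto 4 \<Omega> (\<lambda>n. Gr (r n) (\<Psi>d (r n) c)) (snd fg)" by auto
  then obtain fg where fg: "\<forall>c. lp_mem 2 \<Omega> (fst (fg c)) \<and> lp_mem 4 \<Omega> (snd (fg c))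
      \<and> lp_tendsto 2 \<Omega> (\<lambda>n. PiD (r n) (\<Psi>d (r n) c)) (fst (fg c)) \<and> lp_tendsto 4 \<Omega> (\<lambda>n. Gr (r n) (\<Psi>d (r n) c)) (snd (fg c))"
    by (rule choice[THEN exE])
  define \<Psi> where "\<Psi> c = fst (fg c)" for c
  define G where "G c = snd (fg c)" for c
  have m: "lp_mem 2 \<Omega> (\<Psi> c)" "lp_mem 4 \<Omega> (G c)" and lim: "lp_tendsto 2 \<Omega> (\<lambda>n. PiD (r n) (\<Psi>d (r n) c)) (\<Psi> c)"
    "lp_tendsto 4 \<Omega> (\<lambda>n. Gr (r n) (\<Psi>d (r n) c)) (G c)" for c using fg by (auto simp: \<Psi>_def G_def)
  \<comment> \<open>The limit argument is run on the subsequence as a sequence of discretisations in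
    its own right.\<close>
  interpret R: hessian_scheme_seq \<Omega> A B L alpha C1eq "\<lambda>n. X (r n)" "\<lambda>n. PiD (r n)" "\<lambda>n. Gr (r n)" "\<lambda>n. Hs (r n)" "\<lambda>n. E (r n)"
    by (rule subsequence[OF r])
  from R.limit_of_solutions[where \<Psi>d="\<lambda>n. \<Psi>d (r n)", OF sol m lim]
  obtain H where "cont_sol \<Omega> A B L \<Psi> G H" "(\<lambda>n. lpk_norm 2 \<Omega> (\<lambda>c x. Hs (r n) (\<Psi>d (r n) c) x - H c x)) \<longlonglongrightarrow> 0" by blast
  moreover have "(\<lambda>n. lpk_norm 2 \<Omega> (\<lambda>c x. PiD (r n) (\<Psi>d (r n) c) x - \<Psi> c x)) \<longlonglongrightarrow> 0"
    by (rule lpk_tendsto[where u="\<lambda>n c. PiD (r n) (\<Psi>d (r n) c)", OF _ S.mem(1)[OF X] m(1) lim(1)]) simp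
  moreover have "(\<lambda>n. lpk_norm 4 \<Omega> (\<lambda>c x. Gr (r n) (\<Psi>d (r n) c) x - G c x)) \<longlonglongrightarrow> 0"
    by (rule lpk_tendsto[where u="\<lambda>n c. Gr (r n) (\<Psi>d (r n) c)", OF _ S.mem(2)[OF X] m(2) lim(2)]) simp
  ultimately show ?thesis using r by blast
qed

end

text \<open>The smallness condition is cleared of its denominator and so keeps its meaning when the
  product of constants vanishes. Convergence is claimed for every choice of discrete solutions,
  since these need not be unique. The limit comes with representatives of its gradient and
  Hessian.\<close>

theorem theorem3p4:
  fixes \<Omega> :: "(real^'d::finite) set"
    and X :: "nat \<Rightarrow> 'x::real_vector set"
    and PiD :: "nat \<Rightarrow> 'x \<Rightarrow> real^'d \<Rightarrow> real"
    and Gr :: "nat \<Rightarrow> 'x \<Rightarrow> real^'d \<Rightarrow> real^'d"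
    and Hs :: "nat \<Rightarrow> 'x \<Rightarrow> real^'d \<Rightarrow> real^'d^'d"
    and E :: "nat \<Rightarrow> 'x \<Rightarrow> real^'d \<Rightarrow> real"
    and A :: "('k::finite \<Rightarrow> real^'d \<Rightarrow> real^'d^'d) \<Rightarrow> ('k \<Rightarrow> real^'d \<Rightarrow> real^'d^'d) \<Rightarrow> real"
    and B :: "('k \<Rightarrow> real^'d \<Rightarrow> real^'d^'d) \<Rightarrow> ('k \<Rightarrow> real^'d \<Rightarrow> real^'d) \<Rightarrow> ('k \<Rightarrow> real^'d \<Rightarrow> real^'d) \<Rightarrow> real"
    and L :: "('k \<Rightarrow> real^'d \<Rightarrow> real) \<Rightarrow> real"
    and alpha C1eq :: real
  assumes dom: "open \<Omega>" "connected \<Omega>" "bounded \<Omega>" "\<Omega> \<noteq> {}"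
    and A_bilin1: "\<And>\<xi> \<eta> \<zeta> a b. lpk_mem 2 \<Omega> \<xi> \<Longrightarrow> lpk_mem 2 \<Omega> \<eta> \<Longrightarrow> lpk_mem 2 \<Omega> \<zeta> \<Longrightarrow>
        A (\<lambda>c x. a *\<^sub>R \<xi> c x + b *\<^sub>R \<eta> c x) \<zeta> = a * A \<xi> \<zeta> + b * A \<eta> \<zeta>"
    and A_bilin2: "\<And>\<xi> \<eta> \<zeta> a b. lpk_mem 2 \<Omega> \<xi> \<Longrightarrow> lpk_mem 2 \<Omega> \<eta> \<Longrightarrow> lpk_mem 2 \<Omega> \<zeta> \<Longrightarrow>
        A \<zeta> (\<lambda>c x. a *\<^sub>R \<xi> c x + b *\<^sub>R \<eta> c x) = a * A \<zeta> \<xi> + b * A \<zeta> \<eta>"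
    and A_cont: "\<exists>CA. \<forall>\<xi> \<eta>. lpk_mem 2 \<Omega> \<xi> \<and> lpk_mem 2 \<Omega> \<eta> \<longrightarrow>
        \<bar>A \<xi> \<eta>\<bar> \<le> CA * lpk_norm 2 \<Omega> \<xi> * lpk_norm 2 \<Omega> \<eta>"
    and alpha_pos: "alpha > 0"
    and A_coer: "\<And>\<xi>. lpk_mem 2 \<Omega> \<xi> \<Longrightarrow> A \<xi> \<xi> \<ge> alpha * (lpk_norm 2 \<Omega> \<xi>)\<^sup>2"
    and B_lin1: "\<And>\<xi> \<xi>' \<theta> \<eta> a b. lpk_mem 2 \<Omega> \<xi> \<Longrightarrow> lpk_mem 2 \<Omega> \<xi>' \<Longrightarrow> lpk_mem 4 \<Omega> \<theta> \<Longrightarrow>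
        lpk_mem 4 \<Omega> \<eta> \<Longrightarrow> B (\<lambda>c x. a *\<^sub>R \<xi> c x + b *\<^sub>R \<xi>' c x) \<theta> \<eta> = a * B \<xi> \<theta> \<eta> + b * B \<xi>' \<theta> \<eta>"
    and B_lin2: "\<And>\<xi> \<theta> \<theta>' \<eta> a b. lpk_mem 2 \<Omega> \<xi> \<Longrightarrow> lpk_mem 4 \<Omega> \<theta> \<Longrightarrow> lpk_mem 4 \<Omega> \<theta>' \<Longrightarrow>
        lpk_mem 4 \<Omega> \<eta> \<Longrightarrow> B \<xi> (\<lambda>c x. a *\<^sub>R \<theta> c x + b *\<^sub>R \<theta>' c x) \<eta> = a * B \<xi> \<theta> \<eta> + b * B \<xi> \<theta>' \<eta>"
    and B_lin3: "\<And>\<xi> \<theta> \<eta> \<eta>' a b. lpk_mem 2 \<Omega> \<xi> \<Longrightarrow> lpk_mem 4 \<Omega> \<theta> \<Longrightarrow> lpk_mem 4 \<Omega> \<eta> \<Longrightarrow>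
        lpk_mem 4 \<Omega> \<eta>' \<Longrightarrow> B \<xi> \<theta> (\<lambda>c x. a *\<^sub>R \<eta> c x + b *\<^sub>R \<eta>' c x) = a * B \<xi> \<theta> \<eta> + b * B \<xi> \<theta> \<eta>'"
    and B_cont: "\<exists>CB. \<forall>\<xi> \<theta> \<eta>. lpk_mem 2 \<Omega> \<xi> \<and> lpk_mem 4 \<Omega> \<theta> \<and> lpk_mem 4 \<Omega> \<eta> \<longrightarrow>
        \<bar>B \<xi> \<theta> \<eta>\<bar> \<le> CB * lpk_norm 2 \<Omega> \<xi> * lpk_norm 4 \<Omega> \<theta> * lpk_norm 4 \<Omega> \<eta>"
    and B_skew: "\<And>\<xi> \<theta>. lpk_mem 2 \<Omega> \<xi> \<Longrightarrow> lpk_mem 4 \<Omega> \<theta> \<Longrightarrow> B \<xi> \<theta> \<theta> = 0"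
    and L_lin: "\<And>\<Phi> G\<Phi> \<Psi> G\<Psi> a b. (\<forall>c. in_H10 \<Omega> (\<Phi> c) (G\<Phi> c)) \<Longrightarrow> (\<forall>c. in_H10 \<Omega> (\<Psi> c) (G\<Psi> c)) \<Longrightarrow>
        L (\<lambda>c x. a * \<Phi> c x + b * \<Psi> c x) = a * L \<Phi> + b * L \<Psi>"
    and L_cont: "\<exists>CL. \<forall>\<Phi> G. (\<forall>c. in_H10 \<Omega> (\<Phi> c) (G c)) \<longrightarrow> \<bar>L \<Phi>\<bar> \<le> CL * h1k_norm \<Omega> \<Phi> G"
    and C1eq: "\<And>\<phi> G. in_H10 \<Omega> \<phi> G \<Longrightarrow>
        sqrt ((lp_norm 2 \<Omega> \<phi>)\<^sup>2 + (lp_norm 2 \<Omega> G)\<^sup>2) \<le> C1eq * lp_norm 2 \<Omega> G"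
    and HD: "\<And>m. is_HD \<Omega> (X m) (PiD m) (Gr m) (Hs m)"
    and companion: "\<And>m. is_companion \<Omega> (X m) (E m)"
    and coercive: "HD_coercive \<Omega> X PiD Gr Hs"
    and consistent: "HD_consistent \<Omega> X PiD Gr Hs"
    and limit_conforming: "HD_limit_conforming \<Omega> X PiD Gr Hs"
    and compact: "HD_compact \<Omega> X PiD Gr Hs"
    and omega_lim: "(\<lambda>m. omegaE \<Omega> (X m) (Gr m) (Hs m) (E m)) \<longlonglongrightarrow> 0"
  shows "(\<forall>m. \<exists>\<Psi>. disc_sol (X m) (Gr m) (Hs m) (E m) A B L \<Psi>)
    \<and> (\<forall>\<Psi>d. (\<forall>m. disc_sol (X m) (Gr m) (Hs m) (E m) A B L (\<Psi>d m)) \<longrightarrow>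
         (\<exists>r \<Psi> G H. strict_mono r \<and> cont_sol \<Omega> A B L \<Psi> G H
            \<and> (\<lambda>n. lpk_norm 2 \<Omega> (\<lambda>c x. PiD (r n) (\<Psi>d (r n) c) x - \<Psi> c x)) \<longlonglongrightarrow> 0
            \<and> (\<lambda>n. lpk_norm 4 \<Omega> (\<lambda>c x. Gr (r n) (\<Psi>d (r n) c) x - G c x)) \<longlonglongrightarrow> 0
            \<and> (\<lambda>n. lpk_norm 2 \<Omega> (\<lambda>c x. Hs (r n) (\<Psi>d (r n) c) x - H c x)) \<longlonglongrightarrow> 0))
    \<and> (\<forall>m. dual_norm_H1 \<Omega> L * norm_trilinear \<Omega> B * (C_HD \<Omega> (X m) (PiD m) (Gr m) (Hs m))\<^sup>2
              * (omegaE \<Omega> (X m) (Gr m) (Hs m) (E m)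
                 + measure lebesgue \<Omega> powr (1/4) * C_HD \<Omega> (X m) (PiD m) (Gr m) (Hs m)) * C1eq
            < alpha\<^sup>2 \<longrightarrow>
         (\<forall>\<Psi>1 \<Psi>2. disc_sol (X m) (Gr m) (Hs m) (E m) A B L \<Psi>1
            \<and> disc_sol (X m) (Gr m) (Hs m) (E m) A B L \<Psi>2 \<longrightarrow> \<Psi>1 = \<Psi>2))"
proof -
  have om: "\<Omega> \<in> sets lebesgue" "emeasure lebesgue \<Omega> < \<infinity>"
    using dom(1) emeasure_bounded_finite[OF dom(3)] by auto
  interpret D: hessian_scheme_seq \<Omega> A B L alpha C1eq X PiD Gr Hs E
    by unfold_locales (rule om A_bilin1 A_bilin2 A_cont alpha_pos A_coer B_lin1 B_lin2 B_lin3 B_cont B_skew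
        L_lin L_cont C1eq HD companion coercive consistent limit_conforming omega_lim; assumption)+
  show ?thesis
    by (intro conjI allI impI D.S.disc_sol_exists D.subsequential_convergence[OF compact])
      (auto intro: D.S.disc_sol_unique)
qed

end
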